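(* Let $S\subset C(\mathbf{k})$ be finite and $F\in K[x_1,\dots,x_n]$ a polynomial of degree $d>0$ with $F(0,\dots,0)\ne0$ and such that one of its coefficients equals $1$. Put $N:=\binom{n+d}{n}-1$. Let $\mathbf g=(g_1,\dots,g_n)\in(\mathcal{O}_S^* )^n$ and let $r$ be a positive integer, and suppose that the elements $\mathbf g^{\mathbf i}$ with $\mathbf i\in\mathbb{Z}_{\ge0}^n$, $|\mathbf i|\le d$, are linearly nondegenerate over $V_F(r)$. Then $$\sum_{\mathfrak p\in S}v^0_{\mathfrak p}(F(\mathbf g))\le\Bigl(\tfrac{d_r}{d_{r-1}}-1\Bigr)(N+1)dn\max_{1\le i\le n}h(g_i)+\tfrac{d_r(N+1)}{d_{r-1}}(r+1)h(F)+\tfrac{d_r(N+1)(Nd_r+d_r-1)}{2d_{r-1}}\max\{0,2\mathfrak g-2+|S|\}.$$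
   Context: $\mathbf{k}$ is an algebraically closed field of characteristic zero, $C$ a smooth projective curve over $\mathbf{k}$ of genus $\mathfrak g$, $K=\mathbf{k}(C)$; $v_{\mathfrak p}$ is the order-of-vanishing valuation at $\mathfrak p\in C(\mathbf{k})$, $v^0_{\mathfrak p}(f)=\max\{0,v_{\mathfrak p}(f)\}$ (with $v^0_{\mathfrak p}(0)=+\infty$). $\mathcal{O}_S^*=\{f\in K^*: v_{\mathfrak p}(f)=0\ \forall\mathfrak p\notin S\}$. For $f\in K^*$, $h(f)=\sum_{\mathfrak p}\max\{0,-v_{\mathfrak p}(f)\}$. For nonzero $F=\sum a_{\mathbf i}\mathbf x^{\mathbf i}$, $h(F)=-\sum_{\mathfrak p}\min_{a_{\mathbf i}\ne0}v_{\mathfrak p}(a_{\mathbf i})$. $\mathbf g^{\mathbf i}=g_1^{i_1}\cdots g_n^{i_n}$, $|\mathbf i|=i_1+\cdots+i_n$. For an integer $s\ge0$, $V_F(s)$ is the $\mathbf{k}$-vector subspace of $K$ spanned by all products $\prod_\alpha\alpha^{n_\alpha}$, $\alpha$ running over the nonzero coefficients of $F$, $n_\alpha\ge0$, $\sum n_\alpha=s$ (so $V_F(0)=\mathbf{k}$); $d_s:=\dim_{\mathbf{k}}V_F(s)$. For a $\mathbf{k}$-subspace $E\subset K$, elements $y_1,\dots,y_N\in K$ are linearly nondegenerate over $E$ if $\sum a_iy_i=0$ with all $a_i\in E$ implies all $a_i=0$. *)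

theory Defs
  imports "HOL-Computational_Algebra.Polynomial" "HOL-Library.Extended_Real"
begin

(* The function field K = k(C) is modelled as a type 'K of class field_char_0;
   the constant field k is a subset kk of 'K.  Points p of C(k) are identified
   with the normalized discrete valuations of K/k (order-of-vanishing valuations),
   represented as functions 'K => int (value at 0 is junk, normalized to 0). *)

definition subfield :: "'K::field set \<Rightarrow> bool" where
  "subfield E \<longleftrightarrow> 0 \<in> E \<and> 1 \<in> E \<and> (\<forall>x\<in>E. \<forall>y\<in>E. x + y \<in> E \<and> x * y \<in> E)
     \<and> (\<forall>x\<in>E. - x \<in> E \<and> inverse x \<in> E)"

definition alg_closed_subfield :: "'K::field set \<Rightarrow> bool" where
  "alg_closed_subfield E \<longleftrightarrow> subfield E \<and>
     (\<forall>q::'K poly. (\<forall>i. coeff q i \<in> E) \<longrightarrow> degree q > 0 \<longrightarrow> (\<exists>x\<in>E. poly q x = 0))"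

definition lin_span :: "'K::field set \<Rightarrow> 'K set \<Rightarrow> 'K set" where
  "lin_span E B = {\<Sum>b\<in>B'. c b * b | B' c. finite B' \<and> B' \<subseteq> B \<and> (\<forall>b. c b \<in> E)}"

definition kdim :: "'K::field set \<Rightarrow> 'K set \<Rightarrow> nat" where
  "kdim E V = (LEAST m. \<exists>B. finite B \<and> card B = m \<and> B \<subseteq> V \<and> lin_span E B = V)"

definition transcendental_over :: "'K::field set \<Rightarrow> 'K \<Rightarrow> bool" where
  "transcendental_over E t \<longleftrightarrow>
     (\<forall>q::'K poly. (\<forall>i. coeff q i \<in> E) \<longrightarrow> q \<noteq> 0 \<longrightarrow> poly q t \<noteq> 0)"

definition rat_fun_field :: "'K::field set \<Rightarrow> 'K \<Rightarrow> 'K set" where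
  "rat_fun_field E t = {poly p t / poly q t | p q. (\<forall>i. coeff p i \<in> E) \<and> (\<forall>i. coeff q i \<in> E) \<and> q \<noteq> 0}"

definition function_field_over :: "'K::field set \<Rightarrow> bool" where
  "function_field_over E \<longleftrightarrow> subfield E \<and>
     (\<exists>t B. transcendental_over E t \<and> finite B \<and> lin_span (rat_fun_field E t) B = UNIV)"

definition place :: "'K::field set \<Rightarrow> ('K \<Rightarrow> int) \<Rightarrow> bool" where
  "place E v \<longleftrightarrow> v 0 = 0 \<and>
     (\<forall>x y. x \<noteq> 0 \<longrightarrow> y \<noteq> 0 \<longrightarrow> v (x * y) = v x + v y) \<and>
     (\<forall>x y. x \<noteq> 0 \<longrightarrow> y \<noteq> 0 \<longrightarrow> x + y \<noteq> 0 \<longrightarrow> v (x + y) \<ge> min (v x) (v y)) \<and>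
     (\<forall>c\<in>E. c \<noteq> 0 \<longrightarrow> v c = 0) \<and>
     (\<exists>t. t \<noteq> 0 \<and> v t = 1)"

definition divisor :: "'K::field set \<Rightarrow> (('K \<Rightarrow> int) \<Rightarrow> int) \<Rightarrow> bool" where
  "divisor E D \<longleftrightarrow> finite {p. place E p \<and> D p \<noteq> 0}"

definition div_deg :: "'K::field set \<Rightarrow> (('K \<Rightarrow> int) \<Rightarrow> int) \<Rightarrow> int" where
  "div_deg E D = (\<Sum>p\<in>{p. place E p \<and> D p \<noteq> 0}. D p)"

definition RR_space :: "'K::field set \<Rightarrow> (('K \<Rightarrow> int) \<Rightarrow> int) \<Rightarrow> 'K set" where
  "RR_space E D = {f. f = 0 \<or> (\<forall>p. place E p \<longrightarrow> p f + D p \<ge> 0)}"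

definition genus :: "'K::field set \<Rightarrow> int" where
  "genus E = (THE g. (\<forall>D. divisor E D \<longrightarrow> div_deg E D - int (kdim E (RR_space E D)) + 1 \<le> g)
                   \<and> (\<exists>D. divisor E D \<and> div_deg E D - int (kdim E (RR_space E D)) + 1 = g))"

definition height :: "'K::field set \<Rightarrow> 'K \<Rightarrow> int" where
  "height E f = (\<Sum>p\<in>{p. place E p \<and> p f < 0}. - p f)"

definition vzero :: "('K::field \<Rightarrow> int) \<Rightarrow> 'K \<Rightarrow> ereal" where
  "vzero p f = (if f = 0 then \<infinity> else ereal (of_int (max 0 (p f))))"

definition S_units :: "'K::field set \<Rightarrow> ('K \<Rightarrow> int) set \<Rightarrow> 'K set" where
  "S_units E S = {f. f \<noteq> 0 \<and> (\<forall>p. place E p \<longrightarrow> p \<notin> S \<longrightarrow> p f = 0)}"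

text \<open>Polynomials in n variables x_0..x_{n-1} over K: coefficient functions on
  exponent vectors (nat => nat), with finite support, exponents only in variables < n.\<close>
definition mpoly_in :: "nat \<Rightarrow> ((nat \<Rightarrow> nat) \<Rightarrow> 'K::zero) \<Rightarrow> bool" where
  "mpoly_in n F \<longleftrightarrow> finite {i. F i \<noteq> 0} \<and> (\<forall>i. F i \<noteq> 0 \<longrightarrow> (\<forall>j\<ge>n. i j = 0))"

definition tdeg :: "nat \<Rightarrow> (nat \<Rightarrow> nat) \<Rightarrow> nat" where
  "tdeg n i = (\<Sum>j<n. i j)"

definition mdeg :: "nat \<Rightarrow> ((nat \<Rightarrow> nat) \<Rightarrow> 'K::zero) \<Rightarrow> nat" where
  "mdeg n F = Max {tdeg n i | i. F i \<noteq> 0}"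

definition mmonom :: "nat \<Rightarrow> (nat \<Rightarrow> 'K::field) \<Rightarrow> (nat \<Rightarrow> nat) \<Rightarrow> 'K" where
  "mmonom n g i = (\<Prod>j<n. g j ^ i j)"

definition meval :: "nat \<Rightarrow> ((nat \<Rightarrow> nat) \<Rightarrow> 'K::field) \<Rightarrow> (nat \<Rightarrow> 'K) \<Rightarrow> 'K" where
  "meval n F g = (\<Sum>i\<in>{i. F i \<noteq> 0}. F i * mmonom n g i)"

definition mheight :: "'K::field set \<Rightarrow> ((nat \<Rightarrow> nat) \<Rightarrow> 'K) \<Rightarrow> int" where
  "mheight E F = (\<Sum>p\<in>{p. place E p \<and> Min {p (F i) | i. F i \<noteq> 0} \<noteq> 0}.
                      - Min {p (F i) | i. F i \<noteq> 0})"

fun coeff_prods :: "((nat \<Rightarrow> nat) \<Rightarrow> 'K::field) \<Rightarrow> nat \<Rightarrow> 'K set" where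
  "coeff_prods F 0 = {1}"
| "coeff_prods F (Suc s) = {F i * m | i m. F i \<noteq> 0 \<and> m \<in> coeff_prods F s}"

definition V_F :: "'K::field set \<Rightarrow> ((nat \<Rightarrow> nat) \<Rightarrow> 'K) \<Rightarrow> nat \<Rightarrow> 'K set" where
  "V_F E F s = lin_span E (coeff_prods F s)"

definition d_F :: "'K::field set \<Rightarrow> ((nat \<Rightarrow> nat) \<Rightarrow> 'K) \<Rightarrow> nat \<Rightarrow> nat" where
  "d_F E F s = kdim E (V_F E F s)"

definition lin_nondeg :: "'K::field set \<Rightarrow> 'a set \<Rightarrow> ('a \<Rightarrow> 'K) \<Rightarrow> bool" where
  "lin_nondeg W I y \<longleftrightarrow>
     (\<forall>a. (\<forall>i\<in>I. a i \<in> W) \<longrightarrow> (\<Sum>i\<in>I. a i * y i) = 0 \<longrightarrow> (\<forall>i\<in>I. a i = 0))"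

end

theory Submission
  imports Defs "Jordan_Normal_Form.Char_Poly" "HOL-Computational_Algebra.Formal_Laurent_Series"
begin

text \<open>
  Let \<open>\<gamma>\<close> be a basis of \<open>V(r)\<close> that starts with \<open>F(0)\<close> times a basis \<open>\<beta>\<close> of \<open>V(r - 1)\<close>.  By
  nondegeneracy the family of all products of some \<open>\<gamma> l\<close> with a monomial in \<open>g\<close> of degree at
  most \<open>d\<close> is independent over the constants, so its Wronskian \<open>W\<close> with respect to a derivation
  \<open>d/dz\<close> is nonzero.  Up to a constant factor, \<open>W\<close> may be computed from any other basis of the same
  span, chosen separately at each place: at a place of \<open>S\<close> where \<open>F(g)\<close> vanishes one replaces
  \<open>\<gamma> l\<close> by \<open>\<beta> l\<close> times \<open>F(g)\<close>, which makes \<open>W\<close> vanish to correspondingly higher order; outside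
  \<open>S\<close> a basis with distinct orders at the place avoids any loss.  The orders of \<open>W\<close> sum to zero, and
  so do the orders over \<open>S\<close> of a monomial in \<open>S\<close>-units; what remains is the height of \<open>F\<close> and the
  degree of the divisor of \<open>dz\<close>.

  With the genus defined by Riemann's inequality, the bound \<open>2 genus - 2\<close> for the degree of \<open>dz\<close>
  needs no duality: take a basis of the field over \<open>k(z)\<close>, regular away from the poles of \<open>z\<close>, whose
  pole orders have minimal sum.  Counting polynomial coordinates relates this sum to the genus, and
  the trace form of the basis has a polynomial determinant whose degree is at most twice the sum and
  whose zeros account for the ramification of \<open>z\<close>.
\<close>

section \<open>Linear algebra over a subfield\<close>

text \<open>The constants come from one count. The family has \<open>M = d_r * (N + 1)\<close>
  members, of which \<open>d_(r-1)\<close> carry the monomial 1 and can be traded for multiples of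
  \<open>F(g)\<close>; so \<open>d_(r-1)\<close> multiplies the sum to be bounded, and dividing by
  it produces all the quotients. The factor \<open>M * (M - 1) / 2\<close> is the total number of
  differentiations in one term of the Wronskian. The trade needs \<open>F(0) \<noteq> 0\<close>:
  each replaced member then reappears in its replacement with coefficient 1.

  The obstacle is that points are given only as discrete valuations trivial on \<open>k\<close>.
  Residue field \<open>k\<close>, finitely many zeros, as many zeros as poles, power series, enough
  points: everything has to be drawn from the finite degree of \<open>K\<close> over one field
  \<open>k(t)\<close>. The recurring device is to compare sizes of independent families, where
  independence over \<open>k(x)\<close> is tested by reducing a relation modulo \<open>x\<close> at
  places where \<open>x\<close> vanishes.\<close>

lemma subfieldD:
  assumes "subfield E"
  shows subfield_0: "0 \<in> E" and subfield_1: "1 \<in> E"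
    and subfield_add: "\<And>x y. x \<in> E \<Longrightarrow> y \<in> E \<Longrightarrow> x + y \<in> E"
    and subfield_mult: "\<And>x y. x \<in> E \<Longrightarrow> y \<in> E \<Longrightarrow> x * y \<in> E"
    and subfield_uminus: "\<And>x. x \<in> E \<Longrightarrow> - x \<in> E"
    and subfield_inverse: "\<And>x. x \<in> E \<Longrightarrow> inverse x \<in> E"
  using assms by (auto simp: subfield_def)

lemma subfield_diff: "subfield E \<Longrightarrow> x \<in> E \<Longrightarrow> y \<in> E \<Longrightarrow> x - y \<in> E"
  using subfield_add[of E x "- y"] subfield_uminus[of E y] by simp

lemma subfield_divide: "subfield E \<Longrightarrow> x \<in> E \<Longrightarrow> y \<in> E \<Longrightarrow> x / y \<in> E"
  by (simp add: divide_inverse subfield_mult subfield_inverse)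

lemma subfield_sum: "subfield E \<Longrightarrow> (\<And>i. i \<in> I \<Longrightarrow> f i \<in> E) \<Longrightarrow> sum f I \<in> E"
  by (induction I rule: infinite_finite_induct) (auto simp: subfield_0 subfield_add)

lemma subfield_prod: "subfield E \<Longrightarrow> (\<And>i. i \<in> I \<Longrightarrow> f i \<in> E) \<Longrightarrow> prod f I \<in> E"
  by (induction I rule: infinite_finite_induct) (auto simp: subfield_1 subfield_mult)

lemma subfield_power: "subfield E \<Longrightarrow> x \<in> E \<Longrightarrow> x ^ n \<in> E"
  by (induction n) (auto simp: subfield_1 subfield_mult)

lemma subfield_of_nat: "subfield E \<Longrightarrow> of_nat n \<in> E"
  by (induction n) (auto simp: subfield_0 subfield_1 subfield_add)

text \<open>Each equation eliminates one unknown, and all divisions stay in \<open>E\<close>.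
  Keeping the solution in \<open>E\<close> lets the same count serve the constants,
  \<open>k(x)\<close> and the whole field as scalars.\<close>

lemma homogeneous_system_nontrivial:
  fixes a :: "'i \<Rightarrow> 'j \<Rightarrow> 'K::field"
  assumes E: "subfield E" and "finite I" "finite J" "card I < card J"
    and "\<And>i j. i \<in> I \<Longrightarrow> j \<in> J \<Longrightarrow> a i j \<in> E"
  shows "\<exists>c. (\<forall>j. c j \<in> E) \<and> (\<exists>j\<in>J. c j \<noteq> 0) \<and> (\<forall>i\<in>I. (\<Sum>j\<in>J. a i j * c j) = 0)"
  using assms(2-5)
proof (induction I arbitrary: J a rule: finite_induct)
  case empty
  then obtain j where "j \<in> J" by fastforce
  then show ?case by (intro exI[of _ "\<lambda>_. 1"]) (auto simp: subfield_1[OF E])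
next
  case (insert i0 I)
  show ?case
  proof (cases "\<forall>j\<in>J. a i0 j = 0")
    case True
    have "card I < card J" using insert by simp
    with insert.IH[of J a] insert.prems
    obtain c where "\<forall>j. c j \<in> E" "\<exists>j\<in>J. c j \<noteq> 0" "\<forall>i\<in>I. (\<Sum>j\<in>J. a i j * c j) = 0" by auto
    then show ?thesis using True by (intro exI[of _ c]) auto
  next
    case False
    then obtain j0 where j0: "j0 \<in> J" "a i0 j0 \<noteq> 0" by auto
    define J' where "J' = J - {j0}"
    define b where "b i j = a i j - a i j0 * a i0 j / a i0 j0" for i j
    have "finite J'" "card I < card J'" using insert j0 by (auto simp: J'_def)
    moreover have "b i j \<in> E" if "i \<in> I" "j \<in> J'" for i j
      using that insert.prems(3) j0 unfolding b_def J'_def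
      by (intro subfield_diff[OF E] subfield_divide[OF E] subfield_mult[OF E]) auto
    ultimately obtain c where c: "\<forall>j. c j \<in> E" "\<exists>j\<in>J'. c j \<noteq> 0" "\<forall>i\<in>I. (\<Sum>j\<in>J'. b i j * c j) = 0"
      using insert.IH[of J' b] by blast
    define c0 where "c0 = - (\<Sum>j\<in>J'. a i0 j * c j) / a i0 j0"
    define c' where "c' = c(j0 := c0)"
    have c0E: "c0 \<in> E" unfolding c0_def
      using c(1) insert.prems(3) j0 unfolding J'_def
      by (intro subfield_divide[OF E] subfield_uminus[OF E] subfield_sum[OF E] subfield_mult[OF E]) auto
    have sum_eq: "(\<Sum>j\<in>J. a i j * c' j) = a i j0 * c0 + (\<Sum>j\<in>J'. a i j * c j)" for i
    proof -
      have "(\<Sum>j\<in>J. a i j * c' j) = a i j0 * c' j0 + (\<Sum>j\<in>J'. a i j * c' j)"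
        unfolding J'_def using insert.prems j0 by (simp add: sum.remove)
      also have "(\<Sum>j\<in>J'. a i j * c' j) = (\<Sum>j\<in>J'. a i j * c j)"
        by (intro sum.cong) (auto simp: c'_def J'_def)
      finally show ?thesis by (simp add: c'_def)
    qed
    have "(\<Sum>j\<in>J. a i0 j * c' j) = 0" unfolding sum_eq c0_def using j0 by (simp add: field_simps)
    moreover have "(\<Sum>j\<in>J. a i j * c' j) = 0" if "i \<in> I" for i
    proof -
      have "0 = (\<Sum>j\<in>J'. b i j * c j)" using c(3) that by simp
      also have "\<dots> = (\<Sum>j\<in>J'. a i j * c j) - a i j0 / a i0 j0 * (\<Sum>j\<in>J'. a i0 j * c j)"
        unfolding b_def by (simp add: sum_distrib_left sum_subtractf[symmetric] algebra_simps)
      also have "\<dots> = a i j0 * c0 + (\<Sum>j\<in>J'. a i j * c j)"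
        unfolding c0_def using j0 by (simp add: field_simps)
      finally show ?thesis unfolding sum_eq by simp
    qed
    moreover have "\<exists>j\<in>J. c' j \<noteq> 0" using c(2) by (auto simp: c'_def J'_def)
    moreover have "\<forall>j. c' j \<in> E" using c(1) c0E by (auto simp: c'_def)
    ultimately show ?thesis by (intro exI[of _ c']) auto
  qed
qed

text \<open>Spans of families rather than of sets: the counts run over index sets, and a repeated
  value has to show up as a dependence.\<close>

definition espan :: "'K::field set \<Rightarrow> 'i set \<Rightarrow> ('i \<Rightarrow> 'K) \<Rightarrow> 'K set" where
  "espan E I y = {\<Sum>i\<in>I. c i * y i | c. \<forall>i\<in>I. c i \<in> E}"

definition subspace_over :: "'K::field set \<Rightarrow> 'K set \<Rightarrow> bool" where
  "subspace_over E V \<longleftrightarrow> 0 \<in> V \<and> (\<forall>x\<in>V. \<forall>y\<in>V. x + y \<in> V) \<and> (\<forall>c\<in>E. \<forall>x\<in>V. c * x \<in> V)"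

text \<open>Bounds independent families instead of spanning ones: this passes to subspaces at once
  and is available before \<open>kdim\<close>, a least number that means something only when a
  finite spanning set exists. Index sets in \<open>nat\<close> suffice, by
  \<open>dim_le_card\<close>.\<close>

definition dim_le :: "'K::field set \<Rightarrow> 'K set \<Rightarrow> nat \<Rightarrow> bool" where
  "dim_le E V n \<longleftrightarrow>
     (\<forall>(I::nat set) y. finite I \<longrightarrow> (\<forall>i\<in>I. y i \<in> V) \<longrightarrow> lin_nondeg E I y \<longrightarrow> card I \<le> n)"

lemma lin_nondegI:
  assumes "\<And>a. (\<And>i. i \<in> I \<Longrightarrow> a i \<in> E) \<Longrightarrow> (\<Sum>i\<in>I. a i * y i) = 0 \<Longrightarrow> (\<And>i. i \<in> I \<Longrightarrow> a i = 0)"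
  shows "lin_nondeg E I y"
  using assms unfolding lin_nondeg_def by blast

lemma lin_nondegD:
  assumes "lin_nondeg E I y" "\<And>i. i \<in> I \<Longrightarrow> a i \<in> E" "(\<Sum>i\<in>I. a i * y i) = 0" "i \<in> I"
  shows "a i = 0"
  using assms unfolding lin_nondeg_def by blast

lemma lin_nondeg_reindex:
  assumes "inj_on h J"
  shows "lin_nondeg E (h ` J) y \<longleftrightarrow> lin_nondeg E J (\<lambda>j. y (h j))"
proof
  assume *: "lin_nondeg E (h ` J) y"
  show "lin_nondeg E J (\<lambda>j. y (h j))"
  proof (rule lin_nondegI)
    fix a i assume a: "\<And>i. i \<in> J \<Longrightarrow> a i \<in> E" "(\<Sum>i\<in>J. a i * y (h i)) = 0" "i \<in> J"
    define b where "b i = a (the_inv_into J h i)" for i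
    have "(\<Sum>i\<in>h ` J. b i * y i) = 0"
      unfolding sum.reindex[OF assms] o_def b_def using a(2)
      by (simp add: the_inv_into_f_f[OF assms] cong: sum.cong)
    moreover have "b k \<in> E" if "k \<in> h ` J" for k
      using that a(1) by (auto simp: b_def the_inv_into_f_f[OF assms])
    ultimately have "b (h i) = 0" using lin_nondegD[OF *, of b "h i"] a(3) by blast
    then show "a i = 0" using a by (simp add: b_def the_inv_into_f_f[OF assms])
  qed
next
  assume *: "lin_nondeg E J (\<lambda>j. y (h j))"
  show "lin_nondeg E (h ` J) y"
  proof (rule lin_nondegI)
    fix a i assume a: "\<And>i. i \<in> h ` J \<Longrightarrow> a i \<in> E" "(\<Sum>i\<in>h ` J. a i * y i) = 0" "i \<in> h ` J"
    then obtain j where j: "j \<in> J" "i = h j" by auto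
    have "(\<Sum>i\<in>J. a (h i) * y (h i)) = 0" using a(2) by (simp add: sum.reindex[OF assms])
    from lin_nondegD[OF * _ this j(1)] show "a i = 0" using a j by auto
  qed
qed

lemma lin_nondeg_subset:
  assumes E: "subfield E" and "lin_nondeg E I y" "J \<subseteq> I" "finite I"
  shows "lin_nondeg E J y"
proof (rule lin_nondegI)
  fix a i assume a: "\<And>i. i \<in> J \<Longrightarrow> a i \<in> E" "(\<Sum>i\<in>J. a i * y i) = 0" "i \<in> J"
  define b where "b i = (if i \<in> J then a i else 0)" for i
  have "(\<Sum>i\<in>I. b i * y i) = (\<Sum>i\<in>J. b i * y i)"
    using assms(3,4) by (intro sum.mono_neutral_right) (auto simp: b_def)
  also have "\<dots> = 0" using a(2) by (simp add: b_def cong: sum.cong)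
  finally have "b i = 0"
    using lin_nondegD[OF assms(2), of b i] a assms(3) subfield_0[OF E] by (auto simp: b_def)
  then show "a i = 0" using a by (simp add: b_def)
qed

lemma lin_nondeg_inj:
  assumes E: "subfield E" and "lin_nondeg E I y" "finite I"
  shows "inj_on y I"
proof (rule inj_onI, rule ccontr)
  fix i j assume ij: "i \<in> I" "j \<in> I" "y i = y j" "i \<noteq> j"
  have "lin_nondeg E {i,j} y" using lin_nondeg_subset[OF assms(1,2)] ij assms(3) by auto
  moreover have "(if k = i then 1 else - 1) \<in> E" for k
    using E by (auto simp: subfield_1 subfield_uminus)
  ultimately show False using lin_nondegD[of E "{i,j}" y "\<lambda>k. if k = i then 1 else - 1" i] ij by auto
qed

lemma lin_nondeg_nonzero:
  assumes E: "subfield E" and "lin_nondeg E I y" "finite I" "i \<in> I"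
  shows "y i \<noteq> 0"
proof
  assume "y i = 0"
  have "lin_nondeg E {i} y" using lin_nondeg_subset[OF assms(1,2)] assms by auto
  from lin_nondegD[OF this, of "\<lambda>_. 1" i] \<open>y i = 0\<close> E
  show False by (auto simp: subfield_1)
qed

lemma lin_nondeg_mult:
  assumes "lin_nondeg E I y" "u \<noteq> 0"
  shows "lin_nondeg E I (\<lambda>i. u * y i)"
proof (rule lin_nondegI)
  fix a i assume a: "\<And>i. i \<in> I \<Longrightarrow> a i \<in> E" "(\<Sum>i\<in>I. a i * (u * y i)) = 0" "i \<in> I"
  have "u * (\<Sum>i\<in>I. a i * y i) = 0" using a(2) by (simp add: sum_distrib_left mult_ac)
  then show "a i = 0" using lin_nondegD[OF assms(1) a(1) _ a(3)] assms(2) by simp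
qed

lemma espan_base: "subfield E \<Longrightarrow> finite I \<Longrightarrow> i \<in> I \<Longrightarrow> y i \<in> espan E I y"
  unfolding espan_def
  by (rule CollectI, rule exI[of _ "\<lambda>j. if j = i then 1 else 0"])
     (auto simp: subfield_0 subfield_1 if_distrib[of "\<lambda>x. x * _"] cong: if_cong)

lemma espan_subspace:
  assumes "subfield E" shows "subspace_over E (espan E I y)"
  unfolding subspace_over_def espan_def
proof (intro conjI ballI)
  show "0 \<in> {\<Sum>i\<in>I. c i * y i |c. \<forall>i\<in>I. c i \<in> E}"
    by (rule CollectI, rule exI[of _ "\<lambda>_. 0"]) (auto simp: subfield_0[OF assms])
next
  fix u v assume "u \<in> {\<Sum>i\<in>I. c i * y i |c. \<forall>i\<in>I. c i \<in> E}" "v \<in> {\<Sum>i\<in>I. c i * y i |c. \<forall>i\<in>I. c i \<in> E}"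
  then obtain c d where "u = (\<Sum>i\<in>I. c i * y i)" "\<forall>i\<in>I. c i \<in> E" "v = (\<Sum>i\<in>I. d i * y i)" "\<forall>i\<in>I. d i \<in> E"
    by auto
  then show "u + v \<in> {\<Sum>i\<in>I. c i * y i |c. \<forall>i\<in>I. c i \<in> E}"
    by (intro CollectI exI[of _ "\<lambda>i. c i + d i"]) (auto simp: sum.distrib algebra_simps subfield_add[OF assms])
next
  fix a u assume "a \<in> E" "u \<in> {\<Sum>i\<in>I. c i * y i |c. \<forall>i\<in>I. c i \<in> E}"
  then obtain c where "u = (\<Sum>i\<in>I. c i * y i)" "\<forall>i\<in>I. c i \<in> E" by auto
  with \<open>a \<in> E\<close> show "a * u \<in> {\<Sum>i\<in>I. c i * y i |c. \<forall>i\<in>I. c i \<in> E}"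
    by (intro CollectI exI[of _ "\<lambda>i. a * c i"]) (auto simp: sum_distrib_left algebra_simps subfield_mult[OF assms])
qed

lemma subspace_sum:
  "subspace_over E V \<Longrightarrow> (\<And>i. i \<in> I \<Longrightarrow> f i \<in> V) \<Longrightarrow> sum f I \<in> V"
  by (induction I rule: infinite_finite_induct) (auto simp: subspace_over_def)

lemma subspace_lincomb:
  "subspace_over E V \<Longrightarrow> (\<And>i. i \<in> I \<Longrightarrow> c i \<in> E) \<Longrightarrow> (\<And>i. i \<in> I \<Longrightarrow> y i \<in> V) \<Longrightarrow> (\<Sum>i\<in>I. c i * y i) \<in> V"
  by (rule subspace_sum) (auto simp: subspace_over_def)

lemma espan_subset: "subspace_over E V \<Longrightarrow> (\<And>i. i \<in> I \<Longrightarrow> y i \<in> V) \<Longrightarrow> espan E I y \<subseteq> V"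
  unfolding espan_def by (auto intro!: subspace_lincomb)

lemma not_lin_nondeg_of_card:
  assumes E: "subfield E" and fin: "finite I" "finite J" and span: "\<And>j. j \<in> J \<Longrightarrow> y j \<in> espan E I x"
    and card: "card I < card J"
  shows "\<not> lin_nondeg E J y"
proof
  assume nd: "lin_nondeg E J y"
  have "\<forall>j\<in>J. \<exists>c. (\<forall>i\<in>I. c i \<in> E) \<and> y j = (\<Sum>i\<in>I. c i * x i)" using span unfolding espan_def by blast
  then obtain a where a: "\<And>j i. j \<in> J \<Longrightarrow> i \<in> I \<Longrightarrow> a j i \<in> E" "\<And>j. j \<in> J \<Longrightarrow> y j = (\<Sum>i\<in>I. a j i * x i)"
    by metis
  obtain c where c: "\<And>j. c j \<in> E" "\<exists>j\<in>J. c j \<noteq> 0" "\<forall>i\<in>I. (\<Sum>j\<in>J. a j i * c j) = 0"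
    using homogeneous_system_nontrivial[OF E fin card, of "\<lambda>i j. a j i"] a(1) by blast
  have "(\<Sum>j\<in>J. c j * y j) = (\<Sum>j\<in>J. \<Sum>i\<in>I. x i * (a j i * c j))"
    by (intro sum.cong) (auto simp: a(2) sum_distrib_left algebra_simps)
  also have "\<dots> = (\<Sum>i\<in>I. x i * (\<Sum>j\<in>J. a j i * c j))"
    by (subst sum.swap) (simp add: sum_distrib_left)
  also have "\<dots> = 0" using c(3) by simp
  finally show False using lin_nondegD[OF nd, of c] c(1,2) by blast
qed

lemma lin_nondeg_insert:
  assumes E: "subfield E" and "finite I" "lin_nondeg E I y" "v \<notin> espan E I y" "i \<notin> I"
  shows "lin_nondeg E (insert i I) (y(i := v))"
proof (rule lin_nondegI)
  fix a j assume a: "\<And>j. j \<in> insert i I \<Longrightarrow> a j \<in> E" "(\<Sum>j\<in>insert i I. a j * (y(i := v)) j) = 0" "j \<in> insert i I"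
  have eq: "a i * v + (\<Sum>j\<in>I. a j * y j) = 0"
  proof -
    have "(\<Sum>j\<in>I. a j * (y(i := v)) j) = (\<Sum>j\<in>I. a j * y j)"
      using assms(5) by (intro sum.cong) auto
    then show ?thesis using a(2) assms by simp
  qed
  have "a i = 0"
  proof (rule ccontr)
    assume "a i \<noteq> 0"
    then have "v = (\<Sum>j\<in>I. (- a j / a i) * y j)"
      using eq by (simp add: sum_divide_distrib[symmetric] sum_negf divide_simps sum_distrib_left[symmetric] algebra_simps eq_neg_iff_add_eq_0)
    then have "v \<in> espan E I y" unfolding espan_def using a(1)
      by (intro CollectI exI[of _ "\<lambda>j. - a j / a i"]) (auto intro!: subfield_divide[OF E] subfield_uminus[OF E])
    with assms show False by simp
  qed
  with eq have "(\<Sum>j\<in>I. a j * y j) = 0" by simp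
  with \<open>a i = 0\<close> show "a j = 0" using a lin_nondegD[OF assms(3), of a] by blast
qed

lemma dim_leI:
  assumes "\<And>(I::nat set) y. finite I \<Longrightarrow> (\<And>i. i \<in> I \<Longrightarrow> y i \<in> V) \<Longrightarrow> lin_nondeg E I y \<Longrightarrow> card I \<le> n"
  shows "dim_le E V n"
  unfolding dim_le_def by (intro allI impI assms) auto

lemma dim_le_card:
  assumes "dim_le E V n" "finite J" "\<And>j. j \<in> J \<Longrightarrow> y j \<in> V" "lin_nondeg E J y"
  shows "card J \<le> n"
proof -
  obtain h where h: "bij_betw h {..<card J} J" using ex_bij_betw_nat_finite[OF assms(2)] by (auto simp: atLeast0LessThan)
  have "lin_nondeg E {..<card J} (\<lambda>i. y (h i))"
    using lin_nondeg_reindex[of h "{..<card J}" E y] h assms(4) by (auto simp: bij_betw_def)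
  moreover have "\<forall>i\<in>{..<card J}. y (h i) \<in> V" using assms(3) h by (auto simp: bij_betw_def)
  ultimately show ?thesis
    using assms(1)[unfolded dim_le_def, rule_format, of "{..<card J}" "\<lambda>i. y (h i)"] by simp
qed

lemma dim_le_espan:
  assumes "subfield E" "finite I" shows "dim_le E (espan E I x) (card I)"
proof (rule dim_leI)
  fix I' :: "nat set" and y assume *: "finite I'" "\<And>i. i \<in> I' \<Longrightarrow> y i \<in> espan E I x" "lin_nondeg E I' y"
  show "card I' \<le> card I"
    using not_lin_nondeg_of_card[OF assms *(1), of y x] *(2,3) by (cases "card I < card I'") auto
qed

lemma dim_le_subset:
  assumes "dim_le E V n" "W \<subseteq> V" shows "dim_le E W n"
proof (rule dim_leI)
  fix I :: "nat set" and y assume *: "finite I" "\<And>i. i \<in> I \<Longrightarrow> y i \<in> W" "lin_nondeg E I y"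
  then show "card I \<le> n" using dim_le_card[OF assms(1) *(1) _ *(3)] assms(2) by (simp add: subset_iff)
qed

text \<open>The bound \<open>n\<close> makes a longest independent extension inside \<open>V\<close>
  exist; an element outside its span would prolong it by \<open>lin_nondeg_insert\<close>.\<close>

lemma basis_extension:
  fixes s :: nat
  assumes E: "subfield E" and V: "subspace_over E V" and n: "dim_le E V n"
    and y: "lin_nondeg E {..<s} y" "\<And>i. i < s \<Longrightarrow> y i \<in> V"
  shows "\<exists>(m::nat) y'. s \<le> m \<and> (\<forall>i<s. y' i = y i) \<and> (\<forall>i<m. y' i \<in> V) \<and>
    lin_nondeg E {..<m} y' \<and> V = espan E {..<m} y'"
proof -
  define P where "P m = (\<exists>y'. s \<le> m \<and> (\<forall>i<s. y' i = y i) \<and> (\<forall>i<m. y' i \<in> V) \<and> lin_nondeg E {..<m} y')" for m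
  have "P s" unfolding P_def using y by (intro exI[of _ y]) simp
  moreover have bnd: "\<forall>m. P m \<longrightarrow> m \<le> n"
  proof (intro allI impI)
    fix m assume "P m"
    then obtain y' where "\<forall>i<m. y' i \<in> V" "lin_nondeg E {..<m} y'"
      unfolding P_def by (elim exE conjE) (rule that)
    then show "m \<le> n" using dim_le_card[OF n, of "{..<m}" y'] by simp
  qed
  ultimately have Pm: "P (Greatest P)" and Gr: "\<And>m. P m \<Longrightarrow> m \<le> Greatest P"
    using GreatestI_nat[of P s n] Greatest_le_nat[of P _ n] by metis+
  define m where "m = Greatest P"
  from Pm[folded m_def] obtain y' where y': "s \<le> m" "\<forall>i<s. y' i = y i" "\<forall>i<m. y' i \<in> V" "lin_nondeg E {..<m} y'"
    unfolding P_def by (elim exE conjE) (rule that)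
  have "V = espan E {..<m} y'"
  proof
    show "espan E {..<m} y' \<subseteq> V" by (rule espan_subset[OF V]) (use y'(3) in auto)
    show "V \<subseteq> espan E {..<m} y'"
    proof (rule ccontr)
      assume "\<not> V \<subseteq> espan E {..<m} y'"
      then obtain v where v: "v \<in> V" "v \<notin> espan E {..<m} y'" by blast
      have "lin_nondeg E (insert m {..<m}) (y'(m := v))"
        using lin_nondeg_insert[OF E _ y'(4) v(2)] by simp
      then have "P (Suc m)" unfolding P_def using y' v
        by (intro exI[of _ "y'(m := v)"]) (auto simp: lessThan_Suc)
      from Gr[OF this] show False by (simp add: m_def)
    qed
  qed
  with y' show ?thesis by (intro exI[of _ m] exI[of _ y']) simp
qed

lemma lin_span_espan:
  assumes "subfield E" "finite B" shows "lin_span E B = espan E B (\<lambda>b. b)"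
proof
  show "lin_span E B \<subseteq> espan E B (\<lambda>b. b)"
  proof
    fix x assume "x \<in> lin_span E B"
    then obtain B' c where *: "x = (\<Sum>b\<in>B'. c b * b)" "B' \<subseteq> B" "\<forall>b. c b \<in> E" by (auto simp: lin_span_def)
    have "x = (\<Sum>b\<in>B. (if b \<in> B' then c b else 0) * b)"
      unfolding *(1) using * assms(2) by (intro sum.mono_neutral_cong_left) auto
    then show "x \<in> espan E B (\<lambda>b. b)" unfolding espan_def using * subfield_0[OF assms(1)]
      by (intro CollectI exI[of _ "\<lambda>b. if b \<in> B' then c b else 0"]) auto
  qed
  show "espan E B (\<lambda>b. b) \<subseteq> lin_span E B"
  proof
    fix x assume "x \<in> espan E B (\<lambda>b. b)"
    then obtain c where *: "x = (\<Sum>b\<in>B. c b * b)" "\<forall>b\<in>B. c b \<in> E" by (auto simp: espan_def)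
    then have "x = (\<Sum>b\<in>B. (if b \<in> B then c b else 0) * b)" by (auto intro!: sum.cong)
    then show "x \<in> lin_span E B" unfolding lin_span_def using assms * subfield_0[OF assms(1)]
      by (intro CollectI exI[of _ B] exI[of _ "\<lambda>b. if b \<in> B then c b else 0"]) auto
  qed
qed

lemma espan_image:
  assumes "inj_on y I" shows "espan E (y ` I) (\<lambda>b. b) = espan E I y"
proof
  show "espan E I y \<subseteq> espan E (y ` I) (\<lambda>b. b)"
  proof
    fix x assume "x \<in> espan E I y"
    then obtain c where "x = (\<Sum>i\<in>I. c i * y i)" "\<forall>i\<in>I. c i \<in> E" by (auto simp: espan_def)
    then show "x \<in> espan E (y ` I) (\<lambda>b. b)" unfolding espan_def
      by (intro CollectI exI[of _ "\<lambda>b. c (the_inv_into I y b)"])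
         (auto simp: sum.reindex[OF assms] the_inv_into_f_f[OF assms] cong: sum.cong)
  qed
  show "espan E (y ` I) (\<lambda>b. b) \<subseteq> espan E I y"
    unfolding espan_def by (auto simp: sum.reindex[OF assms])
qed

lemma kdim_eq:
  assumes E: "subfield E" and nd: "lin_nondeg E {..<m} y" and V: "V = espan E {..<m} y"
  shows "kdim E V = m"
  unfolding kdim_def
proof (rule Least_equality)
  have inj: "inj_on y {..<m}" using lin_nondeg_inj[OF E nd] by simp
  have "lin_span E (y ` {..<m}) = V" using lin_span_espan[OF E, of "y ` {..<m}"] espan_image[OF inj] V by simp
  moreover have "y ` {..<m} \<subseteq> V" unfolding V by (auto intro!: espan_base[OF E])
  ultimately show "\<exists>B. finite B \<and> card B = m \<and> B \<subseteq> V \<and> lin_span E B = V"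
    using card_image[OF inj] by (intro exI[of _ "y ` {..<m}"]) auto
next
  fix m' assume "\<exists>B. finite B \<and> card B = m' \<and> B \<subseteq> V \<and> lin_span E B = V"
  then obtain B where B: "finite B" "card B = m'" "lin_span E B = V" by blast
  have "\<not> card B < card {..<m}"
    using not_lin_nondeg_of_card[OF E B(1), of "{..<m}" y "\<lambda>b. b"] nd espan_base[OF E, of "{..<m}" _ y] lin_span_espan[OF E B(1)] B(3) V
    by auto
  with B show "m \<le> m'" by simp
qed

lemma lin_nondeg_empty [simp]: "lin_nondeg E {} y"
  by (simp add: lin_nondeg_def)

lemma kdim_basis:
  assumes "subfield E" "subspace_over E V" "dim_le E V n"
  shows "\<exists>y. (\<forall>i<kdim E V. y i \<in> V) \<and> lin_nondeg E {..<kdim E V} y \<and> V = espan E {..<kdim E V} y"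
proof -
  have "lin_nondeg E {..<0::nat} (\<lambda>_. 0)" by simp
  from basis_extension[OF assms this, simplified] obtain m :: nat and y where y: "\<forall>i<m. y i \<in> V"
    "lin_nondeg E {..<m} y" "V = espan E {..<m} y" by (elim exE conjE) (rule that; assumption)
  have "kdim E V = m" by (rule kdim_eq[OF assms(1) y(2,3)])
  show ?thesis unfolding \<open>kdim E V = m\<close> using y by (intro exI[of _ y] conjI)
qed

lemma kdim_le:
  assumes "subfield E" "subspace_over E V" "dim_le E V n" shows "kdim E V \<le> n"
proof -
  obtain y where "\<And>i. i < kdim E V \<Longrightarrow> y i \<in> V" "lin_nondeg E {..<kdim E V} y"
    using kdim_basis[OF assms] by (elim exE conjE) (rule that; simp)
  then show ?thesis using dim_le_card[OF assms(3), of "{..<kdim E V}" y] by auto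
qed

lemma card_le_kdim:
  assumes "subfield E" "subspace_over E V" "dim_le E V n"
    and "finite J" "\<And>j. j \<in> J \<Longrightarrow> y j \<in> V" "lin_nondeg E J y"
  shows "card J \<le> kdim E V"
proof -
  obtain z where z: "V = espan E {..<kdim E V} z" using kdim_basis[OF assms(1-3)] by (elim exE conjE) (rule that; assumption)
  have "\<And>j. j \<in> J \<Longrightarrow> y j \<in> espan E {..<kdim E V} z" using assms(5) unfolding z[symmetric] .
  then have "\<not> card {..<kdim E V} < card J"
    using not_lin_nondeg_of_card[OF assms(1) _ assms(4), of "{..<kdim E V}" y z] assms(6) by blast
  then show ?thesis by simp
qed
lemma basis_extension_kdim:
  fixes s :: nat
  assumes E: "subfield E" and V: "subspace_over E V" and n: "dim_le E V n"
    and y: "lin_nondeg E {..<s} y" "\<And>i. i < s \<Longrightarrow> y i \<in> V"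
  shows "\<exists>y'. s \<le> kdim E V \<and> (\<forall>i<s. y' i = y i) \<and> (\<forall>i<kdim E V. y' i \<in> V) \<and>
    lin_nondeg E {..<kdim E V} y' \<and> V = espan E {..<kdim E V} y'"
proof -
  have "\<exists>(m::nat) y'. s \<le> m \<and> (\<forall>i<s. y' i = y i) \<and> (\<forall>i<m. y' i \<in> V) \<and>
    lin_nondeg E {..<m} y' \<and> V = espan E {..<m} y'"
    by (rule basis_extension[OF E V n y(1)]) (rule y(2))
  then obtain m :: nat and y' where *: "s \<le> m" "\<forall>i<s. y' i = y i" "\<forall>i<m. y' i \<in> V"
    "lin_nondeg E {..<m} y'" "V = espan E {..<m} y'"
    by (elim exE conjE) (rule that)
  have "kdim E V = m" by (rule kdim_eq[OF E *(4,5)])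
  show ?thesis unfolding \<open>kdim E V = m\<close> using * by (intro exI[of _ y'] conjI)
qed

hide_const (open) Module.smult

section \<open>Degrees over rational subfields\<close>

lemma poly_as_sum:
  fixes p :: "'a::comm_semiring_1 poly"
  assumes "degree p \<le> m" shows "poly p x = (\<Sum>i\<le>m. coeff p i * x ^ i)"
  unfolding poly_altdef using assms by (intro sum.mono_neutral_left) (auto simp: coeff_eq_0)

section \<open>Polynomials with coefficients in a subfield\<close>

definition poly_over :: "'K::field set \<Rightarrow> 'K poly \<Rightarrow> bool" where
  "poly_over E q \<longleftrightarrow> (\<forall>i. coeff q i \<in> E)"

context
  fixes E :: "'K::field set" assumes E: "subfield E"
begin

lemma poly_over_0: "poly_over E 0"
  by (simp add: poly_over_def subfield_0[OF E])

lemma poly_over_pCons: "poly_over E (pCons a q) \<longleftrightarrow> a \<in> E \<and> poly_over E q"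
  unfolding poly_over_def by (auto simp: coeff_pCons split: nat.splits)

lemma poly_over_1: "poly_over E 1"
  by (simp add: one_pCons poly_over_pCons poly_over_0 subfield_1[OF E])

lemma poly_over_add: "poly_over E p \<Longrightarrow> poly_over E q \<Longrightarrow> poly_over E (p + q)"
  by (simp add: poly_over_def subfield_add[OF E])

lemma poly_over_uminus: "poly_over E p \<Longrightarrow> poly_over E (- p)"
  by (simp add: poly_over_def subfield_uminus[OF E])

lemma poly_over_diff: "poly_over E p \<Longrightarrow> poly_over E q \<Longrightarrow> poly_over E (p - q)"
  by (simp add: poly_over_def subfield_diff[OF E])

lemma poly_over_smult: "a \<in> E \<Longrightarrow> poly_over E p \<Longrightarrow> poly_over E (smult a p)"
  by (simp add: poly_over_def subfield_mult[OF E])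

lemma poly_over_monom: "a \<in> E \<Longrightarrow> poly_over E (monom a n)"
  by (simp add: poly_over_def subfield_0[OF E])

lemma poly_over_mult: "poly_over E p \<Longrightarrow> poly_over E q \<Longrightarrow> poly_over E (p * q)"
  unfolding poly_over_def coeff_mult by (auto intro!: subfield_sum[OF E] subfield_mult[OF E])

lemma poly_over_sum: "(\<And>i. i \<in> I \<Longrightarrow> poly_over E (f i)) \<Longrightarrow> poly_over E (sum f I)"
  unfolding poly_over_def coeff_sum by (auto intro!: subfield_sum[OF E])

lemma poly_over_prod: "(\<And>i. i \<in> I \<Longrightarrow> poly_over E (f i)) \<Longrightarrow> poly_over E (prod f I)"
  by (induction I rule: infinite_finite_induct) (auto simp: poly_over_1 poly_over_mult)

lemma poly_over_power: "poly_over E p \<Longrightarrow> poly_over E (p ^ n)"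
  by (induction n) (auto simp: poly_over_1 poly_over_mult)

lemma poly_over_eval: "poly_over E p \<Longrightarrow> a \<in> E \<Longrightarrow> poly p a \<in> E"
  by (induction p) (auto simp: poly_over_pCons subfield_0[OF E] subfield_add[OF E] subfield_mult[OF E])

text \<open>Comparing coefficients downwards from the top expresses each coefficient of
  \<open>q\<close> by the next higher one and a coefficient of the product: synthetic division never
  leaves \<open>E\<close>.\<close>

lemma poly_over_cofactor:
  assumes "poly_over E ([:- r, 1:] * q)" "r \<in> E"
  shows "poly_over E q"
proof -
  have rec: "coeff q i = coeff ([:- r, 1:] * q) (Suc i) + r * coeff q (Suc i)" for i
    by simp
  have "coeff q i \<in> E" if "degree q - i = n" for i n
    using that
  proof (induction n arbitrary: i)
    case 0
    then show ?case
    proof (cases "i = degree q")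
      case True
      have "coeff q (Suc i) = 0" using True by (intro coeff_eq_0) simp
      then show ?thesis using rec[of i] assms(1) by (simp add: poly_over_def del: mult_pCons_left)
    next
      case False
      then have "coeff q i = 0" using 0 by (intro coeff_eq_0) simp
      then show ?thesis by (simp add: subfield_0[OF E])
    qed
  next
    case (Suc n)
    then have "coeff q (Suc i) \<in> E" by (intro Suc.IH) simp
    then show ?case unfolding rec[of i]
      using assms by (intro subfield_add[OF E] subfield_mult[OF E]) (auto simp: poly_over_def simp del: mult_pCons_left)
  qed
  then show ?thesis by (simp add: poly_over_def)
qed

end

lemma alg_closed_poly_splits:
  assumes E: "alg_closed_subfield E" and "poly_over E q" "q \<noteq> 0"
  shows "\<exists>c as. c \<in> E \<and> c \<noteq> 0 \<and> set as \<subseteq> E \<and> q = smult c (\<Prod>a\<leftarrow>as. [:- a, 1:])"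
  using assms(2,3)
proof (induction "degree q" arbitrary: q)
  case 0
  then obtain c where "q = [:c:]" by (auto elim: degree_eq_zeroE)
  with 0 show ?case by (intro exI[of _ c] exI[of _ "[]"]) (auto simp: poly_over_def elim: allE[of _ 0])
next
  case (Suc n)
  have sE: "subfield E" using E by (simp add: alg_closed_subfield_def)
  obtain x where x: "x \<in> E" "poly q x = 0"
    using E Suc.hyps(2) Suc.prems by (auto simp: alg_closed_subfield_def poly_over_def)
  then obtain q' where q': "q = [:- x, 1:] * q'"     using x(2) unfolding poly_eq_0_iff_dvd dvd_def by blast
  have "q' \<noteq> 0" using Suc.prems q' by auto
  moreover have "poly_over E q'" using poly_over_cofactor[OF sE] Suc.prems x q' by metis
  moreover have "degree q = Suc (degree q')" unfolding q' using \<open>q' \<noteq> 0\<close> by (subst degree_mult_eq) auto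
  ultimately obtain c as where "c \<in> E" "c \<noteq> 0" "set as \<subseteq> E" "q' = smult c (\<Prod>a\<leftarrow>as. [:- a, 1:])"
    using Suc.hyps(1)[of q'] Suc.hyps(2) by auto
  then show ?case using x q' by (intro exI[of _ c] exI[of _ "x # as"]) (auto simp: mult_ac simp del: mult_pCons_left mult_pCons_right)
qed

section \<open>The subfields k(x)\<close>

locale function_field =
  fixes kk :: "'K::field_char_0 set"
  assumes alg_closed: "alg_closed_subfield kk" and func_field: "function_field_over kk"
begin

abbreviation "RF \<equiv> rat_fun_field kk"

lemma kk: "subfield kk"
  using alg_closed by (simp add: alg_closed_subfield_def)

text \<open>The linear factors of \<open>q\<close> over the algebraically closed \<open>k\<close>
  account for all its roots in \<open>K\<close>. So every element outside \<open>k\<close> is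
  transcendental, and \<open>x \<notin> kk\<close> stands for transcendence from here on.\<close>

lemma poly_root_in_kk:
  assumes "poly_over kk q" "q \<noteq> 0" "poly q x = 0" shows "x \<in> kk"
proof -
  obtain c as where *: "c \<noteq> 0" "set as \<subseteq> kk" "q = smult c (\<Prod>a\<leftarrow>as. [:- a, 1:])"
    using alg_closed_poly_splits[OF alg_closed assms(1,2)] by auto
  have "(\<Prod>a\<leftarrow>as. x - a) = 0"
    using assms(3) * by (simp add: poly_prod_list o_def)
  then obtain a where "a \<in> set as" "x - a = 0" by (auto simp: prod_list_zero_iff)
  with * show ?thesis by auto
qed

lemma poly_nonconst: "x \<notin> kk \<Longrightarrow> poly_over kk q \<Longrightarrow> q \<noteq> 0 \<Longrightarrow> poly q x \<noteq> 0"
  using poly_root_in_kk by blast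

lemma RF_I: "poly_over kk p \<Longrightarrow> poly_over kk q \<Longrightarrow> q \<noteq> 0 \<Longrightarrow> poly p x / poly q x \<in> RF x"
  unfolding rat_fun_field_def poly_over_def by blast

lemma RF_E:
  assumes "y \<in> RF x"
  obtains p q where "poly_over kk p" "poly_over kk q" "q \<noteq> 0" "y = poly p x / poly q x"
  using assms unfolding rat_fun_field_def poly_over_def by auto

lemma RF_poly: "poly_over kk p \<Longrightarrow> poly p x \<in> RF x"
  using RF_I[of p 1 x] poly_over_1[OF kk] by simp

lemma RF_subfield:
  assumes "x \<notin> kk" shows "subfield (RF x)"
  unfolding subfield_def
proof (intro conjI ballI)
  show "0 \<in> RF x" "1 \<in> RF x" using RF_poly[of 0] RF_poly[of 1] poly_over_0[OF kk] poly_over_1[OF kk] by simp_all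
  fix u assume "u \<in> RF x"
  then obtain p q where pq: "poly_over kk p" "poly_over kk q" "q \<noteq> 0" "u = poly p x / poly q x" by (rule RF_E)
  have q0: "poly q x \<noteq> 0" using pq assms poly_nonconst by blast
  show "- u \<in> RF x" using RF_I[of "- p" q x] pq poly_over_uminus[OF kk] by simp
  show "inverse u \<in> RF x"
  proof (cases "p = 0")
    case True then show ?thesis using pq \<open>0 \<in> RF x\<close> by simp
  next
    case False then show ?thesis using RF_I[of q p x] pq by simp
  qed
  fix v assume "v \<in> RF x"
  then obtain p' q' where pq': "poly_over kk p'" "poly_over kk q'" "q' \<noteq> 0" "v = poly p' x / poly q' x" by (rule RF_E)
  have q0': "poly q' x \<noteq> 0" using pq' assms poly_nonconst by blast
  have "u + v = poly (p * q' + p' * q) x / poly (q * q') x"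
    unfolding pq(4) pq'(4) using q0 q0' by (simp add: field_simps)
  also have "\<dots> \<in> RF x" using pq pq' by (intro RF_I poly_over_add[OF kk] poly_over_mult[OF kk]) auto
  finally show "u + v \<in> RF x" .
  have "u * v = poly (p * p') x / poly (q * q') x" using pq pq' by simp
  also have "\<dots> \<in> RF x" using pq pq' by (intro RF_I poly_over_mult[OF kk]) auto
  finally show "u * v \<in> RF x" .
qed

lemma common_denominator:
  assumes x: "x \<notin> kk" and "finite I" "\<And>i. i \<in> I \<Longrightarrow> c i \<in> RF x"
  shows "\<exists>q P. poly_over kk q \<and> q \<noteq> 0 \<and> (\<forall>i\<in>I. poly_over kk (P i) \<and> poly q x * c i = poly (P i) x)"
  using assms(2,3)
proof (induction I rule: finite_induct)
  case empty
  then show ?case by (intro exI[of _ 1]) (auto simp: poly_over_1[OF kk])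
next
  case (insert j I)
  then obtain q P where qP: "poly_over kk q" "q \<noteq> 0" "\<forall>i\<in>I. poly_over kk (P i) \<and> poly q x * c i = poly (P i) x"
    by auto
  obtain a b where ab: "poly_over kk a" "poly_over kk b" "b \<noteq> 0" "c j = poly a x / poly b x"
    using insert.prems[of j] by (auto elim: RF_E)
  have b: "poly b x \<noteq> 0" using ab x poly_nonconst by blast
  show ?case
  proof (intro exI[of _ "q * b"] exI[of _ "\<lambda>i. if i = j then q * a else b * P i"] conjI ballI)
    fix i assume i: "i \<in> insert j I"
    show "poly_over kk (if i = j then q * a else b * P i)"
      using i qP ab by (auto intro: poly_over_mult[OF kk])
    show "poly (q * b) x * c i = poly (if i = j then q * a else b * P i) x"
    proof (cases "i = j")
      case True then show ?thesis using ab b by simp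
    next
      case False
      then have "poly q x * c i = poly (P i) x" using i qP by auto
      then show ?thesis using False by (simp add: mult.commute mult.left_commute)
    qed
  qed (use qP ab in \<open>auto intro: poly_over_mult[OF kk]\<close>)
qed

text \<open>Dividing a relation over \<open>k(x)\<close> by a power of \<open>x\<close> leaves one whose reduction modulo \<open>x\<close> is nontrivial.\<close>

lemma poly_relation_nonzero_at_0:
  assumes x: "x \<notin> kk" and "finite I" "\<And>i. i \<in> I \<Longrightarrow> poly_over kk (P i)"
    "(\<Sum>i\<in>I. poly (P i) x * y i) = 0" "\<exists>i\<in>I. P i \<noteq> 0"
  shows "\<exists>Q. (\<forall>i\<in>I. poly_over kk (Q i)) \<and> (\<Sum>i\<in>I. poly (Q i) x * y i) = 0 \<and> (\<exists>i\<in>I. coeff (Q i) 0 \<noteq> 0)"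
  using assms(3-5)
proof (induction "\<Sum>i\<in>I. degree (P i)" arbitrary: P rule: less_induct)
  case less
  show ?case
  proof (cases "\<exists>i\<in>I. coeff (P i) 0 \<noteq> 0")
    case True then show ?thesis using less.prems by (intro exI[of _ P]) auto
  next
    case False
    have "\<forall>i. \<exists>a q. P i = pCons a q" by (metis pCons_cases)
    then obtain a R where R: "\<And>i. P i = pCons (a i) (R i)" by metis
    have P: "P i = pCons 0 (R i)" if "i \<in> I" for i using that False R[of i] by auto
    have x0: "x \<noteq> 0" using x subfield_0[OF kk] by auto
    have 1: "poly_over kk (R i)" if "i \<in> I" for i
      using that less.prems(1)[of i] P[OF that] by (simp add: poly_over_pCons[OF kk])
    have "x * (\<Sum>i\<in>I. poly (R i) x * y i) = (\<Sum>i\<in>I. poly (P i) x * y i)"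
      unfolding sum_distrib_left by (intro sum.cong) (auto simp: P)
    then have 2: "(\<Sum>i\<in>I. poly (R i) x * y i) = 0" using less.prems x0 by simp
    obtain i where i: "i \<in> I" "P i \<noteq> 0" using less.prems by auto
    then have "R i \<noteq> 0" using P by auto
    have "(\<Sum>i\<in>I. degree (R i)) < (\<Sum>i\<in>I. degree (P i))"
    proof (rule sum_strict_mono_ex1[OF assms(2)])
      show "\<forall>i\<in>I. degree (R i) \<le> degree (P i)" by (simp add: P degree_pCons_eq_if)
      show "\<exists>i\<in>I. degree (R i) < degree (P i)"
        using i \<open>R i \<noteq> 0\<close> by (intro bexI[of _ i]) (auto simp: P)
    qed
    from less.hyps[OF this 1 2] i \<open>R i \<noteq> 0\<close> show ?thesis by blast
  qed
qed

text \<open>The form in which dependence over \<open>k(x)\<close> is refuted at places where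
  \<open>x\<close> vanishes: there each \<open>poly (Q i) x\<close> reduces to its constant term,
  and not all of these are zero.\<close>

lemma RF_relation_nonzero_at_0:
  assumes x: "x \<notin> kk" and I: "finite I" and nd: "\<not> lin_nondeg (RF x) I y"
  shows "\<exists>Q. (\<forall>i\<in>I. poly_over kk (Q i)) \<and> (\<Sum>i\<in>I. poly (Q i) x * y i) = 0 \<and> (\<exists>i\<in>I. coeff (Q i) 0 \<noteq> 0)"
proof -
  obtain c where c: "\<forall>i\<in>I. c i \<in> RF x" "(\<Sum>i\<in>I. c i * y i) = 0" "\<exists>i\<in>I. c i \<noteq> 0"
    using nd unfolding lin_nondeg_def by blast
  obtain q P where qP: "poly_over kk q" "q \<noteq> 0" "\<forall>i\<in>I. poly_over kk (P i) \<and> poly q x * c i = poly (P i) x"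
    using common_denominator[OF x I, of c] c(1) by blast
  have "(\<Sum>i\<in>I. poly (P i) x * y i) = (\<Sum>i\<in>I. poly q x * (c i * y i))"
    by (intro sum.cong) (use qP(3) in \<open>auto simp: mult.assoc[symmetric]\<close>)
  also have "\<dots> = 0" using c(2) by (simp add: sum_distrib_left[symmetric])
  finally have "(\<Sum>i\<in>I. poly (P i) x * y i) = 0" .
  moreover have "\<exists>i\<in>I. P i \<noteq> 0"
  proof -
    obtain i where "i \<in> I" "c i \<noteq> 0" using c by auto
    then have "poly (P i) x \<noteq> 0" using qP(3) poly_nonconst[OF x qP(1,2)]
      by (metis mult_eq_0_iff)
    then show ?thesis using \<open>i \<in> I\<close> by (intro bexI[of _ i]) auto
  qed
  ultimately show ?thesis using poly_relation_nonzero_at_0[OF x I, of P y] qP(3) by blast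
qed

lemma ex_finite_generation:
  obtains t B where "t \<notin> kk" "finite B" "espan (RF t) B (\<lambda>b. b) = UNIV"
proof -
  obtain t B where tB: "transcendental_over kk t" "finite B" "lin_span (RF t) B = UNIV"
    using func_field unfolding function_field_over_def by auto
  have "t \<notin> kk"
  proof
    assume "t \<in> kk"
    then have "\<forall>i. coeff [:- t, 1:] i \<in> kk"
      using poly_over_pCons[OF kk] poly_over_0[OF kk] subfield_uminus[OF kk] subfield_1[OF kk]
      unfolding poly_over_def[symmetric] by simp
    then have "poly [:- t, 1:] t \<noteq> 0" using tB(1) unfolding transcendental_over_def by (metis one_neq_zero pCons_eq_0_iff)
    then show False by simp
  qed
  then show ?thesis using that tB lin_span_espan[OF RF_subfield tB(2)] by metis
qed

section \<open>Growth of lattices and finite degree over k(x)\<close>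

text \<open>A \<open>k\<close>-space of dimension at most \<open>card B * (m + 1)\<close>. This
  linear growth in \<open>m\<close> is what all the following counts are compared with.\<close>

definition lattice :: "'K \<Rightarrow> 'K set \<Rightarrow> nat \<Rightarrow> 'K set" where
  "lattice t B m = {\<Sum>b\<in>B. poly (P b) t * b | P. \<forall>b\<in>B. poly_over kk (P b) \<and> degree (P b) \<le> m}"

lemma latticeI:
  "u = (\<Sum>b\<in>B. poly (P b) t * b) \<Longrightarrow> (\<And>b. b \<in> B \<Longrightarrow> poly_over kk (P b)) \<Longrightarrow> (\<And>b. b \<in> B \<Longrightarrow> degree (P b) \<le> m)
    \<Longrightarrow> u \<in> lattice t B m"
  unfolding lattice_def by auto

lemma latticeE:
  assumes "u \<in> lattice t B m"
  obtains P where "u = (\<Sum>b\<in>B. poly (P b) t * b)" "\<And>b. b \<in> B \<Longrightarrow> poly_over kk (P b)" "\<And>b. b \<in> B \<Longrightarrow> degree (P b) \<le> m"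
  using assms unfolding lattice_def by auto

lemma lattice_mono: "m \<le> m' \<Longrightarrow> u \<in> lattice t B m \<Longrightarrow> u \<in> lattice t B m'"
  by (erule latticeE, rule latticeI) (auto intro: le_trans)

lemma lattice_poly_mult:
  assumes "poly_over kk q" "u \<in> lattice t B m" shows "poly q t * u \<in> lattice t B (m + degree q)"
  using assms(2)
proof (rule latticeE)
  fix P assume P: "u = (\<Sum>b\<in>B. poly (P b) t * b)" "\<And>b. b \<in> B \<Longrightarrow> poly_over kk (P b)" "\<And>b. b \<in> B \<Longrightarrow> degree (P b) \<le> m"
  show ?thesis
  proof (rule latticeI[where P = "\<lambda>b. q * P b"])
    show "poly q t * u = (\<Sum>b\<in>B. poly (q * P b) t * b)" by (simp add: P(1) sum_distrib_left mult_ac)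
    fix b assume "b \<in> B"
    then show "poly_over kk (q * P b)" using P(2) assms(1) poly_over_mult[OF kk] by blast
    show "degree (q * P b) \<le> m + degree q" using degree_mult_le[of q "P b"] P(3)[OF \<open>b \<in> B\<close>] by simp
  qed
qed

text \<open>The matrix of multiplication by \<open>x\<close> in the generators \<open>B\<close> has
  entries in \<open>k(t)\<close>, and \<open>q\<close> is their common denominator. Including
  \<open>q\<close> alone in the conclusion allows steps with and without a factor \<open>x\<close>
  at the same price.\<close>

lemma lattice_growth:
  assumes t: "t \<notin> kk" and B: "finite B" "espan (RF t) B (\<lambda>b. b) = UNIV"
  shows "\<exists>q c. poly_over kk q \<and> q \<noteq> 0 \<and> (\<forall>m u. u \<in> lattice t B m \<longrightarrow>
           poly q t * x * u \<in> lattice t B (m + c) \<and> poly q t * u \<in> lattice t B (m + c))"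
proof -
  have "\<forall>b. \<exists>c. (\<forall>b'\<in>B. c b' \<in> RF t) \<and> x * b = (\<Sum>b'\<in>B. c b' * b')"
  proof
    fix b
    have "x * b \<in> espan (RF t) B (\<lambda>b. b)" using B by simp
    then show "\<exists>c. (\<forall>b'\<in>B. c b' \<in> RF t) \<and> x * b = (\<Sum>b'\<in>B. c b' * b')" unfolding espan_def by blast
  qed
  then obtain c where c: "\<And>b b'. b' \<in> B \<Longrightarrow> c b b' \<in> RF t" "\<And>b. x * b = (\<Sum>b'\<in>B. c b b' * b')" by metis
  have "\<exists>q P. poly_over kk q \<and> q \<noteq> 0 \<and> (\<forall>i\<in>B\<times>B. poly_over kk (P i) \<and> poly q t * (case i of (b,b') \<Rightarrow> c b b') = poly (P i) t)"
    by (rule common_denominator[OF t]) (use B c in auto)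
  then obtain q P where qP: "poly_over kk q" "q \<noteq> 0" "\<And>b b'. b \<in> B \<Longrightarrow> b' \<in> B \<Longrightarrow> poly_over kk (P (b,b'))"
     "\<And>b b'. b \<in> B \<Longrightarrow> b' \<in> B \<Longrightarrow> poly q t * c b b' = poly (P (b,b')) t" by auto
  define d where "d = (\<Sum>i\<in>B\<times>B. degree (P i)) + degree q"
  have dP: "degree (P (b,b')) \<le> d" if "b \<in> B" "b' \<in> B" for b b'
    using member_le_sum[of "(b,b')" "B\<times>B" "\<lambda>i. degree (P i)"] that B by (simp add: d_def)
  have "poly q t * x * u \<in> lattice t B (m + d)" if u: "u \<in> lattice t B m" for m u
    using u
  proof (rule latticeE)
    fix R assume R: "u = (\<Sum>b\<in>B. poly (R b) t * b)" "\<And>b. b \<in> B \<Longrightarrow> poly_over kk (R b)" "\<And>b. b \<in> B \<Longrightarrow> degree (R b) \<le> m"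
    show ?thesis
    proof (rule latticeI[where P = "\<lambda>b'. \<Sum>b\<in>B. R b * P (b,b')"])
      have "poly q t * x * u = (\<Sum>b\<in>B. poly (R b) t * (poly q t * (x * b)))"
        by (simp add: R(1) sum_distrib_left mult_ac)
      also have "\<dots> = (\<Sum>b\<in>B. \<Sum>b'\<in>B. poly (R b) t * (poly q t * c b b') * b')"
        by (intro sum.cong refl) (simp only: c(2) sum_distrib_left mult.assoc)
      also have "\<dots> = (\<Sum>b\<in>B. \<Sum>b'\<in>B. poly (R b) t * poly (P (b,b')) t * b')"
        by (intro sum.cong refl) (simp only: qP(4))
      also have "\<dots> = (\<Sum>b'\<in>B. \<Sum>b\<in>B. poly (R b) t * poly (P (b,b')) t * b')" by (rule sum.swap)
      also have "\<dots> = (\<Sum>b'\<in>B. poly (\<Sum>b\<in>B. R b * P (b, b')) t * b')"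
        by (simp add: poly_sum sum_distrib_right)
      finally show "poly q t * x * u = (\<Sum>b'\<in>B. poly (\<Sum>b\<in>B. R b * P (b, b')) t * b')" .
      fix b' assume b': "b' \<in> B"
      show "poly_over kk (\<Sum>b\<in>B. R b * P (b, b'))"
        using R(2) qP(3) b' by (intro poly_over_sum[OF kk] poly_over_mult[OF kk]) auto
      show "degree (\<Sum>b\<in>B. R b * P (b, b')) \<le> m + d"
      proof (rule degree_sum_le[OF B(1)])
        fix b assume "b \<in> B"
        then show "degree (R b * P (b, b')) \<le> m + d"
          using degree_mult_le[of "R b" "P (b,b')"] R(3) dP b' by (meson add_mono le_trans)
      qed
    qed
  qed
  moreover have "poly q t * u \<in> lattice t B (m + d)" if u: "u \<in> lattice t B m" for m u
    using lattice_mono[OF _ lattice_poly_mult[OF qP(1) u]] by (simp add: d_def)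
  ultimately show ?thesis using qP(1,2) by (intro exI[of _ q] exI[of _ d]) auto
qed

text \<open>Spending the denominator \<open>w\<close> on every step, also on steps without a factor
  \<open>x\<close>, brings all powers up to \<open>A\<close> into one lattice, whose degree bound
  grows linearly in \<open>A\<close>.\<close>

lemma lattice_growth_power:
  assumes step: "\<And>m u. u \<in> lattice t B m \<Longrightarrow> w * x * u \<in> lattice t B (m + c)"
      "\<And>m u. u \<in> lattice t B m \<Longrightarrow> w * u \<in> lattice t B (m + c)"
    and "i \<le> A" "u \<in> lattice t B m"
  shows "w ^ A * x ^ i * u \<in> lattice t B (m + A * c)"
  using assms(3)
proof (induction A arbitrary: i)
  case 0 then show ?case using assms(4) by simp
next
  case (Suc A)
  show ?case
  proof (cases "i \<le> A")
    case True
    have "w * (w ^ A * x ^ i * u) \<in> lattice t B ((m + A * c) + c)" by (rule step(2)[OF Suc.IH[OF True]])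
    then show ?thesis by (simp add: algebra_simps)
  next
    case False
    with Suc obtain j where j: "i = Suc j" "j \<le> A" by (cases i) auto
    have "w * x * (w ^ A * x ^ j * u) \<in> lattice t B ((m + A * c) + c)" by (rule step(1)[OF Suc.IH[OF j(2)]])
    then show ?thesis using j by (simp add: algebra_simps)
  qed
qed

lemma lattice_subset_espan:
  assumes "finite B"
  shows "lattice t B m \<subseteq> espan kk (B \<times> {..m}) (\<lambda>(b,i). t ^ i * b)"
proof
  fix u assume "u \<in> lattice t B m"
  then obtain P where P: "u = (\<Sum>b\<in>B. poly (P b) t * b)" "\<forall>b\<in>B. poly_over kk (P b) \<and> degree (P b) \<le> m"
    unfolding lattice_def by auto
  have "u = (\<Sum>b\<in>B. \<Sum>i\<le>m. coeff (P b) i * (t ^ i * b))"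
    unfolding P(1)
  proof (rule sum.cong[OF refl])
    fix b assume "b \<in> B"
    then have "poly (P b) t = (\<Sum>i\<le>m. coeff (P b) i * t ^ i)" using P(2) by (intro poly_as_sum) auto
    then show "poly (P b) t * b = (\<Sum>i\<le>m. coeff (P b) i * (t ^ i * b))"
      by (simp add: sum_distrib_right mult.assoc)
  qed
  also have "\<dots> = (\<Sum>(b,i)\<in>B \<times> {..m}. coeff (P b) i * (t ^ i * b))" using assms by (simp add: sum.cartesian_product)
  finally show "u \<in> espan kk (B \<times> {..m}) (\<lambda>(b,i). t ^ i * b)"
    unfolding espan_def using P(2)
    by (intro CollectI exI[of _ "\<lambda>(b,i). coeff (P b) i"]) (auto simp: poly_over_def split_beta)
qed

end

context function_field
begin

text \<open>Transcendence degree one: the \<open>(A + 1) ^ 2\<close> products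
  \<open>x ^ i * y ^ j\<close> lie, after multiplication by \<open>w\<close>, in a space whose
  dimension grows only linearly in \<open>A\<close>.\<close>

lemma algebraic_relation:
  fixes x y :: 'K
  shows "\<exists>(A::nat) p. (\<forall>j. poly_over kk (p j)) \<and> (\<exists>j\<le>A. p j \<noteq> 0) \<and> (\<Sum>j\<le>A. poly (p j) x * y ^ j) = 0"
proof -
  obtain t B where tB: "t \<notin> kk" "finite B" "espan (RF t) B (\<lambda>b. b) = UNIV" by (rule ex_finite_generation)
  have "\<exists>b\<in>B. b \<noteq> 0"
  proof (rule ccontr)
    assume "\<not> (\<exists>b\<in>B. b \<noteq> 0)"
    then have "espan (RF t) B (\<lambda>b. b) \<subseteq> {0}" unfolding espan_def by (auto intro!: sum.neutral)
    then have "(1::'K) \<in> {0}" using tB(3) by blast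
    then show False by simp
  qed
  then obtain u0 where u0: "u0 \<in> B" "u0 \<noteq> 0" by auto
  have u0L: "u0 \<in> lattice t B 0"
    by (rule latticeI[where P = "\<lambda>b. if b = u0 then 1 else 0"])
       (use u0 tB(2) in \<open>auto simp: poly_over_1[OF kk] poly_over_0[OF kk] if_distrib[of "\<lambda>p. poly p t * _"] cong: if_cong\<close>)
  obtain q1 c1 where q1: "poly_over kk q1" "q1 \<noteq> 0"
    "\<And>m u. u \<in> lattice t B m \<Longrightarrow> poly q1 t * x * u \<in> lattice t B (m + c1)"
    "\<And>m u. u \<in> lattice t B m \<Longrightarrow> poly q1 t * u \<in> lattice t B (m + c1)"
    using lattice_growth[OF tB, of x] by blast
  obtain q2 c2 where q2: "poly_over kk q2" "q2 \<noteq> 0"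
    "\<And>m u. u \<in> lattice t B m \<Longrightarrow> poly q2 t * y * u \<in> lattice t B (m + c2)"
    "\<And>m u. u \<in> lattice t B m \<Longrightarrow> poly q2 t * u \<in> lattice t B (m + c2)"
    using lattice_growth[OF tB, of y] by blast
  \<comment> \<open>Large enough for \<open>card B * (A * c1 + A * c2 + 1)\<close> to be at most
    \<open>A * A\<close>.\<close>
  define A where "A = card B * (c1 + c2 + 1)"
  define w where "w = poly q1 t ^ A * poly q2 t ^ A * u0"
  have w: "w \<noteq> 0" unfolding w_def using u0 q1 q2 poly_nonconst[OF tB(1)] by simp
  define I where "I = B \<times> {..A * c1 + A * c2}"
  have sp: "w * (x ^ i * y ^ j) \<in> espan kk I (\<lambda>(b,i). t ^ i * b)" if "i \<le> A" "j \<le> A" for i j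
  proof -
    have "poly q1 t ^ A * x ^ i * u0 \<in> lattice t B (0 + A * c1)"
      by (rule lattice_growth_power[OF q1(3,4) that(1) u0L])
    from lattice_growth_power[OF q2(3,4) that(2) this]
    have "poly q2 t ^ A * y ^ j * (poly q1 t ^ A * x ^ i * u0) \<in> lattice t B ((0 + A * c1) + A * c2)" .
    then have "w * (x ^ i * y ^ j) \<in> lattice t B (A * c1 + A * c2)" by (simp add: w_def mult_ac)
    then show ?thesis unfolding I_def using lattice_subset_espan[OF tB(2)] by blast
  qed
  have "card B \<ge> 1" using u0 tB(2) by (metis One_nat_def Suc_leI card_gt_0_iff empty_iff)
  have "card I = card B * (A * c1 + A * c2 + 1)" unfolding I_def by (simp add: card_cartesian_product)
  also have "\<dots> \<le> card B * (A * c1 + A * c2 + A)" using \<open>card B \<ge> 1\<close> by (intro mult_le_mono) (auto simp: A_def)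
  also have "\<dots> = A * A" by (simp add: A_def algebra_simps)
  also have "\<dots> < card ({..A} \<times> {..A})" by (simp add: card_cartesian_product)
  finally have card: "card I < card ({..A} \<times> {..A})" .
  have "\<not> lin_nondeg kk ({..A} \<times> {..A}) (\<lambda>(i,j). w * (x ^ i * y ^ j))"
    by (rule not_lin_nondeg_of_card[OF kk _ _ _ card]) (use sp tB(2) in \<open>auto simp: I_def\<close>)
  then have "\<not> lin_nondeg kk ({..A} \<times> {..A}) (\<lambda>(i,j). x ^ i * y ^ j)"
    using lin_nondeg_mult[OF _ w, of kk "{..A} \<times> {..A}" "\<lambda>(i,j). x ^ i * y ^ j"] unfolding case_prod_unfold by blast
  then obtain a where a: "\<forall>p\<in>{..A}\<times>{..A}. a p \<in> kk" "(\<Sum>p\<in>{..A}\<times>{..A}. a p * (case p of (i,j) \<Rightarrow> x ^ i * y ^ j)) = 0"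
    "\<exists>p\<in>{..A}\<times>{..A}. a p \<noteq> 0" unfolding lin_nondeg_def by blast
  define p where "p j = (if j \<le> A then \<Sum>i\<le>A. monom (a (i,j)) i else 0)" for j
  have cf: "coeff (p j) i = a (i,j)" if "i \<le> A" "j \<le> A" for i j
    using that by (simp add: p_def coeff_sum if_distrib cong: if_cong)
  show ?thesis
  proof (rule exI[of _ A], rule exI[of _ p], intro conjI allI)
    show "poly_over kk (p j)" for j unfolding p_def using a(1)
      by (auto intro!: poly_over_sum[OF kk] poly_over_monom[OF kk] poly_over_0[OF kk])
    obtain i j where "i \<le> A" "j \<le> A" "a (i,j) \<noteq> 0" using a(3) by auto
    then show "\<exists>j\<le>A. p j \<noteq> 0" using cf[of i j] by (intro exI[of _ j]) auto
    have "(\<Sum>j\<le>A. poly (p j) x * y ^ j) = (\<Sum>j\<le>A. \<Sum>i\<le>A. a (i,j) * (x ^ i * y ^ j))"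
      by (intro sum.cong refl) (simp add: p_def poly_sum poly_monom sum_distrib_right mult.assoc)
    also have "\<dots> = (\<Sum>i\<le>A. \<Sum>j\<le>A. a (i,j) * (x ^ i * y ^ j))" by (rule sum.swap)
    also have "\<dots> = 0" using a(2) by (simp add: sum.cartesian_product case_prod_unfold)
    finally show "(\<Sum>j\<le>A. poly (p j) x * y ^ j) = 0" .
  qed
qed

text \<open>Too many elements independent over \<open>k(f)\<close>, multiplied by the powers of
  \<open>f\<close> up to \<open>A\<close>, would be independent over \<open>k\<close> inside a
  lattice of smaller dimension: in terms of \<open>A\<close> the two counts have slopes
  \<open>card I\<close> and \<open>card B * c\<close>.\<close>

lemma finite_degree:
  assumes f: "f \<notin> kk"
  shows "\<exists>n. dim_le (RF f) UNIV n"
proof -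
  obtain t B where tB: "t \<notin> kk" "finite B" "espan (RF t) B (\<lambda>b. b) = UNIV" by (rule ex_finite_generation)
  obtain q c where q: "poly_over kk q" "q \<noteq> 0"
    "\<And>m u. u \<in> lattice t B m \<Longrightarrow> poly q t * f * u \<in> lattice t B (m + c)"
    "\<And>m u. u \<in> lattice t B m \<Longrightarrow> poly q t * u \<in> lattice t B (m + c)"
    using lattice_growth[OF tB, of f] by blast
  have "dim_le (RF f) UNIV (card B * c)"
  proof (rule dim_leI, rule ccontr)
    fix I :: "nat set" and y assume I: "finite I" "lin_nondeg (RF f) I y" "\<not> card I \<le> card B * c"
    have "\<exists>q0 m. poly_over kk q0 \<and> q0 \<noteq> 0 \<and> (\<forall>i\<in>I. poly q0 t * y i \<in> lattice t B m)"
    proof -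
      have "\<forall>i. \<exists>c. (\<forall>b\<in>B. c b \<in> RF t) \<and> y i = (\<Sum>b\<in>B. c b * b)"
      proof
        fix i
        have "y i \<in> espan (RF t) B (\<lambda>b. b)" using tB by simp
        then show "\<exists>c. (\<forall>b\<in>B. c b \<in> RF t) \<and> y i = (\<Sum>b\<in>B. c b * b)" unfolding espan_def by blast
      qed
      then obtain c where c: "\<And>i b. b \<in> B \<Longrightarrow> c i b \<in> RF t" "\<And>i. y i = (\<Sum>b\<in>B. c i b * b)" by metis
      have "\<exists>q P. poly_over kk q \<and> q \<noteq> 0 \<and> (\<forall>i\<in>I\<times>B. poly_over kk (P i) \<and> poly q t * (case i of (b,b') \<Rightarrow> c b b') = poly (P i) t)"
        by (rule common_denominator[OF tB(1)]) (use tB c I in auto)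
      then obtain q P where qP: "poly_over kk q" "q \<noteq> 0" "\<And>b b'. b \<in> I \<Longrightarrow> b' \<in> B \<Longrightarrow> poly_over kk (P (b,b'))"
         "\<And>b b'. b \<in> I \<Longrightarrow> b' \<in> B \<Longrightarrow> poly q t * c b b' = poly (P (b,b')) t" by auto
      show ?thesis
      proof (intro exI[of _ q] exI[of _ "\<Sum>i\<in>I\<times>B. degree (P i)"] conjI ballI)
        fix i assume i: "i \<in> I"
        show "poly q t * y i \<in> lattice t B (\<Sum>i\<in>I\<times>B. degree (P i))"
        proof (rule latticeI[where P = "\<lambda>b. P (i,b)"])
          show "poly q t * y i = (\<Sum>b\<in>B. poly (P (i, b)) t * b)"
            unfolding c(2) sum_distrib_left by (intro sum.cong refl) (simp add: qP(4)[OF i, symmetric])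
          fix b assume b: "b \<in> B"
          show "poly_over kk (P (i, b))" using qP(3) i b by blast
          show "degree (P (i, b)) \<le> (\<Sum>i\<in>I\<times>B. degree (P i))"
            using member_le_sum[of "(i,b)" "I\<times>B" "\<lambda>i. degree (P i)"] i b I tB by simp
        qed
      qed (use qP in auto)
    qed
    then obtain q0 m where q0: "poly_over kk q0" "q0 \<noteq> 0" "\<And>i. i \<in> I \<Longrightarrow> poly q0 t * y i \<in> lattice t B m" by blast
    \<comment> \<open>Absorbs the part of the dimension that stems from the initial degree bound
      \<open>m\<close>, so that \<open>card J = A + card B * c * A\<close>.\<close>
    define A where "A = card B * m + card B"
    define w where "w = poly q t ^ A * poly q0 t"
    have w: "w \<noteq> 0" unfolding w_def using q q0 poly_nonconst[OF tB(1)] by simp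
    define J where "J = B \<times> {..m + A * c}"
    have sp: "w * (f ^ a * y i) \<in> espan kk J (\<lambda>(b,i). t ^ i * b)" if "i \<in> I" "a \<le> A" for i a
    proof -
      have "poly q t ^ A * f ^ a * (poly q0 t * y i) \<in> lattice t B (m + A * c)"
        by (rule lattice_growth_power[OF q(3,4) that(2) q0(3)[OF that(1)]])
      then have "w * (f ^ a * y i) \<in> lattice t B (m + A * c)" by (simp add: w_def mult_ac)
      then show ?thesis unfolding J_def using lattice_subset_espan[OF tB(2)] by blast
    qed
    have "card J = card B * (m + A * c + 1)" unfolding J_def by (simp add: card_cartesian_product)
    also have "\<dots> = A + card B * c * A" by (simp add: A_def algebra_simps)
    also have "\<dots> < (card B * c + 1) * (A + 1)" by (simp add: algebra_simps)
    also have "\<dots> \<le> card I * (A + 1)" using I(3) by (intro mult_le_mono) auto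
    also have "\<dots> = card (I \<times> {..A})" by (simp add: card_cartesian_product)
    finally have card: "card J < card (I \<times> {..A})" .
    have "\<not> lin_nondeg kk (I \<times> {..A}) (\<lambda>(i,a). w * (f ^ a * y i))"
      by (rule not_lin_nondeg_of_card[OF kk _ _ _ card]) (use sp tB(2) I in \<open>auto simp: J_def\<close>)
    then have "\<not> lin_nondeg kk (I \<times> {..A}) (\<lambda>(i,a). f ^ a * y i)"
      using lin_nondeg_mult[OF _ w, of kk "I \<times> {..A}" "\<lambda>(i,a). f ^ a * y i"] unfolding case_prod_unfold by blast
    then obtain k where k: "\<forall>p\<in>I\<times>{..A}. k p \<in> kk" "(\<Sum>p\<in>I\<times>{..A}. k p * (case p of (i,a) \<Rightarrow> f ^ a * y i)) = 0"
      "\<exists>p\<in>I\<times>{..A}. k p \<noteq> 0" unfolding lin_nondeg_def by blast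
    define p where "p i = (\<Sum>a\<le>A. monom (k (i,a)) a)" for i
    have pk: "poly_over kk (p i)" if "i \<in> I" for i
      unfolding p_def using k(1) that by (auto intro!: poly_over_sum[OF kk] poly_over_monom[OF kk])
    have "(\<Sum>i\<in>I. poly (p i) f * y i) = (\<Sum>i\<in>I. \<Sum>a\<le>A. k (i,a) * (f ^ a * y i))"
      by (intro sum.cong refl) (simp add: p_def poly_sum poly_monom sum_distrib_right mult.assoc)
    also have "\<dots> = 0" using k(2) by (simp add: sum.cartesian_product case_prod_unfold)
    finally have 0: "(\<Sum>i\<in>I. poly (p i) f * y i) = 0" .
    obtain i a where ia: "i \<in> I" "a \<le> A" "k (i,a) \<noteq> 0" using k(3) by auto
    have "poly (p i) f = 0" using lin_nondegD[OF I(2) _ 0 ia(1)] RF_poly pk by blast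
    then have "p i = 0" using poly_nonconst[OF f pk[OF ia(1)]] by blast
    moreover have "coeff (p i) a = k (i,a)"
      using ia by (simp add: p_def coeff_sum if_distrib cong: if_cong)
    ultimately show False using ia by simp
  qed
  then show ?thesis by blast
qed

definition fdeg :: "'K \<Rightarrow> nat" where "fdeg f = kdim (RF f) UNIV"

lemma UNIV_subspace: "subspace_over E UNIV"
  by (simp add: subspace_over_def)

lemma card_le_fdeg: "f \<notin> kk \<Longrightarrow> finite J \<Longrightarrow> lin_nondeg (RF f) J y \<Longrightarrow> card J \<le> fdeg f"
  unfolding fdeg_def using finite_degree[of f] card_le_kdim[OF RF_subfield UNIV_subspace, of f _ J y] by auto

lemma ex_fdeg_basis:
  assumes "f \<notin> kk"
  shows "\<exists>y. lin_nondeg (RF f) {..<fdeg f} y \<and> espan (RF f) {..<fdeg f} y = UNIV"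
proof -
  obtain n where "dim_le (RF f) UNIV n" using finite_degree[OF assms] by blast
  from kdim_basis[OF RF_subfield[OF assms] UNIV_subspace this] show ?thesis unfolding fdeg_def by metis
qed

lemma lin_nondeg_fdeg_basis:
  assumes "f \<notin> kk" and "lin_nondeg (RF f) {..<fdeg f} y"
  shows "espan (RF f) {..<fdeg f} y = UNIV"
proof (rule ccontr)
  assume "espan (RF f) {..<fdeg f} y \<noteq> UNIV"
  then obtain v where "v \<notin> espan (RF f) {..<fdeg f} y" by auto
  from lin_nondeg_insert[OF RF_subfield[OF assms(1)] _ assms(2) this, of "fdeg f"]
  have "card (insert (fdeg f) {..<fdeg f}) \<le> fdeg f" by (intro card_le_fdeg[OF assms(1)]) auto
  then show False by simp
qed

lemma RF_inverse:
  assumes f: "f \<notin> kk" shows "RF (inverse f) = RF f"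
proof -
  have sub: "RF (inverse f) \<subseteq> RF f" if f: "f \<notin> kk" for f
  proof
    fix u assume "u \<in> RF (inverse f)"
    then obtain p q where pq: "poly_over kk p" "poly_over kk q" "u = poly p (inverse f) / poly q (inverse f)" by (rule RF_E)
    have "poly [:0,1:] f \<in> RF f" by (rule RF_poly) (simp add: poly_over_pCons[OF kk] poly_over_0[OF kk] subfield_0[OF kk] subfield_1[OF kk])
    then have inv: "inverse f \<in> RF f" using subfield_inverse[OF RF_subfield[OF f]] by simp
    have sub: "kk \<subseteq> RF f"
    proof
      fix c assume "c \<in> kk"
      then have "poly [:c:] f \<in> RF f" by (intro RF_poly) (simp add: poly_over_pCons[OF kk] poly_over_0[OF kk])
      then show "c \<in> RF f" by simp
    qed
    have "poly r (inverse f) \<in> RF f" if "poly_over kk r" for r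
      using that sub inv by (intro poly_over_eval[OF RF_subfield[OF f]]) (auto simp: poly_over_def)
    then show "u \<in> RF f" unfolding pq(3) using pq by (intro subfield_divide[OF RF_subfield[OF f]]) auto
  qed
  have "inverse f \<notin> kk" using f subfield_inverse[OF kk, of "inverse f"] by auto
  from sub[OF f] sub[OF this] show ?thesis by auto
qed

lemma fdeg_inverse: "f \<notin> kk \<Longrightarrow> fdeg (inverse f) = fdeg f"
  unfolding fdeg_def by (simp add: RF_inverse)

end

section \<open>Existence of places\<close>

definition subring_set :: "'a::ring_1 set \<Rightarrow> bool" where
  "subring_set R \<longleftrightarrow> 0 \<in> R \<and> 1 \<in> R \<and> (\<forall>x\<in>R. \<forall>y\<in>R. x + y \<in> R \<and> x * y \<in> R) \<and> (\<forall>x\<in>R. - x \<in> R)"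

lemma subring_setD:
  assumes "subring_set R"
  shows "0 \<in> R" "1 \<in> R" "\<And>x y. x \<in> R \<Longrightarrow> y \<in> R \<Longrightarrow> x + y \<in> R"
    "\<And>x y. x \<in> R \<Longrightarrow> y \<in> R \<Longrightarrow> x * y \<in> R" "\<And>x. x \<in> R \<Longrightarrow> - x \<in> R"
    "\<And>x y. x \<in> R \<Longrightarrow> y \<in> R \<Longrightarrow> x - y \<in> R"
proof -
  show *: "0 \<in> R" "1 \<in> R" "\<And>x y. x \<in> R \<Longrightarrow> y \<in> R \<Longrightarrow> x + y \<in> R"
    "\<And>x y. x \<in> R \<Longrightarrow> y \<in> R \<Longrightarrow> x * y \<in> R" "\<And>x. x \<in> R \<Longrightarrow> - x \<in> R"
    using assms by (auto simp: subring_set_def)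
  show "\<And>x y. x \<in> R \<Longrightarrow> y \<in> R \<Longrightarrow> x - y \<in> R" using *(3)[of _ "- _"] *(5) by simp
qed

lemma subring_set_sum: "subring_set R \<Longrightarrow> (\<And>i. i \<in> I \<Longrightarrow> f i \<in> R) \<Longrightarrow> sum f I \<in> R"
  by (induction I rule: infinite_finite_induct) (auto simp: subring_setD)

lemma subring_set_power: "subring_set R \<Longrightarrow> x \<in> R \<Longrightarrow> x ^ n \<in> R"
  by (induction n) (auto simp: subring_setD)

lemma subring_set_poly:
  "subring_set R \<Longrightarrow> (\<And>i. coeff p i \<in> R) \<Longrightarrow> x \<in> R \<Longrightarrow> poly p x \<in> R"
  unfolding poly_altdef by (intro subring_set_sum) (auto intro: subring_setD subring_set_power)

lemma subring_set_adjoin: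
  fixes R :: "'a::comm_ring_1 set" and z :: 'a
  assumes R: "subring_set R"
  defines "A \<equiv> {poly p z | p. \<forall>i. coeff p i \<in> R}"
  shows "subring_set A" "R \<subseteq> A" "z \<in> A"
proof -
  have A: "poly p z \<in> A" if "\<And>i. coeff p i \<in> R" for p using that by (auto simp: A_def)
  have c: "c \<in> A" if "c \<in> R" for c
    using A[of "[:c:]"] that subring_setD(1)[OF R] by (auto simp: coeff_pCons split: nat.splits)
  then show "R \<subseteq> A" by auto
  have "poly [:0, 1:] z \<in> A" by (rule A) (auto simp: coeff_pCons subring_setD(1,2)[OF R] split: nat.splits)
  then show "z \<in> A" by simp
  show "subring_set A" unfolding subring_set_def
  proof (intro conjI ballI)
    show "0 \<in> A" "1 \<in> A" using c subring_setD(1,2)[OF R] by auto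
    fix u assume "u \<in> A"
    then obtain p where p: "u = poly p z" "\<And>i. coeff p i \<in> R" by (auto simp: A_def)
    have "poly (- p) z \<in> A" by (rule A) (simp add: p(2) subring_setD(5)[OF R])
    then show "- u \<in> A" using p by simp
    fix v assume "v \<in> A"
    then obtain q where q: "v = poly q z" "\<And>i. coeff q i \<in> R" by (auto simp: A_def)
    have "poly (p + q) z \<in> A" by (rule A) (simp add: p(2) q(2) subring_setD(3)[OF R])
    then show "u + v \<in> A" using p q by simp
    have "poly (p * q) z \<in> A"
      by (rule A) (auto simp: coeff_mult p(2) q(2) intro!: subring_set_sum[OF R] subring_setD(4)[OF R])
    then show "u * v \<in> A" using p q by simp
  qed
qed

text \<open>The classical degree reduction: two integral relations with coefficients in a proper
  ideal, one for \<open>z\<close> and one for its inverse, can be shortened until none is left.\<close>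

lemma integral_relation_shorten:
  fixes z :: "'a::field"
  assumes R: "subring_set R" and J: "J \<subseteq> R" "0 \<in> J" "1 \<notin> J" "\<And>a b. a \<in> J \<Longrightarrow> b \<in> J \<Longrightarrow> a + b \<in> J" "\<And>a b. a \<in> R \<Longrightarrow> b \<in> J \<Longrightarrow> a * b \<in> J"
    and z: "z \<noteq> 0"
    and a: "\<And>i. coeff a i \<in> J" "poly a z = 1" and b: "\<And>i. coeff b i \<in> J" "poly b (inverse z) = 1"
    and deg: "degree b \<le> degree a"
  shows "\<exists>a'. (\<forall>i. coeff a' i \<in> J) \<and> poly a' z = 1 \<and> degree a' < degree a"
proof -
  define n where "n = degree a"
  define m where "m = degree b"
  define b0 where "b0 = coeff b 0"
  define an where "an = coeff a n"
  have n: "n > 0"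
  proof (rule ccontr)
    assume "\<not> n > 0"
    then obtain c where "a = [:c:]" by (auto simp: n_def elim: degree_eq_zeroE)
    then show False using a(1)[of 0] a(2) J(3) by simp
  qed
  \<comment> \<open>The relation for the inverse of \<open>z\<close>, times \<open>z ^ n\<close>,
    says that \<open>poly e z = (1 - b0) * z ^ n\<close>. So \<open>e\<close>, of degree below
    \<open>n\<close>, can replace the leading power in \<open>1 - b0\<close> times the relation for
    \<open>z\<close>.\<close>
  define e where "e = (\<Sum>i=1..m. monom (coeff b i) (n - i))"
  define a' where "a' = [:b0:] + Polynomial.smult (1 - b0) (a - monom an n) + Polynomial.smult an e"
  have JR: "j \<in> R" if "j \<in> J" for j using that J by auto
  have Jminus: "- j \<in> J" if "j \<in> J" for j
    using J(5)[OF subring_setD(5)[OF R subring_setD(2)[OF R]] that] by simp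
  have Jsum: "sum f I \<in> J" if "\<And>i. i \<in> I \<Longrightarrow> f i \<in> J" for f and I :: "nat set"
    using that by (induction I rule: infinite_finite_induct) (auto simp: J)
  have "coeff a' i \<in> J" for i
  proof -
    have 1: "coeff [:b0:] i \<in> J" using b(1)[of 0] J(2) by (simp add: b0_def coeff_pCons split: nat.splits)
    have "coeff (a - monom an n) i \<in> J" using J(4)[OF a(1)[of i] Jminus[OF a(1)[of n]]] a(1)[of i] by (auto simp: an_def)
    then have 2: "(1 - b0) * coeff (a - monom an n) i \<in> J"
      using b(1)[of 0] JR subring_setD[OF R] by (intro J(5)) (auto simp: b0_def)
    have "coeff e i \<in> J" unfolding e_def coeff_sum by (rule Jsum) (use b(1) J(2) in auto)
    then have 3: "an * coeff e i \<in> J" using a(1)[of n] JR by (intro J(5)) (auto simp: an_def)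
    show ?thesis unfolding a'_def coeff_add coeff_smult by (intro J(4) 1 2 3)
  qed
  moreover have "poly a' z = 1"
  proof -
    have "1 = (\<Sum>i\<le>m. coeff b i * inverse z ^ i)" using b(2) unfolding m_def poly_altdef by simp
    also have "\<dots> = b0 + (\<Sum>i=1..m. coeff b i * inverse z ^ i)"
      by (simp add: b0_def atMost_atLeast0 sum.atLeast_Suc_atMost)
    finally have b1: "(\<Sum>i=1..m. coeff b i * inverse z ^ i) = 1 - b0" by (simp add: algebra_simps)
    have "poly e z = (\<Sum>i=1..m. coeff b i * z ^ (n - i))" by (simp add: e_def poly_sum poly_monom)
    also have "\<dots> = z ^ n * (\<Sum>i=1..m. coeff b i * inverse z ^ i)" unfolding sum_distrib_left
    proof (rule sum.cong[OF refl])
      fix i assume "i \<in> {1..m}"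
      then have "i \<le> n" using deg by (simp add: m_def n_def)
      then have "z ^ n = z ^ (n - i) * z ^ i" by (simp add: power_add[symmetric])
      then show "coeff b i * z ^ (n - i) = z ^ n * (coeff b i * inverse z ^ i)" using z by (simp add: field_simps)
    qed
    finally have "poly e z = z ^ n * (1 - b0)" using b1 by simp
    then have "poly a' z = b0 + (1 - b0) * (1 - an * z ^ n) + an * (z ^ n * (1 - b0))"
      using a(2) by (simp add: a'_def poly_monom)
    also have "\<dots> = 1" by (simp add: algebra_simps)
    finally show ?thesis .
  qed
  moreover have "degree a' < degree a"
  proof -
    have "coeff a' i = 0" if "i \<ge> n" for i
    proof -
      have "coeff a i = 0" if "i \<noteq> n" using \<open>i \<ge> n\<close> that by (intro coeff_eq_0) (simp add: n_def)
      then have 1: "coeff (a - monom an n) i = 0" by (cases "i = n") (auto simp: an_def)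
      have 2: "coeff e i = 0" unfolding e_def coeff_sum using that n by (intro sum.neutral) auto
      have "coeff [:b0:] i = 0" using that n by (auto simp: coeff_pCons split: nat.splits)
      then show ?thesis by (simp only: a'_def coeff_add coeff_smult 1 2) simp
    qed
    then have "degree a' \<le> n - 1" using n by (intro degree_le) auto
    then show ?thesis using n by (simp add: n_def)
  qed
  ultimately show ?thesis by blast
qed

lemma no_integral_relations:
  fixes z :: "'a::field"
  assumes R: "subring_set R" and J: "J \<subseteq> R" "0 \<in> J" "1 \<notin> J" "\<And>a b. a \<in> J \<Longrightarrow> b \<in> J \<Longrightarrow> a + b \<in> J" "\<And>a b. a \<in> R \<Longrightarrow> b \<in> J \<Longrightarrow> a * b \<in> J"
    and z: "z \<noteq> 0"
    and a: "\<forall>i. coeff a i \<in> J" "poly a z = 1" and b: "\<forall>i. coeff b i \<in> J" "poly b (inverse z) = 1"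
  shows False
  using a b
proof (induction "degree a + degree b" arbitrary: a b rule: less_induct)
  case less
  show False
  proof (cases "degree b \<le> degree a")
    case True
    obtain a' where "\<forall>i. coeff a' i \<in> J" "poly a' z = 1" "degree a' < degree a"
      using integral_relation_shorten[OF R J z, of a b] less.prems True by auto
    then show False using less.hyps[of a' b] less.prems by simp
  next
    case False
    obtain b' where "\<forall>i. coeff b' i \<in> J" "poly b' (inverse z) = 1" "degree b' < degree b"
      using integral_relation_shorten[OF R J, of "inverse z" b a] z less.prems False by auto
    then show False using less.hyps[of a b'] less.prems by simp
  qed
qed

text \<open>A subring maximal among those that omit \<open>inverse x\<close> has the valuation
  property. If neither \<open>z\<close> nor its inverse belonged to it, adjoining either one would
  produce \<open>inverse x\<close>; multiplied by \<open>x\<close> this is a relation with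
  coefficients in the ideal generated by \<open>x\<close>, which is proper, and two such relations
  exclude each other.\<close>

lemma ex_valuation_ring:
  fixes x :: "'a::field"
  assumes R0: "subring_set R0" "x \<in> R0" "inverse x \<notin> R0" "x \<noteq> 0"
  shows "\<exists>R. subring_set R \<and> R0 \<subseteq> R \<and> inverse x \<notin> R \<and> (\<forall>z. z \<noteq> 0 \<longrightarrow> z \<in> R \<or> inverse z \<in> R)"
proof -
  define F where "F = {R. subring_set R \<and> R0 \<subseteq> R \<and> inverse x \<notin> R}"
  have "\<exists>M\<in>F. \<forall>X\<in>F. M \<subseteq> X \<longrightarrow> X = M"
  proof (rule subset_Zorn_nonempty)
    show "F \<noteq> {}" using R0 by (auto simp: F_def)
    fix C assume C: "C \<noteq> {}" "subset.chain F C"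
    have CF: "C \<subseteq> F" using C(2) by (simp add: subset.chain_def)
    have lin: "X \<subseteq> Y \<or> Y \<subseteq> X" if "X \<in> C" "Y \<in> C" for X Y
      using C(2) that by (auto simp: subset.chain_def)
    have "subring_set (\<Union>C)" unfolding subring_set_def
    proof (intro conjI ballI)
      obtain X where "X \<in> C" using C by auto
      then have "0 \<in> X" "1 \<in> X" using CF subring_setD(1,2)[of X] by (auto simp: F_def)
      then show "0 \<in> \<Union>C" "1 \<in> \<Union>C" using \<open>X \<in> C\<close> by auto
    next
      fix u assume "u \<in> \<Union>C"
      then obtain X where "X \<in> C" "u \<in> X" by auto
      then show "- u \<in> \<Union>C" using CF subring_setD(5)[of X u] by (auto simp: F_def)
    next
      fix u v assume "u \<in> \<Union>C" "v \<in> \<Union>C"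
      then obtain X Y where XY: "X \<in> C" "u \<in> X" "Y \<in> C" "v \<in> Y" by auto
      then obtain Z where Z: "Z \<in> C" "u \<in> Z" "v \<in> Z" using lin[of X Y] by blast
      then have "subring_set Z" using CF by (auto simp: F_def)
      then have "u + v \<in> Z" "u * v \<in> Z" using Z subring_setD(3,4)[of Z] by blast+
      then show "u + v \<in> \<Union>C" "u * v \<in> \<Union>C" using Z by auto
    qed
    moreover have "R0 \<subseteq> \<Union>C" using C CF by (auto simp: F_def)
    ultimately show "\<Union>C \<in> F" using CF by (auto simp: F_def)
  qed
  then obtain R where R: "subring_set R" "R0 \<subseteq> R" "inverse x \<notin> R"
    and max: "\<And>X. X \<in> F \<Longrightarrow> R \<subseteq> X \<Longrightarrow> X = R" by (auto simp: F_def)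
  define J where "J = {x * r | r. r \<in> R}"
  have xR: "x \<in> R" using R0 R by auto
  have key: "\<exists>a. (\<forall>i. coeff a i \<in> J) \<and> poly a z = 1" if "z \<notin> R" for z
  proof -
    define A where "A = {poly p z | p. \<forall>i. coeff p i \<in> R}"
    have A: "subring_set A" "R \<subseteq> A" "z \<in> A" unfolding A_def by (rule subring_set_adjoin[OF R(1)])+
    have "inverse x \<in> A"
    proof (rule ccontr)
      assume "inverse x \<notin> A"
      then have "A \<in> F" using A R by (auto simp: F_def)
      from max[OF this A(2)] A(3) that show False by simp
    qed
    then obtain p where p: "inverse x = poly p z" "\<forall>i. coeff p i \<in> R" by (auto simp: A_def)
    show ?thesis using p R0(4)
      by (intro exI[of _ "Polynomial.smult x p"]) (auto simp: J_def p(1)[symmetric])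
  qed
  have "z \<in> R \<or> inverse z \<in> R" if "z \<noteq> 0" for z
  proof (rule ccontr)
    assume "\<not> (z \<in> R \<or> inverse z \<in> R)"
    then obtain a b where "\<forall>i. coeff a i \<in> J" "poly a z = 1" "\<forall>i. coeff b i \<in> J" "poly b (inverse z) = 1"
      using key[of z] key[of "inverse z"] by blast
    moreover have "J \<subseteq> R" using xR subring_setD(4)[OF R(1)] by (auto simp: J_def)
    moreover have "0 \<in> J" using subring_setD(1)[OF R(1)] by (auto simp: J_def)
    moreover have "1 \<notin> J"
    proof
      assume "1 \<in> J"
      then obtain r where "r \<in> R" "x * r = 1" by (auto simp: J_def)
      then have "inverse x = r" by (simp add: inverse_unique)
      then show False using \<open>r \<in> R\<close> R(3) by simp
    qed
    moreover have "a + b \<in> J" if "a \<in> J" "b \<in> J" for a b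
      using that subring_setD(3)[OF R(1)] by (auto simp: J_def) (metis distrib_left)
    moreover have "a * b \<in> J" if "a \<in> R" "b \<in> J" for a b
      using that subring_setD(4)[OF R(1)] by (auto simp: J_def)
    ultimately show False using no_integral_relations[OF R(1), of J z a b] that by blast
  qed
  with R show ?thesis by blast
qed

section \<open>From a valuation ring to a discrete valuation\<close>

locale valuation_ring = function_field kk for kk :: "'K::field_char_0 set" +
  fixes R :: "'K set"
  assumes R: "subring_set R" and kkR: "kk \<subseteq> R"
    and valring: "z \<noteq> 0 \<Longrightarrow> z \<in> R \<or> inverse z \<in> R"
begin

definition "M = {y \<in> R. y = 0 \<or> inverse y \<notin> R}"
definition "val_units = {y \<in> R. y \<noteq> 0 \<and> inverse y \<in> R}"

lemmas R0 = subring_setD(1)[OF R] and R1 = subring_setD(2)[OF R] and Radd = subring_setD(3)[OF R]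
  and Rmult = subring_setD(4)[OF R] and Rminus = subring_setD(5)[OF R]

lemma M_mult: "y \<in> M \<Longrightarrow> r \<in> R \<Longrightarrow> y * r \<in> M"
proof (rule ccontr)
  assume *: "y \<in> M" "r \<in> R" "y * r \<notin> M"
  then have "y * r \<in> R" "y * r \<noteq> 0" "inverse (y * r) \<in> R" using Rmult by (auto simp: M_def)
  then have "r * inverse (y * r) \<in> R" using Rmult * by blast
  moreover have "r * inverse (y * r) = inverse y" using \<open>y * r \<noteq> 0\<close> by (simp add: field_simps)
  ultimately have "inverse y \<in> R" by metis
  then show False using *(1) \<open>y * r \<noteq> 0\<close> by (simp add: M_def)
qed

lemma M_mult': "y \<in> M \<Longrightarrow> r \<in> R \<Longrightarrow> r * y \<in> M"
  using M_mult[of y r] by (simp add: mult.commute)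

lemma M_R: "y \<in> M \<Longrightarrow> y \<in> R" by (simp add: M_def)

lemma M_0: "0 \<in> M" by (simp add: M_def R0)

lemma M_add: assumes "y \<in> M" "z \<in> M" shows "y + z \<in> M"
proof (cases "y = 0 \<or> z = 0")
  case True then show ?thesis using assms by auto
next
  case False
  then have "y / z \<in> R \<or> z / y \<in> R" using valring[of "y / z"] by simp
  then show ?thesis
  proof
    assume "y / z \<in> R"
    then have "z * (1 + y / z) \<in> M" by (intro M_mult assms Radd R1)
    then show ?thesis using False by (simp add: field_simps)
  next
    assume "z / y \<in> R"
    then have "y * (1 + z / y) \<in> M" by (intro M_mult assms Radd R1)
    then show ?thesis using False by (simp add: field_simps)
  qed
qed

lemma M_sum: "(\<And>i. i \<in> I \<Longrightarrow> f i \<in> M) \<Longrightarrow> sum f I \<in> M"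
  by (induction I rule: infinite_finite_induct) (auto simp: M_0 M_add)

lemma M_uminus: "y \<in> M \<Longrightarrow> - y \<in> M"
  using M_mult[of y "- 1"] Rminus[OF R1] by simp

lemma kk_M: "c \<in> kk \<Longrightarrow> c \<in> M \<Longrightarrow> c = 0"
  using kkR subfield_inverse[OF kk] by (auto simp: M_def)

lemma val_units_or_M: "y \<in> R \<Longrightarrow> y \<in> val_units \<or> y \<in> M"
  by (auto simp: val_units_def M_def)

lemma val_units_M: "y \<in> val_units \<Longrightarrow> y \<in> M \<Longrightarrow> False"
  by (auto simp: val_units_def M_def)

text \<open>Elements whose values strictly decrease inside the maximal ideal are independent
  over \<open>k(y)\<close>; this bounds the length of such chains and makes the valuation discrete.\<close>

lemma chain_length:
  assumes y: "y \<in> M" "y \<noteq> 0" and s: "s 0 = y" "\<And>i. i < n \<Longrightarrow> s i \<in> M \<and> s i \<noteq> 0"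
    "\<And>i j. i < j \<Longrightarrow> j < n \<Longrightarrow> s i / s j \<in> M"
  shows "n \<le> fdeg y"
proof -
  have ykk: "y \<notin> kk" using kk_M y by blast
  have "lin_nondeg (RF y) {..<n} s"
  proof (rule ccontr)
    assume "\<not> lin_nondeg (RF y) {..<n} s"
    from RF_relation_nonzero_at_0[OF ykk _ this]
    obtain Q where Q: "\<And>i. i < n \<Longrightarrow> poly_over kk (Q i)" "(\<Sum>i<n. poly (Q i) y * s i) = 0" "\<exists>i<n. coeff (Q i) 0 \<noteq> 0"
      by auto
    \<comment> \<open>After division by \<open>s j\<close> all other terms lie in \<open>M\<close>:
      for \<open>i < j\<close> because \<open>s i / s j\<close> does, for \<open>i > j\<close>
      because their constant terms vanish and leave a factor \<open>y = s 0\<close>, which is a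
      multiple of \<open>s j\<close> in \<open>R\<close>. The constant term of \<open>Q j\<close>
      would then lie in \<open>M\<close>.\<close>
    define j where "j = Max {i. i < n \<and> coeff (Q i) 0 \<noteq> 0}"
    have fin: "finite {i. i < n \<and> coeff (Q i) 0 \<noteq> 0}" by simp
    have j: "j < n" "coeff (Q j) 0 \<noteq> 0" using Max_in[OF fin] Q(3) by (auto simp: j_def)
    have jmax: "i \<le> j" if "i < n" "coeff (Q i) 0 \<noteq> 0" for i
      unfolding j_def by (rule Max_ge[OF fin]) (use that in auto)
    have sj: "s j \<noteq> 0" using s(2) j by auto
    have QR: "poly (Q i) y \<in> R" if "i < n" for i
      using Q(1)[OF that] kkR M_R[OF y(1)] by (intro subring_set_poly[OF R]) (auto simp: poly_over_def)
    have Qsplit: "\<exists>r\<in>R. poly (Q i) y = coeff (Q i) 0 + y * r" if i: "i < n" for i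
    proof -
      obtain a q where aq: "Q i = pCons a q" by (metis pCons_cases)
      then have "poly q y \<in> R" using Q(1)[OF i] kkR M_R[OF y(1)]
        by (intro subring_set_poly[OF R]) (auto simp: poly_over_def dest: spec[of _ "Suc _"])
      then show ?thesis using aq by auto
    qed
    have trm: "poly (Q i) y * s i / s j \<in> M" if i: "i < n" "i \<noteq> j" for i
    proof (cases "i < j")
      case True
      then show ?thesis using M_mult'[OF s(3)[OF True j(1)] QR[OF i(1)]] by simp
    next
      case False
      then have "coeff (Q i) 0 = 0" using jmax i by force
      then obtain r where r: "r \<in> R" "poly (Q i) y = y * r" using Qsplit[OF i(1)] by auto
      have "y / s j \<in> R"
      proof (cases "j = 0")
        case True then show ?thesis using s(1) y(2) R1 by simp
      next
        case False then show ?thesis using s(3)[of 0 j] j s(1) M_R by auto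
      qed
      then have "s i * (r * (y / s j)) \<in> M" using s(2)[OF i(1)] by (intro M_mult Rmult[OF r(1)]) auto
      then show ?thesis using r by (simp add: mult_ac)
    qed
    have "0 = (\<Sum>i<n. poly (Q i) y * s i / s j)" using Q(2) by (simp add: sum_divide_distrib[symmetric])
    also have "\<dots> = poly (Q j) y + (\<Sum>i\<in>{..<n} - {j}. poly (Q i) y * s i / s j)"
      using j sj by (subst sum.remove[of _ j]) auto
    finally have "poly (Q j) y = - (\<Sum>i\<in>{..<n} - {j}. poly (Q i) y * s i / s j)"
      by (simp add: eq_neg_iff_add_eq_0)
    also have "\<dots> \<in> M" by (intro M_uminus M_sum trm) auto
    finally have "poly (Q j) y \<in> M" .
    moreover obtain r where "r \<in> R" "poly (Q j) y = coeff (Q j) 0 + y * r" using Qsplit[OF j(1)] by auto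
    ultimately have "coeff (Q j) 0 \<in> M"
      using M_add[of "poly (Q j) y" "- (y * r)"] M_uminus[OF M_mult[OF y(1)]] by simp
    then show False using kk_M j Q(1)[OF j(1)] by (auto simp: poly_over_def)
  qed
  then have "card {..<n} \<le> fdeg y" by (intro card_le_fdeg[OF ykk]) auto
  then show ?thesis by simp
qed

text \<open>Chains starting at \<open>x\<close> have bounded length. The last element of a longest
  one generates the maximal ideal, since an element of \<open>M\<close> not divisible by it could be
  appended.\<close>

lemma ex_uniformizer:
  assumes x: "x \<in> M" "x \<noteq> 0"
  shows "\<exists>t\<in>M. t \<noteq> 0 \<and> (\<forall>y\<in>M. y / t \<in> R)"
proof -
  define C where "C n = (\<exists>s. s 0 = x \<and> (\<forall>i<n. s i \<in> M \<and> s i \<noteq> 0) \<and> (\<forall>i j. i < j \<longrightarrow> j < n \<longrightarrow> s i / s j \<in> M))" for n :: nat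
  have "C 1" unfolding C_def using x by (intro exI[of _ "\<lambda>_. x"]) auto
  moreover have "\<forall>n. C n \<longrightarrow> n \<le> fdeg x"
  proof (intro allI impI)
    fix n assume "C n"
    then obtain s where "s 0 = x" "\<forall>i<n. s i \<in> M \<and> s i \<noteq> 0" "\<forall>i j. i < j \<longrightarrow> j < n \<longrightarrow> s i / s j \<in> M"
      unfolding C_def by blast
    then show "n \<le> fdeg x" using chain_length[OF x, of s n] by blast
  qed
  ultimately have max: "C (Greatest C)" "\<And>m. C m \<Longrightarrow> m \<le> Greatest C"
    using GreatestI_nat[of C 1 "fdeg x"] Greatest_le_nat[of C _ "fdeg x"] by metis+
  define n where "n = Greatest C"
  have n1: "n \<ge> 1" using max(2)[OF \<open>C 1\<close>] by (simp add: n_def)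
  obtain s where s: "s (0::nat) = x" "\<And>i. i < n \<Longrightarrow> s i \<in> M \<and> s i \<noteq> 0" "\<And>i j. i < j \<Longrightarrow> j < n \<Longrightarrow> s i / s j \<in> M"
    using max(1)[folded n_def] unfolding C_def by blast
  define t where "t = s (n - 1)"
  have t: "t \<in> M" "t \<noteq> 0" using s(2)[of "n - 1"] n1 by (auto simp: t_def)
  have "y / t \<in> R" if y: "y \<in> M" for y
  proof (rule ccontr)
    assume nR: "y / t \<notin> R"
    then have y0: "y \<noteq> 0" using R0 by auto
    then have "t / y \<in> R" using valring[of "y / t"] nR t by simp
    then have ty: "t / y \<in> M" using nR by (simp add: M_def)
    define s' where "s' = s(n := y)"
    have "C (Suc n)" unfolding C_def
    proof (intro exI[of _ s'] conjI allI impI)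
      show "s' 0 = x" using s(1) n1 by (simp add: s'_def)
      fix i assume "i < Suc n" then show "s' i \<in> M" "s' i \<noteq> 0" using s(2)[of i] y y0 by (auto simp: s'_def)
    next
      fix i j assume ij: "i < j" "j < Suc n"
      show "s' i / s' j \<in> M"
      proof (cases "j = n")
        case False then show ?thesis using ij s(3) by (simp add: s'_def)
      next
        case True
        show ?thesis
        proof (cases "i = n - 1")
          case True then show ?thesis using \<open>j = n\<close> ty n1 by (auto simp: s'_def t_def)
        next
          case False
          then have "s i / t \<in> M" using s(3)[of i "n - 1"] ij \<open>j = n\<close> by (simp add: t_def)
          from M_mult[OF this M_R[OF ty]] show ?thesis using \<open>j = n\<close> ij t by (simp add: s'_def)
        qed
      qed
    qed
    from max(2)[OF this] show False by (simp add: n_def)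
  qed
  with t show ?thesis by blast
qed

lemma val_units_mult: "u \<in> val_units \<Longrightarrow> v \<in> val_units \<Longrightarrow> u * v \<in> val_units"
  by (auto simp: val_units_def Rmult)

lemma val_units_inverse: "u \<in> val_units \<Longrightarrow> inverse u \<in> val_units"
  by (auto simp: val_units_def)

lemma M_power: "t \<in> M \<Longrightarrow> n > 0 \<Longrightarrow> t ^ n \<in> M"
  by (induction n) (auto intro: M_mult M_R subring_set_power[OF R])

text \<open>Only finitely many powers of the generator \<open>t\<close> of the maximal ideal divide
  a given nonzero element, so each nonzero element is a unit times a power of \<open>t\<close>; the
  exponent is the valuation.\<close>

lemma ex_place:
  assumes x: "x \<in> M" "x \<noteq> 0"
  shows "\<exists>v. place kk v \<and> v x > 0"
proof -
  obtain t where t: "t \<in> M" "t \<noteq> 0" and tdiv: "\<And>y. y \<in> M \<Longrightarrow> y / t \<in> R" using ex_uniformizer[OF x] by auto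
  have rep_M: "\<exists>k::nat. y / t ^ k \<in> val_units" if y: "y \<in> M" "y \<noteq> 0" for y
  proof -
    define C where "C m = (y / t ^ m \<in> M)" for m
    have "C 0" using y by (simp add: C_def)
    moreover have "\<forall>m. C m \<longrightarrow> m \<le> fdeg y"
    proof (intro allI impI)
      fix m assume C: "C m"
      \<comment> \<open>The chain \<open>y, t ^ m, ..., t\<close> of length \<open>m + 1\<close>,
        admissible as soon as \<open>y / t ^ m \<in> M\<close>; its length bounds
        \<open>m\<close>.\<close>
      define s where "s i = (if i = 0 then y else t ^ (m + 1 - i))" for i
      have "m + 1 \<le> fdeg y"
      proof (rule chain_length[OF y])
        show "s 0 = y" by (simp add: s_def)
        show "s i \<in> M \<and> s i \<noteq> 0" if "i < m + 1" for i
          using that y t M_power[OF t(1), of "m + 1 - i"] by (auto simp: s_def)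
        show "s i / s j \<in> M" if ij: "i < j" "j < m + 1" for i j
        proof (cases "i = 0")
          case True
          have "m = (m + 1 - j) + (j - 1)" using ij by simp
          then have "t ^ m = t ^ (m + 1 - j) * t ^ (j - 1)" by (metis power_add)
          then have "s i / s j = y / t ^ m * t ^ (j - 1)" using True ij t by (simp add: s_def)
          then show ?thesis using M_mult[OF C[unfolded C_def] subring_set_power[OF R M_R[OF t(1)]]] by metis
        next
          case False
          have "m + 1 - i = (m + 1 - j) + (j - i)" using ij by simp
          then have "t ^ (m + 1 - i) = t ^ (m + 1 - j) * t ^ (j - i)" by (metis power_add)
          then have "s i / s j = t ^ (j - i)" using False ij t by (simp add: s_def)
          then show ?thesis using M_power[OF t(1), of "j - i"] ij by simp
        qed
      qed
      then show "m \<le> fdeg y" by simp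
    qed
    ultimately have max: "C (Greatest C)" "\<And>m. C m \<Longrightarrow> m \<le> Greatest C"
      using GreatestI_nat[of C 0 "fdeg y"] Greatest_le_nat[of C _ "fdeg y"] by metis+
    define m where "m = Greatest C"
    have "y / t ^ Suc m \<in> R" using tdiv[of "y / t ^ m"] max(1) by (simp add: C_def m_def mult.commute)
    moreover have "y / t ^ Suc m \<notin> M" using max(2)[of "Suc m"] by (auto simp: C_def m_def)
    ultimately show ?thesis using val_units_or_M by blast
  qed
  have rep: "\<exists>k::int. y * t powi k \<in> val_units" if "y \<noteq> 0" for y
  proof -
    have R_case: "\<exists>k::int. y * t powi k \<in> val_units" if "y \<in> R" "y \<noteq> 0" for y
    proof (cases "y \<in> M")
      case True
      then obtain k :: nat where "y / t ^ k \<in> val_units" using rep_M \<open>y \<noteq> 0\<close> by blast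
      then show ?thesis by (intro exI[of _ "- int k"]) (simp add: power_int_minus divide_inverse)
    next
      case False
      then show ?thesis using val_units_or_M that by (intro exI[of _ 0]) auto
    qed
    from valring[OF that] show ?thesis
    proof
      assume "inverse y \<in> R"
      then obtain k where "inverse y * t powi k \<in> val_units" using R_case[of "inverse y"] \<open>y \<noteq> 0\<close> by auto
      then have "inverse (inverse y * t powi k) \<in> val_units" by (rule val_units_inverse)
      then show ?thesis by (intro exI[of _ "- k"]) (simp add: power_int_minus)
    qed (use R_case that in blast)
  qed
  have tUn: "k = 0" if "t powi k \<in> val_units" for k
  proof -
    have False if "t powi k \<in> val_units" "k > 0" for k
      using M_power[OF t(1), of "nat k"] that val_units_M[OF that(1)] by (simp add: power_int_def)
    from this[of k] this[of "- k"] that val_units_inverse[OF that] show ?thesis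
      by (cases "k > 0"; cases "k < 0") (auto simp: power_int_minus)
  qed
  define v where "v y = (if y = 0 then 0 else - (SOME k. y * t powi k \<in> val_units))" for y
  have v: "y * t powi (- v y) \<in> val_units" if "y \<noteq> 0" for y
    unfolding v_def using that someI_ex[OF rep[OF that]] by simp
  have vI: "v y = k" if "y \<noteq> 0" "y * t powi (- k) \<in> val_units" for y k
  proof -
    have "(y * t powi (- k)) * inverse (y * t powi (- v y)) \<in> val_units" by (intro val_units_mult val_units_inverse that(2) v that(1))
    also have "(y * t powi (- k)) * inverse (y * t powi (- v y)) = t powi (v y - k)"
      using that(1) t(2) by (simp add: power_int_diff power_int_minus field_simps)
    finally show ?thesis using tUn by fastforce
  qed
  have vR: "v y \<ge> 0" if "y \<in> R" "y \<noteq> 0" for y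
  proof (rule ccontr)
    assume neg: "\<not> v y \<ge> 0"
    have U: "inverse (y * t powi (- v y)) \<in> val_units" using v that val_units_inverse by blast
    have "t powi (- v y) = t ^ nat (- v y)" using neg by (simp add: power_int_def)
    then have "t powi (- v y) \<in> M" using M_power[OF t(1), of "nat (- v y)"] neg by simp
    then have "t powi (- v y) * inverse (y * t powi (- v y)) \<in> M" using U by (intro M_mult) (auto simp: val_units_def)
    then have "inverse y \<in> M" using t(2) that(2) by (simp add: field_simps)
    then show False using that by (auto simp: M_def)
  qed
  have "place kk v" unfolding place_def
  proof (intro conjI allI impI ballI)
    show "v 0 = 0" by (simp add: v_def)
    fix y z :: 'K assume yz: "y \<noteq> 0" "z \<noteq> 0"
    show vm: "v (y * z) = v y + v z"
    proof (rule vI)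
      have "(y * t powi (- v y)) * (z * t powi (- v z)) \<in> val_units" by (intro val_units_mult v yz)
      then show "y * z * t powi (- (v y + v z)) \<in> val_units"
        using t(2) by (simp add: power_int_diff power_int_minus field_simps)
    qed (use yz in auto)
    assume nz: "y + z \<noteq> 0"
    have main: "v (y + z) \<ge> v y" if le: "v y \<le> v z" and yz: "y \<noteq> 0" "z \<noteq> 0" "y + z \<noteq> 0" for y z
    proof -
      define w where "w = y * t powi (- v y) + (z * t powi (- v z)) * t ^ nat (v z - v y)"
      have UGR: "u \<in> R" if "u \<in> val_units" for u using that by (simp add: val_units_def)
      have "w \<in> R" unfolding w_def
        by (rule Radd[OF UGR[OF v[OF yz(1)]] Rmult[OF UGR[OF v[OF yz(2)]] subring_set_power[OF R M_R[OF t(1)]]]])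
      have "t ^ nat (v z - v y) = t powi (v z - v y)" using le by (simp add: power_int_def)
      then have weq: "y + z = w * t powi (v y)"
        using t(2) by (simp add: w_def power_int_diff power_int_minus field_simps)
      then have "w \<noteq> 0" using yz by auto
      have vw: "v w \<ge> 0" by (rule vR) fact+
      have "v (y + z) = v w + v y"
      proof (rule vI)
        show "(y + z) * t powi (- (v w + v y)) \<in> val_units"
          using v[OF \<open>w \<noteq> 0\<close>] t(2) unfolding weq by (simp add: power_int_diff power_int_minus field_simps)
      qed (use yz in auto)
      then show ?thesis using vw by simp
    qed
    show "min (v y) (v z) \<le> v (y + z)"
      using main[of y z] main[of z y] yz nz by (auto simp: min_def add.commute)
  next
    fix c assume "c \<in> kk" "c \<noteq> 0"
    then show "v c = 0" using kkR subfield_inverse[OF kk] by (intro vI) (auto simp: val_units_def)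
  next
    show "\<exists>t. t \<noteq> 0 \<and> v t = 1" using t(2) R1 by (intro exI[of _ t] conjI vI) (auto simp: val_units_def power_int_minus)
  qed
  moreover have "v x \<noteq> 0"
  proof
    assume "v x = 0"
    then show False using v[OF x(2)] val_units_M x by simp
  qed
  then have "v x > 0" using vR[of x] x M_R by force
  ultimately show ?thesis by blast
qed

end

context function_field
begin

text \<open>As \<open>x\<close> is transcendental, \<open>k[x]\<close> does not contain the inverse
  of \<open>x\<close>. A valuation ring that contains \<open>k[x]\<close> but not this inverse has
  \<open>x\<close> in its maximal ideal.\<close>

lemma ex_place_pos:
  assumes x: "x \<notin> kk"
  shows "\<exists>v. place kk v \<and> v x > 0"
proof -
  have sk: "subring_set kk" using kk by (auto simp: subring_set_def subfield_def)
  define R0 where "R0 = {poly p x | p. \<forall>i. coeff p i \<in> kk}"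
  have R0: "subring_set R0" "kk \<subseteq> R0" "x \<in> R0" unfolding R0_def by (rule subring_set_adjoin[OF sk])+
  have x0: "x \<noteq> 0" using x subfield_0[OF kk] by auto
  have "inverse x \<notin> R0"
  proof
    assume "inverse x \<in> R0"
    then obtain p where p: "inverse x = poly p x" "poly_over kk p" by (auto simp: R0_def poly_over_def)
    have "poly (pCons (- 1) p) x = 0" using p x0 by (simp add: p(1)[symmetric])
    moreover have "poly_over kk (pCons (- 1) p)" using p by (simp add: poly_over_pCons[OF kk] subfield_uminus[OF kk] subfield_1[OF kk])
    ultimately show False using poly_nonconst[OF x] by (metis neg_equal_0_iff_equal one_neq_zero pCons_eq_0_iff)
  qed
  from ex_valuation_ring[OF R0(1,3) this x0]
  obtain R where R: "subring_set R" "R0 \<subseteq> R" "inverse x \<notin> R" "\<forall>z. z \<noteq> 0 \<longrightarrow> z \<in> R \<or> inverse z \<in> R" by auto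
  have xR: "x \<in> R" using R(2) R0(3) by auto
  interpret valuation_ring kk R using R R0 by unfold_locales auto
  show ?thesis by (rule ex_place) (use \<open>inverse x \<notin> R\<close> xR x0 in \<open>auto simp: M_def\<close>)
qed

end

section \<open>Orders at places and approximation\<close>

text \<open>Places take the conventional value 0 at 0. Treating zero as having infinite order makes
  the lower bounds stable under sums and products without case distinctions.\<close>

definition vge :: "('K::field \<Rightarrow> int) \<Rightarrow> int \<Rightarrow> 'K \<Rightarrow> bool" where
  "vge p m x \<longleftrightarrow> x = 0 \<or> p x \<ge> m"

lemma vge_0 [simp]: "vge p m 0" by (simp add: vge_def)

lemma vge_mono: "vge p m x \<Longrightarrow> m' \<le> m \<Longrightarrow> vge p m' x" by (auto simp: vge_def)

context function_field
begin

abbreviation "Pl \<equiv> place kk"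

lemma place_mult: "Pl p \<Longrightarrow> x \<noteq> 0 \<Longrightarrow> y \<noteq> 0 \<Longrightarrow> p (x * y) = p x + p y"
  by (simp add: place_def)

lemma place_add: "Pl p \<Longrightarrow> x \<noteq> 0 \<Longrightarrow> y \<noteq> 0 \<Longrightarrow> x + y \<noteq> 0 \<Longrightarrow> min (p x) (p y) \<le> p (x + y)"
  by (simp add: place_def)

lemma place_const: "Pl p \<Longrightarrow> c \<in> kk \<Longrightarrow> p c = 0"
  by (cases "c = 0") (auto simp: place_def)

lemma place_0: "Pl p \<Longrightarrow> p 0 = 0"
  by (simp add: place_def)

lemma place_1: "Pl p \<Longrightarrow> p 1 = 0"
  by (simp add: place_const subfield_1[OF kk])

lemma ex_uniformizer_at: "Pl p \<Longrightarrow> \<exists>t. t \<noteq> 0 \<and> p t = 1"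
  by (simp add: place_def)

lemma place_inverse: "Pl p \<Longrightarrow> p (inverse x) = - p x"
  using place_mult[of p x "inverse x"] place_1[of p] place_0[of p] by (cases "x = 0") auto

lemma place_divide: "Pl p \<Longrightarrow> x \<noteq> 0 \<Longrightarrow> y \<noteq> 0 \<Longrightarrow> p (x / y) = p x - p y"
  by (simp add: divide_inverse place_mult place_inverse)

lemma place_power: "Pl p \<Longrightarrow> p (x ^ n) = int n * p x"
proof (cases "x = 0")
  case True
  then show "Pl p \<Longrightarrow> ?thesis" by (cases n) (auto simp: place_0 place_1)
next
  case False
  then show "Pl p \<Longrightarrow> ?thesis" by (induction n) (auto simp: place_1 place_mult algebra_simps)
qed

lemma place_power_int: "Pl p \<Longrightarrow> p (x powi k) = k * p x"
  by (auto simp: power_int_def place_power place_inverse)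

lemma place_uminus: "Pl p \<Longrightarrow> p (- x) = p x"
  using place_mult[of p "- 1" x] place_const[of p "- 1"] subfield_uminus[OF kk subfield_1[OF kk]]
  by (cases "x = 0") auto

lemma vge_add: "Pl p \<Longrightarrow> vge p m x \<Longrightarrow> vge p m y \<Longrightarrow> vge p m (x + y)"
  using place_add[of p x y] by (cases "x = 0"; cases "y = 0"; cases "x + y = 0") (auto simp: vge_def)

lemma vge_uminus: "Pl p \<Longrightarrow> vge p m x \<Longrightarrow> vge p m (- x)"
  by (auto simp: vge_def place_uminus)

lemma vge_diff: "Pl p \<Longrightarrow> vge p m x \<Longrightarrow> vge p m y \<Longrightarrow> vge p m (x - y)"
  using vge_add[of p m x "- y"] vge_uminus by simp

lemma vge_mult: "Pl p \<Longrightarrow> vge p m x \<Longrightarrow> vge p m' y \<Longrightarrow> vge p (m + m') (x * y)"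
  using place_mult[of p x y] by (cases "x = 0"; cases "y = 0") (auto simp: vge_def)

lemma vge_sum: "Pl p \<Longrightarrow> (\<And>i. i \<in> I \<Longrightarrow> vge p m (f i)) \<Longrightarrow> vge p m (sum f I)"
  by (induction I rule: infinite_finite_induct) (auto intro: vge_add)

lemma vge_const: "Pl p \<Longrightarrow> c \<in> kk \<Longrightarrow> vge p 0 c"
  by (simp add: vge_def place_const)

lemma vge_cmult: "Pl p \<Longrightarrow> c \<in> kk \<Longrightarrow> vge p m x \<Longrightarrow> vge p m (c * x)"
  using vge_mult[of p 0 c m x] vge_const by simp

lemma vge_power: "Pl p \<Longrightarrow> vge p m x \<Longrightarrow> vge p (int n * m) (x ^ n)"
  using place_power[of p x n] by (cases "x = 0"; cases n) (auto simp: vge_def mult_left_mono place_1)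

lemma vge_const_imp_0: "Pl p \<Longrightarrow> c \<in> kk \<Longrightarrow> vge p 1 c \<Longrightarrow> c = 0"
  by (auto simp: vge_def place_const)

lemma vge_poly: "Pl p \<Longrightarrow> poly_over kk q \<Longrightarrow> vge p 0 x \<Longrightarrow> vge p 0 (poly q x)"
  unfolding poly_altdef
  by (rule vge_sum) (auto simp: poly_over_def intro!: vge_cmult dest: vge_power)

lemma vge_valI: "Pl p \<Longrightarrow> x \<noteq> 0 \<Longrightarrow> vge p m x \<Longrightarrow> m \<le> p x"
  by (simp add: vge_def)

lemma place_add_eq:
  assumes "Pl p" "x \<noteq> 0" "vge p (p x + 1) y"
  shows "x + y \<noteq> 0" "p (x + y) = p x"
proof -
  show nz: "x + y \<noteq> 0"
  proof
    assume "x + y = 0"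
    then have "y = - x" by (simp add: eq_neg_iff_add_eq_0 add.commute)
    then show False using assms by (simp add: vge_def place_uminus)
  qed
  have 1: "vge p (p x) (x + y)" by (intro vge_add assms vge_mono[OF assms(3)]) (auto simp: vge_def)
  have "\<not> vge p (p x + 1) (x + y)"
  proof
    assume "vge p (p x + 1) (x + y)"
    then have "vge p (p x + 1) (x + y - y)" by (intro vge_diff assms)
    then show False using assms by (simp add: vge_def)
  qed
  with 1 nz show "p (x + y) = p x" by (auto simp: vge_def)
qed

lemma place_nonconst: "Pl p \<Longrightarrow> p x \<noteq> 0 \<Longrightarrow> x \<notin> kk"
  using place_const by auto

text \<open>Over \<open>k\<close> the polynomial is a product of linear factors; each
  \<open>x - a\<close> has order at least 0, so a product of positive order has a factor of positive
  order.\<close>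

lemma place_const_split:
  assumes p: "Pl p" and x: "vge p 0 x" and q: "poly_over kk q" "q \<noteq> 0" "vge p 1 (poly q x)"
  shows "\<exists>c\<in>kk. vge p 1 (x - c)"
proof -
  obtain c as where *: "c \<in> kk" "c \<noteq> 0" "set as \<subseteq> kk" "q = Polynomial.smult c (\<Prod>a\<leftarrow>as. [:- a, 1:])"
    using alg_closed_poly_splits[OF alg_closed q(1,2)] by auto
  have "vge p 1 (c * (\<Prod>a\<leftarrow>as. x - a))" using q(3) * by (simp add: poly_prod_list o_def)
  then have "vge p 1 (inverse c * (c * (\<Prod>a\<leftarrow>as. x - a)))" by (rule vge_cmult[OF p subfield_inverse[OF kk *(1)]])
  moreover have "inverse c * (c * (\<Prod>a\<leftarrow>as. x - a)) = (\<Prod>a\<leftarrow>as. x - a)" using *(2) by simp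
  ultimately have "vge p 1 (\<Prod>a\<leftarrow>as. x - a)" by (simp only:)
  then show ?thesis using *(3)
  proof (induction as)
    case Nil
    then show ?case using p by (simp add: vge_def place_1)
  next
    case (Cons a as)
    show ?case
    proof (cases "vge p 1 (x - a)")
      case True then show ?thesis using Cons.prems by auto
    next
      case False
      then have xa: "x - a \<noteq> 0" "p (x - a) \<le> 0" by (auto simp: vge_def)
      have "vge p 0 (x - a)" using Cons.prems by (intro vge_diff p x vge_const) auto
      then have "p (x - a) = 0" using xa by (auto simp: vge_def)
      then have "vge p 1 (\<Prod>a\<leftarrow>as. x - a)"
        using Cons.prems(1) xa place_mult[OF p xa(1), of "\<Prod>a\<leftarrow>as. x - a"]
        by (cases "(\<Prod>a\<leftarrow>as. x - a) = 0") (auto simp: vge_def)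
      then show ?thesis using Cons by auto
    qed
  qed
qed

text \<open>The residue field is \<open>k\<close>: a relation between \<open>x\<close> and a
  uniformizer \<open>t\<close>, normalised so that its reduction modulo \<open>t\<close> is
  nontrivial, becomes a polynomial over \<open>k\<close> that the residue class of \<open>x\<close>
  satisfies.\<close>

lemma residue:
  assumes p: "Pl p" and x: "vge p 0 x"
  shows "\<exists>c\<in>kk. vge p 1 (x - c)"
proof -
  obtain t where t: "t \<noteq> 0" "p t = 1" using ex_uniformizer_at[OF p] by auto
  have tkk: "t \<notin> kk" using place_nonconst[OF p, of t] t by simp
  obtain A :: nat and P where P: "\<And>j. poly_over kk (P j)" "\<exists>j\<le>A. P j \<noteq> 0" "(\<Sum>j\<le>A. poly (P j) t * x ^ j) = 0"
    using algebraic_relation[of t x] by blast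
  obtain Q where Q: "\<And>j. j \<le> A \<Longrightarrow> poly_over kk (Q j)" "(\<Sum>j\<le>A. poly (Q j) t * x ^ j) = 0" "\<exists>j\<le>A. coeff (Q j) 0 \<noteq> 0"
    using poly_relation_nonzero_at_0[OF tkk, of "{..A}" P "\<lambda>j. x ^ j"] P by auto
  define q where "q = (\<Sum>j\<le>A. monom (coeff (Q j) 0) j)"
  have cq: "coeff q j = (if j \<le> A then coeff (Q j) 0 else 0)" for j
    unfolding q_def coeff_sum by simp
  have q: "poly_over kk q"
    unfolding poly_over_def cq using Q(1) subfield_0[OF kk] by (auto simp: poly_over_def)
  have "q \<noteq> 0" using Q(3) cq by (metis coeff_0)
  have "poly q x - (\<Sum>j\<le>A. poly (Q j) t * x ^ j) = (\<Sum>j\<le>A. (coeff (Q j) 0 - poly (Q j) t) * x ^ j)"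
    by (simp add: q_def poly_sum poly_monom sum_subtractf algebra_simps)
  also have "vge p 1 \<dots>"
  proof (rule vge_sum[OF p])
    fix j assume "j \<in> {..A}"
    obtain a r where ar: "Q j = pCons a r" by (metis pCons_cases)
    have "poly_over kk r" using Q(1)[of j] \<open>j \<in> {..A}\<close> ar by (simp add: poly_over_pCons[OF kk])
    then have "vge p 0 (poly r t)" using t by (intro vge_poly p) (auto simp: vge_def)
    then have "vge p (1 + 0) (t * poly r t)" using t by (intro vge_mult p) (auto simp: vge_def)
    then have "vge p (1 + int j * 0) (- (t * poly r t) * x ^ j)"
      by (intro vge_mult p vge_uminus vge_power x) auto
    then show "vge p 1 ((coeff (Q j) 0 - poly (Q j) t) * x ^ j)" using ar by simp
  qed
  finally have "vge p 1 (poly q x)" using Q(2) by simp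
  from place_const_split[OF p x q \<open>q \<noteq> 0\<close> this] show ?thesis .
qed

text \<open>Inclusion of the valuation rings sends units to units, which makes \<open>q\<close> an
  integer multiple of \<open>p\<close>; since both places take the value 1, the factor is 1.\<close>

lemma place_eqI:
  assumes p: "Pl p" and q: "Pl q" and le: "\<And>x. x \<noteq> 0 \<Longrightarrow> p x \<ge> 0 \<Longrightarrow> q x \<ge> 0"
  shows "p = q"
proof -
  obtain t where t: "t \<noteq> 0" "p t = 1" using ex_uniformizer_at[OF p] by auto
  obtain s where s: "s \<noteq> 0" "q s = 1" using ex_uniformizer_at[OF q] by auto
  have eq: "q x = p x * q t" if x: "x \<noteq> 0" for x
  proof -
    define u where "u = x * t powi (- p x)"
    have u: "u \<noteq> 0" "p u = 0" using x t p by (simp_all add: u_def place_mult place_power_int)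
    have "q u \<ge> 0" using le[OF u(1)] u by simp
    moreover have "q (inverse u) \<ge> 0" using le[of "inverse u"] u place_inverse[OF p, of u] by simp
    ultimately have "q u = 0" using place_inverse[OF q, of u] by simp
    then show ?thesis using x t q by (simp add: u_def place_mult place_power_int)
  qed
  have "q t \<ge> 0" using le t by simp
  moreover have "p s * q t = 1" using eq[OF s(1)] s by simp
  ultimately have "q t = 1" using zmult_eq_1_iff by fastforce
  then have "q x = p x" for x using eq[of x] place_0[OF p] place_0[OF q] by (cases "x = 0") auto
  then show ?thesis by auto
qed

section \<open>Weak approximation\<close>

lemma separate_two:
  assumes p: "Pl p" and q: "Pl q" and ne: "p \<noteq> q"
  shows "\<exists>x. x \<noteq> 0 \<and> p x > 0 \<and> q x < 0"
proof -
  obtain x where x: "x \<noteq> 0" "p x \<ge> 0" "q x < 0" using place_eqI[OF p q] ne by force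
  obtain y where y: "y \<noteq> 0" "q y \<ge> 0" "p y < 0" using place_eqI[OF q p] ne by force
  show ?thesis using x y p q by (intro exI[of _ "x / y"]) (auto simp: place_divide)
qed

lemma separate_many:
  assumes p: "Pl p" and "finite Q" "\<And>q. q \<in> Q \<Longrightarrow> Pl q" "p \<notin> Q"
  shows "\<exists>x. x \<noteq> 0 \<and> p x > 0 \<and> (\<forall>q\<in>Q. q x < 0)"
  using assms(2-)
proof (induction Q rule: finite_induct)
  case empty
  then show ?case using ex_uniformizer_at[OF p] by force
next
  case (insert q Q)
  then obtain y where y: "y \<noteq> 0" "p y > 0" "\<forall>q\<in>Q. q y < 0" by auto
  have q: "Pl q" "p \<noteq> q" using insert by auto
  show ?case
  proof (cases "q y < 0")
    case True then show ?thesis using y by auto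
  next
    case False
    obtain z where z: "z \<noteq> 0" "p z > 0" "q z < 0" using separate_two[OF p q] by auto
    \<comment> \<open>Beyond every \<open>\<bar>q' y\<bar>\<close>, so that \<open>z ^ r\<close> and
      \<open>y\<close> never have the same order at a place of \<open>insert q Q\<close> and nothing
      can cancel in \<open>y + z ^ r\<close>.\<close>
    define r where "r = Suc (nat (\<Sum>q\<in>Q. \<bar>q y\<bar>))"
    have r: "int r > \<bar>q' y\<bar>" if "q' \<in> Q" for q'
    proof -
      have "\<bar>q' y\<bar> \<le> (\<Sum>q\<in>Q. \<bar>q y\<bar>)" using insert that by (intro member_le_sum) auto
      then show ?thesis by (simp add: r_def)
    qed
    have zr: "z ^ r \<noteq> 0" using z by simp
    have neg: "q' (y + z ^ r) < 0 \<and> y + z ^ r \<noteq> 0" if q': "q' = q \<or> q' \<in> Q" for q'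
    proof -
      have Pq': "Pl q'" using q' insert.prems q by auto
      have pw: "q' (z ^ r) = int r * q' z" using place_power[OF Pq'] .
      have ne: "q' (z ^ r) \<noteq> q' y \<and> (q' (z ^ r) < 0 \<or> q' y < 0)"
      proof (cases "q' = q")
        case True
        moreover have "int r > 0" by (simp only: r_def)
        ultimately have "int r * q' z < 0" using z by (simp add: mult_less_0_iff)
        then show ?thesis using False True pw by auto
      next
        case F: False
        then have yq: "q' y < 0" "int r > \<bar>q' y\<bar>" using q' y r by auto
        have "int r * q' z \<noteq> q' y"
        proof
          assume e: "int r * q' z = q' y"
          then have "q' z \<noteq> 0" using yq by auto
          then have "1 \<le> \<bar>q' z\<bar>" by linarith
          then have "\<bar>int r * q' z\<bar> \<ge> int r" by (simp add: abs_mult mult_le_cancel_left1)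
          then show False using e yq by linarith
        qed
        then show ?thesis using pw yq by auto
      qed
      show ?thesis
      proof (cases "q' (z ^ r) < q' y")
        case True
        then have "z ^ r + y \<noteq> 0" "q' (z ^ r + y) = q' (z ^ r)"
          using place_add_eq[OF Pq' zr, of y] by (auto simp: vge_def)
        then show ?thesis using ne True by (auto simp: add.commute)
      next
        case False
        then have "y + z ^ r \<noteq> 0" "q' (y + z ^ r) = q' y"
          using place_add_eq[OF Pq' y(1), of "z ^ r"] ne by (auto simp: vge_def)
        then show ?thesis using ne False by auto
      qed
    qed
    have "vge p 1 (y + z ^ r)"
    proof (rule vge_add[OF p])
      show "vge p 1 y" using y by (simp add: vge_def)
      have "1 \<le> int r" by (simp add: r_def)
      then show "vge p 1 (z ^ r)" using z p mult_mono[of 1 "int r" 1 "p z"] by (simp add: vge_def place_power)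
    qed
    then show ?thesis using neg[of q] neg by (intro exI[of _ "y + z ^ r"]) (auto simp: vge_def)
  qed
qed

text \<open>With \<open>x\<close> small at \<open>p\<close> and large on \<open>Q\<close>, the
  element \<open>1 / (1 + x ^ m)\<close> is close to 1 at \<open>p\<close> and close to 0 on
  \<open>Q\<close>.\<close>

lemma approx_idempotent:
  fixes m :: nat
  assumes p: "Pl p" and Q: "finite Q" "\<And>q. q \<in> Q \<Longrightarrow> Pl q" "p \<notin> Q" and m: "m > 0"
  shows "\<exists>h. h \<noteq> 0 \<and> p h = 0 \<and> (\<forall>q\<in>Q. q h \<ge> int m)"
proof -
  obtain x where x: "x \<noteq> 0" "p x > 0" "\<forall>q\<in>Q. q x < 0" using separate_many[OF assms(1-4)] by auto
  have xm: "vge p (p 1 + 1) (x ^ m)"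
    using x m mult_mono[of 1 "int m" 1 "p x"] p by (simp add: vge_def place_1 place_power)
  have h: "1 + x ^ m \<noteq> 0" "p (1 + x ^ m) = 0" using place_add_eq[OF p _ xm] place_1[OF p] by auto
  have "q (inverse (1 + x ^ m)) \<ge> int m" if "q \<in> Q" for q
  proof -
    have q: "Pl q" "q x \<le> -1" using that Q x by auto
    have qm: "q (x ^ m) \<le> - int m" using mult_left_mono[OF q(2), of "int m"] place_power[OF q(1), of x m] by simp
    have "q (x ^ m + 1) = q (x ^ m)"
      by (rule place_add_eq[OF q(1)]) (use x qm m q(1) in \<open>auto simp: vge_def place_1\<close>)
    then show ?thesis using qm place_inverse[OF q(1), of "1 + x ^ m"] by (simp add: add.commute)
  qed
  then show ?thesis using h place_inverse[OF p, of "1 + x ^ m"] by (intro exI[of _ "inverse (1 + x ^ m)"]) auto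
qed

lemma approx_order:
  fixes p :: "'K \<Rightarrow> int" and m k :: nat
  assumes p: "Pl p" and Q: "finite Q" "\<And>q. q \<in> Q \<Longrightarrow> Pl q" "p \<notin> Q"
  shows "\<exists>u. u \<noteq> 0 \<and> p u = int k \<and> (\<forall>q\<in>Q. q u \<ge> int m)"
proof -
  obtain t where t: "t \<noteq> 0" "p t = 1" using ex_uniformizer_at[OF p] by auto
  \<comment> \<open>Outweighs the poles that \<open>t ^ k\<close> may have on
    \<open>Q\<close>.\<close>
  define M where "M = Suc m + k * nat (\<Sum>q\<in>Q. \<bar>q t\<bar>)"
  obtain h where h: "h \<noteq> 0" "p h = 0" "\<forall>q\<in>Q. q h \<ge> int M"
    using approx_idempotent[OF assms, of M] by (auto simp: M_def)
  have "q (t ^ k * h) \<ge> int m" if q: "q \<in> Q" for q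
  proof -
    have "\<bar>q t\<bar> \<le> (\<Sum>q\<in>Q. \<bar>q t\<bar>)" using Q q by (intro member_le_sum) auto
    then have "int k * (- q t) \<le> int k * (\<Sum>q\<in>Q. \<bar>q t\<bar>)" by (intro mult_left_mono) auto
    moreover have "(\<Sum>q\<in>Q. \<bar>q t\<bar>) \<ge> 0" by (simp add: sum_nonneg)
    ultimately have "int M + int k * q t \<ge> int m" by (simp add: M_def)
    moreover have "q (t ^ k * h) = int k * q t + q h" using t h q Q by (simp add: place_mult place_power)
    ultimately show ?thesis using h(3) q by force
  qed
  then show ?thesis using h t p by (intro exI[of _ "t ^ k * h"]) (auto simp: place_mult place_power)
qed

section \<open>Zeros, poles and the degree over k(x)\<close>

text \<open>For \<open>q\<close> in \<open>Q\<close> and \<open>k\<close> below \<open>q x\<close>,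
  take \<open>u q k\<close> of order exactly \<open>k\<close> at \<open>q\<close> and of high order
  at the rest of \<open>Q\<close>. These elements are independent over \<open>k(x)\<close>: in a
  relation that is nontrivial modulo \<open>x\<close>, pick a place \<open>q\<close> and the least
  \<open>k\<close> with a nonzero constant term; at \<open>q\<close> this term has order
  \<open>k\<close>, and all remaining contributions have larger order.\<close>

lemma zeros_le_fdeg:
  assumes Q: "finite Q" "\<And>q. q \<in> Q \<Longrightarrow> Pl q \<and> q x > 0"
  shows "(\<Sum>q\<in>Q. q x) \<le> int (fdeg x)"
proof (cases "Q = {}")
  case False
  then obtain q0 where "q0 \<in> Q" by auto
  then have xkk: "x \<notin> kk" using Q place_nonconst[of q0 x] by force
  define e where "e q = nat (q x)" for q
  have e: "int (e q) = q x" if "q \<in> Q" for q using Q(2)[OF that] by (simp add: e_def)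
  define em where "em = Max (e ` Q)"
  have em: "e q \<le> em" if "q \<in> Q" for q using Q that by (simp add: em_def)
  define I where "I = (SIGMA q:Q. {..<e q})"
  have finI: "finite I" using Q by (simp add: I_def)
  have "\<exists>u. u \<noteq> 0 \<and> q u = int k \<and> (\<forall>q'\<in>Q - {q}. q' u \<ge> int em)" if "q \<in> Q" for q and k :: nat
    by (rule approx_order) (use Q that in auto)
  then obtain u where u: "\<And>q k. q \<in> Q \<Longrightarrow> u q k \<noteq> 0 \<and> q (u q k) = int k \<and> (\<forall>q'\<in>Q - {q}. q' (u q k) \<ge> int em)"
    by metis
  have "lin_nondeg (RF x) I (\<lambda>(q,k). u q k)"
  proof (rule ccontr)
    assume "\<not> lin_nondeg (RF x) I (\<lambda>(q,k). u q k)"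
    from RF_relation_nonzero_at_0[OF xkk finI this]
    obtain R where R: "\<forall>i\<in>I. poly_over kk (R i)" "(\<Sum>i\<in>I. poly (R i) x * (case i of (q,k) \<Rightarrow> u q k)) = 0" "\<exists>i\<in>I. coeff (R i) 0 \<noteq> 0"
      by blast
    then obtain q k' where qk': "q \<in> Q" "k' < e q" "coeff (R (q,k')) 0 \<noteq> 0" by (auto simp: I_def)
    define k where "k = (LEAST k. k < e q \<and> coeff (R (q,k)) 0 \<noteq> 0)"
    have k: "k < e q" "coeff (R (q,k)) 0 \<noteq> 0" using LeastI[of "\<lambda>k. k < e q \<and> coeff (R (q,k)) 0 \<noteq> 0"] qk' by (auto simp: k_def)
    have kmin: "coeff (R (q,j)) 0 = 0" if "j < k" for j
      using not_less_Least[of j "\<lambda>k. k < e q \<and> coeff (R (q,k)) 0 \<noteq> 0"] that k(1) by (auto simp: k_def)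
    have q: "Pl q" using Q qk' by auto
    have qx: "vge q (int (e q)) x" using e[OF qk'(1)] by (simp add: vge_def)
    have R0kk: "coeff (R i) 0 \<in> kk" if "i \<in> I" for i using R(1) that by (simp add: poly_over_def)
    have high: "vge q (int k + 1) (poly (R i) x * (case i of (q,k) \<Rightarrow> u q k))" if i: "i \<in> I" "i \<noteq> (q,k)" for i
    proof -
      obtain q' j where ij: "i = (q', j)" by (cases i)
      have q'j: "q' \<in> Q" "j < e q'" using i ij by (auto simp: I_def)
      obtain a r where ar: "R i = pCons a r" by (metis pCons_cases)
      have akk: "a \<in> kk" and rkk: "poly_over kk r" using R(1) i ar by (auto simp: poly_over_pCons[OF kk] dest: bspec[of _ _ i])
      have rx: "vge q 0 (poly r x)" using qx by (intro vge_poly[OF q rkk]) (auto intro: vge_mono)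
      have u0: "vge q 0 (u q' j)" using u[OF q'j(1), of j] qk'(1) by (cases "q' = q") (force simp: vge_def)+
      have 1: "vge q (int (e q) + 0 + 0) (x * poly r x * u q' j)" by (intro vge_mult q qx rx u0)
      have 2: "vge q (int k + 1) (a * u q' j)"
      proof (cases "q' = q")
        case True
        show ?thesis
        proof (cases "j < k")
          case True
          then have "a = 0" using kmin[of j] ar ij \<open>q' = q\<close> by auto
          then show ?thesis by simp
        next
          case False
          then have "j > k" using i ij True by auto
          then show ?thesis using u[OF q'j(1), of j] True by (intro vge_cmult q akk) (auto simp: vge_def)
        qed
      next
        case False
        then have "vge q (int em) (u q' j)" using u[OF q'j(1), of j] qk'(1) by (auto simp: vge_def)
        then have "vge q (int k + 1) (u q' j)" using k em[OF qk'(1)] by (auto elim: vge_mono)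
        then show ?thesis by (intro vge_cmult q akk)
      qed
      have "vge q (int k + 1) (a * u q' j + x * poly r x * u q' j)"
        using k(1) by (intro vge_add q 2 vge_mono[OF 1]) auto
      then show ?thesis using ar ij by (simp add: algebra_simps)
    qed
    have qkI: "(q,k) \<in> I" using qk' k by (simp add: I_def)
    obtain a r where ar: "R (q,k) = pCons a r" by (metis pCons_cases)
    have akk: "a \<in> kk" "a \<noteq> 0" and rkk: "poly_over kk r" using R(1) qkI ar k by (auto simp: poly_over_pCons[OF kk] dest: bspec[of _ _ "(q,k)"])
    have rx: "vge q 0 (poly r x)" using qx by (intro vge_poly[OF q rkk]) (auto intro: vge_mono)
    have "vge q (int (e q) + 0 + 0) (x * poly r x * u q k)"
      using u[OF qk'(1), of k] by (intro vge_mult q qx rx) (auto simp: vge_def)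
    then have v1: "vge q (int k + 1) (x * poly r x * u q k)" using k by (auto elim: vge_mono)
    have "vge q (int k + 1) (\<Sum>i\<in>I - {(q,k)}. poly (R i) x * (case i of (q,k) \<Rightarrow> u q k))"
      by (rule vge_sum[OF q]) (use high in auto)
    with v1 have "vge q (int k + 1) (- (x * poly r x * u q k) - (\<Sum>i\<in>I - {(q,k)}. poly (R i) x * (case i of (q,k) \<Rightarrow> u q k)))"
      by (intro vge_diff vge_uminus q)
    moreover have "a * u q k = - (x * poly r x * u q k) - (\<Sum>i\<in>I - {(q,k)}. poly (R i) x * (case i of (q,k) \<Rightarrow> u q k))"
    proof -
      have "0 = poly (R (q,k)) x * u q k + (\<Sum>i\<in>I - {(q,k)}. poly (R i) x * (case i of (q,k) \<Rightarrow> u q k))"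
        using R(2) sum.remove[OF finI qkI, of "\<lambda>i. poly (R i) x * (case i of (q,k) \<Rightarrow> u q k)"] by simp
      also have "poly (R (q,k)) x * u q k = a * u q k + x * poly r x * u q k" using ar by (simp add: algebra_simps)
      finally show ?thesis by (simp add: algebra_simps eq_neg_iff_add_eq_0)
    qed
    ultimately have "vge q (int k + 1) (a * u q k)" by simp
    then show False using u[OF qk'(1), of k] akk q by (simp add: vge_def place_mult place_const)
  qed
  then have "card I \<le> fdeg x" by (rule card_le_fdeg[OF xkk finI])
  moreover have "card I = (\<Sum>q\<in>Q. e q)" using Q by (simp add: I_def)
  moreover have "int (\<Sum>q\<in>Q. e q) = (\<Sum>q\<in>Q. q x)" using e by simp
  ultimately show ?thesis by linarith
qed simp

lemma finite_zeros: "finite {p. Pl p \<and> p x > 0}"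
proof (rule ccontr)
  assume "infinite {p. Pl p \<and> p x > 0}"
  then obtain Q where Q: "Q \<subseteq> {p. Pl p \<and> p x > 0}" "finite Q" "card Q = Suc (fdeg x)"
    using infinite_arbitrarily_large by blast
  have "int (card Q) \<le> (\<Sum>q\<in>Q. q x)" using Q(1) sum_mono[of Q "\<lambda>_. 1::int" "\<lambda>q. q x"] by force
  also have "\<dots> \<le> int (fdeg x)" using zeros_le_fdeg[OF Q(2)] Q(1) by blast
  finally show False using Q by simp
qed

lemma finite_poles: "finite {p. Pl p \<and> p x < 0}"
proof -
  have "{p. Pl p \<and> p x < 0} = {p. Pl p \<and> p (inverse x) > 0}" by (auto simp: place_inverse)
  then show ?thesis using finite_zeros by simp
qed

lemma finite_support: "finite {p. Pl p \<and> p x \<noteq> 0}"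
proof -
  have "{p. Pl p \<and> p x \<noteq> 0} = {p. Pl p \<and> p x > 0} \<union> {p. Pl p \<and> p x < 0}" by auto
  then show ?thesis using finite_zeros finite_poles by simp
qed

text \<open>Completeness of the curve: the inverse of a nonconstant element has a zero, by
  \<open>ex_place_pos\<close>.\<close>

lemma no_poles_const:
  assumes "\<And>p. Pl p \<Longrightarrow> p x \<ge> 0" shows "x \<in> kk"
proof (rule ccontr)
  assume "x \<notin> kk"
  then have "inverse x \<notin> kk" using subfield_inverse[OF kk, of "inverse x"] by auto
  then obtain v where "Pl v" "v (inverse x) > 0" using ex_place_pos by blast
  then show False using assms[of v] place_inverse[of v x] by auto
qed

end

lemma dim_le_kdim:
  assumes "subfield E" "subspace_over E V" "dim_le E V n"
  shows "dim_le E V (kdim E V)"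
proof (rule dim_leI)
  fix I :: "nat set" and y assume "finite I" "\<And>i. i \<in> I \<Longrightarrow> y i \<in> V" "lin_nondeg E I y"
  then show "card I \<le> kdim E V" by (rule card_le_kdim[OF assms])
qed

section \<open>Riemann-Roch spaces\<close>

context function_field
begin

abbreviation "LD \<equiv> RR_space kk"
abbreviation "ell D \<equiv> kdim kk (RR_space kk D)"

lemma RR_iff: "f \<in> LD D \<longleftrightarrow> (\<forall>p. Pl p \<longrightarrow> vge p (- D p) f)"
  unfolding RR_space_def vge_def by (auto simp: algebra_simps)

lemma RR_subspace: "subspace_over kk (LD D)"
  unfolding subspace_over_def
proof (intro conjI ballI)
  show "0 \<in> LD D" by (simp add: RR_iff)
  show "x + y \<in> LD D" if "x \<in> LD D" "y \<in> LD D" for x y using that vge_add unfolding RR_iff by blast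
  show "c * x \<in> LD D" if "c \<in> kk" "x \<in> LD D" for c x using that vge_cmult unfolding RR_iff by blast
qed

lemma RR_mono:
  assumes "\<And>p. Pl p \<Longrightarrow> D p \<le> D' p" shows "LD D \<subseteq> LD D'"
proof
  fix f assume "f \<in> LD D"
  then have "vge p (- D' p) f" if "Pl p" for p
    using vge_mono[of p "- D p" f "- D' p"] assms[OF that] that by (simp add: RR_iff)
  then show "f \<in> LD D'" by (simp add: RR_iff)
qed

lemma RR_cong: "(\<And>p. Pl p \<Longrightarrow> D p = D' p) \<Longrightarrow> LD D = LD D'"
  by (auto simp: RR_iff)

lemma RR_zero: "LD (\<lambda>_. 0) = kk"
proof
  show "LD (\<lambda>_. 0) \<subseteq> kk"
  proof
    fix f assume "f \<in> LD (\<lambda>_. 0)"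
    then have "p f \<ge> 0" if "Pl p" for p using that place_0[OF that] by (cases "f = 0") (auto simp: RR_iff vge_def)
    then show "f \<in> kk" by (rule no_poles_const)
  qed
  show "kk \<subseteq> LD (\<lambda>_. 0)" by (auto simp: RR_iff vge_const)
qed

text \<open>Since residues lie in \<open>k\<close>, constant multiples of one member of extreme
  order at \<open>p\<close> remove the leading coefficient of all the others there; only that one
  member is lost.\<close>

lemma RR_step:
  fixes I :: "'i set"
  assumes p: "Pl p" and D: "\<And>q. Pl q \<Longrightarrow> q \<noteq> p \<Longrightarrow> D' q = D q" "D' p = D p + 1"
    and I: "finite I" "\<And>i. i \<in> I \<Longrightarrow> y i \<in> LD D'" "lin_nondeg kk I y"
  shows "\<exists>(J::'i set) z. finite J \<and> card I \<le> card J + 1 \<and> (\<forall>i\<in>J. z i \<in> LD D) \<and> lin_nondeg kk J z"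
proof (cases "\<forall>i\<in>I. y i \<in> LD D")
  case True
  then show ?thesis using I by (intro exI[of _ I] exI[of _ y]) auto
next
  case False
  then obtain i0 where i0: "i0 \<in> I" "y i0 \<notin> LD D" by auto
  have in_LD: "f \<in> LD D" if f: "f \<in> LD D'" "vge p (- D p) f" for f
  proof -
    have "vge q (- D q) f" if "Pl q" for q
    proof (cases "q = p")
      case False
      then show ?thesis using f(1) D(1)[OF that False] that unfolding RR_iff by metis
    qed (use f in simp)
    then show ?thesis by (simp add: RR_iff)
  qed
  have "vge p (- (D p + 1)) (y i0)" using I(2)[OF i0(1)] p D(2) unfolding RR_iff by metis
  moreover have "\<not> vge p (- D p) (y i0)" using in_LD[OF I(2)[OF i0(1)]] i0 by blast
  ultimately have y0: "y i0 \<noteq> 0" "p (y i0) = - (D p + 1)" by (auto simp: vge_def)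
  have "\<exists>c\<in>kk. vge p 1 (y i / y i0 - c)" if i: "i \<in> I" for i
  proof (rule residue[OF p])
    have "vge p (- (D p + 1)) (y i)" using I(2)[OF i] p D(2) unfolding RR_iff by metis
    then show "vge p 0 (y i / y i0)" using y0 p by (cases "y i = 0") (auto simp: vge_def place_divide)
  qed
  then obtain c where c: "\<And>i. i \<in> I \<Longrightarrow> c i \<in> kk" "\<And>i. i \<in> I \<Longrightarrow> vge p 1 (y i / y i0 - c i)" by metis
  define z where "z i = y i - c i * y i0" for i
  have zLD: "z i \<in> LD D" if i: "i \<in> I" for i
  proof (rule in_LD)
    have "z i = y i + (- c i) * y i0" by (simp add: z_def)
    then show "z i \<in> LD D'" using RR_subspace[of D'] I(2) i i0(1) subfield_uminus[OF kk c(1)[OF i]]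
      unfolding subspace_over_def by metis
    have "vge p (1 + - (D p + 1)) ((y i / y i0 - c i) * y i0)"
      by (intro vge_mult p c(2) i) (use y0 in \<open>simp add: vge_def\<close>)
    then show "vge p (- D p) (z i)" using y0 by (simp add: z_def algebra_simps)
  qed
  have "lin_nondeg kk (I - {i0}) z"
  proof (rule lin_nondegI)
    fix a i assume a: "\<And>i. i \<in> I - {i0} \<Longrightarrow> a i \<in> kk" "(\<Sum>i\<in>I - {i0}. a i * z i) = 0" "i \<in> I - {i0}"
    define b where "b i = (if i = i0 then - (\<Sum>i\<in>I - {i0}. a i * c i) else a i)" for i
    have "(\<Sum>i\<in>I. b i * y i) = b i0 * y i0 + (\<Sum>i\<in>I - {i0}. b i * y i)"
      using I(1) i0(1) by (rule sum.remove)
    also have "(\<Sum>i\<in>I - {i0}. b i * y i) = (\<Sum>i\<in>I - {i0}. a i * y i)" by (intro sum.cong) (auto simp: b_def)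
    also have "b i0 * y i0 + \<dots> = (\<Sum>i\<in>I - {i0}. a i * z i)"
      by (simp add: b_def z_def algebra_simps sum_subtractf sum_distrib_left sum_distrib_right)
    finally have "(\<Sum>i\<in>I. b i * y i) = 0" using a(2) by simp
    moreover have "b j \<in> kk" if "j \<in> I" for j unfolding b_def using a(1) c(1) that
      by (auto intro!: subfield_uminus[OF kk] subfield_sum[OF kk] subfield_mult[OF kk])
    ultimately have "b i = 0" using lin_nondegD[OF I(3), of b i] a(3) by blast
    then show "a i = 0" using a(3) by (simp add: b_def)
  qed
  then show ?thesis using I i0 zLD by (intro exI[of _ "I - {i0}"] exI[of _ z]) auto
qed

lemma RR_dim_le_step:
  assumes "Pl p" "\<And>q. Pl q \<Longrightarrow> q \<noteq> p \<Longrightarrow> D' q = D q" "D' p = D p + 1" "dim_le kk (LD D) n"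
  shows "dim_le kk (LD D') (n + 1)"
proof (rule dim_leI)
  fix I :: "nat set" and y assume I: "finite I" "\<And>i. i \<in> I \<Longrightarrow> y i \<in> LD D'" "lin_nondeg kk I y"
  have "\<exists>(J::nat set) z. finite J \<and> card I \<le> card J + 1 \<and> (\<forall>i\<in>J. z i \<in> LD D) \<and> lin_nondeg kk J z"
    by (rule RR_step[OF assms(1-3) I])
  then obtain J :: "nat set" and z where "finite J" "card I \<le> card J + 1" "\<forall>i\<in>J. z i \<in> LD D" "lin_nondeg kk J z"
    by blast
  then show "card I \<le> n + 1" using dim_le_card[OF assms(4), of J z] by simp
qed

lemma RR_dim_le_diff:
  assumes T: "finite T" "\<And>p. p \<in> T \<Longrightarrow> Pl p" and le: "\<And>p. Pl p \<Longrightarrow> D p \<le> D' p"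
    and eq: "\<And>p. Pl p \<Longrightarrow> p \<notin> T \<Longrightarrow> D p = D' p" and n: "dim_le kk (LD D) n"
  shows "dim_le kk (LD D') (n + (\<Sum>p\<in>T. nat (D' p - D p)))"
  using le eq
proof (induction "\<Sum>p\<in>T. nat (D' p - D p)" arbitrary: D')
  case 0
  have "D p = D' p" if "Pl p" for p
  proof (cases "p \<in> T")
    case True
    then have "nat (D' p - D p) = 0" using 0(1) T(1) by (simp add: sum_eq_0_iff)
    then show ?thesis using 0(2)[OF that] by simp
  qed (use 0 that in auto)
  then have "LD D' = LD D" using RR_cong[of D' D] by simp
  then show ?case using n 0(1)[symmetric] by simp
next
  case (Suc k)
  have "\<exists>p\<in>T. nat (D' p - D p) \<noteq> 0"
  proof (rule ccontr)
    assume "\<not> ?thesis"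
    then have "(\<Sum>p\<in>T. nat (D' p - D p)) = 0" by (intro sum.neutral) blast
    then show False using Suc(2) by simp
  qed
  then obtain p where p: "p \<in> T" "D p < D' p" by auto
  define D1 where "D1 = D'(p := D' p - 1)"
  have "(\<Sum>p\<in>T. nat (D' p - D p)) = nat (D' p - D p) + (\<Sum>p\<in>T-{p}. nat (D' p - D p))"
    using T(1) p(1) by (rule sum.remove)
  moreover have "(\<Sum>p\<in>T. nat (D1 p - D p)) = nat (D1 p - D p) + (\<Sum>p\<in>T-{p}. nat (D1 p - D p))"
    using T(1) p(1) by (rule sum.remove)
  moreover have "(\<Sum>p\<in>T-{p}. nat (D1 p - D p)) = (\<Sum>p\<in>T-{p}. nat (D' p - D p))"
    by (intro sum.cong) (auto simp: D1_def)
  moreover have "nat (D' p - D p) = Suc (nat (D1 p - D p))" using p by (simp add: D1_def)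
  ultimately have *: "(\<Sum>p\<in>T. nat (D' p - D p)) = Suc (\<Sum>p\<in>T. nat (D1 p - D p))" by simp
  have "dim_le kk (LD D1) (n + (\<Sum>p\<in>T. nat (D1 p - D p)))"
  proof (rule Suc.hyps(1))
    show "k = (\<Sum>p\<in>T. nat (D1 p - D p))" using * Suc(2) by simp
    show "\<And>q. Pl q \<Longrightarrow> D q \<le> D1 q" using Suc.prems(1) p by (auto simp: D1_def)
    show "\<And>q. Pl q \<Longrightarrow> q \<notin> T \<Longrightarrow> D q = D1 q" using Suc.prems(2) p by (auto simp: D1_def)
  qed
  then have "dim_le kk (LD D') (n + (\<Sum>p\<in>T. nat (D1 p - D p)) + 1)"
    by (rule RR_dim_le_step[rotated -1]) (use T(2)[OF p(1)] in \<open>auto simp: D1_def\<close>)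
  then show ?case unfolding * by simp
qed

lemma div_deg_eq:
  assumes "finite T" "\<And>p. p \<in> T \<Longrightarrow> Pl p" "\<And>p. Pl p \<Longrightarrow> p \<notin> T \<Longrightarrow> D p = 0"
  shows "div_deg kk D = (\<Sum>p\<in>T. D p)"
  unfolding div_deg_def by (intro sum.mono_neutral_left) (use assms in auto)

lemma divisorI: "finite T \<Longrightarrow> (\<And>p. Pl p \<Longrightarrow> p \<notin> T \<Longrightarrow> D p = 0) \<Longrightarrow> divisor kk D"
  unfolding divisor_def by (rule finite_subset[of _ T]) auto

lemma divisor_zero: "divisor kk (\<lambda>_. 0)" by (simp add: divisor_def)

lemma dim_le_kk: "dim_le kk kk 1"
proof -
  have "kk \<subseteq> espan kk {..<1::nat} (\<lambda>_. 1)" unfolding espan_def by (auto intro: exI[of _ "\<lambda>_. _"])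
  then show ?thesis using dim_le_subset[OF dim_le_espan[OF kk, of "{..<1::nat}" "\<lambda>_. 1"]] by simp
qed

lemma RR_effective:
  assumes "divisor kk D" "\<And>p. Pl p \<Longrightarrow> D p \<ge> 0"
  shows "dim_le kk (LD D) (1 + nat (div_deg kk D))"
proof -
  define T where "T = {p. Pl p \<and> D p \<noteq> 0}"
  have T: "finite T" using assms by (simp add: T_def divisor_def)
  have "dim_le kk (LD D) (1 + (\<Sum>p\<in>T. nat (D p - 0)))"
    by (rule RR_dim_le_diff[where D = "\<lambda>_. 0"]) (use T assms dim_le_kk RR_zero in \<open>auto simp: T_def\<close>)
  moreover have "int (\<Sum>p\<in>T. nat (D p - 0)) = div_deg kk D"
    unfolding div_deg_def T_def[symmetric] of_nat_sum using assms(2) by (intro sum.cong) (auto simp: T_def)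
  ultimately show ?thesis by (metis nat_int)
qed

lemma RR_finite:
  assumes "divisor kk D" shows "\<exists>n. dim_le kk (LD D) n"
proof -
  define D' where "D' p = max 0 (D p)" for p
  have "divisor kk D'" using assms unfolding divisor_def by (rule rev_finite_subset) (auto simp: D'_def)
  then have "dim_le kk (LD D') (1 + nat (div_deg kk D'))" by (rule RR_effective) (simp add: D'_def)
  moreover have "LD D \<subseteq> LD D'" by (rule RR_mono) (simp add: D'_def)
  ultimately show ?thesis using dim_le_subset by blast
qed

lemma ell_effective:
  assumes "divisor kk D" "\<And>p. Pl p \<Longrightarrow> D p \<ge> 0"
  shows "int (ell D) \<le> 1 + div_deg kk D"
proof -
  have "ell D \<le> 1 + nat (div_deg kk D)" by (rule kdim_le[OF kk RR_subspace RR_effective[OF assms]])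
  moreover have "div_deg kk D \<ge> 0" unfolding div_deg_def by (rule sum_nonneg) (use assms in auto)
  ultimately show ?thesis by simp
qed

lemma card_le_ell:
  assumes "divisor kk D" "finite J" "\<And>j. j \<in> J \<Longrightarrow> y j \<in> LD D" "lin_nondeg kk J y"
  shows "card J \<le> ell D"
  using RR_finite[OF assms(1)] card_le_kdim[OF kk RR_subspace _ assms(2-)] by blast

lemma ell_basis:
  assumes "divisor kk D"
  shows "\<exists>y. (\<forall>i<ell D. y i \<in> LD D) \<and> lin_nondeg kk {..<ell D} y \<and> LD D = espan kk {..<ell D} y"
  using RR_finite[OF assms] kdim_basis[OF kk RR_subspace] by metis

text \<open>Each added point brings at most one dimension. Read as monotonicity of
  \<open>div_deg - ell\<close>, this reduces an upper bound for all divisors to a cofinal family of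
  them.\<close>

lemma ell_diff:
  assumes D: "divisor kk D" "divisor kk D'" "\<And>p. Pl p \<Longrightarrow> D p \<le> D' p"
  shows "int (ell D') \<le> int (ell D) + (div_deg kk D' - div_deg kk D)"
proof -
  define T where "T = {p. Pl p \<and> D p \<noteq> 0} \<union> {p. Pl p \<and> D' p \<noteq> 0}"
  have T: "finite T" "\<And>p. p \<in> T \<Longrightarrow> Pl p" using D(1,2) by (auto simp: T_def divisor_def)
  obtain n where "dim_le kk (LD D) n" using RR_finite[OF D(1)] by blast
  then have "dim_le kk (LD D) (ell D)" by (rule dim_le_kdim[OF kk RR_subspace])
  moreover have "D p = D' p" if "Pl p" "p \<notin> T" for p using that by (simp add: T_def)
  ultimately have "dim_le kk (LD D') (ell D + (\<Sum>p\<in>T. nat (D' p - D p)))"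
    by (intro RR_dim_le_diff[OF T D(3)])
  then have "ell D' \<le> ell D + (\<Sum>p\<in>T. nat (D' p - D p))" by (rule kdim_le[OF kk RR_subspace])
  moreover have "int (\<Sum>p\<in>T. nat (D' p - D p)) = (\<Sum>p\<in>T. D' p) - (\<Sum>p\<in>T. D p)"
    unfolding of_nat_sum sum_subtractf[symmetric] using D(3) T(2) by (intro sum.cong) auto
  moreover have "div_deg kk D = (\<Sum>p\<in>T. D p)" "div_deg kk D' = (\<Sum>p\<in>T. D' p)"
    by (rule div_deg_eq[OF T]; simp add: T_def)+
  ultimately show ?thesis by linarith
qed

lemma ell_shift:
  assumes D: "divisor kk D" and f: "f \<noteq> 0"
  shows "ell D \<le> ell (\<lambda>p. D p + p f)"
proof -
  obtain y where y: "\<forall>i<ell D. y i \<in> LD D" "lin_nondeg kk {..<ell D} y" using ell_basis[OF D] by blast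
  have "divisor kk (\<lambda>p. D p + p f)"
    by (rule divisorI[of "{p. Pl p \<and> D p \<noteq> 0} \<union> {p. Pl p \<and> p f \<noteq> 0}"])
       (use D finite_support[of f] in \<open>auto simp: divisor_def\<close>)
  then have "card {..<ell D} \<le> ell (\<lambda>p. D p + p f)"
  proof (rule card_le_ell)
    show "lin_nondeg kk {..<ell D} (\<lambda>i. inverse f * y i)" using lin_nondeg_mult[OF y(2)] f by simp
    fix i assume "i \<in> {..<ell D}"
    then have "vge p (- D p) (y i)" if "Pl p" for p using y that by (auto simp: RR_iff)
    then have "vge p (- p f + - D p) (inverse f * y i)" if "Pl p" for p
      using that by (intro vge_mult) (auto simp: vge_def place_inverse)
    then show "inverse f * y i \<in> LD (\<lambda>p. D p + p f)" by (simp add: RR_iff algebra_simps)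
  qed simp
  then show ?thesis by simp
qed

section \<open>Pole divisors and Riemann's theorem\<close>

definition poles :: "'K \<Rightarrow> ('K \<Rightarrow> int) \<Rightarrow> int" where "poles x p = max 0 (- p x)"

lemma poles_divisor: "divisor kk (poles x)"
  by (rule divisorI[OF finite_support[of x]]) (auto simp: poles_def)

lemma poles_deg: "div_deg kk (poles x) = height kk x"
  unfolding div_deg_def height_def
proof (rule sum.cong)
  show "{p. Pl p \<and> poles x p \<noteq> 0} = {p. Pl p \<and> p x < 0}" by (auto simp: poles_def)
qed (auto simp: poles_def)

lemma divisor_add: "divisor kk D \<Longrightarrow> divisor kk D' \<Longrightarrow> divisor kk (\<lambda>p. D p + D' p)"
  unfolding divisor_def by (rule finite_subset[of _ "{p. Pl p \<and> D p \<noteq> 0} \<union> {p. Pl p \<and> D' p \<noteq> 0}"]) auto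

lemma divisor_cmult: "divisor kk D \<Longrightarrow> divisor kk (\<lambda>p. c * D p)"
  unfolding divisor_def by (erule rev_finite_subset) auto

lemma divisor_sum: "(\<And>i. i \<in> I \<Longrightarrow> divisor kk (D i)) \<Longrightarrow> divisor kk (\<lambda>p. \<Sum>i\<in>I. D i p)"
  by (induction I rule: infinite_finite_induct) (auto simp: divisor_zero divisor_add)

lemma div_deg_add:
  assumes "divisor kk D" "divisor kk D'" shows "div_deg kk (\<lambda>p. D p + D' p) = div_deg kk D + div_deg kk D'"
proof -
  define T where "T = {p. Pl p \<and> D p \<noteq> 0} \<union> {p. Pl p \<and> D' p \<noteq> 0}"
  have T: "finite T" "\<And>p. p \<in> T \<Longrightarrow> Pl p" using assms by (auto simp: T_def divisor_def)
  have "div_deg kk D = (\<Sum>p\<in>T. D p)" "div_deg kk D' = (\<Sum>p\<in>T. D' p)" "div_deg kk (\<lambda>p. D p + D' p) = (\<Sum>p\<in>T. D p + D' p)"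
    by (rule div_deg_eq[OF T]; simp add: T_def)+
  then show ?thesis by (simp add: sum.distrib)
qed

lemma div_deg_cmult:
  assumes "divisor kk D" shows "div_deg kk (\<lambda>p. c * D p) = c * div_deg kk D"
proof -
  define T where "T = {p. Pl p \<and> D p \<noteq> 0}"
  have T: "finite T" "\<And>p. p \<in> T \<Longrightarrow> Pl p" using assms by (auto simp: T_def divisor_def)
  have "div_deg kk D = (\<Sum>p\<in>T. D p)" "div_deg kk (\<lambda>p. c * D p) = (\<Sum>p\<in>T. c * D p)"
    by (rule div_deg_eq[OF T]; simp add: T_def)+
  then show ?thesis by (simp add: sum_distrib_left)
qed

text \<open>The products of powers of \<open>x\<close> with a \<open>k(x)\<close>-basis of the field fill up the spaces
  attached to multiples of the pole divisor of \<open>x\<close>.\<close>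

lemma ell_poles_lower:
  assumes x: "x \<notin> kk"
  shows "\<exists>C. divisor kk C \<and> (\<forall>p. C p \<ge> 0) \<and> (\<forall>m::nat. fdeg x * (m + 1) \<le> ell (\<lambda>p. int m * poles x p + C p))"
proof -
  obtain u where u: "lin_nondeg (RF x) {..<fdeg x} u" using ex_fdeg_basis[OF x] by blast
  define C where "C p = (\<Sum>i<fdeg x. poles (u i) p)" for p
  have C: "divisor kk C" unfolding C_def by (intro divisor_sum poles_divisor)
  have Cge: "C p \<ge> poles (u i) p" if "i < fdeg x" for i p
    unfolding C_def using that by (intro member_le_sum) (auto simp: poles_def)
  have "fdeg x * (m + 1) \<le> ell (\<lambda>p. int m * poles x p + C p)" for m :: nat
  proof -
    have "card ({..<fdeg x} \<times> {..m}) \<le> ell (\<lambda>p. int m * poles x p + C p)"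
    proof (rule card_le_ell)
      show "divisor kk (\<lambda>p. int m * poles x p + C p)"
        by (intro divisor_add divisor_cmult poles_divisor C)
      fix ij assume "ij \<in> {..<fdeg x} \<times> {..m}"
      then obtain i j where ij: "ij = (i,j)" "i < fdeg x" "j \<le> m" by auto
      have "vge p (- (int m * poles x p + C p)) (x ^ j * u i)" if p: "Pl p" for p
      proof -
        have "vge p (int j * (- poles x p) + - poles (u i) p) (x ^ j * u i)"
          by (intro vge_mult vge_power p) (auto simp: vge_def poles_def)
        moreover have "int j * poles x p \<le> int m * poles x p" using ij by (intro mult_right_mono) (auto simp: poles_def)
        ultimately show ?thesis using Cge[OF ij(2), of p] by (auto elim!: vge_mono)
      qed
      then show "(case ij of (i,j) \<Rightarrow> x ^ j * u i) \<in> LD (\<lambda>p. int m * poles x p + C p)" using ij by (auto simp: RR_iff)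
    next
      show "lin_nondeg kk ({..<fdeg x} \<times> {..m}) (\<lambda>(i,j). x ^ j * u i)"
      proof (rule lin_nondegI)
        fix a ij assume a: "\<And>i. i \<in> {..<fdeg x} \<times> {..m} \<Longrightarrow> a i \<in> kk"
          "(\<Sum>i\<in>{..<fdeg x} \<times> {..m}. a i * (case i of (i,j) \<Rightarrow> x ^ j * u i)) = 0" "ij \<in> {..<fdeg x} \<times> {..m}"
        define P where "P i = (\<Sum>j\<le>m. monom (a (i,j)) j)" for i
        have P: "poly_over kk (P i)" if "i < fdeg x" for i
          unfolding P_def using a(1) that by (auto intro!: poly_over_sum[OF kk] poly_over_monom[OF kk])
        have "(\<Sum>i<fdeg x. poly (P i) x * u i) = (\<Sum>i<fdeg x. \<Sum>j\<le>m. a (i,j) * (x ^ j * u i))"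
          by (intro sum.cong refl) (simp add: P_def poly_sum poly_monom sum_distrib_right mult.assoc)
        also have "\<dots> = 0" using a(2) by (simp add: sum.cartesian_product case_prod_unfold)
        finally have 0: "(\<Sum>i<fdeg x. poly (P i) x * u i) = 0" .
        obtain i j where ij: "ij = (i,j)" "i < fdeg x" "j \<le> m" using a(3) by auto
        have "poly (P i) x = 0" using lin_nondegD[OF u _ 0] RF_poly P ij by blast
        then have "P i = 0" using poly_nonconst[OF x P[OF ij(2)]] by blast
        moreover have "coeff (P i) j = a (i,j)"
          using ij by (simp add: P_def coeff_sum if_distrib cong: if_cong)
        ultimately show "a ij = 0" using ij by simp
      qed
    qed auto
    then show ?thesis by (simp add: card_cartesian_product)
  qed
  moreover have "C p \<ge> 0" for p unfolding C_def by (rule sum_nonneg) (simp add: poles_def)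
  ultimately show ?thesis using C by blast
qed

text \<open>Growth in \<open>m\<close>: the spaces of \<open>ell_poles_lower\<close> grow at least
  with slope \<open>fdeg x\<close>, and by \<open>ell_effective\<close> at most with the degree of
  the poles as slope.\<close>

lemma fdeg_le_poles:
  assumes x: "x \<notin> kk" shows "int (fdeg x) \<le> div_deg kk (poles x)"
proof (rule ccontr)
  assume neg: "\<not> ?thesis"
  define d where "d = div_deg kk (poles x)"
  obtain C where C: "divisor kk C" "\<And>p. C p \<ge> 0" "\<And>m::nat. fdeg x * (m + 1) \<le> ell (\<lambda>p. int m * poles x p + C p)"
    using ell_poles_lower[OF x] by blast
  define m where "m = Suc (nat (div_deg kk C))"
  have dv: "divisor kk (\<lambda>p. int m * poles x p)" by (intro divisor_cmult poles_divisor)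
  have "div_deg kk C \<ge> 0" unfolding div_deg_def by (rule sum_nonneg) (use C in auto)
  have d0: "d \<ge> 0" unfolding d_def div_deg_def by (rule sum_nonneg) (auto simp: poles_def)
  have "int (fdeg x * (m + 1)) \<le> int (ell (\<lambda>p. int m * poles x p + C p))" using C(3)[of m] by (simp only: of_nat_le_iff)
  also have "\<dots> \<le> 1 + div_deg kk (\<lambda>p. int m * poles x p + C p)"
    by (rule ell_effective[OF divisor_add[OF dv C(1)]]) (use C(2) in \<open>auto simp: poles_def\<close>)
  also have "\<dots> = 1 + int m * d + div_deg kk C"
    using div_deg_add[OF dv C(1)] div_deg_cmult[OF poles_divisor, of "int m" x] by (simp add: d_def)
  finally have "int (fdeg x) * int (m + 1) \<le> 1 + int m * d + div_deg kk C" by (simp only: of_nat_mult)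
  moreover have "(d + 1) * int (m + 1) \<le> int (fdeg x) * int (m + 1)"
    using neg by (intro mult_right_mono) (auto simp: d_def)
  ultimately have "d + int m \<le> div_deg kk C" by (simp add: algebra_simps)
  then show False using \<open>div_deg kk C \<ge> 0\<close> d0 by (simp add: m_def)
qed

text \<open>The poles of \<open>x\<close> are the zeros of its inverse, and both generate the same
  rational subfield, so \<open>zeros_le_fdeg\<close> supplies the missing inequality.\<close>

lemma poles_eq_fdeg:
  assumes x: "x \<notin> kk" shows "div_deg kk (poles x) = int (fdeg x)"
proof -
  have "div_deg kk (poles x) = (\<Sum>p\<in>{p. Pl p \<and> p x < 0}. p (inverse x))"
    unfolding poles_deg height_def by (intro sum.cong) (auto simp: place_inverse)
  also have "\<dots> \<le> int (fdeg (inverse x))"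
    by (rule zeros_le_fdeg[OF finite_poles]) (auto simp: place_inverse)
  finally show ?thesis using fdeg_le_poles[OF x] fdeg_inverse[OF x] by simp
qed

lemma zeros_eq_fdeg:
  assumes x: "x \<notin> kk" shows "(\<Sum>p\<in>{p. Pl p \<and> p x > 0}. p x) = int (fdeg x)"
proof -
  have "inverse x \<notin> kk" using x subfield_inverse[OF kk, of "inverse x"] by auto
  then have "height kk (inverse x) = int (fdeg x)" using poles_eq_fdeg[of "inverse x"] poles_deg fdeg_inverse[OF x] by simp
  moreover have "height kk (inverse x) = (\<Sum>p\<in>{p. Pl p \<and> p x > 0}. p x)"
    unfolding height_def by (intro sum.cong) (auto simp: place_inverse)
  ultimately show ?thesis by simp
qed

lemma product_formula:
  assumes T: "finite T" "\<And>p. p \<in> T \<Longrightarrow> Pl p" "\<And>p. Pl p \<Longrightarrow> p \<notin> T \<Longrightarrow> p x = 0"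
  shows "(\<Sum>p\<in>T. p x) = 0"
proof (cases "x \<in> kk")
  case True
  then show ?thesis using T place_const by (intro sum.neutral) auto
next
  case False
  define Z where "Z = {p. Pl p \<and> p x > 0}"
  define Y where "Y = {p. Pl p \<and> p x < 0}"
  have ZY: "finite Z" "finite Y" "Z \<inter> Y = {}" using finite_zeros finite_poles by (auto simp: Z_def Y_def)
  have "(\<Sum>p\<in>T. p x) = (\<Sum>p\<in>Z \<union> Y. p x)" using T
    by (intro sum.mono_neutral_right) (force simp: Z_def Y_def)+
  also have "\<dots> = (\<Sum>p\<in>Z. p x) + (\<Sum>p\<in>Y. p x)" by (rule sum.union_disjoint[OF ZY])
  also have "(\<Sum>p\<in>Z. p x) = int (fdeg x)" unfolding Z_def by (rule zeros_eq_fdeg[OF False])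
  also have "(\<Sum>p\<in>Y. p x) = - height kk x" unfolding height_def Y_def by (simp add: sum_negf)
  finally show ?thesis using poles_eq_fdeg[OF False] poles_deg by simp
qed

text \<open>For the multiples \<open>Dm m\<close> of the pole divisor of a fixed \<open>x\<close>
  the bound is \<open>ell_poles_lower\<close>. Any \<open>D\<close> lies below its positive part
  \<open>A\<close>, and for large \<open>m\<close> there is an \<open>f\<close> with
  \<open>A \<le> Dm m + div f\<close>. Adding a principal divisor keeps the degree and does not
  lower \<open>ell\<close>, so monotonicity of \<open>div_deg - ell\<close> carries the bound over
  to \<open>D\<close>.\<close>

lemma riemann_bound: "\<exists>c. \<forall>D. divisor kk D \<longrightarrow> div_deg kk D - int (ell D) \<le> c"
proof -
  obtain x where x: "x \<notin> kk" using ex_finite_generation by metis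
  obtain C where C: "divisor kk C" "\<And>p. C p \<ge> 0" "\<And>m::nat. fdeg x * (m + 1) \<le> ell (\<lambda>p. int m * poles x p + C p)"
    using ell_poles_lower[OF x] by blast
  define N where "N = int (fdeg x)"
  have "N > 0"
  proof -
    obtain v where "Pl v" "v x > 0" using ex_place_pos[OF x] by blast
    then have "v x \<le> (\<Sum>p\<in>{v}. p x)" "(\<Sum>p\<in>{v}. p x) \<le> int (fdeg x)" using zeros_le_fdeg[of "{v}" x] by auto
    then show ?thesis using \<open>v x > 0\<close> by (simp add: N_def)
  qed
  define Dm where "Dm m p = int m * poles x p" for m p
  have Dm: "divisor kk (Dm m)" for m unfolding Dm_def by (intro divisor_cmult poles_divisor)
  have Dmdeg: "div_deg kk (Dm m) = int m * N" for m
    unfolding Dm_def N_def using div_deg_cmult[OF poles_divisor] poles_eq_fdeg[OF x] by simp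
  have lower: "int (ell (Dm m)) \<ge> int m * N + N - div_deg kk C" for m
  proof -
    have "int (fdeg x * (m + 1)) \<le> int (ell (\<lambda>p. Dm m p + C p))" using C(3)[of m] by (simp only: of_nat_le_iff Dm_def)
    also have "\<dots> \<le> int (ell (Dm m)) + (div_deg kk (\<lambda>p. Dm m p + C p) - div_deg kk (Dm m))"
      by (rule ell_diff[OF Dm divisor_add[OF Dm C(1)]]) (use C in auto)
    also have "\<dots> = int (ell (Dm m)) + div_deg kk C" using div_deg_add[OF Dm C(1)] by simp
    finally show ?thesis by (simp add: N_def algebra_simps)
  qed
  have "div_deg kk D - int (ell D) \<le> div_deg kk C - N" if D: "divisor kk D" for D
  proof -
    define A where "A p = max 0 (D p)" for p
    have A: "divisor kk A" using D unfolding divisor_def by (rule rev_finite_subset) (auto simp: A_def)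
    have A0: "div_deg kk A \<ge> 0" unfolding div_deg_def by (rule sum_nonneg) (auto simp: A_def)
    \<comment> \<open>Makes the lower bound for \<open>ell E\<close> positive, so that a nonzero
      \<open>f\<close> in this space exists.\<close>
    define m where "m = nat (div_deg kk A + div_deg kk C + 1)"
    have C0: "div_deg kk C \<ge> 0" unfolding div_deg_def by (rule sum_nonneg) (use C in auto)
    have m: "int m = div_deg kk A + div_deg kk C + 1" using A0 C0 by (simp add: m_def)
    define E where "E p = Dm m p + (- 1) * A p" for p
    have E: "divisor kk E" unfolding E_def by (intro divisor_add divisor_cmult Dm A)
    have degE: "div_deg kk E = int m * N - div_deg kk A"
      unfolding E_def using div_deg_add[OF Dm divisor_cmult[OF A, of "-1"]] div_deg_cmult[OF A, of "-1"] Dmdeg by simp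
    have "int (ell (Dm m)) \<le> int (ell E) + (div_deg kk (Dm m) - div_deg kk E)"
      by (rule ell_diff[OF E Dm]) (auto simp: E_def A_def)
    then have "int (ell E) \<ge> int m * N + N - div_deg kk C - div_deg kk A" using lower[of m] Dmdeg degE by simp
    moreover have "int m * N \<ge> int m" using \<open>N > 0\<close> by (simp add: mult_le_cancel_left1)
    ultimately have "ell E \<noteq> 0" using m \<open>N > 0\<close> by linarith
    obtain y where y: "\<forall>i<ell E. y i \<in> LD E" "lin_nondeg kk {..<ell E} y" using ell_basis[OF E] by blast
    define f where "f = y 0"
    have f: "f \<noteq> 0" "f \<in> LD E" using y \<open>ell E \<noteq> 0\<close> lin_nondeg_nonzero[OF kk y(2), of 0] by (auto simp: f_def)
    define G where "G p = Dm m p + p f" for p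
    have pf: "divisor kk (\<lambda>p. p f)" using finite_support[of f] by (simp add: divisor_def)
    have G: "divisor kk G" unfolding G_def by (intro divisor_add Dm pf)
    have AG: "A p \<le> G p" if "Pl p" for p
      using f that vge_valI[of p f "- E p"] by (auto simp: RR_iff G_def E_def)
    have "div_deg kk (\<lambda>p. p f) = 0" unfolding div_deg_def
      by (rule product_formula[OF finite_support]) auto
    then have degG: "div_deg kk G = int m * N" unfolding G_def using div_deg_add[OF Dm pf] Dmdeg by simp
    have 1: "int (ell G) \<le> int (ell A) + (div_deg kk G - div_deg kk A)" by (rule ell_diff[OF A G AG])
    have 2: "ell (Dm m) \<le> ell G" unfolding G_def by (rule ell_shift[OF Dm f(1)])
    have 3: "int (ell A) \<le> int (ell D) + (div_deg kk A - div_deg kk D)" by (rule ell_diff[OF D A]) (simp add: A_def)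
    show ?thesis using 1 2 3 lower[of m] degG by linarith
  qed
  then show ?thesis by blast
qed

text \<open>The definite description in \<open>genus\<close> denotes the maximum of a nonempty set
  of integers bounded above by \<open>riemann_bound\<close>. Cutting that set off below at one of
  its values makes it finite, so \<open>Max\<close> yields the witness.\<close>

lemma genus_ge:
  assumes D: "divisor kk D" shows "div_deg kk D - int (ell D) + 1 \<le> genus kk"
proof -
  obtain c where c: "\<And>D. divisor kk D \<Longrightarrow> div_deg kk D - int (ell D) \<le> c" using riemann_bound by blast
  define V where "V = {div_deg kk D - int (ell D) + 1 | D. divisor kk D}"
  define n0 where "n0 = div_deg kk D - int (ell D) + 1"
  have n0: "n0 \<in> V" using D by (auto simp: V_def n0_def)
  have c': "n \<le> c + 1" if "n \<in> V" for n using that c unfolding V_def by fastforce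
  define V' where "V' = V \<inter> {n0..c + 1}"
  have fin: "finite V'" by (simp add: V'_def)
  have V'n: "n0 \<in> V'" using n0 c'[OF n0] by (simp add: V'_def)
  define g0 where "g0 = Max V'"
  have "g0 \<in> V'" unfolding g0_def by (rule Max_in[OF fin]) (use V'n in blast)
  then have g0V: "g0 \<in> V" by (simp add: V'_def)
  have g0: "n \<le> g0" if "n \<in> V" for n
  proof (cases "n \<ge> n0")
    case True
    have "n \<le> c + 1" by (rule c'[OF that])
    then have "n \<in> V'" using True that by (simp add: V'_def)
    then show ?thesis using Max_ge[OF fin] by (simp add: g0_def)
  next
    case False
    then show ?thesis using Max_ge[OF fin V'n] by (simp add: g0_def)
  qed
  have VI: "div_deg kk D - int (ell D) + 1 \<in> V" if "divisor kk D" for D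
    unfolding V_def using that by (intro CollectI exI conjI) (rule refl)
  obtain D0 where D0: "divisor kk D0" "g0 = div_deg kk D0 - int (ell D0) + 1" using g0V unfolding V_def by blast
  have "genus kk = g0" unfolding genus_def
  proof (rule the_equality)
    show "(\<forall>D. divisor kk D \<longrightarrow> div_deg kk D - int (ell D) + 1 \<le> g0) \<and> (\<exists>D. divisor kk D \<and> div_deg kk D - int (ell D) + 1 = g0)"
    proof (intro conjI allI impI)
      show "div_deg kk D - int (ell D) + 1 \<le> g0" if "divisor kk D" for D by (rule g0[OF VI[OF that]])
      show "\<exists>D. divisor kk D \<and> div_deg kk D - int (ell D) + 1 = g0" using D0 by (intro exI[of _ D0]) simp
    qed
    fix g assume g: "(\<forall>D. divisor kk D \<longrightarrow> div_deg kk D - int (ell D) + 1 \<le> g) \<and> (\<exists>D. divisor kk D \<and> div_deg kk D - int (ell D) + 1 = g)"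
    then obtain D1 where D1: "divisor kk D1" "div_deg kk D1 - int (ell D1) + 1 = g" by blast
    have "g \<le> g0" using g0[OF VI[OF D1(1)]] D1(2) by simp
    moreover have "g0 \<le> g" using conjunct1[OF g, rule_format, OF D0(1)] D0(2) by simp
    ultimately show "g = g0" by simp
  qed
  then show ?thesis using g0[OF n0] by (simp add: n0_def)
qed

end

section \<open>Polynomial determinants\<close>

definition fdet :: "nat \<Rightarrow> (nat \<Rightarrow> nat \<Rightarrow> 'a::comm_ring_1) \<Rightarrow> 'a" where
  "fdet N a = det (mat N N (\<lambda>(i,j). a i j))"

lemma fdet_leibniz:
  "fdet N a = (\<Sum>\<sigma> | \<sigma> permutes {0..<N}. signof \<sigma> * (\<Prod>i = 0..<N. a i (\<sigma> i)))"
proof -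
  have "fdet N a = (\<Sum>\<sigma> | \<sigma> permutes {0..<N}. signof \<sigma> * (\<Prod>i = 0..<N. mat N N (\<lambda>(i,j). a i j) $$ (i, \<sigma> i)))"
    unfolding fdet_def by (rule det_def') simp
  also have "\<dots> = (\<Sum>\<sigma> | \<sigma> permutes {0..<N}. signof \<sigma> * (\<Prod>i = 0..<N. a i (\<sigma> i)))"
  proof (intro sum.cong refl arg_cong2[of _ _ _ _ "(*)"] prod.cong)
    fix \<sigma> i assume "\<sigma> \<in> {\<sigma>. \<sigma> permutes {0..<N}}" "i \<in> {0..<N}"
    then have "\<sigma> i < N" using permutes_in_image[of \<sigma> "{0..<N}" i] by simp
    then show "mat N N (\<lambda>(i,j). a i j) $$ (i, \<sigma> i) = a i (\<sigma> i)" using \<open>i \<in> {0..<N}\<close> by simp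
  qed
  finally show ?thesis .
qed

lemma fdet_mult:
  assumes "\<And>i j. i < N \<Longrightarrow> j < N \<Longrightarrow> c i j = (\<Sum>k<N. a i k * b k j)"
  shows "fdet N c = fdet N a * fdet N b"
proof -
  have "mat N N (\<lambda>(i,j). c i j) = mat N N (\<lambda>(i,j). a i j) * mat N N (\<lambda>(i,j). b i j)"
    by (rule eq_matI) (auto simp: assms scalar_prod_def lessThan_atLeast0)
  then show ?thesis unfolding fdet_def by (simp add: det_mult[of _ N])
qed

lemma fdet_id: "fdet N (\<lambda>i j. if i = j then 1 else 0) = (1 :: 'a::comm_ring_1)"
proof -
  have "mat N N (\<lambda>(i,j). if i = j then 1 else 0) = (1\<^sub>m N :: 'a mat)" by (rule eq_matI) auto
  then show ?thesis unfolding fdet_def by simp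
qed

lemma fdet_poly_eval: "poly (fdet N a) x = fdet N (\<lambda>i j. poly (a i j) x)"
proof -
  have "poly (of_int (sign \<sigma>)) x = of_int (sign \<sigma>)" for \<sigma> :: "nat \<Rightarrow> nat" by (simp add: sign_def)
  then show ?thesis unfolding fdet_leibniz poly_sum poly_mult poly_prod by simp
qed

text \<open>A unit vector appended as an extra column gives more unknowns than equations. The
  trivial kernel forces its coefficient to be nonzero, so every unit vector is attained and the
  matrix has a right inverse.\<close>

lemma fdet_nonzero:
  fixes a :: "nat \<Rightarrow> nat \<Rightarrow> 'K::field"
  assumes E: "subfield E" and a: "\<And>i j. i < N \<Longrightarrow> j < N \<Longrightarrow> a i j \<in> E"
    and triv: "\<And>c. (\<And>j. c j \<in> E) \<Longrightarrow> (\<And>i. i < N \<Longrightarrow> (\<Sum>j<N. a i j * c j) = 0) \<Longrightarrow> (\<And>j. j < N \<Longrightarrow> c j = 0)"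
  shows "fdet N a \<noteq> 0"
proof -
  have "\<exists>b. \<forall>i<N. (\<Sum>j<N. a i j * b j) = (if i = k then 1 else 0)" if k: "k < N" for k
  proof -
    define a' where "a' i j = (if j < N then a i j else if i = k then - 1 else 0)" for i j
    have "\<exists>c. (\<forall>j. c j \<in> E) \<and> (\<exists>j\<in>{..N}. c j \<noteq> 0) \<and> (\<forall>i\<in>{..<N}. (\<Sum>j\<in>{..N}. a' i j * c j) = 0)"
      by (rule homogeneous_system_nontrivial[OF E])
         (use a in \<open>auto simp: a'_def subfield_0[OF E] subfield_1[OF E] subfield_uminus[OF E]\<close>)
    then obtain c where c: "\<And>j. c j \<in> E" "\<exists>j\<le>N. c j \<noteq> 0" "\<And>i. i < N \<Longrightarrow> (\<Sum>j\<le>N. a' i j * c j) = 0" by auto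
    have eq: "(\<Sum>j<N. a i j * c j) = (if i = k then c N else 0)" if i: "i < N" for i
    proof -
      have "(\<Sum>j\<le>N. a' i j * c j) = (\<Sum>j<N. a' i j * c j) + a' i N * c N"
        by (simp add: lessThan_Suc_atMost[symmetric])
      also have "(\<Sum>j<N. a' i j * c j) = (\<Sum>j<N. a i j * c j)" by (intro sum.cong) (auto simp: a'_def)
      finally show ?thesis using c(3)[OF i] by (auto simp: a'_def split: if_splits)
    qed
    have "c N \<noteq> 0"
    proof
      assume "c N = 0"
      then have "c j = 0" if "j < N" for j using triv[of c j] eq c(1) that by simp
      with \<open>c N = 0\<close> c(2) show False by (metis le_neq_implies_less)
    qed
    then show ?thesis
      by (intro exI[of _ "\<lambda>j. c j / c N"]) (auto simp: sum_divide_distrib[symmetric] eq)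
  qed
  then obtain b where b: "\<And>k i. k < N \<Longrightarrow> i < N \<Longrightarrow> (\<Sum>j<N. a i j * b k j) = (if i = k then 1 else 0)" by metis
  have "fdet N (\<lambda>i j. if i = j then 1 else 0) = fdet N a * fdet N (\<lambda>j k. b k j)"
    by (rule fdet_mult) (simp add: b)
  then show ?thesis unfolding fdet_id by auto
qed

lemma fdet_dvd:
  fixes a :: "nat \<Rightarrow> nat \<Rightarrow> 'a::comm_ring_1"
  assumes "I \<subseteq> {..<N}" "\<And>i j. i \<in> I \<Longrightarrow> j < N \<Longrightarrow> d dvd a i j"
  shows "d ^ card I dvd fdet N a"
  unfolding fdet_leibniz
proof (intro dvd_sum dvd_mult)
  fix \<sigma> assume "\<sigma> \<in> {\<sigma>. \<sigma> permutes {0..<N}}"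
  then have \<sigma>: "\<sigma> i < N" if "i < N" for i using permutes_in_image[of \<sigma> "{0..<N}" i] that by simp
  have finI: "finite I" using assms(1) finite_subset by auto
  have "d ^ card I = (\<Prod>i\<in>I. d)" by simp
  also have "\<dots> dvd (\<Prod>i\<in>I. a i (\<sigma> i))" using assms \<sigma> by (intro prod_dvd_prod) auto
  also have "\<dots> dvd (\<Prod>i\<in>{0..<N}. a i (\<sigma> i))" using assms(1) by (intro prod_dvd_prod_subset) auto
  finally show "d ^ card I dvd (\<Prod>i\<in>{0..<N}. a i (\<sigma> i))" .
qed

lemma fdet_degree:
  assumes "\<And>i j. i < N \<Longrightarrow> j < N \<Longrightarrow> degree (a i j) \<le> \<mu> i + \<mu> j"
  shows "degree (fdet N a) \<le> 2 * (\<Sum>i<N. \<mu> i)"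
  unfolding fdet_leibniz
proof (rule degree_sum_le)
  show "finite {\<sigma>. \<sigma> permutes {0..<N}}" by (simp add: finite_permutations)
  fix \<sigma> assume \<sigma>: "\<sigma> \<in> {\<sigma>. \<sigma> permutes {0..<N}}"
  then have \<sigma>N: "\<sigma> i < N" if "i < N" for i using permutes_in_image[of \<sigma> "{0..<N}" i] that by simp
  have "degree (signof \<sigma> * (\<Prod>i = 0..<N. a i (\<sigma> i))) \<le> degree (\<Prod>i = 0..<N. a i (\<sigma> i))"
    by (cases "signof \<sigma> = (1::'a poly)") (auto simp: sign_def)
  also have "\<dots> \<le> (\<Sum>i = 0..<N. degree (a i (\<sigma> i)))" by (rule degree_prod_sum_le[unfolded o_def]) simp
  also have "\<dots> \<le> (\<Sum>i = 0..<N. \<mu> i + \<mu> (\<sigma> i))" using assms \<sigma>N by (intro sum_mono) auto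
  also have "\<dots> = (\<Sum>i = 0..<N. \<mu> i) + (\<Sum>i = 0..<N. \<mu> i)"
    using sum.permute[of \<sigma> "{0..<N}" \<mu>] \<sigma> by (simp add: sum.distrib o_def)
  finally show "degree (signof \<sigma> * (\<Prod>i = 0..<N. a i (\<sigma> i))) \<le> 2 * (\<Sum>i<N. \<mu> i)"
    by (simp add: lessThan_atLeast0)
qed

text \<open>The polynomial matrix \<open>1 + sX\<close> is invertible when \<open>X\<close> is nilpotent, so its determinant
  is constant in \<open>s\<close>; the coefficient of \<open>s\<close> is the trace.  Here \<open>X k\<close> plays the role of the
  \<open>k\<close>-th power of \<open>X 1\<close>.\<close>

lemma trace_nilpotent:
  fixes X :: "nat \<Rightarrow> nat \<Rightarrow> nat \<Rightarrow> 'a::field"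
  assumes X0: "\<And>i j. i < N \<Longrightarrow> j < N \<Longrightarrow> X 0 i j = (if i = j then 1 else 0)"
    and XS: "\<And>k i j. i < N \<Longrightarrow> j < N \<Longrightarrow> X (Suc k) i j = (\<Sum>l<N. X 1 i l * X k l j)"
    and Xe: "\<And>i j. i < N \<Longrightarrow> j < N \<Longrightarrow> X e i j = 0"
  shows "(\<Sum>i<N. X 1 i i) = 0"
proof -
  define A where "A i j = [:if i = j then 1 else 0, X 1 i j:]" for i j
  \<comment> \<open>The geometric series for the inverse of \<open>1 + sX\<close>, cut off where the
    powers of \<open>X\<close> vanish.\<close>
  define B where "B i j = (\<Sum>k<e. monom ((- 1) ^ k * X k i j) k)" for i j
  have "fdet N (\<lambda>i j. if i = j then 1 else 0) = fdet N A * fdet N B"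
  proof (rule fdet_mult)
    fix i j assume ij: "i < N" "j < N"
    have m: "[:0, x:] * monom y k = monom (x * y) (Suc k)" for x y :: 'a and k
      by (simp add: monom_Suc smult_monom)
    have "(\<Sum>l<N. A i l * B l j) = (\<Sum>l<N. (if i = l then B l j else 0)) + (\<Sum>l<N. [:0, X 1 i l:] * B l j)"
      unfolding sum.distrib[symmetric] by (intro sum.cong refl) (simp add: A_def)
    also have "(\<Sum>l<N. (if i = l then B l j else 0)) = B i j" using ij by simp
    also have "(\<Sum>l<N. [:0, X 1 i l:] * B l j) = (\<Sum>l<N. \<Sum>k<e. monom (X 1 i l * ((- 1) ^ k * X k l j)) (Suc k))"
      unfolding B_def sum_distrib_left m by simp
    also have "\<dots> = (\<Sum>k<e. \<Sum>l<N. monom (X 1 i l * ((- 1) ^ k * X k l j)) (Suc k))" by (rule sum.swap)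
    also have "\<dots> = (\<Sum>k<e. monom ((- 1) ^ k * X (Suc k) i j) (Suc k))"
    proof (rule sum.cong[OF refl])
      fix k
      have "(\<Sum>l<N. monom (X 1 i l * ((- 1) ^ k * X k l j)) (Suc k)) = monom (\<Sum>l<N. X 1 i l * ((- 1) ^ k * X k l j)) (Suc k)"
        by (induction N) (auto simp: add_monom[symmetric])
      also have "(\<Sum>l<N. X 1 i l * ((- 1) ^ k * X k l j)) = (- 1) ^ k * X (Suc k) i j"
        unfolding XS[OF ij] sum_distrib_left by (intro sum.cong) (auto simp: mult_ac)
      finally show "(\<Sum>l<N. monom (X 1 i l * ((- 1) ^ k * X k l j)) (Suc k)) = monom ((- 1) ^ k * X (Suc k) i j) (Suc k)" .
    qed
    finally have "(\<Sum>l<N. A i l * B l j) = (\<Sum>k<e. monom ((- 1) ^ k * X k i j) k - monom ((- 1) ^ Suc k * X (Suc k) i j) (Suc k))"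
      by (simp add: B_def sum.distrib[symmetric] minus_monom[symmetric])
    also have "\<dots> = monom ((- 1) ^ 0 * X 0 i j) 0 - monom ((- 1) ^ e * X e i j) e"
      by (rule sum_lessThan_telescope')
    also have "\<dots> = (if i = j then 1 else 0)" using X0[OF ij] Xe[OF ij] by simp
    finally show "(if i = j then 1 else 0) = (\<Sum>l<N. A i l * B l j)" by simp
  qed
  then have "fdet N A dvd 1" unfolding fdet_id by (metis dvd_triv_left)
  then have d0: "degree (fdet N A) = 0" using poly_dvd_1[of "fdet N A"] by (auto simp: is_unit_iff_degree)
  have c1: "coeff (\<Prod>i\<in>I. A i i) 0 = 1 \<and> coeff (\<Prod>i\<in>I. A i i) 1 = (\<Sum>i\<in>I. X 1 i i)" if "finite I" for I
    using that
  proof (induction I rule: finite_induct)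
    case (insert i I)
    have "coeff ([:1, c:] * p) 0 = coeff p 0 \<and> coeff ([:1, c:] * p) 1 = coeff p 1 + c * coeff p 0" for c :: 'a and p
      by (simp add: coeff_pCons split: nat.splits)
    then show ?case using insert by (simp add: A_def add.commute)
  qed auto
  have "coeff (fdet N A) 1 = (\<Sum>\<sigma> | \<sigma> permutes {0..<N}. coeff (signof \<sigma> * (\<Prod>i = 0..<N. A i (\<sigma> i))) 1)"
    unfolding fdet_leibniz coeff_sum ..
  also have "\<dots> = (\<Sum>\<sigma>\<in>{id}. coeff (signof \<sigma> * (\<Prod>i = 0..<N. A i (\<sigma> i))) 1)"
  proof (rule sum.mono_neutral_right)
    show "finite {\<sigma>. \<sigma> permutes {0..<N}}" by (simp add: finite_permutations)
    show "{id} \<subseteq> {\<sigma>. \<sigma> permutes {0..<N}}" by (simp add: permutes_id)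
    show "\<forall>\<sigma>\<in>{\<sigma>. \<sigma> permutes {0..<N}} - {id}. coeff (signof \<sigma> * (\<Prod>i = 0..<N. A i (\<sigma> i))) 1 = 0"
    proof
      fix \<sigma> assume "\<sigma> \<in> {\<sigma>. \<sigma> permutes {0..<N}} - {id}"
      then have \<sigma>: "\<sigma> permutes {0..<N}" "\<sigma> \<noteq> id" by auto
      then obtain i where i: "\<sigma> i \<noteq> i" by (auto simp: fun_eq_iff)
      then have iN: "i < N" using \<sigma>(1) permutes_not_in by fastforce
      \<comment> \<open>A permutation other than the identity moves at least two indices. Both
        off-diagonal factors are multiples of \<open>s\<close>, so the product has no linear
        term.\<close>
      define j where "j = \<sigma> i"
      have jN: "j < N" using permutes_in_image[OF \<sigma>(1), of i] iN by (simp add: j_def)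
      have j: "\<sigma> j \<noteq> j" "j \<noteq> i" using i permutes_inj[OF \<sigma>(1)] by (auto simp: j_def inj_def)
      have "(\<Prod>i = 0..<N. A i (\<sigma> i)) = A i (\<sigma> i) * (A j (\<sigma> j) * (\<Prod>i\<in>{0..<N} - {i} - {j}. A i (\<sigma> i)))"
        using iN jN j(2) by (simp add: prod.remove[of _ i] prod.remove[of _ j])
      also have "\<dots> = pCons 0 (pCons 0 (Polynomial.smult (X 1 i (\<sigma> i) * X 1 j (\<sigma> j)) (\<Prod>i\<in>{0..<N} - {i} - {j}. A i (\<sigma> i))))"
        using i j by (simp add: A_def mult.commute)
      finally have "(\<Prod>i = 0..<N. A i (\<sigma> i)) = \<dots>" .
      then show "coeff (signof \<sigma> * (\<Prod>i = 0..<N. A i (\<sigma> i))) 1 = 0"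
        by (cases "signof \<sigma> = (1::'a poly)") (auto simp: sign_def coeff_pCons)
    qed
  qed
  also have "\<dots> = (\<Sum>i<N. X 1 i i)" using c1[of "{0..<N}"] by (simp add: lessThan_atLeast0)
  finally show ?thesis using d0 coeff_eq_0[of "fdet N A" 1] by simp
qed

lemma lin_nondeg_exchange:
  assumes E: "subfield E" and nd: "lin_nondeg E I y" and I: "finite I" "i0 \<in> I"
    and c: "\<And>i. i \<in> I \<Longrightarrow> c i \<in> E" "c i0 \<noteq> 0"
  shows "lin_nondeg E I (y(i0 := \<Sum>i\<in>I. c i * y i))"
proof (rule lin_nondegI)
  let ?f = "\<Sum>i\<in>I. c i * y i"
  fix a i assume a: "\<And>i. i \<in> I \<Longrightarrow> a i \<in> E" "(\<Sum>i\<in>I. a i * (y(i0 := ?f)) i) = 0" "i \<in> I"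
  define b where "b i = a i0 * c i + (if i = i0 then 0 else a i)" for i
  have "(\<Sum>i\<in>I. a i * (y(i0 := ?f)) i) = a i0 * ?f + (\<Sum>i\<in>I - {i0}. a i * (y(i0 := ?f)) i)"
    by (subst sum.remove[OF I]) simp
  also have "(\<Sum>i\<in>I - {i0}. a i * (y(i0 := ?f)) i) = (\<Sum>i\<in>I - {i0}. (if i = i0 then 0 else a i) * y i)"
    by (intro sum.cong) auto
  also have "\<dots> = (\<Sum>i\<in>I. (if i = i0 then 0 else a i) * y i)" by (subst sum.remove[OF I]) simp
  also have "a i0 * ?f + \<dots> = (\<Sum>i\<in>I. b i * y i)"
    by (simp add: b_def sum_distrib_left sum.distrib[symmetric] algebra_simps)
  finally have b0: "(\<Sum>i\<in>I. b i * y i) = 0" using a(2) by simp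
  have bE: "b i \<in> E" if "i \<in> I" for i unfolding b_def
    using a(1) c(1) that I(2) subfield_0[OF E] by (intro subfield_add[OF E] subfield_mult[OF E]) auto
  have bz: "b i = 0" if "i \<in> I" for i using lin_nondegD[OF nd bE b0 that] .
  have "a i0 = 0" using bz[OF I(2)] c(2) by (simp add: b_def)
  then show "a i = 0" using bz[OF a(3)] by (cases "i = i0") (auto simp: b_def)
qed

section \<open>Reduced bases\<close>

locale cover = function_field kk for kk :: "'K::field_char_0 set" +
  fixes z :: 'K
  assumes z: "z \<notin> kk"
begin

abbreviation "N \<equiv> fdeg z"

text \<open>The coordinate ring of the part of the curve above the affine
  \<open>z\<close>-line.\<close>

definition A :: "'K set" where "A = {y. \<forall>p. Pl p \<longrightarrow> p z \<ge> 0 \<longrightarrow> vge p 0 y}"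

text \<open>Filters \<open>A\<close> by the pole order at infinity, measured in multiples of the
  poles of \<open>z\<close>: multiplication by \<open>z\<close> raises the index by one, division by
  some \<open>z - a\<close> that stays in \<open>A\<close> lowers it by one.\<close>

definition L :: "int \<Rightarrow> 'K set" where "L m = LD (\<lambda>p. m * poles z p)"

lemma z0: "z \<noteq> 0" using z subfield_0[OF kk] by auto

lemma E: "subfield (RF z)" by (rule RF_subfield[OF z])

lemma kk_RF: "c \<in> kk \<Longrightarrow> c \<in> RF z"
  using RF_poly[of "[:c:]" z] by (simp add: poly_over_pCons[OF kk] poly_over_0[OF kk])

lemma z_RF: "z \<in> RF z"
  using RF_poly[of "[:0,1:]" z] by (simp add: poly_over_pCons[OF kk] poly_over_0[OF kk] subfield_0[OF kk] subfield_1[OF kk])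

lemma ex_place_inf: "\<exists>p. Pl p \<and> p z < 0"
proof -
  have "inverse z \<notin> kk" using z subfield_inverse[OF kk, of "inverse z"] by auto
  then obtain v where "Pl v" "v (inverse z) > 0" using ex_place_pos by blast
  then show ?thesis using place_inverse[of v z] by auto
qed

lemma N_pos: "N > 0"
proof -
  obtain v where "Pl v" "v z > 0" using ex_place_pos[OF z] by blast
  then have "v z \<le> (\<Sum>p\<in>{v}. p z)" "(\<Sum>p\<in>{v}. p z) \<le> int N" using zeros_le_fdeg[of "{v}" z] by auto
  then show ?thesis using \<open>v z > 0\<close> by linarith
qed

lemma L_iff: "y \<in> L m \<longleftrightarrow> y \<in> A \<and> (\<forall>p. Pl p \<longrightarrow> p z < 0 \<longrightarrow> vge p (m * p z) y)"
proof -
  have "vge p (- (m * poles z p)) y \<longleftrightarrow> (p z \<ge> 0 \<longrightarrow> vge p 0 y) \<and> (p z < 0 \<longrightarrow> vge p (m * p z) y)" for p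
    by (cases "p z < 0") (auto simp: poles_def max_def)
  then show ?thesis unfolding L_def RR_iff A_def by blast
qed

lemma L_A: "y \<in> L m \<Longrightarrow> y \<in> A" by (simp add: L_iff)

lemma A_iff: "y \<in> A \<longleftrightarrow> (\<forall>p. Pl p \<longrightarrow> p z \<ge> 0 \<longrightarrow> vge p 0 y)" by (simp add: A_def)

lemma A_subring: "subring_set A"
  unfolding subring_set_def
proof (intro conjI ballI)
  show "0 \<in> A" "1 \<in> A" by (auto simp: A_iff vge_def place_1)
  show "x + y \<in> A" if "x \<in> A" "y \<in> A" for x y using that vge_add unfolding A_iff by blast
  show "- x \<in> A" if "x \<in> A" for x using that vge_uminus unfolding A_iff by blast
  show "x * y \<in> A" if "x \<in> A" "y \<in> A" for x y
    unfolding A_iff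
  proof (intro allI impI)
    fix p assume "Pl p" "0 \<le> p z"
    then show "vge p 0 (x * y)" using vge_mult[of p 0 x 0 y] that unfolding A_iff by simp
  qed
qed

lemmas A_add = subring_setD(3)[OF A_subring] and A_mult = subring_setD(4)[OF A_subring]
  and A_diff = subring_setD(6)[OF A_subring] and A_sum = subring_set_sum[OF A_subring]
  and A_0 = subring_setD(1)[OF A_subring] and A_1 = subring_setD(2)[OF A_subring]
  and A_power = subring_set_power[OF A_subring]

lemma A_const: "c \<in> kk \<Longrightarrow> c \<in> A" by (auto simp: A_iff vge_const)

lemma A_z: "z \<in> A" by (simp add: A_iff vge_def)

lemma A_poly: "poly_over kk q \<Longrightarrow> poly q z \<in> A"
  by (rule subring_set_poly[OF A_subring _ A_z]) (auto simp: poly_over_def A_const)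

lemma L_mono: "m \<le> m' \<Longrightarrow> y \<in> L m \<Longrightarrow> y \<in> L m'"
  unfolding L_iff by (auto elim!: vge_mono intro: mult_right_mono_neg)

lemma L_subspace: "subspace_over kk (L m)"
  unfolding L_def by (rule RR_subspace)

lemma L_0: "0 \<in> L m" using L_subspace by (simp add: subspace_over_def)

lemma L_sum: "(\<And>i. i \<in> I \<Longrightarrow> f i \<in> L m) \<Longrightarrow> sum f I \<in> L m"
  by (rule subspace_sum[OF L_subspace])

lemma L_cmult: "c \<in> kk \<Longrightarrow> y \<in> L m \<Longrightarrow> c * y \<in> L m"
  using L_subspace[of m] by (simp add: subspace_over_def)

lemma L_add: "x \<in> L m \<Longrightarrow> y \<in> L m \<Longrightarrow> x + y \<in> L m"
  using L_subspace[of m] by (simp add: subspace_over_def)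

lemma L_diff: "x \<in> L m \<Longrightarrow> y \<in> L m \<Longrightarrow> x - y \<in> L m"
  using L_add[of x m "(-1) * y"] L_cmult[of "-1" y m] subfield_uminus[OF kk subfield_1[OF kk]] by simp

lemma L_mult:
  assumes "x \<in> L m" "y \<in> L m'" shows "x * y \<in> L (m + m')"
proof -
  have "vge p ((m + m') * p z) (x * y)" if p: "Pl p" "p z < 0" for p
  proof -
    have "vge p (m * p z + m' * p z) (x * y)" using assms p by (intro vge_mult) (auto simp: L_iff)
    then show ?thesis by (simp add: distrib_right)
  qed
  then show ?thesis using A_mult assms by (simp add: L_iff)
qed

lemma L_z_power: "z ^ j \<in> L (int j)"
proof -
  have "vge p (int j * p z) (z ^ j)" if "Pl p" for p using place_power[OF that, of z j] by (simp add: vge_def)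
  then show ?thesis by (simp add: L_iff A_power A_z)
qed

lemma L_poly: "poly_over kk q \<Longrightarrow> int (degree q) \<le> m \<Longrightarrow> poly q z \<in> L m"
  unfolding poly_altdef
proof (rule L_sum)
  fix i assume q: "poly_over kk q" "int (degree q) \<le> m" "i \<in> {..degree q}"
  then have "z ^ i \<in> L m" by (intro L_mono[OF _ L_z_power]) auto
  then show "coeff q i * z ^ i \<in> L m" using q by (intro L_cmult) (auto simp: poly_over_def)
qed

lemma L_neg:
  assumes "m < 0" "y \<in> L m" shows "y = 0"
proof (rule ccontr)
  assume y: "y \<noteq> 0"
  have "p y \<ge> 0" if p: "Pl p" for p
  proof (cases "p z \<ge> 0")
    case True then show ?thesis using assms(2) y p by (auto simp: L_iff A_iff vge_def)
  next
    case False
    then have "p y \<ge> m * p z" using assms(2) y p by (auto simp: L_iff vge_def)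
    moreover have "m * p z \<ge> 0" using assms(1) False by (simp add: mult_nonpos_nonpos)
    ultimately show ?thesis by simp
  qed
  then have "y \<in> kk" by (rule no_poles_const)
  obtain p where p: "Pl p" "p z < 0" using ex_place_inf by auto
  then have "p y \<ge> m * p z" using assms(2) y by (auto simp: L_iff vge_def)
  moreover have "m * p z > 0" using assms(1) p(2) by (simp add: mult_neg_neg)
  ultimately show False using place_const[OF p(1) \<open>y \<in> kk\<close>] by simp
qed

lemma zma: "a \<in> kk \<Longrightarrow> z - a \<notin> kk" "a \<in> kk \<Longrightarrow> z - a \<noteq> 0"
proof -
  show *: "a \<in> kk \<Longrightarrow> z - a \<notin> kk"
  proof
    assume a: "a \<in> kk" "z - a \<in> kk"
    from subfield_add[OF kk a(2) a(1)] show False using z by simp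
  qed
  show "a \<in> kk \<Longrightarrow> z - a \<noteq> 0" using z by auto
qed

lemma place_zma:
  assumes "a \<in> kk" "Pl p"
  shows "p z \<ge> 0 \<Longrightarrow> p (z - a) \<ge> 0" "p z < 0 \<Longrightarrow> p (z - a) = p z" "p (z - a) > 0 \<Longrightarrow> p z \<ge> 0"
proof -
  show 1: "p (z - a) \<ge> 0" if "p z \<ge> 0"
    using vge_diff[OF assms(2), of 0 z a] vge_const[OF assms(2,1)] that zma(2)[OF assms(1)] by (auto simp: vge_def)
  show 2: "p (z - a) = p z" if "p z < 0"
  proof -
    have "vge p (p z + 1) (- a)" using that vge_const[OF assms(2), of "- a"] subfield_uminus[OF kk assms(1)] by (auto elim!: vge_mono)
    from place_add_eq(2)[OF assms(2) z0 this] show ?thesis by simp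
  qed
  show "p z \<ge> 0" if "p (z - a) > 0" using 2 that by (cases "p z < 0") auto
qed

lemma fdeg_zma: assumes "a \<in> kk" shows "fdeg (z - a) = N"
proof -
  have "{p. Pl p \<and> p (z - a) < 0} = {p. Pl p \<and> p z < 0}"
  proof (intro Collect_cong conj_cong refl)
    fix p assume "Pl p"
    then show "p (z - a) < 0 \<longleftrightarrow> p z < 0" using place_zma(1,2)[OF assms, of p] by (cases "p z < 0") auto
  qed
  then have "height kk (z - a) = height kk z" unfolding height_def
    using place_zma(2)[OF assms] by (intro sum.cong) auto
  then show ?thesis using poles_eq_fdeg[OF z] poles_eq_fdeg[OF zma(1)[OF assms]] poles_deg by simp
qed

lemma L_divide:
  assumes a: "a \<in> kk" and y: "y \<in> L m" "y / (z - a) \<in> A" shows "y / (z - a) \<in> L (m - 1)"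
proof -
  have "vge p ((m - 1) * p z) (y / (z - a))" if p: "Pl p" "p z < 0" for p
  proof (cases "y = 0")
    case False
    then have "p y \<ge> m * p z" using y(1) p by (auto simp: L_iff vge_def)
    then show ?thesis using place_divide[OF p(1) False zma(2)[OF a]] place_zma(2)[OF a p]
      by (simp add: vge_def algebra_simps)
  qed simp
  then show ?thesis using y(2) by (simp add: L_iff)
qed

text \<open>Each pole of \<open>y\<close> at which \<open>z\<close> is regular lies over a value
  \<open>c\<close> of \<open>z\<close> in \<open>k\<close>; enough factors \<open>z - c\<close>
  remove it.\<close>

lemma clear_poles: "\<exists>q. poly_over kk q \<and> q \<noteq> 0 \<and> poly q z * y \<in> A"
proof (cases "y = 0")
  case True then show ?thesis using A_0 by (intro exI[of _ 1]) (auto simp: poly_over_1[OF kk])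
next
  case False
  define P where "P = {p. Pl p \<and> p y < 0 \<and> p z \<ge> 0}"
  have finP: "finite P" using finite_poles[of y] by (auto simp: P_def intro: rev_finite_subset)
  have "\<exists>c\<in>kk. vge p 1 (z - c)" if "p \<in> P" for p
    by (rule residue) (use that in \<open>auto simp: P_def vge_def\<close>)
  then obtain c where c: "\<And>p. p \<in> P \<Longrightarrow> c p \<in> kk" "\<And>p. p \<in> P \<Longrightarrow> vge p 1 (z - c p)" by metis
  define q where "q = (\<Prod>p\<in>P. [:- c p, 1:] ^ nat (- p y))"
  have q: "poly_over kk q" unfolding q_def using c(1)
    by (intro poly_over_prod[OF kk] poly_over_power[OF kk])
       (auto simp: poly_over_pCons[OF kk] poly_over_0[OF kk] subfield_uminus[OF kk] subfield_1[OF kk])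
  have q0: "q \<noteq> 0" unfolding q_def using finP by (subst prod_zero_iff) auto
  have "vge p 0 (poly q z * y)" if p: "Pl p" "p z \<ge> 0" for p
  proof (cases "p \<in> P")
    case False
    have "vge p (0 + 0) (poly q z * y)"
      by (intro vge_mult p vge_poly q) (use p False in \<open>auto simp: vge_def P_def\<close>)
    then show ?thesis by simp
  next
    case True
    define q' where "q' = (\<Prod>p\<in>P-{p}. [:- c p, 1:] ^ nat (- p y))"
    have q': "poly_over kk q'" unfolding q'_def using c(1)
      by (intro poly_over_prod[OF kk] poly_over_power[OF kk])
         (auto simp: poly_over_pCons[OF kk] poly_over_0[OF kk] subfield_uminus[OF kk] subfield_1[OF kk])
    have "q = [:- c p, 1:] ^ nat (- p y) * q'" unfolding q_def q'_def using finP True by (rule prod.remove)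
    then have eq: "poly q z * y = (z - c p) ^ nat (- p y) * poly q' z * y" by simp
    have "vge p (int (nat (- p y)) * 1 + 0 + p y) ((z - c p) ^ nat (- p y) * poly q' z * y)"
      by (intro vge_mult p(1) vge_power c(2) True vge_poly q') (use p in \<open>auto simp: vge_def\<close>)
    moreover have "int (nat (- p y)) * 1 + 0 + p y = 0" using True by (simp add: P_def)
    ultimately show ?thesis unfolding eq by (simp only:)
  qed
  then show ?thesis using q q0 by (intro exI[of _ q]) (auto simp: A_iff)
qed

lemma A_L: "y \<in> A \<Longrightarrow> \<exists>m::nat. y \<in> L (int m)"
proof -
  assume y: "y \<in> A"
  define P where "P = {p. Pl p \<and> p y < 0}"
  have finP: "finite P" using finite_poles[of y] by (auto simp: P_def)
  define m where "m = (\<Sum>p\<in>P. nat (- p y))"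
  have "vge p (int m * p z) y" if p: "Pl p" "p z < 0" for p
  proof (cases "p y < 0")
    case True
    have "nat (- p y) \<le> m" unfolding m_def using finP True p by (intro member_le_sum) (auto simp: P_def)
    then have "- p y \<le> int m" by simp
    moreover have "int m * p z \<le> int m * (-1)" using p by (intro mult_left_mono) auto
    ultimately show ?thesis by (simp add: vge_def)
  next
    case False
    have "int m * p z \<le> 0" using p by (simp add: mult_nonneg_nonpos)
    then show ?thesis using False by (simp add: vge_def)
  qed
  then show ?thesis using y by (auto simp: L_iff)
qed

definition weighted :: "(nat \<Rightarrow> 'K) \<Rightarrow> (nat \<Rightarrow> nat) \<Rightarrow> bool" where
  "weighted \<omega> \<mu> \<longleftrightarrow> lin_nondeg (RF z) {..<N} \<omega> \<and> (\<forall>i<N. \<omega> i \<in> L (int (\<mu> i)))"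

lemma ex_weighted: "\<exists>\<omega> \<mu>. weighted \<omega> \<mu>"
proof -
  obtain u where u: "lin_nondeg (RF z) {..<N} u" using ex_fdeg_basis[OF z] by blast
  have "\<forall>i. \<exists>q. poly_over kk q \<and> q \<noteq> 0 \<and> poly q z * u i \<in> A" using clear_poles by blast
  then obtain q where q: "\<And>i. poly_over kk (q i)" "\<And>i. q i \<noteq> 0" "\<And>i. poly (q i) z * u i \<in> A" by metis
  have "\<forall>i. \<exists>m::nat. poly (q i) z * u i \<in> L (int m)" using A_L q(3) by blast
  then obtain \<mu> where \<mu>: "\<And>i. poly (q i) z * u i \<in> L (int (\<mu> i))" by metis
  have "lin_nondeg (RF z) {..<N} (\<lambda>i. poly (q i) z * u i)"
  proof (rule lin_nondegI)
    fix a i assume a: "\<And>i. i \<in> {..<N} \<Longrightarrow> a i \<in> RF z" "(\<Sum>i<N. a i * (poly (q i) z * u i)) = 0" "i \<in> {..<N}"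
    have 1: "a i * poly (q i) z \<in> RF z" if "i \<in> {..<N}" for i using a(1)[OF that] RF_poly[OF q(1)] by (rule subfield_mult[OF E])
    have 2: "(\<Sum>i<N. (a i * poly (q i) z) * u i) = 0" using a(2) by (simp add: mult.assoc)
    have "a i * poly (q i) z = 0" by (rule lin_nondegD[OF u 1 2 a(3)])
    then show "a i = 0" using poly_nonconst[OF z q(1,2)] by simp
  qed
  then show ?thesis using \<mu> unfolding weighted_def by blast
qed

text \<open>Minimality has two effects. Over the affine line it makes the family a
  \<open>k[z]\<close>-basis of \<open>A\<close> (\<open>A_coords\<close>); at infinity it keeps
  leading terms from cancelling (\<open>coords_degree\<close>).\<close>

definition minimal_weight :: "(nat \<Rightarrow> 'K) \<Rightarrow> (nat \<Rightarrow> nat) \<Rightarrow> bool" where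
  "minimal_weight \<omega> \<mu> \<longleftrightarrow> weighted \<omega> \<mu> \<and> (\<forall>\<omega>' \<mu>'. weighted \<omega>' \<mu>' \<longrightarrow> (\<Sum>i<N. \<mu> i) \<le> (\<Sum>i<N. \<mu>' i))"

lemma ex_minimal_weight: "\<exists>\<omega> \<mu>. minimal_weight \<omega> \<mu>"
proof -
  define P where "P n = (\<exists>\<omega> \<mu>. weighted \<omega> \<mu> \<and> (\<Sum>i<N. \<mu> i) = n)" for n
  have "\<exists>n. P n" using ex_weighted by (auto simp: P_def)
  then have "P (LEAST n. P n)" by (rule LeastI_ex)
  then obtain \<omega> \<mu> where *: "weighted \<omega> \<mu>" "(\<Sum>i<N. \<mu> i) = (LEAST n. P n)" by (auto simp: P_def)
  have "(\<Sum>i<N. \<mu> i) \<le> (\<Sum>i<N. \<mu>' i)" if "weighted \<omega>' \<mu>'" for \<omega>' \<mu>'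
    unfolding *(2) by (rule Least_le) (use that in \<open>auto simp: P_def\<close>)
  then show ?thesis using * unfolding minimal_weight_def by blast
qed

end

locale reduced_basis = cover kk z for kk :: "'K::field_char_0 set" and z +
  fixes \<omega> :: "nat \<Rightarrow> 'K" and \<mu> :: "nat \<Rightarrow> nat"
  assumes minimal: "minimal_weight \<omega> \<mu>"
begin

lemma nd: "lin_nondeg (RF z) {..<N} \<omega>" and \<omega>L: "i < N \<Longrightarrow> \<omega> i \<in> L (int (\<mu> i))"
  using minimal by (auto simp: minimal_weight_def weighted_def)

lemma \<omega>A: "i < N \<Longrightarrow> \<omega> i \<in> A" using \<omega>L L_A by blast

text \<open>Exchanging the combination for \<open>\<omega> i0\<close> would lower the minimal sum of the pole orders.\<close>

lemma no_improvement:
  assumes i0: "i0 < N" and c: "\<And>i. i < N \<Longrightarrow> c i \<in> RF z" "c i0 \<noteq> 0"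
    and f: "(\<Sum>i<N. c i * \<omega> i) \<in> L (int (\<mu> i0) - 1)"
  shows False
proof (cases "\<mu> i0 = 0")
  case True
  then have "(\<Sum>i<N. c i * \<omega> i) = 0" using L_neg[of "-1"] f by simp
  from lin_nondegD[OF nd _ this, of i0] c i0 show False by auto
next
  case False
  define \<omega>' where "\<omega>' = \<omega>(i0 := \<Sum>i<N. c i * \<omega> i)"
  define \<mu>' where "\<mu>' = \<mu>(i0 := \<mu> i0 - 1)"
  have "lin_nondeg (RF z) {..<N} \<omega>'" unfolding \<omega>'_def
    by (rule lin_nondeg_exchange[OF E nd]) (use i0 c in auto)
  moreover have "\<omega>' i \<in> L (int (\<mu>' i))" if "i < N" for i
    using \<omega>L[OF that] f False by (auto simp: \<omega>'_def \<mu>'_def of_nat_diff)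
  ultimately have "weighted \<omega>' \<mu>'" by (simp add: weighted_def)
  then have "(\<Sum>i<N. \<mu> i) \<le> (\<Sum>i<N. \<mu>' i)" using minimal by (simp add: minimal_weight_def)
  moreover have "(\<Sum>i<N. \<mu>' i) < (\<Sum>i<N. \<mu> i)"
    by (rule sum_strict_mono_ex1) (use i0 False in \<open>auto simp: \<mu>'_def intro!: bexI[of _ i0]\<close>)
  ultimately show False by simp
qed

text \<open>If the combination were divisible by \<open>z - a\<close>, the quotient could be
  exchanged for a member of largest weight that occurs in it, at a weight smaller by one.\<close>

lemma primitive:
  assumes a: "a \<in> kk" and \<alpha>: "\<And>i. i < N \<Longrightarrow> \<alpha> i \<in> kk" and f: "(\<Sum>i<N. \<alpha> i * \<omega> i) / (z - a) \<in> A" and i: "i < N"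
  shows "\<alpha> i = 0"
proof (rule ccontr)
  assume "\<alpha> i \<noteq> 0"
  define J where "J = {i. i < N \<and> \<alpha> i \<noteq> 0}"
  have J: "finite J" "J \<noteq> {}" using i \<open>\<alpha> i \<noteq> 0\<close> by (auto simp: J_def)
  obtain i0 where i0: "i0 \<in> J" "\<And>i. i \<in> J \<Longrightarrow> \<mu> i \<le> \<mu> i0"
    using Max_in[of "\<mu> ` J"] Max_ge[of "\<mu> ` J"] J by (metis (no_types, lifting) finite_imageI image_iff image_is_empty imageI)
  have "\<alpha> i * \<omega> i \<in> L (int (\<mu> i0))" if "i < N" for i
  proof (cases "\<alpha> i = 0")
    case True then show ?thesis by (simp add: L_0)
  next
    case False
    then have "\<mu> i \<le> \<mu> i0" using i0(2) that by (simp add: J_def)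
    then show ?thesis using L_mono[OF _ \<omega>L[OF that]] \<alpha>[OF that] by (intro L_cmult) auto
  qed
  then have "(\<Sum>i<N. \<alpha> i * \<omega> i) \<in> L (int (\<mu> i0))" by (intro L_sum) auto
  then have 1: "(\<Sum>i<N. \<alpha> i * \<omega> i) / (z - a) \<in> L (int (\<mu> i0) - 1)" by (rule L_divide[OF a _ f])
  have 2: "(\<Sum>i<N. \<alpha> i * \<omega> i) / (z - a) = (\<Sum>i<N. (\<alpha> i / (z - a)) * \<omega> i)"
    by (simp add: sum_divide_distrib)
  have "z - a \<in> RF z" using z_RF kk_RF[OF a] by (rule subfield_diff[OF E])
  then have 3: "\<alpha> i / (z - a) \<in> RF z" if "i < N" for i using kk_RF[OF \<alpha>[OF that]] by (intro subfield_divide[OF E])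
  show False by (rule no_improvement[of i0 "\<lambda>i. \<alpha> i / (z - a)"])
    (use i0 1 2 3 zma(2)[OF a] in \<open>auto simp: J_def\<close>)
qed

text \<open>A denominator of the coordinates is removed root by root. At a root \<open>a\<close> the
  values of the numerators form a constant combination divisible by \<open>z - a\<close>; by
  \<open>primitive\<close> they all vanish, and \<open>z - a\<close> cancels.\<close>

lemma A_coords:
  assumes f: "f \<in> A"
  shows "\<exists>P. (\<forall>i<N. poly_over kk (P i)) \<and> f = (\<Sum>i<N. poly (P i) z * \<omega> i)"
proof -
  have main: "\<exists>P. (\<forall>i<N. poly_over kk (P i)) \<and> f = (\<Sum>i<N. poly (P i) z * \<omega> i)"
    if "poly_over kk q" "q \<noteq> 0" "\<forall>i<N. poly_over kk (P i)" "poly q z * f = (\<Sum>i<N. poly (P i) z * \<omega> i)" for q P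
    using that
  proof (induction "degree q" arbitrary: q P)
    case 0
    then obtain c where c: "q = [:c:]" by (auto elim: degree_eq_zeroE)
    then have c': "c \<in> kk" "c \<noteq> 0" using 0 by (auto simp: poly_over_pCons[OF kk])
    have "f = inverse c * (poly q z * f)" using c c' by simp
    also have "\<dots> = (\<Sum>i<N. poly (Polynomial.smult (inverse c) (P i)) z * \<omega> i)"
      unfolding 0(5) sum_distrib_left by (simp add: mult.assoc)
    finally show ?case using 0(4) c' by (intro exI[of _ "\<lambda>i. Polynomial.smult (inverse c) (P i)"])
      (auto intro: poly_over_smult[OF kk] subfield_inverse[OF kk])
  next
    case (Suc n)
    obtain a where a: "a \<in> kk" "poly q a = 0"
      using alg_closed Suc.hyps(2) Suc.prems(1) by (auto simp: alg_closed_subfield_def poly_over_def)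
    then obtain q' where q': "q = [:- a, 1:] * q'" unfolding poly_eq_0_iff_dvd dvd_def by blast
    have q'0: "q' \<noteq> 0" and q'k: "poly_over kk q'"
      using Suc.prems(1,2) q' poly_over_cofactor[OF kk, of a q'] a by auto
    have degq': "degree q = Suc (degree q')" unfolding q' using q'0 by (subst degree_mult_eq) auto
    define \<alpha> where "\<alpha> i = poly (P i) a" for i
    have \<alpha>: "\<alpha> i \<in> kk" if "i < N" for i unfolding \<alpha>_def using Suc.prems(3) that a(1) poly_over_eval[OF kk] by blast
    have "\<exists>R. P i = [:- a, 1:] * R + [:\<alpha> i:]" for i
    proof -
      have "poly (P i - [:\<alpha> i:]) a = 0" by (simp add: \<alpha>_def)
      then obtain R where "P i - [:\<alpha> i:] = [:- a, 1:] * R" unfolding poly_eq_0_iff_dvd dvd_def by blast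
      then show ?thesis by (intro exI[of _ R]) (simp add: algebra_simps)
    qed
    then obtain R where R: "\<And>i. P i = [:- a, 1:] * R i + [:\<alpha> i:]" by metis
    have Rk: "poly_over kk (R i)" if "i < N" for i
    proof (rule poly_over_cofactor[OF kk _ a(1)])
      have "[:- a, 1:] * R i = P i - [:\<alpha> i:]" by (simp add: R)
      then show "poly_over kk ([:- a, 1:] * R i)" using Suc.prems(3) that \<alpha>[OF that]
        by (metis poly_over_diff[OF kk] poly_over_pCons[OF kk] poly_over_0[OF kk])
    qed
    have eq: "(z - a) * (poly q' z * f - (\<Sum>i<N. poly (R i) z * \<omega> i)) = (\<Sum>i<N. \<alpha> i * \<omega> i)"
    proof -
      have "(z - a) * poly q' z * f = (\<Sum>i<N. poly (P i) z * \<omega> i)" using Suc.prems(4) q' by (simp add: algebra_simps)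
      also have "\<dots> = (z - a) * (\<Sum>i<N. poly (R i) z * \<omega> i) + (\<Sum>i<N. \<alpha> i * \<omega> i)"
        unfolding sum_distrib_left sum.distrib[symmetric] by (intro sum.cong refl) (simp add: R algebra_simps)
      finally show ?thesis by (simp add: algebra_simps)
    qed
    have "poly q' z * f - (\<Sum>i<N. poly (R i) z * \<omega> i) \<in> A"
      using q'k Rk f \<omega>A by (intro A_diff A_mult A_sum A_poly) auto
    then have "(\<Sum>i<N. \<alpha> i * \<omega> i) / (z - a) \<in> A" unfolding eq[symmetric] using zma(2)[OF a(1)] by simp
    then have "\<alpha> i = 0" if "i < N" for i using primitive[OF a(1), of \<alpha>] \<alpha> that by blast
    then have "(z - a) * (poly q' z * f - (\<Sum>i<N. poly (R i) z * \<omega> i)) = 0" unfolding eq by simp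
    then have "poly q' z * f = (\<Sum>i<N. poly (R i) z * \<omega> i)" using zma(2)[OF a(1)] by simp
    then show ?case using Suc.hyps(1)[of q' R] Suc.hyps(2) degq' q'k q'0 Rk by auto
  qed
  have "f \<in> espan (RF z) {..<N} \<omega>" using lin_nondeg_fdeg_basis[OF z nd] by simp
  then obtain c where c: "\<forall>i\<in>{..<N}. c i \<in> RF z" "f = (\<Sum>i<N. c i * \<omega> i)" by (auto simp: espan_def)
  have "\<exists>q P. poly_over kk q \<and> q \<noteq> 0 \<and> (\<forall>i\<in>{..<N}. poly_over kk (P i) \<and> poly q z * c i = poly (P i) z)"
    by (rule common_denominator[OF z]) (use c in auto)
  then obtain q P where qP: "poly_over kk q" "q \<noteq> 0" "\<And>i. i < N \<Longrightarrow> poly_over kk (P i)" "\<And>i. i < N \<Longrightarrow> poly q z * c i = poly (P i) z"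
    by auto
  have "poly q z * f = (\<Sum>i<N. poly (P i) z * \<omega> i)"
    unfolding c(2) sum_distrib_left by (intro sum.cong refl) (simp add: qP(4)[symmetric] mult.assoc)
  with main[OF qP(1,2), of P] qP(3) show ?thesis by blast
qed

text \<open>Let \<open>M\<close> be the largest total degree of a term. If the sum had smaller order
  at infinity, the leading coefficients of the terms of degree \<open>M\<close>, with powers of
  \<open>z\<close> levelling the weights, would give a combination \<open>h\<close> of smaller
  weight than its heaviest member, and exchanging it would improve the basis.\<close>

lemma coords_degree:
  assumes P: "\<And>i. i < N \<Longrightarrow> poly_over kk (P i)" and f: "(\<Sum>i<N. poly (P i) z * \<omega> i) \<in> L m"
    and i: "i < N" "P i \<noteq> 0"
  shows "int (degree (P i) + \<mu> i) \<le> m"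
proof (rule ccontr)
  assume neg: "\<not> int (degree (P i) + \<mu> i) \<le> m"
  define J where "J = {i. i < N \<and> P i \<noteq> 0}"
  have J: "finite J" "J \<noteq> {}" using i by (auto simp: J_def)
  define M where "M = Max ((\<lambda>i. degree (P i) + \<mu> i) ` J)"
  have Mge: "degree (P i) + \<mu> i \<le> M" if "i \<in> J" for i unfolding M_def using J that by (intro Max_ge) auto
  have "M \<in> (\<lambda>i. degree (P i) + \<mu> i) ` J" unfolding M_def using J by (intro Max_in) auto
  then obtain i1 where i1: "i1 \<in> J" "M = degree (P i1) + \<mu> i1" by auto
  have Mm: "m \<le> int M - 1" using neg Mge[of i] i by (auto simp: J_def)
  \<comment> \<open>The part of \<open>P i\<close> that contributes to total degree
    \<open>M\<close>. The guard keeps the truncated difference from selecting a constant term when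
    \<open>\<mu> i\<close> exceeds \<open>M\<close>.\<close>
  define \<gamma> where "\<gamma> i = (if \<mu> i \<le> M then coeff (P i) (M - \<mu> i) else 0)" for i
  have \<gamma>k: "\<gamma> i \<in> kk" if "i < N" for i using P[OF that] subfield_0[OF kk] by (auto simp: \<gamma>_def poly_over_def)
  have "\<gamma> i1 \<noteq> 0" using i1 by (auto simp: \<gamma>_def J_def)
  define G where "G = {i. i < N \<and> \<gamma> i \<noteq> 0}"
  have G: "finite G" "G \<noteq> {}" using i1 \<open>\<gamma> i1 \<noteq> 0\<close> by (auto simp: G_def J_def)
  obtain i0 where i0: "i0 \<in> G" "\<And>i. i \<in> G \<Longrightarrow> \<mu> i \<le> \<mu> i0"
    using Max_in[of "\<mu> ` G"] Max_ge[of "\<mu> ` G"] G by (metis (no_types, lifting) finite_imageI image_iff image_is_empty imageI)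
  have \<mu>M: "\<mu> i0 \<le> M" using i0(1) by (auto simp: G_def \<gamma>_def split: if_splits)
  define h where "h = (\<Sum>i<N. (\<gamma> i * z ^ (\<mu> i0 - \<mu> i)) * \<omega> i)"
  have hA: "h \<in> A" unfolding h_def
  proof (rule A_sum)
    fix i assume "i \<in> {..<N}"
    then show "\<gamma> i * z ^ (\<mu> i0 - \<mu> i) * \<omega> i \<in> A" using \<gamma>k \<omega>A
      by (intro A_mult[OF A_mult[OF A_const A_power[OF A_z]]]) auto
  qed
  have low: "poly (P i) z * \<omega> i - z ^ (M - \<mu> i0) * ((\<gamma> i * z ^ (\<mu> i0 - \<mu> i)) * \<omega> i) \<in> L (int M - 1)" if i: "i < N" for i
  proof -
    define Q where "Q = P i - monom (\<gamma> i) (M - \<mu> i)"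
    have eq: "z ^ (M - \<mu> i0) * (\<gamma> i * z ^ (\<mu> i0 - \<mu> i)) = \<gamma> i * z ^ (M - \<mu> i)"
    proof (cases "\<gamma> i = 0")
      case False
      then have "\<mu> i \<le> \<mu> i0" using i0(2) i by (simp add: G_def)
      then have "M - \<mu> i = (M - \<mu> i0) + (\<mu> i0 - \<mu> i)" using \<mu>M by simp
      then show ?thesis by (simp add: power_add)
    qed simp
    have "poly (P i) z * \<omega> i - z ^ (M - \<mu> i0) * ((\<gamma> i * z ^ (\<mu> i0 - \<mu> i)) * \<omega> i) = poly Q z * \<omega> i"
      unfolding Q_def mult.assoc[symmetric] eq[unfolded mult.assoc[symmetric]] by (simp add: poly_monom left_diff_distrib)
    moreover have "poly Q z * \<omega> i \<in> L (int M - 1)"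
    proof (cases "Q = 0")
      case True then show ?thesis by (simp add: L_0)
    next
      case False
      have Qk: "poly_over kk Q" unfolding Q_def using P[OF i] \<gamma>k[OF i] by (intro poly_over_diff[OF kk] poly_over_monom[OF kk])
      have "degree Q + \<mu> i < M"
      proof (cases "P i = 0")
        case True
        then have "\<gamma> i = 0" by (simp add: \<gamma>_def)
        then show ?thesis using False True by (simp add: Q_def)
      next
        case P0: False
        then have le: "degree (P i) + \<mu> i \<le> M" using Mge i by (simp add: J_def)
        have "degree Q \<le> M - \<mu> i" unfolding Q_def using le by (intro degree_diff_le) (auto simp: degree_monom_eq intro: degree_monom_le[THEN le_trans])
        moreover have "coeff Q (M - \<mu> i) = 0" using le by (simp add: Q_def \<gamma>_def)
        then have "degree Q \<noteq> M - \<mu> i" using False by (metis leading_coeff_0_iff)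
        ultimately show ?thesis using le by linarith
      qed
      then have "int (degree Q) + int (\<mu> i) \<le> int M - 1" by linarith
      from L_mono[OF this L_mult[OF L_poly[OF Qk order_refl] \<omega>L[OF i]]] show ?thesis .
    qed
    ultimately show ?thesis by simp
  qed
  have "z ^ (M - \<mu> i0) * h = (\<Sum>i<N. poly (P i) z * \<omega> i) - (\<Sum>i<N. poly (P i) z * \<omega> i - z ^ (M - \<mu> i0) * ((\<gamma> i * z ^ (\<mu> i0 - \<mu> i)) * \<omega> i))"
    unfolding h_def sum_subtractf by (simp add: sum_distrib_left)
  also have "\<dots> \<in> L (int M - 1)" by (rule L_diff[OF L_mono[OF Mm f] L_sum]) (use low in auto)
  finally have zh: "z ^ (M - \<mu> i0) * h \<in> L (int M - 1)" .
  have hL: "h \<in> L (int (\<mu> i0) - 1)"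
  proof -
    have "vge p ((int (\<mu> i0) - 1) * p z) h" if p: "Pl p" "p z < 0" for p
    proof (cases "h = 0")
      case False
      then have "p (z ^ (M - \<mu> i0) * h) \<ge> (int M - 1) * p z" using zh p z0 by (auto simp: L_iff vge_def)
      moreover have "p (z ^ (M - \<mu> i0) * h) = (int M - int (\<mu> i0)) * p z + p h"
        using False z0 \<mu>M by (simp add: place_mult[OF p(1)] place_power[OF p(1)] of_nat_diff)
      ultimately show ?thesis by (simp add: vge_def algebra_simps)
    qed simp
    then show ?thesis using hA by (simp add: L_iff)
  qed
  show False
  proof (rule no_improvement[of i0 "\<lambda>i. \<gamma> i * z ^ (\<mu> i0 - \<mu> i)"])
    show "\<gamma> i * z ^ (\<mu> i0 - \<mu> i) \<in> RF z" if "i < N" for i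
      using kk_RF[OF \<gamma>k[OF that]] z_RF by (intro subfield_mult[OF E] subfield_power[OF E])
  qed (use i0 hL in \<open>auto simp: G_def h_def\<close>)
qed

text \<open>The coordinates of an element of \<open>L m\<close> have degree at most
  \<open>m - \<mu> i\<close>, and counting their coefficients bounds the dimension. Taking for
  \<open>m\<close> the sum of the weights keeps all these differences free of truncation. With
  \<open>genus_ge\<close> the total weight is then at most \<open>genus + N - 1\<close>.\<close>

lemma ell_upper: "\<exists>m::nat. int (ell (\<lambda>p. int m * poles z p)) \<le> int N * (int m + 1) - int (\<Sum>i<N. \<mu> i)"
proof -
  define m where "m = (\<Sum>i<N. \<mu> i)"
  have \<mu>m: "\<mu> i \<le> m" if "i < N" for i unfolding m_def using that by (intro member_le_sum) auto
  define I where "I = (SIGMA i:{..<N}. {..m - \<mu> i})"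
  have sub: "L (int m) \<subseteq> espan kk I (\<lambda>(i,j). z ^ j * \<omega> i)"
  proof
    fix f assume f: "f \<in> L (int m)"
    obtain P where P: "\<And>i. i < N \<Longrightarrow> poly_over kk (P i)" "f = (\<Sum>i<N. poly (P i) z * \<omega> i)" using A_coords[OF L_A[OF f]] by blast
    have deg: "degree (P i) \<le> m - \<mu> i" if i: "i < N" for i
    proof (cases "P i = 0")
      case False
      from coords_degree[of P, OF P(1) _ i False] f P(2) have "int (degree (P i) + \<mu> i) \<le> int m" by simp
      then show ?thesis by linarith
    qed simp
    have "f = (\<Sum>i<N. \<Sum>j\<le>m - \<mu> i. coeff (P i) j * (z ^ j * \<omega> i))"
      unfolding P(2)
    proof (intro sum.cong refl)
      fix i assume "i \<in> {..<N}"
      then have "poly (P i) z = (\<Sum>j\<le>m - \<mu> i. coeff (P i) j * z ^ j)" using deg by (intro poly_as_sum) auto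
      then show "poly (P i) z * \<omega> i = (\<Sum>j\<le>m - \<mu> i. coeff (P i) j * (z ^ j * \<omega> i))"
        by (simp add: sum_distrib_right mult.assoc)
    qed
    also have "\<dots> = (\<Sum>(i,j)\<in>I. coeff (P i) j * (z ^ j * \<omega> i))" unfolding I_def by (rule sum.Sigma) auto
    finally show "f \<in> espan kk I (\<lambda>(i,j). z ^ j * \<omega> i)"
      unfolding espan_def using P(1)
      by (intro CollectI exI[of _ "\<lambda>(i,j). coeff (P i) j"]) (auto simp: poly_over_def split_beta I_def)
  qed
  have finI: "finite I" by (simp add: I_def)
  have "ell (\<lambda>p. int m * poles z p) \<le> card I"
    using kdim_le[OF kk L_subspace dim_le_subset[OF dim_le_espan[OF kk finI] sub]] by (simp add: L_def)
  moreover have "int (card I) = int N * (int m + 1) - int (\<Sum>i<N. \<mu> i)"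
  proof -
    have "card I = (\<Sum>i<N. Suc (m - \<mu> i))" by (simp add: I_def)
    then have "int (card I) = (\<Sum>i<N. int m + 1 - int (\<mu> i))"
      using \<mu>m by (simp add: of_nat_diff algebra_simps)
    then show ?thesis by (simp add: sum_subtractf)
  qed
  ultimately show ?thesis by (intro exI[of _ m]) linarith
qed

end

section \<open>Discriminant and ramification\<close>

context reduced_basis
begin

definition coord :: "'K \<Rightarrow> nat \<Rightarrow> 'K poly" where
  "coord f = (SOME P. (\<forall>i<N. poly_over kk (P i)) \<and> f = (\<Sum>i<N. poly (P i) z * \<omega> i))"

lemma coord:
  assumes "f \<in> A" shows "i < N \<Longrightarrow> poly_over kk (coord f i)" "(\<Sum>i<N. poly (coord f i) z * \<omega> i) = f"
proof -
  have "(\<forall>i<N. poly_over kk (coord f i)) \<and> f = (\<Sum>i<N. poly (coord f i) z * \<omega> i)"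
    unfolding coord_def by (rule someI_ex[OF A_coords[OF assms]])
  then show "i < N \<Longrightarrow> poly_over kk (coord f i)" "(\<Sum>i<N. poly (coord f i) z * \<omega> i) = f" by auto
qed

lemma sum_\<omega>_A: "(\<And>i. i < N \<Longrightarrow> poly_over kk (P i)) \<Longrightarrow> (\<Sum>i<N. poly (P i) z * \<omega> i) \<in> A"
  by (intro A_sum A_mult A_poly \<omega>A) auto

lemma coord_eq:
  assumes P: "\<And>i. i < N \<Longrightarrow> poly_over kk (P i)" and f: "f = (\<Sum>i<N. poly (P i) z * \<omega> i)" and i: "i < N"
  shows "coord f i = P i"
proof -
  have fA: "f \<in> A" unfolding f by (rule sum_\<omega>_A[OF P])
  have k: "poly_over kk (coord f i - P i)" if "i < N" for i
    using coord(1)[OF fA that] P[OF that] by (rule poly_over_diff[OF kk])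
  have "(\<Sum>i<N. poly (coord f i - P i) z * \<omega> i) = 0"
    using coord(2)[OF fA] f by (simp add: left_diff_distrib sum_subtractf)
  from lin_nondegD[OF nd _ this, of i] k i have "poly (coord f i - P i) z = 0" using RF_poly by blast
  then have "coord f i - P i = 0" using poly_nonconst[OF z k[OF i]] by blast
  then show ?thesis by simp
qed

lemma coord_add: "f \<in> A \<Longrightarrow> g \<in> A \<Longrightarrow> i < N \<Longrightarrow> coord (f + g) i = coord f i + coord g i"
proof (rule coord_eq)
  assume fg: "f \<in> A" "g \<in> A"
  show "f + g = (\<Sum>i<N. poly (coord f i + coord g i) z * \<omega> i)"
    using coord(2)[OF fg(1)] coord(2)[OF fg(2)] by (simp add: distrib_right sum.distrib)
  show "poly_over kk (coord f i + coord g i)" if "i < N" for i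
    using coord(1)[OF fg(1) that] coord(1)[OF fg(2) that] by (rule poly_over_add[OF kk])
qed

lemma coord_pmult: "f \<in> A \<Longrightarrow> poly_over kk q \<Longrightarrow> i < N \<Longrightarrow> coord (poly q z * f) i = q * coord f i"
proof (rule coord_eq)
  assume f: "f \<in> A" and q: "poly_over kk q"
  have "poly q z * f = poly q z * (\<Sum>i<N. poly (coord f i) z * \<omega> i)" by (simp add: coord(2)[OF f])
  then show "poly q z * f = (\<Sum>i<N. poly (q * coord f i) z * \<omega> i)" by (simp add: sum_distrib_left mult.assoc)
  show "poly_over kk (q * coord f i)" if "i < N" for i
    using q coord(1)[OF f that] by (rule poly_over_mult[OF kk])
qed

lemma coord_0: "i < N \<Longrightarrow> coord 0 i = 0"
  by (rule coord_eq[where P = "\<lambda>_. 0"]) (auto simp: poly_over_0[OF kk])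

text \<open>Row \<open>i\<close> holds the coordinates of \<open>x * \<omega> i\<close>:
  multiplication by \<open>x\<close> on the free \<open>k[z]\<close>-module
  \<open>A\<close>.\<close>

definition mult_mat :: "'K \<Rightarrow> nat \<Rightarrow> nat \<Rightarrow> 'K poly" where "mult_mat x i j = coord (x * \<omega> i) j"

definition trc :: "'K \<Rightarrow> 'K poly" where "trc x = (\<Sum>i<N. mult_mat x i i)"

lemma trc_over: "x \<in> A \<Longrightarrow> poly_over kk (trc x)"
  unfolding trc_def mult_mat_def by (intro poly_over_sum[OF kk] coord(1) A_mult \<omega>A) auto

lemma trc_add: "x \<in> A \<Longrightarrow> y \<in> A \<Longrightarrow> trc (x + y) = trc x + trc y"
  unfolding trc_def mult_mat_def by (simp add: distrib_right coord_add A_mult \<omega>A sum.distrib)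

lemma trc_pmult: "x \<in> A \<Longrightarrow> poly_over kk q \<Longrightarrow> trc (poly q z * x) = q * trc x"
  unfolding trc_def mult_mat_def by (simp add: mult.assoc coord_pmult A_mult \<omega>A sum_distrib_left)

lemma trc_0: "trc 0 = 0" unfolding trc_def mult_mat_def by (simp add: coord_0)

lemma trc_sum: "finite J \<Longrightarrow> (\<And>j. j \<in> J \<Longrightarrow> f j \<in> A) \<Longrightarrow> trc (\<Sum>j\<in>J. f j) = (\<Sum>j\<in>J. trc (f j))"
  by (induction J rule: finite_induct) (auto simp: trc_0 trc_add A_sum)

lemma mult_mat_1: "i < N \<Longrightarrow> j < N \<Longrightarrow> mult_mat 1 i j = (if i = j then 1 else 0)"
  unfolding mult_mat_def
  by (rule coord_eq) (auto simp: poly_over_0[OF kk] poly_over_1[OF kk] if_distrib[of "\<lambda>p. poly p z * _"] cong: if_cong)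

lemma trc_1: "trc 1 = of_nat N" unfolding trc_def by (simp add: mult_mat_1)

lemma mult_mat_mult:
  assumes x: "x \<in> A" and y: "y \<in> A" and ij: "i < N" "j < N"
  shows "mult_mat (x * y) i j = (\<Sum>l<N. mult_mat y i l * mult_mat x l j)"
  unfolding mult_mat_def
proof (rule coord_eq[OF _ _ ij(2)])
  have yi: "y * \<omega> i \<in> A" by (intro A_mult y \<omega>A ij)
  have k: "poly_over kk (coord (y * \<omega> i) l)" if "l < N" for l using coord(1)[OF yi that] .
  have k': "poly_over kk (coord (x * \<omega> l) j)" if "l < N" "j < N" for l j
    by (rule coord(1)[OF A_mult[OF x \<omega>A[OF that(1)]] that(2)])
  show "poly_over kk (\<Sum>l<N. coord (y * \<omega> i) l * coord (x * \<omega> l) j)" if "j < N" for j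
    using k k' that by (intro poly_over_sum[OF kk] poly_over_mult[OF kk]) auto
  have "x * y * \<omega> i = x * (\<Sum>l<N. poly (coord (y * \<omega> i) l) z * \<omega> l)" by (simp add: coord(2)[OF yi] mult.assoc)
  also have "\<dots> = (\<Sum>l<N. poly (coord (y * \<omega> i) l) z * (\<Sum>j<N. poly (coord (x * \<omega> l) j) z * \<omega> j))"
    unfolding sum_distrib_left[of x]
  proof (intro sum.cong refl)
    fix l assume "l \<in> {..<N}"
    then have "(\<Sum>j<N. poly (coord (x * \<omega> l) j) z * \<omega> j) = x * \<omega> l" by (intro coord(2) A_mult x \<omega>A) auto
    then show "x * (poly (coord (y * \<omega> i) l) z * \<omega> l) = poly (coord (y * \<omega> i) l) z * (\<Sum>j<N. poly (coord (x * \<omega> l) j) z * \<omega> j)"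
      by (simp only:) (simp add: mult_ac)
  qed
  also have "\<dots> = (\<Sum>j<N. \<Sum>l<N. poly (coord (y * \<omega> i) l) z * poly (coord (x * \<omega> l) j) z * \<omega> j)"
    unfolding sum_distrib_left mult.assoc by (rule sum.swap)
  also have "\<dots> = (\<Sum>j<N. poly (\<Sum>l<N. coord (y * \<omega> i) l * coord (x * \<omega> l) j) z * \<omega> j)"
    by (simp add: poly_sum sum_distrib_right)
  finally show "x * y * \<omega> i = (\<Sum>j<N. poly (\<Sum>l<N. coord (y * \<omega> i) l * coord (x * \<omega> l) j) z * \<omega> j)" .
qed

definition over :: "'K \<Rightarrow> ('K \<Rightarrow> int) set" where "over a = {p. Pl p \<and> p (z - a) > 0}"

lemma over_finite: "finite (over a)" unfolding over_def by (rule finite_zeros)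

lemma over_fin: "a \<in> kk \<Longrightarrow> p \<in> over a \<Longrightarrow> p z \<ge> 0"
  using place_zma(3) by (auto simp: over_def)

lemma sum_over_le:
  assumes "a \<in> kk" shows "(\<Sum>p\<in>over a. p (z - a)) \<le> int N"
proof -
  have "(\<Sum>p\<in>over a. p (z - a)) \<le> int (fdeg (z - a))"
    by (rule zeros_le_fdeg[OF over_finite]) (simp add: over_def)
  then show ?thesis using fdeg_zma[OF assms] by simp
qed

text \<open>A power of \<open>x\<close> is divisible by \<open>z - a\<close>, so \<open>x\<close> acts nilpotently modulo \<open>z - a\<close>.\<close>

lemma trc_vanish:
  assumes a: "a \<in> kk" and x: "x \<in> A" "\<And>p. p \<in> over a \<Longrightarrow> vge p 1 x"
  shows "poly (trc x) a = 0"
proof -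
  \<comment> \<open>No order of \<open>z - a\<close> at a place over \<open>a\<close> exceeds
    \<open>N\<close>, so \<open>x ^ N / (z - a)\<close> is regular there.\<close>
  define e where "e = N"
  have ple: "p (z - a) \<le> int e" if "p \<in> over a" for p
  proof -
    have "p (z - a) \<le> (\<Sum>p\<in>over a. p (z - a))" using over_finite that by (intro member_le_sum) (auto simp: over_def)
    then show ?thesis using sum_over_le[OF a] by (simp add: e_def)
  qed
  define y where "y = x ^ e / (z - a)"
  have "vge p 0 y" if p: "Pl p" "p z \<ge> 0" for p
  proof (cases "x = 0")
    case True then show ?thesis using N_pos by (simp add: y_def e_def power_0_left)
  next
    case False
    have py: "p y = int e * p x - p (z - a)"
      using False zma(2)[OF a] p(1) by (simp add: y_def place_divide place_power)
    show ?thesis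
    proof (cases "p \<in> over a")
      case True
      then have "p x \<ge> 1" using x(2) False by (simp add: vge_def)
      then have "int e * 1 \<le> int e * p x" by (intro mult_left_mono) auto
      then show ?thesis using py ple[OF True] by (simp add: vge_def)
    next
      case F: False
      then have "p (z - a) = 0" using place_zma(1)[OF a p(1,2)] p by (auto simp: over_def)
      moreover have "p x \<ge> 0" using x(1) p False by (auto simp: A_iff vge_def)
      ultimately show ?thesis using py by (simp add: vge_def)
    qed
  qed
  then have yA: "y \<in> A" by (simp add: A_iff)
  have xe: "x ^ e = poly [:- a, 1:] z * y" using zma(2)[OF a] by (simp add: y_def)
  have ak: "poly_over kk [:- a, 1:]" using a by (simp add: poly_over_pCons[OF kk] poly_over_0[OF kk] subfield_uminus[OF kk] subfield_1[OF kk])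
  have "(\<Sum>i<N. poly (mult_mat (x ^ 1) i i) a) = 0"
  proof (rule trace_nilpotent[where X = "\<lambda>k i j. poly (mult_mat (x ^ k) i j) a" and e = e])
    fix i j assume ij: "i < N" "j < N"
    show "poly (mult_mat (x ^ 0) i j) a = (if i = j then 1 else 0)" using mult_mat_1[OF ij] by simp
    show "poly (mult_mat (x ^ Suc k) i j) a = (\<Sum>l<N. poly (mult_mat (x ^ 1) i l) a * poly (mult_mat (x ^ k) l j) a)" for k
      using mult_mat_mult[OF A_power[OF x(1), of k] x(1) ij] by (simp add: poly_sum mult.commute[of x])
    have "mult_mat (x ^ e) i j = [:- a, 1:] * mult_mat y i j"
      unfolding mult_mat_def xe mult.assoc by (rule coord_pmult[OF A_mult[OF yA \<omega>A[OF ij(1)]] ak ij(2)])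
    then show "poly (mult_mat (x ^ e) i j) a = 0" by simp
  qed
  then show ?thesis by (simp add: trc_def poly_sum)
qed

text \<open>A diagonal entry compares \<open>x * \<omega> i\<close> with \<open>\<omega> i\<close>
  itself; the weight \<open>\<mu> i\<close> enters both sides of the degree bound and
  cancels.\<close>

lemma trc_degree:
  assumes x: "x \<in> L (int m)" shows "degree (trc x) \<le> m"
  unfolding trc_def
proof (rule degree_sum_le)
  fix i assume "i \<in> {..<N}"
  then have i: "i < N" by simp
  have xi: "x * \<omega> i \<in> L (int m + int (\<mu> i))" by (rule L_mult[OF x \<omega>L[OF i]])
  show "degree (mult_mat x i i) \<le> m"
  proof (cases "mult_mat x i i = 0")
    case False
    have "int (degree (coord (x * \<omega> i) i) + \<mu> i) \<le> int m + int (\<mu> i)"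
      by (rule coords_degree[OF coord(1)[OF L_A[OF xi]]])
         (use coord(2)[OF L_A[OF xi]] xi i False in \<open>auto simp: mult_mat_def\<close>)
    then show ?thesis by (simp add: mult_mat_def)
  qed simp
qed simp

definition T :: "nat \<Rightarrow> nat \<Rightarrow> 'K poly" where "T i j = trc (\<omega> i * \<omega> j)"

definition disc :: "'K poly" where "disc = fdet N T"

lemma disc_degree: "degree disc \<le> 2 * (\<Sum>i<N. \<mu> i)"
  unfolding disc_def
proof (rule fdet_degree)
  fix i j assume "i < N" "j < N"
  then have "\<omega> i * \<omega> j \<in> L (int (\<mu> i) + int (\<mu> j))" by (intro L_mult \<omega>L)
  then show "degree (T i j) \<le> \<mu> i + \<mu> j" unfolding T_def by (intro trc_degree) simp
qed

text \<open>A kernel vector gives an \<open>x\<close> with \<open>trc (x * y) = 0\<close> for all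
  \<open>y\<close> in \<open>A\<close>. If \<open>x\<close> were nonzero,
  \<open>y = s(z) / x\<close>, with \<open>s\<close> clearing the poles, would give
  \<open>s * N = 0\<close>, impossible in characteristic zero.\<close>

lemma disc_nonzero: "disc \<noteq> 0"
proof -
  have Tk: "poly_over kk (T i j)" if "i < N" "j < N" for i j
    unfolding T_def by (intro trc_over A_mult \<omega>A that)
  have "fdet N (\<lambda>i j. poly (T i j) z) \<noteq> 0"
  proof (rule fdet_nonzero[OF E])
    show "poly (T i j) z \<in> RF z" if "i < N" "j < N" for i j by (rule RF_poly[OF Tk[OF that]])
    fix c j assume c: "\<And>j. c j \<in> RF z" "\<And>i. i < N \<Longrightarrow> (\<Sum>j<N. poly (T i j) z * c j) = 0" "j < N"
    have "\<exists>q P. poly_over kk q \<and> q \<noteq> 0 \<and> (\<forall>i\<in>{..<N}. poly_over kk (P i) \<and> poly q z * c i = poly (P i) z)"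
      by (rule common_denominator[OF z]) (use c in auto)
    then obtain q P where qP: "poly_over kk q" "q \<noteq> 0" "\<And>i. i < N \<Longrightarrow> poly_over kk (P i)" "\<And>i. i < N \<Longrightarrow> poly q z * c i = poly (P i) z"
      by auto
    have qz: "poly q z \<noteq> 0" by (rule poly_nonconst[OF z qP(1,2)])
    have PT: "(\<Sum>j<N. P j * T i j) = 0" if i: "i < N" for i
    proof -
      have "poly (\<Sum>j<N. P j * T i j) z = (\<Sum>j<N. poly q z * (poly (T i j) z * c j))"
        unfolding poly_sum by (intro sum.cong refl) (simp add: qP(4)[symmetric] mult_ac)
      also have "\<dots> = 0" unfolding sum_distrib_left[symmetric] c(2)[OF i] by simp
      finally have "poly (\<Sum>j<N. P j * T i j) z = 0" .
      moreover have "poly_over kk (\<Sum>j<N. P j * T i j)"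
        using qP(3) Tk i by (intro poly_over_sum[OF kk] poly_over_mult[OF kk]) auto
      ultimately show ?thesis using poly_nonconst[OF z] by blast
    qed
    define x where "x = (\<Sum>j<N. poly (P j) z * \<omega> j)"
    have xA: "x \<in> A" unfolding x_def by (rule sum_\<omega>_A[OF qP(3)])
    have tx: "trc (x * \<omega> i) = 0" if i: "i < N" for i
    proof -
      have "trc (x * \<omega> i) = trc (\<Sum>j<N. poly (P j) z * (\<omega> j * \<omega> i))"
        by (simp add: x_def sum_distrib_right mult.assoc)
      also have "\<dots> = (\<Sum>j<N. P j * trc (\<omega> j * \<omega> i))"
        using qP(3) i by (subst trc_sum) (auto intro!: A_mult A_poly \<omega>A sum.cong trc_pmult)
      also have "\<dots> = (\<Sum>j<N. P j * T i j)" by (simp add: T_def mult.commute)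
      finally show ?thesis using PT[OF i] by simp
    qed
    have txy: "trc (x * y) = 0" if y: "y \<in> A" for y
    proof -
      have "x * y = (\<Sum>i<N. poly (coord y i) z * (x * \<omega> i))"
        unfolding coord(2)[OF y, symmetric, THEN arg_cong, of "\<lambda>u. x * u"] sum_distrib_left
        by (simp add: mult_ac)
      also have "trc \<dots> = (\<Sum>i<N. coord y i * trc (x * \<omega> i))"
        using coord(1)[OF y] xA by (subst trc_sum) (auto intro!: A_mult A_poly \<omega>A sum.cong trc_pmult)
      also have "\<dots> = 0" by (simp add: tx)
      finally show ?thesis .
    qed
    have "x = 0"
    proof (rule ccontr)
      assume x0: "x \<noteq> 0"
      obtain s where s: "poly_over kk s" "s \<noteq> 0" "poly s z * inverse x \<in> A" using clear_poles by blast
      have "x * (poly s z * inverse x) = poly s z * 1" using x0 by simp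
      then have "trc (poly s z * 1) = 0" using txy[OF s(3)] by (simp only:)
      then have "s * of_nat N = 0" using trc_pmult[OF A_1 s(1)] trc_1 by simp
      then show False using s(2) N_pos by simp
    qed
    then have "(\<Sum>j<N. c j * \<omega> j) = 0"
    proof -
      have "poly q z * (\<Sum>j<N. c j * \<omega> j) = x"
        unfolding x_def sum_distrib_left by (intro sum.cong refl) (simp add: qP(4)[symmetric] mult.assoc)
      then show ?thesis using \<open>x = 0\<close> qz by simp
    qed
    from lin_nondegD[OF nd _ this, of j] c show "c j = 0" by auto
  qed
  then show ?thesis unfolding disc_def fdet_poly_eval[symmetric] by auto
qed

text \<open>Residues at the places over \<open>a\<close> take few independent values, so after a constant change of
  basis all but \<open>card (over a)\<close> basis elements vanish at every place over \<open>a\<close>; the corresponding rows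
  of the trace matrix are divisible by \<open>z - a\<close>.\<close>

lemma disc_dvd:
  assumes a: "a \<in> kk" shows "[:- a, 1:] ^ (N - card (over a)) dvd disc"
proof -
  \<comment> \<open>Linear independence over \<open>k\<close> of the \<open>\<omega> i\<close>
    modulo the functions that vanish at every place over \<open>a\<close>. The residues at these
    places embed the quotient into a space of dimension \<open>card (over a)\<close>.\<close>
  define indep where "indep J \<longleftrightarrow> J \<subseteq> {..<N} \<and> (\<forall>c. (\<forall>i. c i \<in> kk) \<longrightarrow>
      (\<forall>p\<in>over a. vge p 1 (\<Sum>i\<in>J. c i * \<omega> i)) \<longrightarrow> (\<forall>i\<in>J. c i = 0))" for J
  have "indep {}" by (simp add: indep_def)
  moreover have "\<forall>J. indep J \<longrightarrow> card J < Suc N"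
    by (auto simp: indep_def less_Suc_eq_le dest!: card_mono[rotated])
  ultimately obtain J where J: "indep J" "\<And>J'. indep J' \<Longrightarrow> card J' \<le> card J"
    using ex_has_greatest_nat[of indep "{}" card "Suc N"] by blast
  have JN: "J \<subseteq> {..<N}" and finJ: "finite J" using J(1) by (auto simp: indep_def intro: finite_subset)
  have "card J \<le> card (over a)"
  proof (rule ccontr)
    assume neg: "\<not> ?thesis"
    have "\<exists>c\<in>kk. vge p 1 (\<omega> i - c)" if "p \<in> over a" "i \<in> J" for p i
      by (rule residue) (use that over_fin[OF a that(1)] \<omega>A[of i] JN in \<open>auto simp: over_def A_iff\<close>)
    then obtain \<rho> where \<rho>: "\<And>p i. p \<in> over a \<Longrightarrow> i \<in> J \<Longrightarrow> \<rho> p i \<in> kk" "\<And>p i. p \<in> over a \<Longrightarrow> i \<in> J \<Longrightarrow> vge p 1 (\<omega> i - \<rho> p i)"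
      by metis
    have "\<exists>c. (\<forall>j. c j \<in> kk) \<and> (\<exists>j\<in>J. c j \<noteq> 0) \<and> (\<forall>p\<in>over a. (\<Sum>j\<in>J. \<rho> p j * c j) = 0)"
      by (rule homogeneous_system_nontrivial[OF kk over_finite finJ]) (use neg \<rho> in auto)
    then obtain c where c: "\<And>j. c j \<in> kk" "\<exists>j\<in>J. c j \<noteq> 0" "\<And>p. p \<in> over a \<Longrightarrow> (\<Sum>j\<in>J. \<rho> p j * c j) = 0" by blast
    have "vge p 1 (\<Sum>i\<in>J. c i * \<omega> i)" if p: "p \<in> over a" for p
    proof -
      have Pp: "Pl p" using p by (simp add: over_def)
      have "(\<Sum>i\<in>J. c i * \<omega> i) = (\<Sum>i\<in>J. c i * (\<omega> i - \<rho> p i)) + (\<Sum>i\<in>J. \<rho> p i * c i)"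
        unfolding sum.distrib[symmetric] by (intro sum.cong refl) (simp add: algebra_simps)
      also have "\<dots> = (\<Sum>i\<in>J. c i * (\<omega> i - \<rho> p i))" using c(3)[OF p] by simp
      finally show ?thesis using \<rho>(2)[OF p] c(1) by (auto intro!: vge_sum[OF Pp] vge_cmult[OF Pp])
    qed
    then show False using J(1) c unfolding indep_def by blast
  qed
  have "\<exists>k. (\<forall>l. k l \<in> kk) \<and> (\<forall>p\<in>over a. vge p 1 (\<omega> i - (\<Sum>l\<in>J. k l * \<omega> l)))" if i: "i < N" "i \<notin> J" for i
  proof -
    have "\<not> indep (insert i J)" using J(2)[of "insert i J"] i finJ by auto
    then obtain c where c: "\<And>j. c j \<in> kk" "\<And>p. p \<in> over a \<Longrightarrow> vge p 1 (\<Sum>l\<in>insert i J. c l * \<omega> l)" "\<exists>l\<in>insert i J. c l \<noteq> 0"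
      using i JN unfolding indep_def by blast
    have c0: "c i \<noteq> 0"
    proof
      assume "c i = 0"
      then have "\<forall>p\<in>over a. vge p 1 (\<Sum>l\<in>J. c l * \<omega> l)" "\<exists>l\<in>J. c l \<noteq> 0" using c(2,3) finJ i by auto
      then show False using J(1) c(1) unfolding indep_def by blast
    qed
    show ?thesis
    proof (intro exI[of _ "\<lambda>l. - c l / c i"] conjI allI ballI)
      show "- c l / c i \<in> kk" for l by (intro subfield_divide[OF kk] subfield_uminus[OF kk] c(1))
      fix p assume p: "p \<in> over a"
      have "\<omega> i - (\<Sum>l\<in>J. - c l / c i * \<omega> l) = inverse (c i) * (\<Sum>l\<in>insert i J. c l * \<omega> l)"
        using finJ i c0 by (simp add: sum_distrib_left distrib_left sum_negf divide_inverse mult_ac)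
      then show "vge p 1 (\<omega> i - (\<Sum>l\<in>J. - c l / c i * \<omega> l))"
        using vge_cmult[OF _ subfield_inverse[OF kk c(1)] c(2)[OF p]] p by (simp add: over_def)
    qed
  qed
  then obtain \<kappa> where \<kappa>: "\<And>i l. i < N \<Longrightarrow> i \<notin> J \<Longrightarrow> \<kappa> i l \<in> kk"
    "\<And>i p. i < N \<Longrightarrow> i \<notin> J \<Longrightarrow> p \<in> over a \<Longrightarrow> vge p 1 (\<omega> i - (\<Sum>l\<in>J. \<kappa> i l * \<omega> l))" by metis
  \<comment> \<open>The row operations that subtract combinations of rows in \<open>J\<close> from
    the other rows. As \<open>U\<close> leads from outside \<open>J\<close> into \<open>J\<close>,
    its square is zero; so \<open>1 - U\<close> has inverse \<open>1 + U\<close>, and its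
    determinant is a unit.\<close>
  define U :: "nat \<Rightarrow> nat \<Rightarrow> 'K poly" where "U i l = (if i \<notin> J \<and> l \<in> J then [:\<kappa> i l:] else 0)" for i l
  define \<delta> :: "nat \<Rightarrow> nat \<Rightarrow> 'K poly" where "\<delta> i j = (if i = j then 1 else 0)" for i j
  have \<delta>sum: "(\<Sum>l<N. \<delta> i l * f l) = f i" if "i < N" for i and f :: "nat \<Rightarrow> 'K poly"
    using that by (simp add: \<delta>_def if_distrib[of "\<lambda>x. x * _"] cong: if_cong)
  have Usum: "(\<Sum>l<N. U i l * f l) = (if i \<notin> J then (\<Sum>l\<in>J. [:\<kappa> i l:] * f l) else 0)" for i and f :: "nat \<Rightarrow> 'K poly"
  proof (cases "i \<in> J")
    case False
    have "(\<Sum>l<N. U i l * f l) = (\<Sum>l\<in>J. U i l * f l)" using JN by (intro sum.mono_neutral_right) (auto simp: U_def)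
    also have "\<dots> = (\<Sum>l\<in>J. [:\<kappa> i l:] * f l)" using False by (intro sum.cong) (auto simp: U_def)
    finally show ?thesis using False by simp
  qed (simp add: U_def)
  define T' where "T' i j = (\<Sum>l<N. (\<delta> i l - U i l) * T l j)" for i j
  have d1: "fdet N T' = fdet N (\<lambda>i l. \<delta> i l - U i l) * disc"
    unfolding disc_def by (rule fdet_mult) (simp add: T'_def)
  have d2: "fdet N \<delta> = fdet N (\<lambda>i l. \<delta> i l + U i l) * fdet N (\<lambda>i l. \<delta> i l - U i l)"
  proof (rule fdet_mult)
    fix i j assume ij: "i < N" "j < N"
    have "(\<Sum>l<N. (\<delta> i l + U i l) * (\<delta> l j - U l j)) = \<delta> i j - U i j + (\<Sum>l<N. U i l * (\<delta> l j - U l j))"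
      using \<delta>sum[OF ij(1), of "\<lambda>l. \<delta> l j - U l j"] by (simp add: distrib_right sum.distrib)
    also have "(\<Sum>l<N. U i l * (\<delta> l j - U l j)) = (\<Sum>l<N. U i l * \<delta> l j)"
      by (intro sum.cong) (auto simp: U_def)
    also have "\<dots> = (\<Sum>l<N. \<delta> j l * U i l)" by (intro sum.cong) (auto simp: \<delta>_def)
    also have "\<dots> = U i j" by (rule \<delta>sum[OF ij(2)])
    finally show "\<delta> i j = (\<Sum>l<N. (\<delta> i l + U i l) * (\<delta> l j - U l j))" by simp
  qed
  have d3: "fdet N \<delta> = 1" unfolding \<delta>_def by (rule fdet_id)
  have disc_eq: "disc = fdet N (\<lambda>i l. \<delta> i l + U i l) * fdet N T'"
    unfolding d1 mult.assoc[symmetric] d2[symmetric] d3 by simp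
  have dv: "[:- a, 1:] ^ card ({..<N} - J) dvd fdet N T'"
  proof (rule fdet_dvd)
    fix i j assume "i \<in> {..<N} - J" and j: "j < N"
    then have i: "i < N" "i \<notin> J" by auto
    define \<eta> where "\<eta> = \<omega> i - (\<Sum>l\<in>J. \<kappa> i l * \<omega> l)"
    have JNl: "l < N" if "l \<in> J" for l using JN that by auto
    have \<eta>A: "\<eta> \<in> A" unfolding \<eta>_def
      by (rule A_diff[OF \<omega>A[OF i(1)] A_sum[OF A_mult[OF A_const[OF \<kappa>(1)[OF i]] \<omega>A[OF JNl]]]])
    have t1: "T' i j = T i j - (\<Sum>l\<in>J. [:\<kappa> i l:] * T l j)"
      using \<delta>sum[OF i(1), of "\<lambda>l. T l j"] Usum[of i "\<lambda>l. T l j"] i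
      by (simp add: T'_def left_diff_distrib sum_subtractf)
    have t2: "trc (\<eta> * \<omega> j) + (\<Sum>l\<in>J. [:\<kappa> i l:] * T l j) = T i j"
    proof -
      have k: "poly_over kk [:\<kappa> i l:]" for l using \<kappa>(1)[OF i] by (simp add: poly_over_pCons[OF kk] poly_over_0[OF kk])
      have "(\<Sum>l\<in>J. [:\<kappa> i l:] * T l j) = (\<Sum>l\<in>J. trc (poly [:\<kappa> i l:] z * (\<omega> l * \<omega> j)))"
        unfolding T_def by (intro sum.cong refl trc_pmult[symmetric] k A_mult \<omega>A JNl j)
      also have "\<dots> = trc (\<Sum>l\<in>J. poly [:\<kappa> i l:] z * (\<omega> l * \<omega> j))"
        by (rule trc_sum[OF finJ, symmetric]) (intro A_mult A_poly k \<omega>A JNl j)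
      also have "trc (\<eta> * \<omega> j) + \<dots> = trc (\<eta> * \<omega> j + (\<Sum>l\<in>J. poly [:\<kappa> i l:] z * (\<omega> l * \<omega> j)))"
        by (rule trc_add[symmetric]) (intro A_mult \<eta>A A_sum A_poly k \<omega>A JNl j)+
      also have "\<eta> * \<omega> j + (\<Sum>l\<in>J. poly [:\<kappa> i l:] z * (\<omega> l * \<omega> j)) = \<omega> i * \<omega> j"
        by (simp add: \<eta>_def algebra_simps sum_distrib_right sum_distrib_left)
      finally show ?thesis by (simp add: T_def)
    qed
    have T'trc: "T' i j = trc (\<eta> * \<omega> j)" unfolding t1 t2[symmetric] by (rule add_diff_cancel_right')
    have "poly (trc (\<eta> * \<omega> j)) a = 0"
    proof (rule trc_vanish[OF a A_mult[OF \<eta>A \<omega>A[OF j]]])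
      fix p assume p: "p \<in> over a"
      have "vge p (1 + 0) (\<eta> * \<omega> j)"
        by (intro vge_mult) (use p \<kappa>(2)[OF i p] over_fin[OF a p] \<omega>A[OF j] in \<open>auto simp: over_def \<eta>_def A_iff\<close>)
      then show "vge p 1 (\<eta> * \<omega> j)" by simp
    qed
    then show "[:- a, 1:] dvd T' i j" unfolding T'trc poly_eq_0_iff_dvd .
  qed auto
  have "N - card (over a) \<le> card ({..<N} - J)"
    using \<open>card J \<le> card (over a)\<close> JN finJ by (simp add: card_Diff_subset)
  from power_le_dvd[OF dv this] show ?thesis unfolding disc_eq by (rule dvd_mult)
qed

text \<open>The orders over \<open>a\<close> sum to at most \<open>N\<close>, so the excess over one
  per place is at most \<open>N - card (over a)\<close>, a lower bound for the multiplicity of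
  \<open>a\<close> as a root of \<open>disc\<close>. The multiplicities of all roots add up to at
  most the degree.\<close>

lemma ramification_sum_le:
  assumes F: "finite F" "F \<subseteq> kk"
  shows "(\<Sum>a\<in>F. \<Sum>p\<in>over a. p (z - a) - 1) \<le> 2 * int (\<Sum>i<N. \<mu> i)"
proof -
  have "(\<Sum>p\<in>over a. p (z - a) - 1) \<le> int (order a disc)" if a: "a \<in> F" for a
  proof -
    have ak: "a \<in> kk" using a F by auto
    have "(\<Sum>p\<in>over a. p (z - a) - 1) = (\<Sum>p\<in>over a. p (z - a)) - int (card (over a))"
      by (simp add: sum_subtractf)
    also have "\<dots> \<le> int N - int (card (over a))" using sum_over_le[OF ak] by simp
    also have "\<dots> \<le> int (N - card (over a))" by simp
    also have "N - card (over a) \<le> order a disc"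
      using disc_dvd[OF ak] order_divides[of a "N - card (over a)" disc] disc_nonzero by simp
    finally show ?thesis by simp
  qed
  then have "(\<Sum>a\<in>F. \<Sum>p\<in>over a. p (z - a) - 1) \<le> (\<Sum>a\<in>F. int (order a disc))" by (rule sum_mono)
  also have "\<dots> = int (\<Sum>a\<in>F. order a disc)" by simp
  also have "(\<Sum>a\<in>F. order a disc) \<le> (\<Sum>a\<in>{x. poly disc x = 0}. order a disc)"
  proof -
    have "(\<Sum>a\<in>F. order a disc) = (\<Sum>a\<in>F \<inter> {x. poly disc x = 0}. order a disc)"
      using F by (intro sum.mono_neutral_right) (auto simp: order_0I)
    also have "\<dots> \<le> (\<Sum>a\<in>{x. poly disc x = 0}. order a disc)"
      using poly_roots_finite[OF disc_nonzero] by (intro sum_mono2) auto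
    finally show ?thesis .
  qed
  also have "\<dots> \<le> degree disc" by (rule sum_order_le_degree[OF disc_nonzero])
  also have "\<dots> \<le> 2 * (\<Sum>i<N. \<mu> i)" by (rule disc_degree)
  finally show ?thesis by simp
qed

end

section \<open>The Riemann-Hurwitz inequality\<close>

context cover
begin

definition res :: "('K \<Rightarrow> int) \<Rightarrow> 'K" where "res p = (SOME c. c \<in> kk \<and> vge p 1 (z - c))"

text \<open>The ramification index of \<open>z\<close> at \<open>p\<close>, provided that
  \<open>z\<close> is regular there.\<close>

definition ram :: "('K \<Rightarrow> int) \<Rightarrow> int" where "ram p = p (z - res p)"

lemma res:
  assumes "Pl p" "p z \<ge> 0" shows "res p \<in> kk" "ram p \<ge> 1"
proof -
  have "\<exists>c. c \<in> kk \<and> vge p 1 (z - c)" using residue[OF assms(1), of z] assms(2) by (auto simp: vge_def)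
  from someI_ex[OF this] have *: "res p \<in> kk" "vge p 1 (z - res p)" by (auto simp: res_def)
  show "res p \<in> kk" "ram p \<ge> 1" using * zma(2)[OF *(1)] by (auto simp: ram_def vge_def)
qed

text \<open>Both sides are compared with the total weight of a minimal basis: \<open>disc\<close>
  bounds the ramification by twice the weight, and \<open>ell_upper\<close> bounds the weight by
  \<open>genus + N - 1\<close>.\<close>

lemma hurwitz:
  assumes Q: "finite Q" "\<And>p. p \<in> Q \<Longrightarrow> Pl p \<and> p z \<ge> 0"
  shows "(\<Sum>p\<in>Q. ram p - 1) - 2 * int N \<le> 2 * genus kk - 2"
proof -
  obtain \<omega> \<mu> where "minimal_weight \<omega> \<mu>" using ex_minimal_weight by blast
  then interpret reduced_basis kk z \<omega> \<mu> by unfold_locales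
  obtain m :: nat where m: "int (ell (\<lambda>p. int m * poles z p)) \<le> int N * (int m + 1) - int (\<Sum>i<N. \<mu> i)"
    using ell_upper by blast
  have "div_deg kk (\<lambda>p. int m * poles z p) = int m * int N"
    using div_deg_cmult[OF poles_divisor] poles_eq_fdeg[OF z] by simp
  then have g: "int (\<Sum>i<N. \<mu> i) - int N + 1 \<le> genus kk"
    using genus_ge[OF divisor_cmult[OF poles_divisor], of "int m" z] m by (simp add: algebra_simps)
  have "(\<Sum>p\<in>Q. ram p - 1) = (\<Sum>a\<in>res ` Q. \<Sum>p\<in>{p \<in> Q. res p = a}. ram p - 1)"
    by (rule sum.image_gen[OF Q(1)])
  also have "\<dots> \<le> (\<Sum>a\<in>res ` Q. \<Sum>p\<in>over a. p (z - a) - 1)"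
  proof (rule sum_mono)
    fix a assume "a \<in> res ` Q"
    have "(\<Sum>p\<in>{p \<in> Q. res p = a}. ram p - 1) = (\<Sum>p\<in>{p \<in> Q. res p = a}. p (z - a) - 1)"
      by (intro sum.cong) (auto simp: ram_def)
    also have "\<dots> \<le> (\<Sum>p\<in>over a. p (z - a) - 1)"
    proof (rule sum_mono2[OF over_finite])
      show "{p \<in> Q. res p = a} \<subseteq> over a"
      proof
        fix p assume "p \<in> {p \<in> Q. res p = a}"
        then have "p \<in> Q" "res p = a" by auto
        then have "Pl p" "p z \<ge> 0" "p (z - a) = ram p" using Q(2)[of p] by (simp_all add: ram_def)
        then show "p \<in> over a" using res(2)[of p] by (simp add: over_def)
      qed
    qed (auto simp: over_def)
    finally show "(\<Sum>p\<in>{p \<in> Q. res p = a}. ram p - 1) \<le> (\<Sum>p\<in>over a. p (z - a) - 1)" .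
  qed
  also have "\<dots> \<le> 2 * int (\<Sum>i<N. \<mu> i)"
  proof (rule ramification_sum_le)
    show "finite (res ` Q)" using Q(1) by simp
    show "res ` Q \<subseteq> kk" using Q(2) res(1) by blast
  qed
  finally have le: "(\<Sum>p\<in>Q. ram p - 1) \<le> 2 * int (\<Sum>i<N. \<mu> i)" .
  have "s - 2 * n \<le> 2 * g - 2" if "s \<le> 2 * m" "m - n + 1 \<le> g" for s m n g :: int
    using that by linarith
  from this[OF le g] show ?thesis .
qed

text \<open>Each ramified place contributes at least 1 to the left side of \<open>hurwitz\<close>,
  whose bound is the same for all finite sets of places.\<close>

lemma finite_ramified: "finite {p. Pl p \<and> p z \<ge> 0 \<and> ram p \<ge> 2}"
proof (rule ccontr)
  assume inf: "infinite {p. Pl p \<and> p z \<ge> 0 \<and> ram p \<ge> 2}"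
  obtain Q where Q: "Q \<subseteq> {p. Pl p \<and> p z \<ge> 0 \<and> ram p \<ge> 2}" "finite Q" "card Q = Suc (nat (2 * genus kk - 2 + 2 * int N))"
    using infinite_arbitrarily_large[OF inf, of "Suc (nat (2 * genus kk - 2 + 2 * int N))"] by (elim exE conjE) (rule that)
  have "int (card Q) \<le> (\<Sum>p\<in>Q. ram p - 1)" using Q(1) sum_mono[of Q "\<lambda>_. 1::int" "\<lambda>p. ram p - 1"] by force
  also have "\<dots> \<le> 2 * genus kk - 2 + 2 * int N"
  proof -
    have "(\<Sum>p\<in>Q. ram p - 1) - 2 * int N \<le> 2 * genus kk - 2"
      by (rule hurwitz[OF Q(2)]) (use Q(1) in auto)
    then show ?thesis by linarith
  qed
  finally have "int (card Q) \<le> 2 * genus kk - 2 + 2 * int N" .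
  moreover have "int (card Q) = 1 + int (nat (2 * genus kk - 2 + 2 * int N))" using Q(3) by simp
  moreover have "2 * genus kk - 2 + 2 * int N \<le> int (nat (2 * genus kk - 2 + 2 * int N))" by simp
  ultimately show False by linarith
qed

end

context function_field
begin

lemma infinite_kk: "infinite kk"
proof
  assume "finite kk"
  moreover have "range (of_nat :: nat \<Rightarrow> 'K) \<subseteq> kk" using subfield_of_nat[OF kk] by auto
  ultimately have "finite (range (of_nat :: nat \<Rightarrow> 'K))" by (rule rev_finite_subset)
  moreover have "inj (of_nat :: nat \<Rightarrow> 'K)" by (simp add: inj_def)
  ultimately show False using range_inj_infinite[of "of_nat :: nat \<Rightarrow> 'K"] by simp
qed

text \<open>The inverse of \<open>z - c\<close>, for a value \<open>c\<close> outside the finitely many branch points of \<open>z\<close>.\<close>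

lemma ex_unramified_at_infinity: "\<exists>z. z \<notin> kk \<and> (\<forall>p. Pl p \<longrightarrow> p z < 0 \<longrightarrow> p z = -1)"
proof -
  obtain z where "z \<notin> kk" using ex_finite_generation by metis
  then interpret cover kk z by unfold_locales
  have "infinite (kk - res ` {p. Pl p \<and> p z \<ge> 0 \<and> ram p \<ge> 2})"
    by (rule Diff_infinite_finite[OF finite_imageI[OF finite_ramified] infinite_kk])
  then have "kk - res ` {p. Pl p \<and> p z \<ge> 0 \<and> ram p \<ge> 2} \<noteq> {}" by (metis finite.emptyI)
  then obtain c where c: "c \<in> kk" "c \<notin> res ` {p. Pl p \<and> p z \<ge> 0 \<and> ram p \<ge> 2}" by blast
  have "p (z - c) = 1" if p: "Pl p" "p (z - c) > 0" for p
  proof -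
    have pz: "p z \<ge> 0" by (rule place_zma(3)[OF c(1) p])
    have 1: "vge p 1 (z - res p)" using res(2)[OF p(1) pz] by (simp add: ram_def vge_def)
    have 2: "vge p 1 (z - c)" using p by (simp add: vge_def)
    have "vge p 1 ((z - c) - (z - res p))" by (rule vge_diff[OF p(1) 2 1])
    then have "vge p 1 (res p - c)" by simp
    moreover have "res p - c \<in> kk" by (rule subfield_diff[OF kk res(1)[OF p(1) pz] c(1)])
    ultimately have "res p - c = 0" by (intro vge_const_imp_0[OF p(1)])
    then have "res p = c" by simp
    have "\<not> ram p \<ge> 2"
    proof
      assume "ram p \<ge> 2"
      then have "res p \<in> res ` {p. Pl p \<and> p z \<ge> 0 \<and> ram p \<ge> 2}" using p(1) pz by (intro imageI) simp
      then show False using c(2) \<open>res p = c\<close> by simp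
    qed
    then have "ram p < 2" by simp
    then show ?thesis using \<open>res p = c\<close> p by (simp add: ram_def)
  qed
  then have "p (inverse (z - c)) = - 1" if "Pl p" "p (inverse (z - c)) < 0" for p
    using that place_inverse[OF that(1), of "z - c"] by simp
  moreover have "inverse (z - c) \<notin> kk"
  proof
    assume "inverse (z - c) \<in> kk"
    from subfield_inverse[OF kk this] show False using zma(1)[OF c(1)] by simp
  qed
  ultimately show ?thesis by (intro exI[of _ "inverse (z - c)"]) blast
qed

end

section \<open>Local expansions and derivations\<close>

locale local_expansion = function_field kk for kk :: "'K::field_char_0 set" +
  fixes p :: "'K \<Rightarrow> int" and t :: 'K
  assumes p: "Pl p" and t: "t \<noteq> 0" "p t = 1"
begin

lemma vge_t: "vge p 1 t" by (simp add: vge_def t)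

lemma vge_poly_t:
  assumes "poly_over kk P" "\<And>i. i < n \<Longrightarrow> coeff P i = 0" shows "vge p (int n) (poly P t)"
  unfolding poly_altdef
proof (rule vge_sum[OF p])
  fix i
  show "vge p (int n) (coeff P i * t ^ i)"
  proof (cases "i < n")
    case True then show ?thesis using assms(2) by simp
  next
    case False
    have "vge p (int i * 1) (t ^ i)" by (rule vge_power[OF p vge_t])
    then have "vge p (int n) (t ^ i)" using False by (auto elim: vge_mono)
    then show ?thesis using assms(1) by (intro vge_cmult[OF p]) (auto simp: poly_over_def)
  qed
qed

lemma coeff_zero_of_vge:
  "poly_over kk P \<Longrightarrow> vge p (int n) (poly P t) \<Longrightarrow> i < n \<Longrightarrow> coeff P i = 0"
proof (induction n arbitrary: P i)
  case (Suc n)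
  obtain c P' where P: "P = pCons c P'" by (metis pCons_cases)
  have cP: "c \<in> kk" "poly_over kk P'" using Suc.prems(1) P by (auto simp: poly_over_pCons[OF kk])
  have 0: "vge p 0 (poly P' t)" by (rule vge_poly[OF p cP(2) vge_mono[OF vge_t]]) simp
  have 1: "vge p (1 + 0) (t * poly P' t)" by (rule vge_mult[OF p vge_t 0])
  have "vge p 1 (poly P t)" by (rule vge_mono[OF Suc.prems(2)]) simp
  from vge_diff[OF p this] 1 have "vge p 1 (poly P t - t * poly P' t)" by simp
  then have "vge p 1 c" by (simp add: P)
  then have c: "c = 0" by (rule vge_const_imp_0[OF p cP(1)])
  have "vge p (int n) (poly P' t)"
  proof (cases "poly P' t = 0")
    case False
    have "int (Suc n) \<le> p (t * poly P' t)" using Suc.prems(2) False t(1) c by (simp add: P vge_def)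
    also have "p (t * poly P' t) = 1 + p (poly P' t)" using place_mult[OF p t(1) False] t(2) by simp
    finally show ?thesis by (simp add: vge_def)
  qed simp
  from Suc.IH[OF cP(2) this] show ?case using Suc.prems(3) c P by (cases i) auto
qed simp

text \<open>Says that \<open>F\<close> is the \<open>t\<close>-adic expansion of \<open>f\<close>
  without forming a completion: each truncation is witnessed by a polynomial in \<open>t\<close>
  over \<open>k\<close> that agrees with \<open>f\<close> up to that order.\<close>

definition taylor :: "'K \<Rightarrow> 'K fps \<Rightarrow> bool" where
  "taylor f F \<longleftrightarrow> (\<forall>n. \<exists>P. poly_over kk P \<and> vge p (int n) (f - poly P t) \<and> (\<forall>i<n. fps_nth F i = coeff P i))"

lemma taylorE:
  assumes "taylor f F"
  obtains P where "poly_over kk P" "vge p (int n) (f - poly P t)" "\<And>i. i < n \<Longrightarrow> fps_nth F i = coeff P i"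
  using assms unfolding taylor_def by blast

lemma taylor_unique:
  assumes "taylor f F" "taylor f G" shows "F = G"
proof (rule fps_ext)
  fix i
  obtain P where P: "poly_over kk P" "vge p (int (Suc i)) (f - poly P t)" "\<And>j. j < Suc i \<Longrightarrow> fps_nth F j = coeff P j"
    using taylorE[OF assms(1)] by metis
  obtain Q where Q: "poly_over kk Q" "vge p (int (Suc i)) (f - poly Q t)" "\<And>j. j < Suc i \<Longrightarrow> fps_nth G j = coeff Q j"
    using taylorE[OF assms(2)] by metis
  have "vge p (int (Suc i)) ((f - poly Q t) - (f - poly P t))" by (rule vge_diff[OF p Q(2) P(2)])
  then have "vge p (int (Suc i)) (poly (P - Q) t)" by simp
  then have "coeff (P - Q) i = 0" by (rule coeff_zero_of_vge[OF poly_over_diff[OF kk P(1) Q(1)]]) simp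
  then show "fps_nth F i = fps_nth G i" using P(3)[of i] Q(3)[of i] by simp
qed

lemma ex_taylor_poly: "vge p 0 f \<Longrightarrow> \<exists>P. poly_over kk P \<and> vge p (int n) (f - poly P t)"
proof (induction n arbitrary: f)
  case 0
  then show ?case by (intro exI[of _ 0]) (simp add: poly_over_0[OF kk])
next
  case (Suc n)
  obtain c where c: "c \<in> kk" "vge p 1 (f - c)" using residue[OF p Suc.prems] by blast
  have "vge p 0 ((f - c) / t)"
    using c(2) place_divide[OF p _ t(1), of "f - c"] t by (cases "f = c") (auto simp: vge_def)
  from Suc.IH[OF this] obtain P where P: "poly_over kk P" "vge p (int n) ((f - c) / t - poly P t)" by blast
  have "vge p (1 + int n) (t * ((f - c) / t - poly P t))" by (rule vge_mult[OF p vge_t P(2)])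
  moreover have "t * ((f - c) / t - poly P t) = f - poly (pCons c P) t" using t(1) by (simp add: field_simps)
  ultimately show ?case using P(1) c(1) by (intro exI[of _ "pCons c P"]) (simp add: poly_over_pCons[OF kk])
qed

lemma ex_taylor: assumes "vge p 0 f" shows "\<exists>F. taylor f F"
proof -
  have "\<forall>n. \<exists>P. poly_over kk P \<and> vge p (int n) (f - poly P t)" using ex_taylor_poly[OF assms] by blast
  then obtain P where P: "\<And>n. poly_over kk (P n)" "\<And>n. vge p (int n) (f - poly (P n) t)" by metis
  have "coeff (P (Suc i)) i = coeff (P n) i" if "i < n" for i n
  proof -
    have "vge p (int (Suc i)) ((f - poly (P n) t) - (f - poly (P (Suc i)) t))"
      by (rule vge_diff[OF p vge_mono[OF P(2)] P(2)]) (use that in simp)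
    then have "vge p (int (Suc i)) (poly (P (Suc i) - P n) t)" by simp
    then have "coeff (P (Suc i) - P n) i = 0" by (rule coeff_zero_of_vge[OF poly_over_diff[OF kk P(1) P(1)]]) simp
    then show ?thesis by simp
  qed
  then have "taylor f (Abs_fps (\<lambda>i. coeff (P (Suc i)) i))"
    unfolding taylor_def using P by (intro allI exI[of _ "P _"]) auto
  then show ?thesis by blast
qed

lemma taylor_vge: "taylor f F \<Longrightarrow> vge p 0 f"
proof -
  assume "taylor f F"
  then obtain P where P: "poly_over kk P" "vge p (int 0) (f - poly P t)" using taylorE by metis
  have "vge p 0 (poly P t)" by (rule vge_poly[OF p P(1) vge_mono[OF vge_t]]) simp
  from vge_add[OF p _ this, of "f - poly P t"] P(2) show ?thesis by simp
qed

lemma taylor_poly: "poly_over kk P \<Longrightarrow> taylor (poly P t) (fps_of_poly P)"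
  unfolding taylor_def by (intro allI exI[of _ P]) simp

lemma taylor_add: assumes "taylor f F" "taylor g G" shows "taylor (f + g) (F + G)"
  unfolding taylor_def
proof
  fix n
  obtain P where P: "poly_over kk P" "vge p (int n) (f - poly P t)" "\<And>j. j < n \<Longrightarrow> fps_nth F j = coeff P j"
    using taylorE[OF assms(1)] by metis
  obtain Q where Q: "poly_over kk Q" "vge p (int n) (g - poly Q t)" "\<And>j. j < n \<Longrightarrow> fps_nth G j = coeff Q j"
    using taylorE[OF assms(2)] by metis
  have "vge p (int n) ((f - poly P t) + (g - poly Q t))" by (rule vge_add[OF p P(2) Q(2)])
  then show "\<exists>P. poly_over kk P \<and> vge p (int n) (f + g - poly P t) \<and> (\<forall>i<n. fps_nth (F + G) i = coeff P i)"
    using P Q by (intro exI[of _ "P + Q"]) (auto simp: poly_over_add[OF kk] algebra_simps)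
qed

lemma taylor_mult: assumes "taylor f F" "taylor g G" shows "taylor (f * g) (F * G)"
  unfolding taylor_def
proof
  fix n
  obtain P where P: "poly_over kk P" "vge p (int n) (f - poly P t)" "\<And>j. j < n \<Longrightarrow> fps_nth F j = coeff P j"
    using taylorE[OF assms(1)] by metis
  obtain Q where Q: "poly_over kk Q" "vge p (int n) (g - poly Q t)" "\<And>j. j < n \<Longrightarrow> fps_nth G j = coeff Q j"
    using taylorE[OF assms(2)] by metis
  have "vge p 0 (poly P t)" by (rule vge_poly[OF p P(1) vge_mono[OF vge_t]]) simp
  then have "vge p (0 + int n) (poly P t * (g - poly Q t))" by (rule vge_mult[OF p _ Q(2)])
  moreover have "vge p (int n + 0) ((f - poly P t) * g)" by (rule vge_mult[OF p P(2) taylor_vge[OF assms(2)]])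
  ultimately have "vge p (int n) ((f - poly P t) * g + poly P t * (g - poly Q t))" by (intro vge_add[OF p]) auto
  moreover have "(f - poly P t) * g + poly P t * (g - poly Q t) = f * g - poly (P * Q) t" by (simp add: algebra_simps)
  ultimately have 1: "vge p (int n) (f * g - poly (P * Q) t)" by simp
  have 2: "fps_nth (F * G) i = coeff (P * Q) i" if "i < n" for i
    unfolding fps_mult_nth coeff_mult using that P(3) Q(3) by (intro sum.cong) (auto simp: atLeast0AtMost)
  show "\<exists>P. poly_over kk P \<and> vge p (int n) (f * g - poly P t) \<and> (\<forall>i<n. fps_nth (F * G) i = coeff P i)"
    using poly_over_mult[OF kk P(1) Q(1)] 1 2 by blast
qed

lemma taylor_nth_kk: "taylor f F \<Longrightarrow> fps_nth F i \<in> kk"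
proof -
  assume "taylor f F"
  then obtain P where P: "poly_over kk P" "\<And>j. j < Suc i \<Longrightarrow> fps_nth F j = coeff P j" using taylorE by metis
  then show ?thesis by (simp add: poly_over_def)
qed

lemma taylor_const: "c \<in> kk \<Longrightarrow> taylor c (fps_const c)"
  using taylor_poly[of "[:c:]"] by (simp add: poly_over_pCons[OF kk] poly_over_0[OF kk] fps_of_poly_const)

lemma taylor_t_power: "taylor (t ^ k) (fps_X ^ k)"
proof -
  have "poly_over kk (monom 1 k)" by (rule poly_over_monom[OF kk subfield_1[OF kk]])
  from taylor_poly[OF this] show ?thesis by (simp add: poly_monom fps_of_poly_monom')
qed

lemma taylor_subdegree:
  assumes F: "taylor f F" and f: "f \<noteq> 0" shows "F \<noteq> 0" "int (subdegree F) = p f"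
proof -
  define n where "n = nat (p f)"
  have n: "int n = p f" using taylor_vge[OF F] f by (simp add: n_def vge_def)
  obtain P where P: "poly_over kk P" "vge p (int (Suc n)) (f - poly P t)" "\<And>j. j < Suc n \<Longrightarrow> fps_nth F j = coeff P j"
    using taylorE[OF F] by metis
  have "vge p (int n) (f - (f - poly P t))"
    by (rule vge_diff[OF p _ vge_mono[OF P(2)]]) (auto simp: vge_def n)
  then have low': "coeff P i = 0" if "i < n" for i using coeff_zero_of_vge[OF P(1), of n i] that by simp
  have low: "fps_nth F i = 0" if "i < n" for i using low' that P(3) by simp
  have nz: "fps_nth F n \<noteq> 0"
  proof
    assume "fps_nth F n = 0"
    then have "coeff P i = 0" if "i < Suc n" for i using P(3)[of n] low'[of i] that by (auto simp: less_Suc_eq)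
    then have "vge p (int (Suc n)) (poly P t)" by (rule vge_poly_t[OF P(1)])
    from vge_add[OF p P(2) this] have "vge p (int (Suc n)) f" by simp
    then show False using f n by (simp add: vge_def)
  qed
  then show "F \<noteq> 0" by auto
  have "subdegree F = n" using nz low by (intro subdegreeI) auto
  then show "int (subdegree F) = p f" using n by simp
qed

definition laurent :: "'K \<Rightarrow> 'K fls \<Rightarrow> bool" where
  "laurent f G \<longleftrightarrow> (\<exists>k F. taylor (t ^ k * f) F \<and> G * fls_X ^ k = fps_to_fls F)"

lemma laurent_raise:
  assumes "taylor (t ^ k * f) F" "G * fls_X ^ k = fps_to_fls F"
  shows "taylor (t ^ (j + k) * f) (fps_X ^ j * F)" "G * fls_X ^ (j + k) = fps_to_fls (fps_X ^ j * F)"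
proof -
  show "taylor (t ^ (j + k) * f) (fps_X ^ j * F)"
    using taylor_mult[OF taylor_t_power[of j] assms(1)] by (simp add: power_add mult.assoc)
  show "G * fls_X ^ (j + k) = fps_to_fls (fps_X ^ j * F)"
    using assms(2) by (simp add: power_add fls_times_fps_to_fls fps_to_fls_power mult_ac)
qed

lemma ex_laurent: "\<exists>G. laurent f G"
proof -
  define k where "k = nat (- p f)"
  have "vge p 0 (t ^ k * f)"
  proof (cases "f = 0")
    case False
    then show ?thesis using t p by (simp add: vge_def place_mult place_power k_def)
  qed simp
  then obtain F where F: "taylor (t ^ k * f) F" using ex_taylor by blast
  have "fps_to_fls F * inverse (fls_X ^ k) * fls_X ^ k = fps_to_fls F" by (simp add: mult.assoc)
  then show ?thesis unfolding laurent_def using F by blast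
qed

lemma laurent_unique: assumes "laurent f G" "laurent f G'" shows "G = G'"
proof -
  obtain k F where 1: "taylor (t ^ k * f) F" "G * fls_X ^ k = fps_to_fls F" using assms(1) by (auto simp: laurent_def)
  obtain k' F' where 2: "taylor (t ^ k' * f) F'" "G' * fls_X ^ k' = fps_to_fls F'" using assms(2) by (auto simp: laurent_def)
  note a = laurent_raise[OF 1, of k'] and b = laurent_raise[OF 2, of k]
  have "fps_X ^ k' * F = fps_X ^ k * F'" by (rule taylor_unique[OF a(1)]) (use b(1) in \<open>simp add: add.commute\<close>)
  then have "G * fls_X ^ (k' + k) = G' * fls_X ^ (k' + k)" using a(2) b(2) by (simp add: add.commute)
  then show ?thesis by simp
qed

lemma laurent_add: assumes "laurent f F" "laurent g G" shows "laurent (f + g) (F + G)"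
proof -
  obtain k F' where 1: "taylor (t ^ k * f) F'" "F * fls_X ^ k = fps_to_fls F'" using assms(1) by (auto simp: laurent_def)
  obtain j G' where 2: "taylor (t ^ j * g) G'" "G * fls_X ^ j = fps_to_fls G'" using assms(2) by (auto simp: laurent_def)
  note a = laurent_raise[OF 1, of j] and b = laurent_raise[OF 2, of k]
  have b': "taylor (t ^ (j + k) * g) (fps_X ^ k * G')" "G * fls_X ^ (j + k) = fps_to_fls (fps_X ^ k * G')"
    using b by (simp_all add: add.commute)
  have "taylor (t ^ (j + k) * (f + g)) (fps_X ^ j * F' + fps_X ^ k * G')"
    using taylor_add[OF a(1) b'(1)] by (simp add: distrib_left)
  moreover have "(F + G) * fls_X ^ (j + k) = fps_to_fls (fps_X ^ j * F' + fps_X ^ k * G')"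
    using a(2) b'(2) by (simp add: distrib_right)
  ultimately show ?thesis unfolding laurent_def by blast
qed

lemma laurent_mult: assumes "laurent f F" "laurent g G" shows "laurent (f * g) (F * G)"
proof -
  obtain k F' where 1: "taylor (t ^ k * f) F'" "F * fls_X ^ k = fps_to_fls F'" using assms(1) by (auto simp: laurent_def)
  obtain j G' where 2: "taylor (t ^ j * g) G'" "G * fls_X ^ j = fps_to_fls G'" using assms(2) by (auto simp: laurent_def)
  have "taylor (t ^ (k + j) * (f * g)) (F' * G')" using taylor_mult[OF 1(1) 2(1)] by (simp add: power_add mult_ac)
  moreover have "(F * G) * fls_X ^ (k + j) = fps_to_fls (F' * G')"
  proof -
    have "(F * G) * fls_X ^ (k + j) = (F * fls_X ^ k) * (G * fls_X ^ j)" by (simp only: power_add mult_ac)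
    then show ?thesis unfolding 1(2) 2(2) by (simp add: fls_times_fps_to_fls)
  qed
  ultimately show ?thesis unfolding laurent_def by blast
qed

lemma laurent_const: "c \<in> kk \<Longrightarrow> laurent c (fls_const c)"
  unfolding laurent_def by (intro exI[of _ 0] exI[of _ "fps_const c"]) (simp add: taylor_const)

lemma laurent_subdegree:
  assumes "laurent f G" "f \<noteq> 0" shows "G \<noteq> 0" "fls_subdegree G = p f"
proof -
  obtain k F where 1: "taylor (t ^ k * f) F" "G * fls_X ^ k = fps_to_fls F" using assms(1) by (auto simp: laurent_def)
  have nz: "t ^ k * f \<noteq> 0" using assms t by simp
  have F: "F \<noteq> 0" "int (subdegree F) = p (t ^ k * f)" using taylor_subdegree[OF 1(1) nz] by auto
  show "G \<noteq> 0" using 1(2) F(1) by auto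
  have "fls_subdegree (G * fls_X ^ k) = p (t ^ k * f)" unfolding 1(2) fls_subdegree_fls_to_fps using F(2) .
  moreover have "fls_subdegree (fls_X ^ k :: 'K fls) = int k" by (simp add: fls_subdegree_pow)
  moreover have "p (t ^ k * f) = int k + p f" using assms(2) t p by (simp add: place_mult place_power)
  ultimately show "fls_subdegree G = p f" using \<open>G \<noteq> 0\<close> by simp
qed

text \<open>In characteristic zero the series is then constant, its constant term lies in
  \<open>k\<close>, and subtracting this constant from \<open>f\<close> leaves an element with zero
  expansion.\<close>

lemma laurent_deriv_0:
  assumes "laurent f G" "fls_deriv G = 0" shows "f \<in> kk"
proof -
  have G: "G = fls_const (fls_nth G 0)" using assms(2) by (simp only: fls_deriv_eq_0_iff)
  obtain k F where 1: "taylor (t ^ k * f) F" "G * fls_X ^ k = fps_to_fls F" using assms(1) by (auto simp: laurent_def)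
  have "fls_nth G 0 = fps_nth F k"
  proof -
    have "fls_nth (G * fls_X ^ k) (int k) = fps_nth F k" unfolding 1(2) by simp
    moreover have "fls_nth (G * fls_X ^ k) (int k) = fls_nth G 0" by (subst G) simp
    ultimately show ?thesis by simp
  qed
  then have c: "fls_nth G 0 \<in> kk" using taylor_nth_kk[OF 1(1)] by simp
  define c where "c = fls_nth G 0"
  have ck: "c \<in> kk" and Gc: "G = fls_const c" using G c by (simp_all add: c_def)
  have "laurent (- c) (fls_const (- c))" by (rule laurent_const[OF subfield_uminus[OF kk ck]])
  from laurent_add[OF assms(1) this] have l0: "laurent (f + - c) (G + fls_const (- c))" .
  have "G + fls_const (- c) = 0" unfolding Gc by (rule fls_eqI) simp
  then have "f + - c = 0" using laurent_subdegree(1)[OF l0] by metis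
  then show ?thesis using ck by simp
qed

end

section \<open>Expansions as field embeddings and the derivation d/dz\<close>

context function_field
begin

text \<open>The choice of uniformizer is forgotten. What is kept is an embedding into Laurent series
  that turns the order at \<open>p\<close> into the subdegree and whose derivative detects the
  constants.\<close>

definition expansion :: "('K \<Rightarrow> int) \<Rightarrow> ('K \<Rightarrow> 'K fls) \<Rightarrow> bool" where
  "expansion p \<phi> \<longleftrightarrow> (\<forall>x y. \<phi> (x + y) = \<phi> x + \<phi> y) \<and> (\<forall>x y. \<phi> (x * y) = \<phi> x * \<phi> y) \<and>
     (\<forall>c\<in>kk. \<phi> c = fls_const c) \<and> (\<forall>x. x \<noteq> 0 \<longrightarrow> \<phi> x \<noteq> 0 \<and> fls_subdegree (\<phi> x) = p x) \<and>
     (\<forall>x. fls_deriv (\<phi> x) = 0 \<longrightarrow> x \<in> kk)"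

lemma ex_expansion: assumes "Pl p" shows "\<exists>\<phi>. expansion p \<phi>"
proof -
  obtain t where "t \<noteq> 0" "p t = 1" using ex_uniformizer_at[OF assms] by blast
  then interpret local_expansion kk p t using assms by unfold_locales
  have "\<forall>f. \<exists>G. laurent f G" using ex_laurent by blast
  then obtain \<phi> where \<phi>: "\<And>f. laurent f (\<phi> f)" by metis
  have "expansion p \<phi>" unfolding expansion_def
  proof (intro conjI allI ballI impI)
    show "\<phi> (x + y) = \<phi> x + \<phi> y" for x y by (rule laurent_unique[OF \<phi> laurent_add[OF \<phi> \<phi>]])
    show "\<phi> (x * y) = \<phi> x * \<phi> y" for x y by (rule laurent_unique[OF \<phi> laurent_mult[OF \<phi> \<phi>]])
    show "\<phi> c = fls_const c" if "c \<in> kk" for c by (rule laurent_unique[OF \<phi> laurent_const[OF that]])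
    show "\<phi> x \<noteq> 0" "fls_subdegree (\<phi> x) = p x" if "x \<noteq> 0" for x using laurent_subdegree[OF \<phi> that] by auto
    show "x \<in> kk" if "fls_deriv (\<phi> x) = 0" for x by (rule laurent_deriv_0[OF \<phi> that])
  qed
  then show ?thesis by blast
qed

context
  fixes p \<phi> assumes \<phi>: "expansion p \<phi>"
begin

lemma exp_add: "\<phi> (x + y) = \<phi> x + \<phi> y" and exp_mult: "\<phi> (x * y) = \<phi> x * \<phi> y"
  and exp_const: "c \<in> kk \<Longrightarrow> \<phi> c = fls_const c" and exp_nonzero: "x \<noteq> 0 \<Longrightarrow> \<phi> x \<noteq> 0"
  and exp_subdegree: "x \<noteq> 0 \<Longrightarrow> fls_subdegree (\<phi> x) = p x" and exp_deriv_0: "fls_deriv (\<phi> x) = 0 \<Longrightarrow> x \<in> kk"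
  using \<phi> by (auto simp: expansion_def)

lemma exp_0: "\<phi> 0 = 0" using exp_add[of 0 0] by simp

lemma exp_1: "\<phi> 1 = 1" using exp_const[OF subfield_1[OF kk]] by simp

lemma exp_uminus: "\<phi> (- x) = - \<phi> x"
  using exp_add[of x "- x"] exp_0 by (simp add: eq_neg_iff_add_eq_0 add.commute)

lemma exp_diff: "\<phi> (x - y) = \<phi> x - \<phi> y"
  using exp_add[of x "- y"] exp_uminus[of y] by simp

lemma exp_power: "\<phi> (x ^ n) = \<phi> x ^ n"
  by (induction n) (auto simp: exp_1 exp_mult)

lemma exp_sum: "\<phi> (sum f I) = (\<Sum>i\<in>I. \<phi> (f i))"
  by (induction I rule: infinite_finite_induct) (auto simp: exp_0 exp_add)

lemma exp_of_nat: "\<phi> (of_nat n) = of_nat n"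
  by (induction n) (auto simp: exp_0 exp_1 exp_add)

lemma exp_inject: "\<phi> x = \<phi> y \<Longrightarrow> x = y"
  using exp_nonzero[of "x - y"] exp_diff[of x y] by auto

lemma exp_divide: "y \<noteq> 0 \<Longrightarrow> \<phi> (x / y) * \<phi> y = \<phi> x"
  using exp_mult[of "x / y" y] by simp

lemma exp_deriv_poly:
  assumes "poly_over kk q" shows "fls_deriv (\<phi> (poly q z)) = \<phi> (poly (pderiv q) z) * fls_deriv (\<phi> z)"
  using assms
proof (induction q)
  case 0 then show ?case by (simp add: exp_0)
next
  case (pCons a q)
  then have a: "a \<in> kk" and q: "poly_over kk q" by (auto simp: poly_over_pCons[OF kk])
  show ?case
    by (simp add: pderiv_pCons exp_add exp_mult exp_const[OF a] pCons.IH[OF q] algebra_simps)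
qed

end

text \<open>Differentiating a minimal relation \<open>P(z, x) = 0\<close> gives \<open>y\<close> as minus the quotient of the partial
  derivatives of \<open>P\<close>, the same element at every place.\<close>

lemma ex_derivative:
  assumes z: "z \<notin> kk"
  shows "\<exists>y. \<forall>p \<phi>. expansion p \<phi> \<longrightarrow> fls_deriv (\<phi> x) = \<phi> y * fls_deriv (\<phi> z)"
proof -
  define rel where "rel n = (\<exists>q. (\<forall>j. poly_over kk (q j)) \<and> q n \<noteq> 0 \<and> (\<Sum>j\<le>n. poly (q j) z * x ^ j) = 0)" for n :: nat
  have "\<exists>n. rel n"
  proof -
    obtain A :: nat and q where q: "\<forall>j. poly_over kk (q j)" "\<exists>j\<le>A. q j \<noteq> 0" "(\<Sum>j\<le>A. poly (q j) z * x ^ j) = 0"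
      using algebraic_relation[of z x] by blast
    define n where "n = Max {j. j \<le> A \<and> q j \<noteq> 0}"
    have fin: "finite {j. j \<le> A \<and> q j \<noteq> 0}" by simp
    have "n \<in> {j. j \<le> A \<and> q j \<noteq> 0}" unfolding n_def by (rule Max_in[OF fin]) (use q(2) in auto)
    then have n: "n \<le> A" "q n \<noteq> 0" by auto
    have "q j = 0" if "n < j" "j \<le> A" for j
    proof (rule ccontr)
      assume "q j \<noteq> 0"
      then have "j \<in> {j. j \<le> A \<and> q j \<noteq> 0}" using that by simp
      from Max_ge[OF fin this] that(1) show False by (simp add: n_def)
    qed
    then have "(\<Sum>j\<le>n. poly (q j) z * x ^ j) = (\<Sum>j\<le>A. poly (q j) z * x ^ j)"
      using n(1) by (intro sum.mono_neutral_left) auto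
    then have "rel n" unfolding rel_def using q n by (intro exI[of _ q]) auto
    then show ?thesis by blast
  qed
  then have rl: "rel (LEAST n. rel n)" by (rule LeastI_ex)
  define n where "n = (LEAST n. rel n)"
  have min: "\<not> rel m" if "m < n" for m using that not_less_Least by (auto simp: n_def)
  obtain q where q: "\<And>j. poly_over kk (q j)" "q n \<noteq> 0" "(\<Sum>j\<le>n. poly (q j) z * x ^ j) = 0"
    using rl[folded n_def] by (auto simp: rel_def)
  have n0: "n \<noteq> 0" using q poly_nonconst[OF z] by (cases n) auto
  define Sx where "Sx = (\<Sum>j\<le>n. poly (q j) z * (of_nat j * x ^ (j - 1)))"
  define Sz where "Sz = (\<Sum>j\<le>n. poly (pderiv (q j)) z * x ^ j)"
  \<comment> \<open>Otherwise \<open>Sx\<close> would itself be a relation of degree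
    \<open>n - 1\<close> in \<open>x\<close>; its top coefficient is \<open>n\<close> times the old
    one and thus nonzero in characteristic zero.\<close>
  have Sx0: "Sx \<noteq> 0"
  proof
    assume S: "Sx = 0"
    have "(\<Sum>j\<le>n - 1. poly (Polynomial.smult (of_nat (Suc j)) (q (Suc j))) z * x ^ j) = (\<Sum>j\<le>n - 1. poly (q (Suc j)) z * (of_nat (Suc j) * x ^ (Suc j - 1)))"
      by (intro sum.cong refl) (simp add: mult_ac)
    also have "\<dots> = (\<Sum>j=Suc 0..Suc (n - 1). poly (q j) z * (of_nat j * x ^ (j - 1)))"
      unfolding sum.shift_bounds_cl_Suc_ivl by (simp add: atMost_atLeast0)
    also have "\<dots> = Sx" unfolding Sx_def using n0 by (simp add: atMost_atLeast0 sum.atLeast_Suc_atMost)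
    finally have "(\<Sum>j\<le>n - 1. poly (Polynomial.smult (of_nat (Suc j)) (q (Suc j))) z * x ^ j) = 0" using S by simp
    moreover have "Polynomial.smult (of_nat (Suc (n - 1))) (q (Suc (n - 1))) \<noteq> 0" using q(2) n0 by (simp del: of_nat_Suc)
    moreover have "\<forall>j. poly_over kk (Polynomial.smult (of_nat (Suc j)) (q (Suc j)))"
      using q(1) by (auto intro: poly_over_smult[OF kk] subfield_of_nat[OF kk] simp del: of_nat_Suc)
    ultimately have "rel (n - 1)" unfolding rel_def
      by (intro exI[of _ "\<lambda>j. Polynomial.smult (of_nat (Suc j)) (q (Suc j))"] conjI)
    then show False using min[of "n - 1"] n0 by simp
  qed
  have "fls_deriv (\<phi> x) = \<phi> (- Sz / Sx) * fls_deriv (\<phi> z)" if \<phi>: "expansion p \<phi>" for p \<phi>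
  proof -
    note ex = exp_add[OF \<phi>] exp_mult[OF \<phi>] exp_power[OF \<phi>] exp_of_nat[OF \<phi>]
    have "0 = fls_deriv (\<phi> (\<Sum>j\<le>n. poly (q j) z * x ^ j))" using q(3) exp_0[OF \<phi>] by simp
    also have "\<dots> = (\<Sum>j\<le>n. fls_deriv (\<phi> (poly (q j) z) * \<phi> x ^ j))"
      by (simp add: exp_sum[OF \<phi>] ex fls_deriv_sum)
    also have "\<dots> = (\<Sum>j\<le>n. \<phi> (poly (q j) z * (of_nat j * x ^ (j - 1))) * fls_deriv (\<phi> x) + \<phi> (poly (pderiv (q j)) z * x ^ j) * fls_deriv (\<phi> z))"
      by (intro sum.cong refl) (simp add: exp_deriv_poly[OF \<phi> q(1)] fls_deriv_power ex algebra_simps)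
    also have "\<dots> = \<phi> Sx * fls_deriv (\<phi> x) + \<phi> Sz * fls_deriv (\<phi> z)"
      by (simp add: Sx_def Sz_def exp_sum[OF \<phi>] sum.distrib sum_distrib_right)
    finally have 1: "\<phi> Sx * fls_deriv (\<phi> x) = - (\<phi> Sz * fls_deriv (\<phi> z))" by (simp add: eq_neg_iff_add_eq_0)
    have "\<phi> Sx * (\<phi> (- Sz / Sx) * fls_deriv (\<phi> z)) = (\<phi> (- Sz / Sx) * \<phi> Sx) * fls_deriv (\<phi> z)" by (simp only: mult_ac)
    also have "\<dots> = \<phi> Sx * fls_deriv (\<phi> x)" unfolding exp_divide[OF \<phi> Sx0] 1 exp_uminus[OF \<phi>] by simp
    finally show ?thesis using exp_nonzero[OF \<phi> Sx0] by simp
  qed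
  then show ?thesis by blast
qed

end

context cover
begin

text \<open>The derivation \<open>d/dz\<close>. Since every expansion is injective and the
  derivative of \<open>z\<close> is nonzero in it, any single expansion determines the chosen
  value.\<close>

definition D :: "'K \<Rightarrow> 'K" where
  "D x = (SOME y. \<forall>p \<phi>. expansion p \<phi> \<longrightarrow> fls_deriv (\<phi> x) = \<phi> y * fls_deriv (\<phi> z))"

lemma D: "expansion p \<phi> \<Longrightarrow> fls_deriv (\<phi> x) = \<phi> (D x) * fls_deriv (\<phi> z)"
  using someI_ex[OF ex_derivative[OF z, of x]] unfolding D_def by blast

lemma exp_deriv_z: "expansion p \<phi> \<Longrightarrow> fls_deriv (\<phi> z) \<noteq> 0"
  using exp_deriv_0 z by blast

lemma ex_some_expansion: "\<exists>p \<phi>. Pl p \<and> expansion p \<phi>"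
  using ex_place_inf ex_expansion by blast

lemma D_eqI:
  assumes "\<And>p \<phi>. expansion p \<phi> \<Longrightarrow> fls_deriv (\<phi> x) = \<phi> y * fls_deriv (\<phi> z)" shows "D x = y"
proof -
  obtain p \<phi> where \<phi>: "expansion p \<phi>" using ex_some_expansion by blast
  have "\<phi> (D x) * fls_deriv (\<phi> z) = \<phi> y * fls_deriv (\<phi> z)" using D[OF \<phi>] assms[OF \<phi>] by metis
  then have "\<phi> (D x) = \<phi> y" using exp_deriv_z[OF \<phi>] by simp
  then show ?thesis by (rule exp_inject[OF \<phi>])
qed

lemma D_add: "D (x + y) = D x + D y"
proof (rule D_eqI)
  fix p \<phi> assume \<phi>: "expansion p \<phi>"
  show "fls_deriv (\<phi> (x + y)) = \<phi> (D x + D y) * fls_deriv (\<phi> z)"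
    unfolding exp_add[OF \<phi>] fls_deriv_add D[OF \<phi>, of x] D[OF \<phi>, of y] by (simp add: algebra_simps)
qed

lemma D_mult: "D (x * y) = x * D y + D x * y"
proof (rule D_eqI)
  fix p \<phi> assume \<phi>: "expansion p \<phi>"
  show "fls_deriv (\<phi> (x * y)) = \<phi> (x * D y + D x * y) * fls_deriv (\<phi> z)"
    unfolding exp_add[OF \<phi>] exp_mult[OF \<phi>] fls_deriv_mult D[OF \<phi>, of x] D[OF \<phi>, of y] by (simp add: algebra_simps)
qed

lemma D_const: "c \<in> kk \<Longrightarrow> D c = 0"
proof (rule D_eqI)
  fix p \<phi> assume \<phi>: "expansion p \<phi>" and c: "c \<in> kk"
  show "fls_deriv (\<phi> c) = \<phi> 0 * fls_deriv (\<phi> z)" unfolding exp_const[OF \<phi> c] exp_0[OF \<phi>] by simp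
qed

lemma D_eq_0: assumes "D x = 0" shows "x \<in> kk"
proof -
  obtain p \<phi> where \<phi>: "expansion p \<phi>" using ex_some_expansion by blast
  have "fls_deriv (\<phi> x) = 0" using D[OF \<phi>, of x] assms exp_0[OF \<phi>] by simp
  then show ?thesis by (rule exp_deriv_0[OF \<phi>])
qed

lemma D_0: "D 0 = 0" by (rule D_const[OF subfield_0[OF kk]])

lemma D_sum: "D (sum f I) = (\<Sum>i\<in>I. D (f i))"
  by (induction I rule: infinite_finite_induct) (auto simp: D_0 D_add)

text \<open>The order of \<open>dz\<close> at a place.\<close>

definition \<delta> :: "('K \<Rightarrow> int) \<Rightarrow> int" where "\<delta> p = (if p z < 0 then p z - 1 else ram p - 1)"

lemma exp_deriv_z_subdegree:
  assumes p: "Pl p" and \<phi>: "expansion p \<phi>" shows "fls_subdegree (fls_deriv (\<phi> z)) = \<delta> p"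
proof (cases "p z < 0")
  case True
  then show ?thesis using exp_subdegree[OF \<phi> z0] by (simp add: fls_subdegree_deriv \<delta>_def)
next
  case False
  then have r: "res p \<in> kk" "ram p \<ge> 1" using res[OF p] by auto
  have "\<phi> z = \<phi> (z - res p) + fls_const (res p)" using exp_add[OF \<phi>, of "z - res p" "res p"] exp_const[OF \<phi> r(1)] by simp
  then have "fls_deriv (\<phi> z) = fls_deriv (\<phi> (z - res p))" by simp
  moreover have "fls_subdegree (\<phi> (z - res p)) = ram p" using exp_subdegree[OF \<phi> zma(2)[OF r(1)]] by (simp add: ram_def)
  ultimately show ?thesis using r(2) False by (simp add: fls_subdegree_deriv \<delta>_def)
qed

text \<open>Differentiating a series by its own variable lowers the order by at most one; division
  by the derivative of \<open>z\<close> costs a further \<open>\<delta> p\<close>.\<close>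

lemma D_order:
  assumes p: "Pl p" and x: "vge p m x" shows "vge p (m - 1 - \<delta> p) (D x)"
proof (cases "D x = 0")
  case False
  obtain \<phi> where \<phi>: "expansion p \<phi>" using ex_expansion[OF p] by (rule exE)
  have x0: "x \<noteq> 0" using False D_0 by metis
  have nz: "fls_deriv (\<phi> x) \<noteq> 0" unfolding D[OF \<phi>, of x] using exp_nonzero[OF \<phi> False] exp_deriv_z[OF \<phi>] by simp
  have 1: "fls_subdegree (fls_deriv (\<phi> x)) = p (D x) + \<delta> p"
    unfolding D[OF \<phi>, of x] using exp_nonzero[OF \<phi> False] exp_deriv_z[OF \<phi>] exp_subdegree[OF \<phi> False] exp_deriv_z_subdegree[OF p \<phi>]
    by simp
  have "fls_subdegree (fls_deriv (\<phi> x)) \<ge> fls_subdegree (\<phi> x) - 1"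
    by (cases "fls_subdegree (\<phi> x) = 0") (auto simp: fls_subdegree_deriv dest: fls_deriv_subdegree0)
  then have "p (D x) + \<delta> p \<ge> p x - 1" using 1 exp_subdegree[OF \<phi> x0] by simp
  then show ?thesis using x x0 by (simp add: vge_def)
qed simp

lemma \<delta>_support: "finite {p. Pl p \<and> \<delta> p \<noteq> 0}"
proof -
  have "{p. Pl p \<and> \<delta> p \<noteq> 0} \<subseteq> {p. Pl p \<and> p z < 0} \<union> {p. Pl p \<and> p z \<ge> 0 \<and> ram p \<ge> 2}"
  proof
    fix p assume "p \<in> {p. Pl p \<and> \<delta> p \<noteq> 0}"
    then have "Pl p" "\<delta> p \<noteq> 0" by auto
    then show "p \<in> {p. Pl p \<and> p z < 0} \<union> {p. Pl p \<and> p z \<ge> 0 \<and> ram p \<ge> 2}"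
      using res(2)[of p] by (cases "p z < 0") (auto simp: \<delta>_def)
  qed
  then show ?thesis by (rule finite_subset[OF _ finite_UnI[OF finite_poles finite_ramified]])
qed

text \<open>The poles of \<open>z\<close> are simple, so there are \<open>N\<close> of them and each
  contributes -2, the term \<open>- 2 * N\<close> in \<open>hurwitz\<close>; the other places
  contribute their ramification.\<close>

lemma \<delta>_sum:
  assumes unram: "\<And>p. Pl p \<Longrightarrow> p z < 0 \<Longrightarrow> p z = -1"
    and T: "finite T" "\<And>p. p \<in> T \<Longrightarrow> Pl p" "\<And>p. Pl p \<Longrightarrow> p z < 0 \<Longrightarrow> p \<in> T"
  shows "(\<Sum>p\<in>T. \<delta> p) \<le> 2 * genus kk - 2"
proof -
  define Y where "Y = {p. Pl p \<and> p z < 0}"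
  have Y: "Y \<subseteq> T"
  proof
    fix p assume "p \<in> Y"
    then show "p \<in> T" by (intro T(3)) (simp_all add: Y_def)
  qed
  have "(\<Sum>p\<in>T. \<delta> p) = (\<Sum>p\<in>T - Y. \<delta> p) + (\<Sum>p\<in>Y. \<delta> p)" by (rule sum.subset_diff[OF Y T(1)])
  also have "(\<Sum>p\<in>Y. \<delta> p) = (\<Sum>p\<in>Y. - 2 * - p z)"
  proof (rule sum.cong[OF refl])
    fix p assume "p \<in> Y"
    then have "p z < 0" "p z = -1" using unram[of p] by (simp_all add: Y_def)
    then show "\<delta> p = - 2 * - p z" by (simp add: \<delta>_def)
  qed
  also have "\<dots> = - 2 * height kk z" unfolding height_def Y_def by (simp only: sum_distrib_left)
  also have "\<dots> = - 2 * int N" using poles_eq_fdeg[OF z] poles_deg by simp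
  also have "(\<Sum>p\<in>T - Y. \<delta> p) = (\<Sum>p\<in>T - Y. ram p - 1)"
  proof (rule sum.cong[OF refl])
    fix p assume "p \<in> T - Y"
    then have "\<not> p z < 0" using T(2)[of p] by (simp add: Y_def)
    then show "\<delta> p = ram p - 1" by (simp add: \<delta>_def)
  qed
  finally have eq: "(\<Sum>p\<in>T. \<delta> p) = (\<Sum>p\<in>T - Y. ram p - 1) + - 2 * int N" .
  have "(\<Sum>p\<in>T - Y. ram p - 1) - 2 * int N \<le> 2 * genus kk - 2"
  proof (rule hurwitz)
    show "finite (T - Y)" using T(1) by simp
    fix p assume "p \<in> T - Y"
    then show "Pl p \<and> p z \<ge> 0" using T(2)[of p] by (auto simp: Y_def)
  qed
  then show ?thesis unfolding eq by simp
qed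

end

section \<open>Wronskians\<close>

text \<open>Sorted, distinct integers from \<open>m\<close> on exceed \<open>m\<close> by at least
  0, 1, 2 and so on. This triangular gain offsets the differentiations in the Wronskian at places
  outside \<open>S\<close>.\<close>

lemma sum_distinct_ge:
  fixes S :: "int set"
  assumes "finite S" "\<And>s. s \<in> S \<Longrightarrow> m \<le> s"
  shows "int (card S) * m + (\<Sum>j<card S. int j) \<le> \<Sum>S"
  using assms
proof (induction "card S" arbitrary: S)
  case 0
  then show ?case by simp
next
  case (Suc n)
  then have ne: "S \<noteq> {}" by auto
  define x where "x = Max S"
  have x: "x \<in> S" "\<And>s. s \<in> S \<Longrightarrow> s \<le> x" using Suc.prems(1) ne by (auto simp: x_def)
  have "S \<subseteq> {m..x}" using Suc.prems(2) x(2) by auto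
  then have "card S \<le> card {m..x}" by (intro card_mono) auto
  then have "int (Suc n) \<le> x - m + 1" using Suc.hyps(2) Suc.prems(2)[OF x(1)] by simp
  moreover have "n = card (S - {x})" using Suc.hyps(2) x(1) Suc.prems(1) by simp
  then have "int n * m + (\<Sum>j<n. int j) \<le> \<Sum>(S - {x})"
    using Suc.hyps(1)[of "S - {x}"] Suc.prems by simp
  moreover have "\<Sum>S = x + \<Sum>(S - {x})" using Suc.prems(1) x(1) by (rule sum.remove)
  ultimately show ?case unfolding Suc.hyps(2)[symmetric] by (simp add: algebra_simps)
qed

context function_field
begin

lemma vge_prod:
  "Pl p \<Longrightarrow> (\<And>i. i \<in> I \<Longrightarrow> vge p (m i) (f i)) \<Longrightarrow> vge p (\<Sum>i\<in>I. m i) (\<Prod>i\<in>I. f i)"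
proof (induction I rule: infinite_finite_induct)
  case (insert i I)
  have "vge p (m i + (\<Sum>i\<in>I. m i)) (f i * (\<Prod>i\<in>I. f i))"
    by (rule vge_mult) (use insert in auto)
  then show ?case using insert by simp
qed (auto simp: vge_def place_1)

lemma fdet_in_kk:
  assumes "\<And>i j. i < M \<Longrightarrow> j < M \<Longrightarrow> a i j \<in> kk" shows "fdet M a \<in> kk"
  unfolding fdet_leibniz
proof (intro subfield_sum[OF kk] subfield_mult[OF kk] subfield_prod[OF kk])
  fix \<sigma> i assume \<sigma>: "\<sigma> \<in> {\<sigma>. \<sigma> permutes {0..<M}}"
  show "of_int (sign \<sigma>) \<in> kk" using subfield_1[OF kk] subfield_uminus[OF kk] by (auto simp: sign_def)
  assume "i \<in> {0..<M}"
  then show "a i (\<sigma> i) \<in> kk" using \<sigma> permutes_in_image[of \<sigma> "{0..<M}" i] by (intro assms) auto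
qed

lemma lin_nondeg_distinct:
  assumes p: "Pl p" and I: "finite I" and f: "\<And>i. i \<in> I \<Longrightarrow> f i \<noteq> 0" "inj_on (\<lambda>i. p (f i)) I"
  shows "lin_nondeg kk I f"
proof (rule lin_nondegI, rule ccontr)
  fix a i assume a: "\<And>i. i \<in> I \<Longrightarrow> a i \<in> kk" "(\<Sum>i\<in>I. a i * f i) = 0" "i \<in> I" "a i \<noteq> 0"
  define J where "J = {i \<in> I. a i \<noteq> 0}"
  have J: "finite J" "J \<noteq> {}" using I a by (auto simp: J_def)
  define v where "v = Min ((\<lambda>i. p (f i)) ` J)"
  have "v \<in> (\<lambda>i. p (f i)) ` J" unfolding v_def using J by (intro Min_in) auto
  then obtain j where j: "j \<in> J" "p (f j) = v" by auto
  have jI: "j \<in> I" "a j \<noteq> 0" using j by (auto simp: J_def)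
  have "vge p (v + 1) (a k * f k)" if k: "k \<in> I - {j}" for k
  proof (cases "a k = 0")
    case False
    then have "p (f k) \<ge> v" unfolding v_def using J k by (intro Min_le) (auto simp: J_def)
    moreover have "p (f k) \<noteq> p (f j)" using inj_onD[OF f(2), of k j] k jI by auto
    ultimately have "vge p (v + 1) (f k)" using j by (auto simp: vge_def)
    then show ?thesis using a(1) k by (intro vge_cmult[OF p]) auto
  qed simp
  then have "vge p (v + 1) (\<Sum>k\<in>I - {j}. a k * f k)" by (intro vge_sum[OF p])
  moreover have "a j * f j + (\<Sum>k\<in>I - {j}. a k * f k) = 0" using a(2) sum.remove[OF I jI(1), of "\<lambda>k. a k * f k"] by simp
  then have "a j * f j = - (\<Sum>k\<in>I - {j}. a k * f k)" by (simp add: eq_neg_iff_add_eq_0)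
  ultimately have "vge p (v + 1) (a j * f j)" using vge_uminus[OF p] by metis
  then have "v + 1 \<le> p (a j * f j)" using f(1)[OF jI(1)] jI(2) by (simp add: vge_def)
  moreover have "p (a j * f j) = p (a j) + p (f j)" by (rule place_mult[OF p jI(2) f(1)[OF jI(1)]])
  moreover have "p (a j) = 0" by (rule place_const[OF p a(1)[OF jI(1)]])
  ultimately show False using j by simp
qed

text \<open>As long as the order of \<open>x\<close> is taken by some \<open>f j\<close>,
  subtracting a constant multiple of \<open>f j\<close> raises it. The number of members of at least
  that order then drops, so the process stops.\<close>

lemma reduce_valuation:
  fixes M :: nat
  assumes p: "Pl p" and V: "subspace_over kk V" and f: "\<And>j. j < M \<Longrightarrow> f j \<in> V \<and> f j \<noteq> 0"
    and x: "x \<notin> V"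
  shows "\<exists>u\<in>V. p (x - u) \<notin> (\<lambda>j. p (f j)) ` {..<M}"
  using x
proof (induction "card {j. j < M \<and> p (f j) \<ge> p x}" arbitrary: x rule: less_induct)
  case less
  show ?case
  proof (cases "p x \<in> (\<lambda>j. p (f j)) ` {..<M}")
    case False
    then show ?thesis using V by (intro bexI[of _ 0]) (auto simp: subspace_over_def)
  next
    case True
    then obtain j where j: "j < M" "p x = p (f j)" by auto
    have x0: "x \<noteq> 0" using less.prems V by (auto simp: subspace_over_def)
    have fj: "f j \<in> V" "f j \<noteq> 0" using f[OF j(1)] by auto
    have "vge p 0 (x / f j)" using place_divide[OF p x0 fj(2)] j by (simp add: vge_def)
    then obtain c where c: "c \<in> kk" "vge p 1 (x / f j - c)" using residue[OF p] by blast
    define x' where "x' = x - c * f j"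
    have cf: "c * f j \<in> V" using V c(1) fj(1) by (simp add: subspace_over_def)
    have x'V: "x' \<notin> V"
    proof
      assume "x' \<in> V"
      then have "x' + c * f j \<in> V" using V cf unfolding subspace_over_def by metis
      then show False using less.prems by (simp add: x'_def)
    qed
    have x'0: "x' \<noteq> 0" using x'V V by (auto simp: subspace_over_def)
    have "vge p (1 + p (f j)) ((x / f j - c) * f j)" by (intro vge_mult[OF p c(2)]) (simp add: vge_def)
    moreover have "(x / f j - c) * f j = x'" using fj(2) by (simp add: x'_def field_simps)
    ultimately have px': "p x' > p x" using x'0 j by (simp add: vge_def)
    have "{j. j < M \<and> p (f j) \<ge> p x'} \<subset> {j. j < M \<and> p (f j) \<ge> p x}"
    proof
      show "{j. j < M \<and> p (f j) \<ge> p x'} \<subseteq> {j. j < M \<and> p (f j) \<ge> p x}" using px' by auto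
      have "j \<in> {j. j < M \<and> p (f j) \<ge> p x}" "j \<notin> {j. j < M \<and> p (f j) \<ge> p x'}" using j px' by auto
      then show "{j. j < M \<and> p (f j) \<ge> p x'} \<noteq> {j. j < M \<and> p (f j) \<ge> p x}" by metis
    qed
    then have "card {j. j < M \<and> p (f j) \<ge> p x'} < card {j. j < M \<and> p (f j) \<ge> p x}" by (rule psubset_card_mono[rotated]) simp
    from less.hyps[OF this x'V] obtain u where u: "u \<in> V" "p (x' - u) \<notin> (\<lambda>j. p (f j)) ` {..<M}" by blast
    have "c * f j + u \<in> V" using V cf u(1) unfolding subspace_over_def by metis
    moreover have "x - (c * f j + u) = x' - u" by (simp add: x'_def)
    ultimately show ?thesis using u(2) by metis
  qed
qed

lemma espan_mono_lessThan:
  fixes M :: nat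
  assumes "y \<in> espan kk {..<M} f" shows "y \<in> espan kk {..<Suc M} f"
proof -
  obtain c where c: "\<forall>i\<in>{..<M}. c i \<in> kk" "y = (\<Sum>i<M. c i * f i)" using assms by (auto simp: espan_def)
  have "(\<Sum>i<M. (if i < M then c i else 0) * f i) = y" unfolding c(2) by (intro sum.cong) auto
  then have "y = (\<Sum>i<Suc M. (if i < M then c i else 0) * f i)" by simp
  then show ?thesis unfolding espan_def using c(1) subfield_0[OF kk]
    by (intro CollectI exI[of _ "\<lambda>i. if i < M then c i else 0"]) auto
qed

lemma adapted_basis:
  fixes M :: nat
  assumes p: "Pl p" and f: "lin_nondeg kk {..<M} f"
  shows "\<exists>f'. (\<forall>j<M. f' j \<in> espan kk {..<M} f \<and> f' j \<noteq> 0) \<and> inj_on (\<lambda>j. p (f' j)) {..<M}"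
  using f
proof (induction M)
  case (Suc M)
  have ndM: "lin_nondeg kk {..<M} f" by (rule lin_nondeg_subset[OF kk Suc.prems]) auto
  obtain f' where f': "\<And>j. j < M \<Longrightarrow> f' j \<in> espan kk {..<M} f \<and> f' j \<noteq> 0" "inj_on (\<lambda>j. p (f' j)) {..<M}"
    using Suc.IH[OF ndM] by blast
  have fM: "f M \<notin> espan kk {..<M} f"
  proof
    assume "f M \<in> espan kk {..<M} f"
    then obtain c where c: "\<forall>i\<in>{..<M}. c i \<in> kk" "f M = (\<Sum>i<M. c i * f i)" by (auto simp: espan_def)
    define a where "a i = (if i < M then c i else - 1)" for i
    have "(\<Sum>i<M. a i * f i) = f M" unfolding c(2) by (intro sum.cong) (auto simp: a_def)
    then have 0: "(\<Sum>i<Suc M. a i * f i) = 0" by (simp add: a_def)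
    have "a i \<in> kk" for i using c(1) subfield_uminus[OF kk subfield_1[OF kk]] by (auto simp: a_def)
    from lin_nondegD[OF Suc.prems this 0, of M] show False by (simp add: a_def)
  qed
  have "\<exists>u\<in>espan kk {..<M} f. p (f M - u) \<notin> (\<lambda>j. p (f' j)) ` {..<M}"
    by (rule reduce_valuation[OF p espan_subspace[OF kk] _ fM]) (use f'(1) in blast)
  then obtain u where u: "u \<in> espan kk {..<M} f" "p (f M - u) \<notin> (\<lambda>j. p (f' j)) ` {..<M}" by blast
  have nz: "f M - u \<noteq> 0" using fM u(1) by auto
  have V: "subspace_over kk (espan kk {..<Suc M} f)" by (rule espan_subspace[OF kk])
  have "- 1 * u \<in> espan kk {..<Suc M} f"
    using V espan_mono_lessThan[OF u(1)] subfield_uminus[OF kk subfield_1[OF kk]] unfolding subspace_over_def by metis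
  moreover have "f M \<in> espan kk {..<Suc M} f" by (rule espan_base[OF kk]) auto
  ultimately have "f M + - 1 * u \<in> espan kk {..<Suc M} f" using V unfolding subspace_over_def by metis
  then have mem: "f M - u \<in> espan kk {..<Suc M} f" by simp
  have "inj_on (\<lambda>j. p ((f'(M := f M - u)) j)) {..<Suc M}"
    unfolding lessThan_Suc inj_on_insert
  proof
    show "inj_on (\<lambda>j. p ((f'(M := f M - u)) j)) {..<M}"
      using f'(2) by (simp add: inj_on_def)
    show "p ((f'(M := f M - u)) M) \<notin> (\<lambda>j. p ((f'(M := f M - u)) j)) ` ({..<M} - {M})"
      using u(2) by (auto simp: image_iff)
  qed
  moreover have "(f'(M := f M - u)) j \<in> espan kk {..<Suc M} f \<and> (f'(M := f M - u)) j \<noteq> 0" if "j < Suc M" for j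
    using that f'(1)[of j] espan_mono_lessThan[of "f' j" M f] mem nz by (cases "j = M") auto
  ultimately show ?case by blast
qed simp

lemma vge_espan:
  assumes p: "Pl p" and "\<And>i. i \<in> I \<Longrightarrow> vge p m (f i)" "y \<in> espan kk I f" shows "vge p m y"
proof -
  obtain c where c: "\<forall>i\<in>I. c i \<in> kk" "y = (\<Sum>i\<in>I. c i * f i)" using assms(3) by (auto simp: espan_def)
  show ?thesis unfolding c(2) using c(1) assms(2) by (intro vge_sum[OF p] vge_cmult[OF p]) auto
qed

end

section \<open>The Wronskian and its orders\<close>

context cover
begin

lemma D_minus_const: "c \<in> kk \<Longrightarrow> D (c * x) = c * D x"
  by (simp add: D_mult D_const)

lemma Dpow_lincomb:
  "(\<And>l. l \<in> I \<Longrightarrow> c l \<in> kk) \<Longrightarrow> (D ^^ i) (\<Sum>l\<in>I. c l * f l) = (\<Sum>l\<in>I. c l * (D ^^ i) (f l))"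
  by (induction i) (simp_all add: D_sum D_minus_const)

lemma Dpow_order:
  assumes p: "Pl p" and x: "vge p m x" shows "vge p (m - int i * (1 + \<delta> p)) ((D ^^ i) x)"
proof (induction i)
  case (Suc i)
  from D_order[OF p Suc] show ?case by (simp add: algebra_simps)
qed (use x in simp)

text \<open>Differentiating a relation among the columns of the Wronskian matrix, normalised at its
  last entry, produces a shorter one unless the coefficients are constants.\<close>

lemma wronskian_kernel:
  assumes "lin_nondeg kk {..<M} f" "\<And>i. i < M \<Longrightarrow> (\<Sum>j<M. c j * (D ^^ i) (f j)) = 0" "j < M"
  shows "c j = 0"
  using assms
proof (induction M arbitrary: c j)
  case (Suc M)
  have ndM: "lin_nondeg kk {..<M} f" by (rule lin_nondeg_subset[OF kk Suc.prems(1)]) auto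
  show ?case
  proof (cases "c M = 0")
    case True
    have "(\<Sum>j<M. c j * (D ^^ i) (f j)) = 0" if "i < M" for i using Suc.prems(2)[of i] that True by simp
    then have "c j = 0" if "j < M" for j using Suc.IH[OF ndM, of c j] that by blast
    then show ?thesis using True Suc.prems(3) by (cases "j = M") auto
  next
    case False
    define b where "b j = c j / c M" for j
    have b: "(\<Sum>j<Suc M. b j * (D ^^ i) (f j)) = 0" if "i < Suc M" for i
    proof -
      have "(\<Sum>j<Suc M. b j * (D ^^ i) (f j)) = (\<Sum>j<Suc M. c j * (D ^^ i) (f j)) / c M"
        by (simp only: b_def sum_divide_distrib times_divide_eq_left)
      then show ?thesis using Suc.prems(2)[OF that] by simp
    qed
    have bM: "b M = 1" using False by (simp add: b_def)
    have Db: "(\<Sum>j<M. D (b j) * (D ^^ i) (f j)) = 0" if i: "i < M" for i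
    proof -
      have "0 = D (\<Sum>j<Suc M. b j * (D ^^ i) (f j))" using b[of i] i D_0 by simp
      also have "\<dots> = (\<Sum>j<Suc M. b j * (D ^^ Suc i) (f j)) + (\<Sum>j<Suc M. D (b j) * (D ^^ i) (f j))"
        unfolding D_sum D_mult sum.distrib by simp
      also have "(\<Sum>j<Suc M. b j * (D ^^ Suc i) (f j)) = 0" using b[of "Suc i"] i by (simp only: Suc_less_eq)
      also have "(\<Sum>j<Suc M. D (b j) * (D ^^ i) (f j)) = (\<Sum>j<M. D (b j) * (D ^^ i) (f j))"
        using bM D_const[OF subfield_1[OF kk]] by simp
      finally show ?thesis by simp
    qed
    have "D (b j) = 0" if "j < M" for j by (rule Suc.IH[OF ndM Db that])
    then have bk: "b j \<in> kk" if "j < Suc M" for j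
      using that D_eq_0 bM subfield_1[OF kk] by (cases "j = M") auto
    have "(\<Sum>j<Suc M. b j * f j) = 0" using b[of 0] by simp
    from lin_nondegD[OF Suc.prems(1) _ this, of M] bk have "b M = 0" by blast
    then show ?thesis using bM by simp
  qed
qed simp

definition wronskian :: "nat \<Rightarrow> (nat \<Rightarrow> 'K) \<Rightarrow> 'K" where "wronskian M f = fdet M (\<lambda>i j. (D ^^ i) (f j))"

lemma wronskian_nonzero:
  assumes "lin_nondeg kk {..<M} f" shows "wronskian M f \<noteq> 0"
  unfolding wronskian_def
proof (rule fdet_nonzero[where E = UNIV])
  show "subfield (UNIV :: 'K set)" by (simp add: subfield_def)
  fix c j assume "\<And>i. i < M \<Longrightarrow> (\<Sum>j<M. (D ^^ i) (f j) * c j) = 0" "j < M"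
  then show "c j = 0" using wronskian_kernel[OF assms, of c j] by (simp add: mult.commute)
qed simp

lemma wronskian_order_eq:
  assumes p: "Pl p" and f: "lin_nondeg kk {..<M} f" and g: "lin_nondeg kk {..<M} g"
    and gf: "\<And>j. j < M \<Longrightarrow> g j \<in> espan kk {..<M} f"
  shows "p (wronskian M g) = p (wronskian M f)"
proof -
  have "\<forall>j<M. \<exists>a. (\<forall>l<M. a l \<in> kk) \<and> g j = (\<Sum>l<M. a l * f l)"
  proof (intro allI impI)
    fix j assume "j < M"
    from gf[OF this] obtain a where "\<forall>l\<in>{..<M}. a l \<in> kk" "g j = (\<Sum>l<M. a l * f l)" by (auto simp: espan_def)
    then show "\<exists>a. (\<forall>l<M. a l \<in> kk) \<and> g j = (\<Sum>l<M. a l * f l)" by (intro exI[of _ a]) simp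
  qed
  then obtain a where a: "\<And>j l. j < M \<Longrightarrow> l < M \<Longrightarrow> a j l \<in> kk" "\<And>j. j < M \<Longrightarrow> g j = (\<Sum>l<M. a j l * f l)" by metis
  have eq: "wronskian M g = wronskian M f * fdet M (\<lambda>l j. a j l)"
    unfolding wronskian_def
  proof (rule fdet_mult)
    fix i j assume "i < M" "j < M"
    then show "(D ^^ i) (g j) = (\<Sum>l<M. (D ^^ i) (f l) * a j l)"
      unfolding a(2)[OF \<open>j < M\<close>] using a(1) by (subst Dpow_lincomb) (auto simp: mult.commute)
  qed
  have "fdet M (\<lambda>l j. a j l) \<noteq> 0" using eq wronskian_nonzero[OF g] by auto
  moreover have "fdet M (\<lambda>l j. a j l) \<in> kk" by (rule fdet_in_kk) (use a(1) in blast)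
  ultimately show ?thesis unfolding eq using place_mult[OF p wronskian_nonzero[OF f]] place_const[OF p] by simp
qed

text \<open>In every Leibniz term each column \<open>j\<close> appears once and contributes
  \<open>m j\<close>, and the row of \<open>i\<close>-th derivatives loses
  \<open>i * (1 + \<delta> p)\<close>, whatever the permutation.\<close>

lemma wronskian_order:
  assumes p: "Pl p" and f: "\<And>j. j < M \<Longrightarrow> vge p (m j) (f j)"
  shows "vge p ((\<Sum>j<M. m j) - (1 + \<delta> p) * (\<Sum>j<M. int j)) (wronskian M f)"
  unfolding wronskian_def fdet_leibniz
proof (rule vge_sum[OF p])
  fix \<sigma> assume \<sigma>: "\<sigma> \<in> {\<sigma>. \<sigma> permutes {0..<M}}"
  have "of_int (sign \<sigma>) \<in> kk" using subfield_1[OF kk] subfield_uminus[OF kk] by (auto simp: sign_def)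
  moreover have "vge p (\<Sum>i = 0..<M. m (\<sigma> i) - int i * (1 + \<delta> p)) (\<Prod>i = 0..<M. (D ^^ i) (f (\<sigma> i)))"
  proof (rule vge_prod[OF p])
    fix i assume "i \<in> {0..<M}"
    then have "\<sigma> i < M" using \<sigma> permutes_in_image[of \<sigma> "{0..<M}" i] by simp
    then show "vge p (m (\<sigma> i) - int i * (1 + \<delta> p)) ((D ^^ i) (f (\<sigma> i)))" by (intro Dpow_order[OF p f])
  qed
  moreover have "(\<Sum>i = 0..<M. m (\<sigma> i) - int i * (1 + \<delta> p)) = (\<Sum>j<M. m j) - (1 + \<delta> p) * (\<Sum>j<M. int j)"
    using sum.permute[of \<sigma> "{0..<M}" m] \<sigma>
    by (simp add: sum_subtractf sum_distrib_right[symmetric] lessThan_atLeast0 o_def mult.commute)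
  ultimately show "vge p ((\<Sum>j<M. m j) - (1 + \<delta> p) * (\<Sum>j<M. int j)) (of_int (sign \<sigma>) * (\<Prod>i = 0..<M. (D ^^ i) (f (\<sigma> i))))"
    using vge_cmult[OF p] by metis
qed

text \<open>A basis with distinct orders wins back one unit per differentiation by
  \<open>sum_distinct_ge\<close>; only the loss caused by \<open>dz\<close> remains.\<close>

lemma wronskian_order_outside:
  assumes p: "Pl p" and f: "lin_nondeg kk {..<M} f" "\<And>j. j < M \<Longrightarrow> vge p e (f j)"
  shows "int M * e - \<delta> p * (\<Sum>j<M. int j) \<le> p (wronskian M f)"
proof -
  obtain f' where f': "\<And>j. j < M \<Longrightarrow> f' j \<in> espan kk {..<M} f \<and> f' j \<noteq> 0" "inj_on (\<lambda>j. p (f' j)) {..<M}"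
    using adapted_basis[OF p f(1)] by blast
  have nd: "lin_nondeg kk {..<M} f'" by (rule lin_nondeg_distinct[OF p _ _ f'(2)]) (use f'(1) in auto)
  have eq: "p (wronskian M f') = p (wronskian M f)" by (rule wronskian_order_eq[OF p f(1) nd]) (use f'(1) in blast)
  have "vge p ((\<Sum>j<M. p (f' j)) - (1 + \<delta> p) * (\<Sum>j<M. int j)) (wronskian M f')"
    by (rule wronskian_order[OF p]) (simp add: vge_def)
  then have 1: "(\<Sum>j<M. p (f' j)) - (1 + \<delta> p) * (\<Sum>j<M. int j) \<le> p (wronskian M f)"
    using wronskian_nonzero[OF nd] eq by (simp add: vge_def)
  define S where "S = (\<lambda>j. p (f' j)) ` {..<M}"
  have S: "finite S" "card S = M" "\<Sum>S = (\<Sum>j<M. p (f' j))"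
    unfolding S_def using card_image[OF f'(2)] sum.reindex[OF f'(2), of "\<lambda>x. x"] by (auto simp: o_def)
  have "e \<le> s" if s: "s \<in> S" for s
  proof -
    obtain j where j: "j < M" "s = p (f' j)" using s by (auto simp: S_def)
    have "vge p e (f' j)" by (rule vge_espan[OF p _ conjunct1[OF f'(1)[OF j(1)]]]) (use f(2) in simp)
    then show ?thesis using f'(1)[OF j(1)] j by (simp add: vge_def)
  qed
  from sum_distinct_ge[OF S(1) this] have "int M * e + (\<Sum>j<M. int j) \<le> (\<Sum>j<M. p (f' j))" using S by simp
  then show ?thesis using 1 by (simp add: algebra_simps)
qed

end

context function_field
begin

text \<open>The orders of the Wronskian sum to zero. Per differentiation the loss is
  \<open>\<delta> p\<close> at every place and one more on \<open>S\<close>, hence the sum of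
  \<open>\<delta>\<close> plus \<open>card S\<close>. The divisor \<open>e\<close> bounds the
  members only outside \<open>S\<close>, so its part on \<open>S\<close> is taken off its
  degree.\<close>

lemma wronskian_inequality:
  assumes f: "lin_nondeg kk {..<M} f"
    and S: "finite S" "\<And>p. p \<in> S \<Longrightarrow> Pl p"
    and b: "\<And>p. p \<in> S \<Longrightarrow> lin_nondeg kk {..<M} (b p)"
      "\<And>p j. p \<in> S \<Longrightarrow> j < M \<Longrightarrow> b p j \<in> espan kk {..<M} f"
      "\<And>p j. p \<in> S \<Longrightarrow> j < M \<Longrightarrow> vge p (m p j) (b p j)"
    and e: "divisor kk e" "\<And>p j. Pl p \<Longrightarrow> p \<notin> S \<Longrightarrow> j < M \<Longrightarrow> vge p (e p) (f j)"
  shows "(\<Sum>p\<in>S. \<Sum>j<M. m p j) + int M * (div_deg kk e - (\<Sum>p\<in>S. e p)) \<le>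
    (\<Sum>j<M. int j) * (2 * genus kk - 2 + int (card S))"
proof -
  obtain z where zk: "z \<notin> kk" and unram: "\<And>p. Pl p \<Longrightarrow> p z < 0 \<Longrightarrow> p z = -1" using ex_unramified_at_infinity by blast
  interpret cover kk z by unfold_locales (rule zk)
  define m2 where "m2 = (\<Sum>j<M. int j)"
  define w where "w = wronskian M f"
  define T where "T = S \<union> {p. Pl p \<and> p w \<noteq> 0} \<union> {p. Pl p \<and> e p \<noteq> 0} \<union> {p. Pl p \<and> p z < 0}"
  have finT: "finite T" using S(1) finite_support[of w] finite_poles[of z] e(1) by (simp add: T_def divisor_def)
  have TPl: "Pl p" if "p \<in> T" for p using that S(2) unfolding T_def by blast
  have ST: "S \<subseteq> T" unfolding T_def by blast
  have w0: "w \<noteq> 0" unfolding w_def by (rule wronskian_nonzero[OF f])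
  have "p w = 0" if "Pl p" "p \<notin> T" for p using that unfolding T_def by blast
  then have "(\<Sum>p\<in>T. p w) = 0" by (intro product_formula[OF finT TPl])
  moreover have "(\<Sum>p\<in>T. p w) = (\<Sum>p\<in>T - S. p w) + (\<Sum>p\<in>S. p w)" by (rule sum.subset_diff[OF ST finT])
  ultimately have 0: "(\<Sum>p\<in>T - S. p w) + (\<Sum>p\<in>S. p w) = 0" by simp
  have inS: "(\<Sum>j<M. m p j) - (1 + \<delta> p) * m2 \<le> p w" if p: "p \<in> S" for p
  proof -
    have "vge p ((\<Sum>j<M. m p j) - (1 + \<delta> p) * m2) (wronskian M (b p))" unfolding m2_def
      by (rule wronskian_order[OF S(2)[OF p] b(3)[OF p]])
    then have "(\<Sum>j<M. m p j) - (1 + \<delta> p) * m2 \<le> p (wronskian M (b p))" using wronskian_nonzero[OF b(1)[OF p]] by (simp add: vge_def)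
    also have "p (wronskian M (b p)) = p w" unfolding w_def by (rule wronskian_order_eq[OF S(2)[OF p] f b(1)[OF p] b(2)[OF p]])
    finally show ?thesis .
  qed
  have outS: "int M * e p - \<delta> p * m2 \<le> p w" if p: "p \<in> T - S" for p
  proof -
    have "Pl p" "p \<notin> S" using p TPl by auto
    then show ?thesis unfolding w_def m2_def using e(2) by (intro wronskian_order_outside f) auto
  qed
  have "(\<Sum>p\<in>S. (\<Sum>j<M. m p j) - (1 + \<delta> p) * m2) + (\<Sum>p\<in>T - S. int M * e p - \<delta> p * m2) \<le> 0"
  proof -
    have "(\<Sum>p\<in>S. (\<Sum>j<M. m p j) - (1 + \<delta> p) * m2) \<le> (\<Sum>p\<in>S. p w)" by (rule sum_mono, rule inS)
    moreover have "(\<Sum>p\<in>T - S. int M * e p - \<delta> p * m2) \<le> (\<Sum>p\<in>T - S. p w)" by (rule sum_mono, rule outS)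
    ultimately show ?thesis using 0 by linarith
  qed
  moreover have "(\<Sum>p\<in>S. (\<Sum>j<M. m p j) - (1 + \<delta> p) * m2) = (\<Sum>p\<in>S. \<Sum>j<M. m p j) - (int (card S) + (\<Sum>p\<in>S. \<delta> p)) * m2"
    by (simp add: sum_subtractf sum_distrib_right[symmetric] sum.distrib)
  moreover have "(\<Sum>p\<in>T - S. int M * e p - \<delta> p * m2) = int M * (\<Sum>p\<in>T - S. e p) - (\<Sum>p\<in>T - S. \<delta> p) * m2"
    by (simp add: sum_subtractf sum_distrib_right[symmetric] sum_distrib_left[symmetric])
  moreover have "(\<Sum>p\<in>T - S. e p) = div_deg kk e - (\<Sum>p\<in>S. e p)"
  proof -
    have "e p = 0" if "Pl p" "p \<notin> T" for p using that unfolding T_def by blast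
    then have "div_deg kk e = (\<Sum>p\<in>T. e p)" by (intro div_deg_eq[OF finT TPl])
    then show ?thesis using sum.subset_diff[OF ST finT, of e] by simp
  qed
  moreover have "(\<Sum>p\<in>T. \<delta> p) = (\<Sum>p\<in>T - S. \<delta> p) + (\<Sum>p\<in>S. \<delta> p)" by (rule sum.subset_diff[OF ST finT])
  ultimately have main: "(\<Sum>p\<in>S. \<Sum>j<M. m p j) + int M * (div_deg kk e - (\<Sum>p\<in>S. e p)) \<le> m2 * ((\<Sum>p\<in>T. \<delta> p) + int (card S))"
    by (simp add: algebra_simps)
  have "(\<Sum>p\<in>T. \<delta> p) \<le> 2 * genus kk - 2"
  proof (rule \<delta>_sum)
    show "p z = -1" if "Pl p" "p z < 0" for p by (rule unram[OF that])
    show "finite T" by (rule finT)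
    show "Pl p" if "p \<in> T" for p by (rule TPl[OF that])
    show "p \<in> T" if "Pl p" "p z < 0" for p using that unfolding T_def by blast
  qed
  moreover have "m2 \<ge> 0" unfolding m2_def by (rule sum_nonneg) simp
  ultimately have "m2 * ((\<Sum>p\<in>T. \<delta> p) + int (card S)) \<le> m2 * (2 * genus kk - 2 + int (card S))"
    by (intro mult_left_mono) auto
  with main show ?thesis unfolding m2_def by linarith
qed

end

context function_field
begin

lemma wronskian_inequality_indexed:
  fixes J :: "'j set"
  assumes J: "finite J" and f: "lin_nondeg kk J f"
    and S: "finite S" "\<And>p. p \<in> S \<Longrightarrow> Pl p"
    and b: "\<And>p. p \<in> S \<Longrightarrow> lin_nondeg kk J (b p)"
      "\<And>p j. p \<in> S \<Longrightarrow> j \<in> J \<Longrightarrow> b p j \<in> espan kk J f"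
      "\<And>p j. p \<in> S \<Longrightarrow> j \<in> J \<Longrightarrow> vge p (m p j) (b p j)"
    and e: "divisor kk e" "\<And>p j. Pl p \<Longrightarrow> p \<notin> S \<Longrightarrow> j \<in> J \<Longrightarrow> vge p (e p) (f j)"
  shows "(\<Sum>p\<in>S. \<Sum>j\<in>J. m p j) + int (card J) * (div_deg kk e - (\<Sum>p\<in>S. e p)) \<le>
    (\<Sum>j<card J. int j) * (2 * genus kk - 2 + int (card S))"
proof -
  obtain h where h: "bij_betw h {..<card J} J"
    using ex_bij_betw_nat_finite[OF J] by (auto simp: atLeast0LessThan)
  then have inj: "inj_on h {..<card J}" and img: "h ` {..<card J} = J" by (auto simp: bij_betw_def)
  have hJ: "h j \<in> J" if "j < card J" for j using img that by auto
  have nd: "lin_nondeg kk {..<card J} (\<lambda>j. y (h j))" if "lin_nondeg kk J y" for y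
    using lin_nondeg_reindex[OF inj, of kk y] that img by simp
  have sp: "espan kk J y \<subseteq> espan kk {..<card J} (\<lambda>j. y (h j))" for y
  proof (rule espan_subset[OF espan_subspace[OF kk]])
    fix i assume "i \<in> J"
    then obtain j where j: "j < card J" "i = h j" using img by auto
    have "(\<lambda>j. y (h j)) j \<in> espan kk {..<card J} (\<lambda>j. y (h j))" by (rule espan_base[OF kk]) (use j in auto)
    then show "y i \<in> espan kk {..<card J} (\<lambda>j. y (h j))" using j by simp
  qed
  have "(\<Sum>p\<in>S. \<Sum>j<card J. m p (h j)) + int (card J) * (div_deg kk e - (\<Sum>p\<in>S. e p)) \<le>
    (\<Sum>j<card J. int j) * (2 * genus kk - 2 + int (card S))"
  proof (rule wronskian_inequality[where f = "\<lambda>j. f (h j)" and b = "\<lambda>p j. b p (h j)"])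
    show "lin_nondeg kk {..<card J} (\<lambda>j. f (h j))" by (rule nd[OF f])
    show "finite S" by (rule S)
    show "Pl p" if "p \<in> S" for p by (rule S(2)[OF that])
    show "lin_nondeg kk {..<card J} (\<lambda>j. b p (h j))" if "p \<in> S" for p by (rule nd[OF b(1)[OF that]])
    show "b p (h j) \<in> espan kk {..<card J} (\<lambda>j. f (h j))" if "p \<in> S" "j < card J" for p j
      using b(2)[OF that(1) hJ[OF that(2)]] sp by blast
    show "vge p (m p (h j)) (b p (h j))" if "p \<in> S" "j < card J" for p j by (rule b(3)[OF that(1) hJ[OF that(2)]])
    show "divisor kk e" by (rule e)
    show "vge p (e p) (f (h j))" if "Pl p" "p \<notin> S" "j < card J" for p j by (rule e(2)[OF that(1,2) hJ[OF that(3)]])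
  qed
  moreover have "(\<Sum>j<card J. m p (h j)) = (\<Sum>j\<in>J. m p j)" for p
    by (rule sum.reindex_bij_betw[OF h])
  ultimately show ?thesis by simp
qed

end

section \<open>Values of polynomials at units\<close>

definition exponents :: "nat \<Rightarrow> nat \<Rightarrow> (nat \<Rightarrow> nat) set" where
  "exponents n d = {i. (\<forall>j\<ge>n. i j = 0) \<and> tdeg n i \<le> d}"

text \<open>An exponent vector of total degree at most \<open>d\<close> in \<open>n\<close> variables is a composition of \<open>d\<close>
  into \<open>n + 1\<close> parts, the last part being the slack.\<close>

lemma card_exponents: "finite (exponents n d)" "card (exponents n d) = (n + d) choose n"
proof -
  define to where "to i = map i [0..<n] @ [d - tdeg n i]" for i
  have "bij_betw to (exponents n d) {l. length l = n + 1 \<and> sum_list l = d}"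
  proof (rule bij_betw_imageI)
    have sl: "sum_list (map i [0..<n]) = tdeg n i" for i
      unfolding tdeg_def by (simp add: interv_sum_list_conv_sum_set_nat lessThan_atLeast0)
    show "inj_on to (exponents n d)"
    proof (rule inj_onI, rule ext)
      fix i i' j assume *: "i \<in> exponents n d" "i' \<in> exponents n d" "to i = to i'"
      then have "map i [0..<n] = map i' [0..<n]" by (simp add: to_def)
      then show "i j = i' j" using * by (cases "j < n") (auto simp: exponents_def)
    qed
    show "to ` exponents n d = {l. length l = n + 1 \<and> sum_list l = d}"
    proof
      show "to ` exponents n d \<subseteq> {l. length l = n + 1 \<and> sum_list l = d}"
        by (auto simp: to_def exponents_def sl)
      show "{l. length l = n + 1 \<and> sum_list l = d} \<subseteq> to ` exponents n d"
      proof
        fix l :: "nat list" assume "l \<in> {l. length l = n + 1 \<and> sum_list l = d}"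
        then have l: "length l = n + 1" "sum_list l = d" by auto
        then have "l \<noteq> []" by auto
        then obtain k x where kx: "l = k @ [x]" using append_butlast_last_id[of l] by metis
        define i where "i j = (if j < n then k ! j else 0)" for j
        have k: "length k = n" using l kx by simp
        have mk: "map i [0..<n] = k" using k by (intro nth_equalityI) (auto simp: i_def)
        then have td: "tdeg n i = sum_list k" using sl[of i] by simp
        have "i \<in> exponents n d" using td l kx by (auto simp: exponents_def i_def)
        moreover have "to i = l" using mk td l kx by (simp add: to_def)
        ultimately show "l \<in> to ` exponents n d" by blast
      qed
    qed
  qed
  then have c: "card (exponents n d) = card {l::nat list. length l = n + 1 \<and> sum_list l = d}"
    by (rule bij_betw_same_card)
  also have "\<dots> = (d + n) choose d" by (simp add: card_length_sum_list)
  also have "\<dots> = (n + d) choose n" using binomial_symmetric[of d "d + n"] by (simp add: add.commute)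
  finally show cd: "card (exponents n d) = (n + d) choose n" .
  have "(n + d) choose n > 0" by simp
  then show "finite (exponents n d)" using cd card.infinite[of "exponents n d"] by linarith
qed

section \<open>The coefficient spaces of F\<close>

context function_field
begin

context
  fixes F :: "(nat \<Rightarrow> nat) \<Rightarrow> 'K" and n d :: nat
  assumes F: "mpoly_in n F" and deg: "mdeg n F = d" and F0: "F (\<lambda>_. 0) \<noteq> 0" and F1: "\<exists>i. F i = 1"
begin

abbreviation "Supp \<equiv> {i. F i \<noteq> 0}"

lemma Supp_finite: "finite Supp" using F by (simp add: mpoly_in_def)

lemma Supp_exponents: "Supp \<subseteq> exponents n d"
proof
  fix i assume i: "i \<in> Supp"
  have "{tdeg n i | i. F i \<noteq> 0} = tdeg n ` Supp" by auto
  then have "tdeg n i \<le> d" using deg Supp_finite i by (auto simp: mdeg_def)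
  then show "i \<in> exponents n d" using F i by (simp add: exponents_def mpoly_in_def)
qed

lemma coeff_prods_finite: "finite (coeff_prods F s)"
proof (induction s)
  case (Suc s)
  have "coeff_prods F (Suc s) = (\<lambda>(i,m). F i * m) ` (Supp \<times> coeff_prods F s)" by auto
  then show ?case using Suc Supp_finite by (metis finite_SigmaI finite_imageI)
qed simp

lemma one_in_coeff_prods: "1 \<in> coeff_prods F s"
proof (induction s)
  case (Suc s)
  obtain i where "F i = 1" using F1 by blast
  then show ?case using Suc by (auto intro!: exI[of _ i])
qed simp

lemma V_F_espan: "V_F kk F s = espan kk (coeff_prods F s) (\<lambda>b. b)"
  unfolding V_F_def by (rule lin_span_espan[OF kk coeff_prods_finite])

lemma V_F_subspace: "subspace_over kk (V_F kk F s)"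
  unfolding V_F_espan by (rule espan_subspace[OF kk])

lemma V_F_dim_le: "dim_le kk (V_F kk F s) (card (coeff_prods F s))"
  unfolding V_F_espan by (rule dim_le_espan[OF kk coeff_prods_finite])

lemma V_F_base: "m \<in> coeff_prods F s \<Longrightarrow> m \<in> V_F kk F s"
  unfolding V_F_espan using espan_base[OF kk coeff_prods_finite, of m s "\<lambda>b. b"] by simp

lemma V_F_mult: assumes "y \<in> V_F kk F s" shows "F i * y \<in> V_F kk F (Suc s)"
proof (cases "F i = 0")
  case True
  then show ?thesis using V_F_subspace[of "Suc s"] by (simp add: subspace_over_def)
next
  case False
  obtain c where c: "\<forall>m\<in>coeff_prods F s. c m \<in> kk" "y = (\<Sum>m\<in>coeff_prods F s. c m * m)"
    using assms by (auto simp: V_F_espan espan_def)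
  have "F i * y = (\<Sum>m\<in>coeff_prods F s. c m * (F i * m))" by (simp add: c(2) sum_distrib_left mult_ac)
  also have "\<dots> \<in> V_F kk F (Suc s)"
  proof (rule subspace_lincomb[OF V_F_subspace])
    fix m assume m: "m \<in> coeff_prods F s"
    then show "c m \<in> kk" using c(1) by blast
    have "F i * m \<in> coeff_prods F (Suc s)" using m False by auto
    then show "F i * m \<in> V_F kk F (Suc s)" by (rule V_F_base)
  qed
  finally show ?thesis .
qed

lemma d_F_pos: "d_F kk F s > 0"
proof -
  have "card {..<1::nat} \<le> d_F kk F s" unfolding d_F_def
  proof (rule card_le_kdim[OF kk V_F_subspace V_F_dim_le])
    show "1 \<in> V_F kk F s" by (rule V_F_base[OF one_in_coeff_prods])
    show "lin_nondeg kk {..<1::nat} (\<lambda>_. 1)" by (rule lin_nondegI) auto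
  qed simp
  then show ?thesis by simp
qed

definition vF :: "('K \<Rightarrow> int) \<Rightarrow> int" where "vF p = Min {p (F i) | i. F i \<noteq> 0}"

lemma vF_image: "{p (F i) | i. F i \<noteq> 0} = (\<lambda>i. p (F i)) ` Supp" by auto

lemma vF_le: "F i \<noteq> 0 \<Longrightarrow> vF p \<le> p (F i)"
  unfolding vF_def vF_image using Supp_finite by (intro Min_le) auto

text \<open>The coefficient 1 has order 0 everywhere. Hence an extra factor \<open>vF p\<close> only
  weakens a lower bound, and passing from \<open>s\<close> to \<open>Suc s\<close> in such bounds is
  harmless.\<close>

lemma vF_nonpos: "Pl p \<Longrightarrow> vF p \<le> 0"
proof -
  assume p: "Pl p"
  obtain i where "F i = 1" using F1 by blast
  then show "vF p \<le> 0" using vF_le[of i p] place_1[OF p] by simp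
qed

lemma vF_divisor: "divisor kk vF"
proof (rule divisorI)
  show "finite (\<Union>i\<in>Supp. {p. Pl p \<and> p (F i) \<noteq> 0})" using Supp_finite finite_support by blast
  fix p assume p: "Pl p" "p \<notin> (\<Union>i\<in>Supp. {p. Pl p \<and> p (F i) \<noteq> 0})"
  have "vF p \<in> (\<lambda>i. p (F i)) ` Supp" unfolding vF_def vF_image by (rule Min_in) (use Supp_finite F0 in auto)
  then obtain i where "i \<in> Supp" "vF p = p (F i)" by blast
  then show "vF p = 0" using p by auto
qed

text \<open>Lets the height of \<open>F\<close> enter the Wronskian inequality as the degree of a
  divisor of lower bounds.\<close>

lemma mheight_eq: "mheight kk F = - div_deg kk vF"
  unfolding mheight_def div_deg_def vF_def by (simp add: sum_negf)

lemma mheight_nonneg: "mheight kk F \<ge> 0"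
  unfolding mheight_def vF_def[symmetric] by (rule sum_nonneg) (use vF_nonpos in auto)

lemma coeff_prods_order: "Pl p \<Longrightarrow> m \<in> coeff_prods F s \<Longrightarrow> vge p (int s * vF p) m"
proof (induction s arbitrary: m)
  case 0 then show ?case by (simp add: vge_def place_1)
next
  case (Suc s)
  then obtain i m' where m: "m = F i * m'" "F i \<noteq> 0" "m' \<in> coeff_prods F s" by auto
  have "vge p (vF p) (F i)" using vF_le[OF m(2)] by (simp add: vge_def)
  from vge_mult[OF Suc.prems(1) this Suc.IH[OF Suc.prems(1) m(3)]] show ?case
    unfolding m(1) by (simp add: algebra_simps)
qed

lemma V_F_order: "Pl p \<Longrightarrow> y \<in> V_F kk F s \<Longrightarrow> vge p (int s * vF p) y"
  unfolding V_F_espan by (rule vge_espan[where f = "\<lambda>b. b"]) (auto intro: coeff_prods_order)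

context
  fixes S :: "('K \<Rightarrow> int) set" and g :: "nat \<Rightarrow> 'K" and s :: nat
  assumes S: "S \<subseteq> {p. Pl p}" "finite S" and g: "\<forall>j<n. g j \<in> S_units kk S"
    and nondeg: "lin_nondeg (V_F kk F (Suc s)) (exponents n d) (mmonom n g)"
begin

abbreviation "I \<equiv> exponents n d"
abbreviation "X \<equiv> mmonom n g"

lemma g0: "j < n \<Longrightarrow> g j \<noteq> 0" and g_out: "j < n \<Longrightarrow> Pl p \<Longrightarrow> p \<notin> S \<Longrightarrow> p (g j) = 0"
  using g by (auto simp: S_units_def)

lemma zero_I: "(\<lambda>_. 0) \<in> I" by (simp add: exponents_def tdeg_def)

lemma X_0: "X (\<lambda>_. 0) = 1" by (simp add: mmonom_def)

lemma X_nonzero: "X i \<noteq> 0" using g0 by (simp add: mmonom_def)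

lemma X_order: assumes p: "Pl p" shows "p (X i) = (\<Sum>j<n. int (i j) * p (g j))"
proof -
  have "(\<forall>j<m. g j \<noteq> 0) \<Longrightarrow> p (\<Prod>j<m. g j ^ i j) = (\<Sum>j<m. int (i j) * p (g j))" for m
    by (induction m) (auto simp: place_1[OF p] place_mult[OF p] place_power[OF p])
  then show ?thesis using g0 by (simp add: mmonom_def)
qed

lemma X_order_sum: "(\<Sum>p\<in>S. p (X i)) = 0"
proof -
  have "(\<Sum>p\<in>S. p (X i)) = (\<Sum>p\<in>S. \<Sum>j<n. int (i j) * p (g j))"
    using S(1) by (intro sum.cong refl X_order) auto
  also have "\<dots> = (\<Sum>j<n. int (i j) * (\<Sum>p\<in>S. p (g j)))"
    by (subst sum.swap) (simp add: sum_distrib_left)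
  also have "\<dots> = 0"
  proof (rule sum.neutral, rule ballI)
    fix j assume "j \<in> {..<n}"
    then have "(\<Sum>p\<in>S. p (g j)) = 0" using S g_out[of j] by (intro product_formula) auto
    then show "int (i j) * (\<Sum>p\<in>S. p (g j)) = 0" by simp
  qed
  finally show ?thesis .
qed

lemma X_out: assumes "Pl p" "p \<notin> S" shows "p (X i) = 0"
  unfolding X_order[OF assms(1)] by (rule sum.neutral) (use g_out assms in simp)

definition Y :: 'K where "Y = meval n F g"

lemma Y_eq: "Y = (\<Sum>i\<in>I. F i * X i)"
  unfolding Y_def meval_def using Supp_exponents card_exponents(1)[of n d]
  by (intro sum.mono_neutral_left) auto

lemma F_in_V: "F i \<in> V_F kk F (Suc s)"
  using V_F_mult[OF V_F_base[OF one_in_coeff_prods], of i s] by simp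

lemma Y_nonzero: "Y \<noteq> 0"
proof
  assume "Y = 0"
  then have "F (\<lambda>_. 0) = 0" using lin_nondegD[OF nondeg F_in_V _ zero_I] Y_eq by simp
  then show False using F0 by simp
qed

text \<open>The basis \<open>\<gamma>\<close> of \<open>V(r)\<close> starts with \<open>F(0)\<close> times a basis \<open>\<beta>\<close> of \<open>V(r - 1)\<close>, so that
  replacing \<open>\<gamma> l\<close> by \<open>\<beta> l \<sqdot> F(g)\<close> changes the family of all \<open>\<gamma> l \<sqdot> g\<^sup>i\<close> unitriangularly.\<close>

lemma main_inequality:
  defines "M \<equiv> d_F kk F (Suc s) * card I"
  shows "d_F kk F s \<le> d_F kk F (Suc s) \<and>
    int (d_F kk F s) * (\<Sum>p\<in>S. max 0 (p Y)) \<le>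
      int M * int (Suc s) * mheight kk F + (\<Sum>j<M. int j) * (2 * genus kk - 2 + int (card S))"
proof -
  define d0 where "d0 = d_F kk F s"
  define d1 where "d1 = d_F kk F (Suc s)"
  let ?V = "V_F kk F (Suc s)"
  have finI: "finite I" by (rule card_exponents)
  obtain \<beta> where \<beta>: "\<And>l. l < d0 \<Longrightarrow> \<beta> l \<in> V_F kk F s" "lin_nondeg kk {..<d0} \<beta>"
    using kdim_basis[OF kk V_F_subspace V_F_dim_le, of s] unfolding d0_def d_F_def by auto
  have "\<exists>\<gamma>. d0 \<le> d1 \<and> (\<forall>l<d0. \<gamma> l = F (\<lambda>_. 0) * \<beta> l) \<and> (\<forall>l<d1. \<gamma> l \<in> ?V) \<and>
      lin_nondeg kk {..<d1} \<gamma> \<and> ?V = espan kk {..<d1} \<gamma>"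
    unfolding d1_def d_F_def
  proof (rule basis_extension_kdim[OF kk V_F_subspace V_F_dim_le])
    show "lin_nondeg kk {..<d0} (\<lambda>l. F (\<lambda>_. 0) * \<beta> l)" by (rule lin_nondeg_mult[OF \<beta>(2) F0])
    show "F (\<lambda>_. 0) * \<beta> l \<in> ?V" if "l < d0" for l by (rule V_F_mult[OF \<beta>(1)[OF that]])
  qed
  then obtain \<gamma> where d01: "d0 \<le> d1" and \<gamma>0: "\<And>l. l < d0 \<Longrightarrow> \<gamma> l = F (\<lambda>_. 0) * \<beta> l"
    and \<gamma>V: "\<And>l. l < d1 \<Longrightarrow> \<gamma> l \<in> ?V" and \<gamma>nd: "lin_nondeg kk {..<d1} \<gamma>" and Vsp: "?V = espan kk {..<d1} \<gamma>"
    by blast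
  define J where "J = {..<d1} \<times> I"
  have finJ: "finite J" and cardJ: "card J = M"
    using finI by (auto simp: J_def M_def d1_def card_cartesian_product)
  define f where "f = (\<lambda>(l,i). \<gamma> l * X i)"
  \<comment> \<open>Marks the \<open>d0\<close> members to be replaced: the monomial 1 paired with
    some \<open>F(0) * \<beta> l\<close>.\<close>
  define sp where "sp l i \<longleftrightarrow> l < d0 \<and> i = (\<lambda>_. 0)" for l and i :: "nat \<Rightarrow> nat"
  define b where "b = (\<lambda>(l,i). if sp l i then \<beta> l * Y else \<gamma> l * X i)"
  define F' where "F' i = (if i = (\<lambda>_. 0) then 0 else F i)" for i
  have VX: "v * X i \<in> espan kk J f" if v: "v \<in> ?V" and i: "i \<in> I" for v i
  proof -
    obtain c where c: "\<forall>l\<in>{..<d1}. c l \<in> kk" "v = (\<Sum>l<d1. c l * \<gamma> l)" using v unfolding Vsp espan_def by blast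
    have "v * X i = (\<Sum>l<d1. c l * f (l,i))" by (simp add: c(2) f_def sum_distrib_right mult.assoc)
    also have "\<dots> \<in> espan kk J f"
    proof (rule subspace_lincomb[OF espan_subspace[OF kk]])
      fix l assume l: "l \<in> {..<d1}"
      then show "c l \<in> kk" using c(1) by blast
      show "f (l,i) \<in> espan kk J f" by (rule espan_base[OF kk finJ]) (use l i in \<open>simp add: J_def\<close>)
    qed
    finally show ?thesis .
  qed
  have \<beta>Y: "\<beta> l * Y = \<gamma> l + (\<Sum>i\<in>I. \<beta> l * F' i * X i)" if l: "l < d0" for l
  proof -
    have "Y = F (\<lambda>_. 0) * X (\<lambda>_. 0) + (\<Sum>i\<in>I - {\<lambda>_. 0}. F i * X i)" unfolding Y_eq by (rule sum.remove[OF finI zero_I])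
    also have "(\<Sum>i\<in>I - {\<lambda>_. 0}. F i * X i) = (\<Sum>i\<in>I - {\<lambda>_. 0}. F' i * X i)" by (intro sum.cong) (auto simp: F'_def)
    also have "\<dots> = (\<Sum>i\<in>I. F' i * X i)" using finI by (intro sum.mono_neutral_left) (auto simp: F'_def)
    finally have "Y = F (\<lambda>_. 0) + (\<Sum>i\<in>I. F' i * X i)" by (simp add: X_0)
    then show ?thesis by (simp add: \<gamma>0[OF l] distrib_left sum_distrib_left mult_ac)
  qed
  have \<beta>F': "\<beta> l * F' i \<in> ?V" if l: "l < d0" for l i
    using V_F_mult[OF \<beta>(1)[OF l], of i] V_F_subspace[of "Suc s"] by (auto simp: F'_def subspace_over_def mult.commute)
  have bsp: "b x \<in> espan kk J f" if x: "x \<in> J" for x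
  proof -
    obtain l i where li: "x = (l,i)" "l < d1" "i \<in> I" using x by (auto simp: J_def)
    show ?thesis
    proof (cases "sp l i")
      case True
      then have l: "l < d0" by (simp add: sp_def)
      have "b x = (\<Sum>i\<in>I. \<beta> l * F i * X i)" using True li by (simp add: b_def Y_eq sum_distrib_left mult.assoc)
      also have "\<dots> \<in> espan kk J f"
        by (rule subspace_sum[OF espan_subspace[OF kk]], rule VX)
           (use V_F_mult[OF \<beta>(1)[OF l]] in \<open>auto simp: mult.commute\<close>)
      finally show ?thesis .
    next
      case False
      then show ?thesis using li VX[OF \<gamma>V[OF li(2)] li(3)] by (simp add: b_def)
    qed
  qed
  have coef0: "a (l,i) = 0"
    if a: "\<forall>x\<in>J. a x \<in> kk" and li: "l < d1" "i \<in> I" and z: "(\<Sum>l<d1. a (l,i) * \<gamma> l) = 0" for a l i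
    using lin_nondegD[OF \<gamma>nd _ z, of l] a li by (auto simp: J_def)
  have combV: "(\<Sum>l<d1. a (l,i) * \<gamma> l) \<in> ?V" if "\<forall>x\<in>J. a x \<in> kk" "i \<in> I" for a i
    by (rule subspace_lincomb[OF V_F_subspace]) (use that \<gamma>V in \<open>auto simp: J_def\<close>)
  have sumf: "(\<Sum>x\<in>J. a x * f x) = (\<Sum>i\<in>I. (\<Sum>l<d1. a (l,i) * \<gamma> l) * X i)" for a
  proof -
    have "(\<Sum>x\<in>J. a x * f x) = (\<Sum>l<d1. \<Sum>i\<in>I. a (l,i) * (\<gamma> l * X i))"
      unfolding J_def by (simp add: sum.cartesian_product f_def case_prod_unfold)
    also have "\<dots> = (\<Sum>i\<in>I. \<Sum>l<d1. a (l,i) * (\<gamma> l * X i))" by (rule sum.swap)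
    finally show ?thesis by (simp add: sum_distrib_right mult.assoc)
  qed
  have fnd: "lin_nondeg kk J f"
  proof (rule lin_nondegI)
    fix a x assume a: "\<And>x. x \<in> J \<Longrightarrow> a x \<in> kk" "(\<Sum>x\<in>J. a x * f x) = 0" "x \<in> J"
    then have a1: "\<forall>x\<in>J. a x \<in> kk" by blast
    obtain l i where li: "x = (l,i)" "l < d1" "i \<in> I" using a(3) by (auto simp: J_def)
    have "(\<Sum>l<d1. a (l,i) * \<gamma> l) = 0"
      by (rule lin_nondegD[OF nondeg combV[OF a1] _ li(3)]) (use a(2) sumf in auto)
    then show "a x = 0" using coef0[OF a1 li(2,3)] li(1) by simp
  qed
  have bnd: "lin_nondeg kk J b"
  proof (rule lin_nondegI)
    fix a x assume a: "\<And>x. x \<in> J \<Longrightarrow> a x \<in> kk" "(\<Sum>x\<in>J. a x * b x) = 0" "x \<in> J"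
    then have a1: "\<forall>x\<in>J. a x \<in> kk" by blast
    \<comment> \<open>Collects what the replaced members contribute to the monomial
      \<open>i\<close>. It lies in \<open>V(r)\<close>, so nondegeneracy splits the relation by
      monomials. \<open>F'\<close> has no constant term, hence \<open>u\<close> vanishes at the
      monomial 1; this kills the coefficients of the replaced members, then \<open>u\<close> itself,
      and leaves the old relation.\<close>
    define u where "u i = (\<Sum>l<d0. a (l, \<lambda>_. 0) * (\<beta> l * F' i))" for i
    have uV: "u i \<in> ?V" for i unfolding u_def
      by (rule subspace_lincomb[OF V_F_subspace]) (use a(1) zero_I d01 \<beta>F' in \<open>auto simp: J_def\<close>)
    define spJ where "spJ = (\<lambda>l. (l, \<lambda>_::nat. 0::nat)) ` {..<d0}"
    have spJ: "spJ \<subseteq> J" using zero_I d01 by (auto simp: spJ_def J_def)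
    have inj: "inj_on (\<lambda>l. (l, \<lambda>_::nat. 0::nat)) {..<d0}" by (auto simp: inj_on_def)
    have "(\<Sum>x\<in>J. a x * b x) = (\<Sum>x\<in>J. a x * f x) + (\<Sum>x\<in>J. a x * (b x - f x))"
      by (simp add: sum.distrib[symmetric] algebra_simps)
    also have "(\<Sum>x\<in>J. a x * (b x - f x)) = (\<Sum>x\<in>spJ. a x * (b x - f x))"
    proof (rule sum.mono_neutral_right[OF finJ spJ], rule ballI)
      fix x assume "x \<in> J - spJ"
      then have "\<not> sp (fst x) (snd x)" by (cases x) (auto simp: spJ_def sp_def image_iff)
      then show "a x * (b x - f x) = 0" by (simp add: b_def f_def case_prod_unfold)
    qed
    also have "\<dots> = (\<Sum>l<d0. a (l, \<lambda>_. 0) * (\<Sum>i\<in>I. \<beta> l * F' i * X i))"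
      unfolding spJ_def sum.reindex[OF inj] o_def
    proof (rule sum.cong[OF refl])
      fix l assume "l \<in> {..<d0}"
      then have l: "l < d0" by simp
      have "b (l, \<lambda>_. 0) - f (l, \<lambda>_. 0) = (\<Sum>i\<in>I. \<beta> l * F' i * X i)"
        using \<beta>Y[OF l] l by (simp add: b_def f_def sp_def X_0)
      then show "a (l, \<lambda>_. 0) * (b (l, \<lambda>_. 0) - f (l, \<lambda>_. 0)) = a (l, \<lambda>_. 0) * (\<Sum>i\<in>I. \<beta> l * F' i * X i)" by simp
    qed
    also have "\<dots> = (\<Sum>l<d0. \<Sum>i\<in>I. a (l, \<lambda>_. 0) * (\<beta> l * F' i * X i))" by (simp only: sum_distrib_left)
    also have "\<dots> = (\<Sum>i\<in>I. \<Sum>l<d0. a (l, \<lambda>_. 0) * (\<beta> l * F' i * X i))" by (rule sum.swap)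
    also have "\<dots> = (\<Sum>i\<in>I. u i * X i)" by (simp add: u_def sum_distrib_right mult.assoc)
    also have "(\<Sum>x\<in>J. a x * f x) + \<dots> = (\<Sum>i\<in>I. ((\<Sum>l<d1. a (l,i) * \<gamma> l) + u i) * X i)"
      unfolding sumf by (simp add: distrib_right sum.distrib)
    finally have z: "(\<Sum>i\<in>I. ((\<Sum>l<d1. a (l,i) * \<gamma> l) + u i) * X i) = 0" using a(2) by simp
    have inV: "(\<Sum>l<d1. a (l,i) * \<gamma> l) + u i \<in> ?V" if "i \<in> I" for i
      using combV[OF a1 that] uV[of i] V_F_subspace[of "Suc s"] by (auto simp: subspace_over_def)
    have z': "(\<Sum>l<d1. a (l,i) * \<gamma> l) + u i = 0" if "i \<in> I" for i
      by (rule lin_nondegD[OF nondeg inV z that])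
    have "u (\<lambda>_. 0) = 0" by (simp add: u_def F'_def)
    then have a0: "a (l, \<lambda>_. 0) = 0" if "l < d1" for l
      using coef0[OF a1 that zero_I] z'[OF zero_I] by simp
    then have "u i = 0" for i using d01 by (simp add: u_def)
    then have "(\<Sum>l<d1. a (l,i) * \<gamma> l) = 0" if "i \<in> I" for i using z'[OF that] by simp
    moreover obtain l i where li: "x = (l,i)" "l < d1" "i \<in> I" using a(3) by (auto simp: J_def)
    ultimately show "a x = 0" using coef0[OF a1 li(2,3)] by simp
  qed
  define m where "m p = (\<lambda>(l,i). int (Suc s) * vF p + p (X i) + (if sp l i then max 0 (p Y) else 0))" for p :: "'K \<Rightarrow> int"
  \<comment> \<open>Where \<open>F(g)\<close> has a pole the exchange would be a loss, so the
    original family is kept there. This matches the \<open>max 0\<close> in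
    \<open>m\<close>.\<close>
  define B where "B p = (if p Y \<ge> 0 then b else f)" for p :: "'K \<Rightarrow> int"
  have f_order: "vge p (int (Suc s) * vF p + p (X i)) (f (l,i))" if "Pl p" "l < d1" for p l i
    unfolding f_def split using V_F_order[OF that(1) \<gamma>V[OF that(2)]] X_nonzero
    by (intro vge_mult[OF that(1)]) (auto simp: vge_def)
  have B_order: "vge p (m p x) (B p x)" if pS: "p \<in> S" and x: "x \<in> J" for p x
  proof -
    have p: "Pl p" using pS S by auto
    obtain l i where li: "x = (l,i)" "l < d1" "i \<in> I" using x by (auto simp: J_def)
    show ?thesis
    proof (cases "sp l i \<and> p Y \<ge> 0")
      case True
      then have l: "l < d0" and i: "i = (\<lambda>_. 0)" by (auto simp: sp_def)
      have "vge p (int s * vF p + p Y) (\<beta> l * Y)"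
        by (intro vge_mult[OF p] V_F_order[OF p \<beta>(1)[OF l]]) (simp add: vge_def)
      \<comment> \<open>The exchange gives up one of the \<open>Suc s\<close> factors
        \<open>vF p\<close>, which is at most 0, so the uniform bound \<open>m\<close> still
        holds.\<close>
      moreover have "m p x \<le> int s * vF p + p Y"
        using True vF_nonpos[OF p] li i X_0 place_1[OF p] by (simp add: m_def algebra_simps)
      ultimately have "vge p (m p x) (\<beta> l * Y)" by (rule vge_mono)
      then show ?thesis using True li by (simp add: B_def b_def)
    next
      case False
      then have "m p x = int (Suc s) * vF p + p (X i)" "B p x = f (l,i)"
        using li by (auto simp: m_def B_def b_def f_def)
      then show ?thesis using f_order[OF p li(2)] by simp
    qed
  qed
  have "(\<Sum>p\<in>S. \<Sum>x\<in>J. m p x) + int (card J) * (div_deg kk (\<lambda>p. int (Suc s) * vF p) - (\<Sum>p\<in>S. int (Suc s) * vF p))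
      \<le> (\<Sum>j<card J. int j) * (2 * genus kk - 2 + int (card S))"
  proof (rule wronskian_inequality_indexed[OF finJ fnd S(2)])
    show "Pl p" if "p \<in> S" for p using S(1) that by auto
    show "lin_nondeg kk J (B p)" for p using fnd bnd by (simp add: B_def)
    show "B p x \<in> espan kk J f" if "x \<in> J" for p x using bsp[OF that] espan_base[OF kk finJ that, of f] by (simp add: B_def)
    show "vge p (m p x) (B p x)" if "p \<in> S" "x \<in> J" for p x by (rule B_order[OF that])
    show "divisor kk (\<lambda>p. int (Suc s) * vF p)" by (rule divisor_cmult[OF vF_divisor])
    show "vge p (int (Suc s) * vF p) (f x)" if p: "Pl p" "p \<notin> S" and x: "x \<in> J" for p x
    proof -
      obtain l i where li: "x = (l,i)" "l < d1" "i \<in> I" using x by (auto simp: J_def)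
      then show ?thesis using f_order[OF p(1) li(2), of i] X_out[OF p] by simp
    qed
  qed
  moreover have "div_deg kk (\<lambda>p. int (Suc s) * vF p) = - int (Suc s) * mheight kk F"
    unfolding div_deg_cmult[OF vF_divisor] mheight_eq by (simp only: minus_mult_minus)
  moreover have "(\<Sum>p\<in>S. \<Sum>x\<in>J. m p x) = int M * (\<Sum>p\<in>S. int (Suc s) * vF p) + int d0 * (\<Sum>p\<in>S. max 0 (p Y))"
  proof -
    have mp: "(\<Sum>x\<in>J. m p x) = int M * (int (Suc s) * vF p) + int d1 * (\<Sum>i\<in>I. p (X i)) + int d0 * max 0 (p Y)" for p
    proof -
      have "(\<Sum>x\<in>J. m p x) = (\<Sum>l<d1. \<Sum>i\<in>I. int (Suc s) * vF p + p (X i) + (if sp l i then max 0 (p Y) else 0))"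
        unfolding J_def by (simp only: sum.cartesian_product m_def)
      also have "\<dots> = int M * (int (Suc s) * vF p) + int d1 * (\<Sum>i\<in>I. p (X i)) + (\<Sum>l<d1. \<Sum>i\<in>I. if sp l i then max 0 (p Y) else 0)"
        by (simp add: sum.distrib M_def d1_def mult.assoc distrib_left)
      also have "(\<Sum>l<d1. \<Sum>i\<in>I. if sp l i then max 0 (p Y) else 0) = (\<Sum>l<d1. if l < d0 then max 0 (p Y) else 0)"
        using finI zero_I by (intro sum.cong refl) (simp add: sp_def if_distrib cong: if_cong)
      also have "\<dots> = (\<Sum>l<d0. max 0 (p Y))" using d01 by (intro sum.mono_neutral_cong_right) auto
      finally show ?thesis by simp
    qed
    have "(\<Sum>p\<in>S. \<Sum>i\<in>I. p (X i)) = 0" by (subst sum.swap) (simp add: X_order_sum)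
    then show ?thesis unfolding mp sum.distrib sum_distrib_left[symmetric] by simp
  qed
  \<comment> \<open>Bookkeeping in the integers: the orders of the coefficients on \<open>S\<close>
    occur on both sides and cancel, so only the full degree of their divisor, minus the height of
    \<open>F\<close>, is left.\<close>
  moreover have "x \<le> c * e * k + u" if "y + c * (z - w) \<le> u" "z = - e * k" "y = c * w + x" for x c e k u y z w :: int
    using that(1) unfolding that(2,3) by (simp add: algebra_simps)
  ultimately have "int d0 * (\<Sum>p\<in>S. max 0 (p Y)) \<le> int M * int (Suc s) * mheight kk F + (\<Sum>j<M. int j) * (2 * genus kk - 2 + int (card S))"
    unfolding cardJ by blast
  then show ?thesis using d01 unfolding d0_def d1_def by simp
qed

end

end

lemma height_nonneg: "height kk x \<ge> 0"
  unfolding height_def by (rule sum_nonneg) auto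

end

section \<open>Assembling the constants\<close>

theorem theorem6p4:
  fixes kk :: "'K::field_char_0 set"
    and S :: "('K \<Rightarrow> int) set"
    and F :: "(nat \<Rightarrow> nat) \<Rightarrow> 'K"
    and n d r :: nat
    and g :: "nat \<Rightarrow> 'K"
  assumes k_alg_closed: "alg_closed_subfield kk"
    and K_function_field: "function_field_over kk"
    and S_places: "S \<subseteq> {p. place kk p}" and S_finite: "finite S"
    and F_poly: "mpoly_in n F"
    and deg: "mdeg n F = d" and d_pos: "d > 0"
    and F_const: "F (\<lambda>_. 0) \<noteq> 0"
    and F_coeff_one: "\<exists>i. F i = 1"
    and g_units: "\<forall>j<n. g j \<in> S_units kk S"
    and r_pos: "r > 0"
    and nondeg: "lin_nondeg (V_F kk F r) {i. (\<forall>j\<ge>n. i j = 0) \<and> tdeg n i \<le> d} (mmonom n g)"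
  shows
    "(\<Sum>p\<in>S. vzero p (meval n F g)) \<le> ereal (
        (real (d_F kk F r) / real (d_F kk F (r - 1)) - 1)
          * real ((n + d) choose n) * real d * real n
          * real_of_int (Max {height kk (g j) | j. j < n})
      + real (d_F kk F r) * real ((n + d) choose n) / real (d_F kk F (r - 1))
          * real (r + 1) * real_of_int (mheight kk F)
      + real (d_F kk F r) * real ((n + d) choose n)
          * ((real ((n + d) choose n) - 1) * real (d_F kk F r) + real (d_F kk F r) - 1)
          / (2 * real (d_F kk F (r - 1)))
          * real_of_int (max 0 (2 * genus kk - 2 + int (card S))))"
proof -
  interpret function_field kk by unfold_locales (fact k_alg_closed, fact K_function_field)
  obtain s where r: "r = Suc s" using r_pos by (cases r) auto
  define c where "c = (n + d) choose n"
  define d0 where "d0 = d_F kk F s"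
  define d1 where "d1 = d_F kk F r"
  define M where "M = d1 * c"
  define y where "y = meval n F g"
  define h where "h = mheight kk F"
  define G where "G = max 0 (2 * genus kk - 2 + int (card S))"
  define H where "H = Max {height kk (g j) | j. j < n}"
  define V where "V = (\<Sum>p\<in>S. max 0 (p y))"
  have nd: "lin_nondeg (V_F kk F (Suc s)) (exponents n d) (mmonom n g)"
    using nondeg by (simp add: exponents_def r)
  have y0: "y \<noteq> 0"
    unfolding y_def using Y_nonzero[OF F_poly deg F_const F_coeff_one S_places S_finite g_units nd]
    by (simp add: Y_def[OF F_poly deg F_const F_coeff_one S_places S_finite g_units nd])
  have main: "d0 \<le> d1" "int d0 * V \<le> int M * int (Suc s) * h + (\<Sum>j<M. int j) * (2 * genus kk - 2 + int (card S))"
    using main_inequality[OF F_poly deg F_const F_coeff_one S_places S_finite g_units nd]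
    by (simp_all add: Y_def[OF F_poly deg F_const F_coeff_one S_places S_finite g_units nd]
        card_exponents(2) c_def d0_def d1_def M_def y_def h_def V_def r)
  have d0: "d0 > 0" unfolding d0_def by (rule d_F_pos[OF F_poly deg F_const F_coeff_one])
  have h0: "h \<ge> 0" unfolding h_def by (rule mheight_nonneg[OF F_poly deg F_const F_coeff_one])
  \<comment> \<open>Without variables every total degree would be 0, contrary to
    \<open>d > 0\<close>. This makes the set of heights of the units nonempty, as \<open>Max\<close>
    requires.\<close>
  have "n > 0"
  proof (rule ccontr)
    assume "\<not> n > 0"
    then have "{tdeg n i | i. F i \<noteq> 0} = {0}" using F_const by (auto simp: tdeg_def)
    then show False using deg d_pos by (simp add: mdeg_def)
  qed
  have H0: "H \<ge> 0"
  proof -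
    have img: "{height kk (g j) | j. j < n} = (\<lambda>j. height kk (g j)) ` {..<n}" by auto
    have "H \<in> (\<lambda>j. height kk (g j)) ` {..<n}" unfolding H_def img by (rule Max_in) (use \<open>n > 0\<close> in auto)
    then show ?thesis using height_nonneg by auto
  qed
  have sumM: "2 * (\<Sum>j<M. int j) = int M * (int M - 1)"
    by (induction M) (auto simp: algebra_simps)
  \<comment> \<open>Doubled, so that \<open>M * (M - 1) / 2\<close> stays integral. The factor
    \<open>Suc s\<close>, which is \<open>r\<close>, is enlarged to \<open>r + 1\<close>; this is
    legitimate because \<open>h\<close> is nonnegative.\<close>
  have le: "2 * (int d0 * V) \<le> 2 * (int M * int (r + 1) * h) + int M * (int M - 1) * G"
  proof -
    have "(\<Sum>j<M. int j) * (2 * genus kk - 2 + int (card S)) \<le> (\<Sum>j<M. int j) * G"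
      by (intro mult_left_mono sum_nonneg) (auto simp: G_def)
    then have "2 * ((\<Sum>j<M. int j) * (2 * genus kk - 2 + int (card S))) \<le> int M * (int M - 1) * G"
      unfolding sumM[symmetric] by (simp add: mult.assoc)
    moreover have "int M * int (Suc s) * h \<le> int M * int (r + 1) * h"
      using h0 by (intro mult_right_mono mult_left_mono) (auto simp: r)
    ultimately show ?thesis using main(2) by linarith
  qed
  have "(\<Sum>p\<in>S. vzero p y) = ereal (real_of_int V)"
    using y0 by (simp add: vzero_def V_def)
  also have "\<dots> \<le> ereal ((real d1 / real d0 - 1) * real c * real d * real n * real_of_int H
      + real d1 * real c / real d0 * real (r + 1) * real_of_int h
      + real d1 * real c * ((real c - 1) * real d1 + real d1 - 1) / (2 * real d0) * real_of_int G)"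
  proof -
    have "real_of_int (2 * (int d0 * V)) \<le> real_of_int (2 * (int M * int (r + 1) * h) + int M * (int M - 1) * G)"
      using le by (simp only: of_int_le_iff)
    then have "2 * real d0 * real_of_int V \<le> 2 * (real M * real (r + 1) * real_of_int h) + real M * (real M - 1) * real_of_int G"
      by simp
    then have "real_of_int V \<le> (2 * (real M * real (r + 1) * real_of_int h) + real M * (real M - 1) * real_of_int G) / (2 * real d0)"
      using d0 by (simp add: pos_le_divide_eq mult.commute)
    \<comment> \<open>With \<open>M = d1 * c\<close> and \<open>c = N + 1\<close>, the factor
      \<open>M - 1\<close> is \<open>(c - 1) * d1 + d1 - 1\<close>.\<close>
    also have "\<dots> = real d1 * real c / real d0 * real (r + 1) * real_of_int h
      + real d1 * real c * ((real c - 1) * real d1 + real d1 - 1) / (2 * real d0) * real_of_int G"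
      using d0 by (simp add: M_def field_simps)
    \<comment> \<open>The term with the heights of the units is nonnegative because
      \<open>d0 \<le> d1\<close>, so adding it preserves the bound.\<close>
    also have "\<dots> \<le> (real d1 / real d0 - 1) * real c * real d * real n * real_of_int H + \<dots>"
    proof -
      have "0 \<le> (real d1 / real d0 - 1) * real c * real d * real n * real_of_int H"
        using main(1) d0 H0 by (intro mult_nonneg_nonneg) auto
      then show ?thesis by simp
    qed
    finally show ?thesis by (simp add: add.assoc)
  qed
  finally show ?thesis unfolding y_def c_def d1_def d0_def h_def G_def H_def r by simp
qed

end
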